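(* Let $0<\beta<6\pi$, $z\in\mathbb R$, and $\epsilon>0$ with $1/\epsilon\in\mathbb N$. Let $\Phi^{\mathrm{SG}_\epsilon}\in C([0,\infty),X_\epsilon)$ be the unique $\mathcal F^t$-adapted process such that for all $t\ge0$ $$\Phi_t^{\mathrm{SG}_\epsilon}=-\int_t^\infty\dot c_u^\epsilon\nabla v_u^\epsilon(\Phi_u^{\mathrm{SG}_\epsilon})\,du+\Phi_t^{\mathrm{GFF}_\epsilon}.$$ Then $\Phi_0^{\mathrm{SG}_\epsilon}$ is distributed as the sine-Gordon field on $\Omega_\epsilon$, i.e. its law is $$\nu^{\mathrm{SG}_\epsilon}(d\varphi)=\frac1{Z_\epsilon}\exp\Big[-\epsilon^2\sum_{x\in\Omega_\epsilon}\Big(\tfrac12\varphi(x)(-\Delta^\epsilon\varphi)(x)+\tfrac12\varphi(x)^2+2z\,\epsilon^{-\beta/4\pi}\cos(\sqrt\beta\varphi(x))\Big)\Big]\prod_{x\in\Omega_\epsilon}d\varphi(x),$$ where $Z_\epsilon$ is the normalising constant.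
   Context: $\Omega=\mathbb T^2=\mathbb R^2/\mathbb Z^2$, $\Omega_\epsilon=\Omega\cap\epsilon\mathbb Z^2$, $X_\epsilon=\{\varphi:\Omega_\epsilon\to\mathbb R\}$, $\Delta^\epsilon f(x)=\epsilon^{-2}\sum_{y\sim x}(f(y)-f(x))$ (nearest neighbours, periodic). The mass is $m=1$: $\dot c_t^\epsilon=e^{t\Delta^\epsilon}e^{-t}$, $c_t^\epsilon=\int_0^t\dot c_s^\epsilon ds$, with kernels normalised by $\dot c_t^\epsilon f(x)=\epsilon^2\sum_{y\in\Omega_\epsilon}\dot c_t^\epsilon(x,y)f(y)$. $v_0^\epsilon(\varphi)=\epsilon^2\sum_{x\in\Omega_\epsilon}2z\epsilon^{-\beta/4\pi}\cos(\sqrt\beta\varphi(x))$ and $e^{-v_t^\epsilon(\varphi)}=\mathbf E_{c_t^\epsilon}[e^{-v_0^\epsilon(\varphi+\zeta)}]$, where $\mathbf E_c$ is the expectation of the centred Gaussian measure on $X_\epsilon$ with $\mathbf E_c[\zeta(x)\zeta(y)]=c(x,y)$. $\dot c_t^\epsilon\nabla v_t^\epsilon(\varphi)\in X_\epsilon$ is the function $x\mapsto\sum_{y\in\Omega_\epsilon}\dot c_t^\epsilon(x,y)\frac{\partial v_t^\epsilon}{\partial\varphi(y)}(\varphi)$. $W^\epsilon=(W^\epsilon_t(x))_{x\in\Omega_\epsilon,t\ge0}$ are independent Brownian motions with quadratic variation $t/\epsilon^2$, and $\Phi_t^{\mathrm{GFF}_\epsilon}=\int_t^\infty q_u^\epsilon\,dW_u^\epsilon$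 with $q_u^\epsilon=\dot c_{u/2}^\epsilon$. $\mathcal F^t$ is the completion of the $\sigma$-algebra generated by $\{W^\epsilon_s-W^\epsilon_t:s\ge t\}$ (backward filtration). The integral equation above has a unique $\mathcal F^t$-adapted solution in $C([0,\infty),X_\epsilon)$. *)

theory Defs
  imports "HOL-Probability.Probability"
begin

section \<open>The discretised torus\<close>

text \<open>
  With \<open>N = 1/\<epsilon>\<close>, the pair \<open>(i, j)\<close> with \<open>0 \<le> i, j < N\<close> stands for the point \<open>(\<epsilon> i, \<epsilon> j)\<close>
  of the torus. Fields are functions \<open>int \<times> int \<Rightarrow> real\<close> of which only the values on
  \<open>sites \<epsilon>\<close> matter; measures on fields live on the product space over \<open>sites \<epsilon>\<close>.
\<close>

type_synonym site = "int \<times> int"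

definition side :: "real \<Rightarrow> int" where
  "side \<epsilon> = \<lfloor>1 / \<epsilon>\<rfloor>"

definition sites :: "real \<Rightarrow> site set" where
  "sites \<epsilon> = {0..<side \<epsilon>} \<times> {0..<side \<epsilon>}"

text \<open>
  The sum runs over the four lattice directions, that is, over the nearest neighbours of a point
  in the plane lattice for the periodic extension of \<open>f\<close>. In particular, for \<open>N = 2\<close> the two
  opposite directions lead to the same site and that site is counted twice.
\<close>

definition lattice_laplacian :: "real \<Rightarrow> (site \<Rightarrow> real) \<Rightarrow> site \<Rightarrow> real" where
  "lattice_laplacian \<epsilon> f x =
     (\<Sum>d\<in>{(1, 0), (-1, 0), (0, 1), (0, -1)}.
        f ((fst x + fst d) mod side \<epsilon>, (snd x + snd d) mod side \<epsilon>) - f x) / \<epsilon>\<^sup>2"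

section \<open>Covariances\<close>

definition heat_semigroup :: "real \<Rightarrow> real \<Rightarrow> (site \<Rightarrow> real) \<Rightarrow> site \<Rightarrow> real" where
  "heat_semigroup \<epsilon> t f x = (\<Sum>n. t ^ n / fact n * (lattice_laplacian \<epsilon> ^^ n) f x)"

definition cdot_op :: "real \<Rightarrow> real \<Rightarrow> (site \<Rightarrow> real) \<Rightarrow> site \<Rightarrow> real" where
  "cdot_op \<epsilon> t f x = heat_semigroup \<epsilon> t f x * exp (- t)"

text \<open>
  Kernels are normalised by \<open>cdot_op \<epsilon> t f x = \<epsilon>\<^sup>2 * (\<Sum>y\<in>sites \<epsilon>. cdot_kernel \<epsilon> t x y * f y)\<close>;
  taking \<open>f\<close> to be the indicator of a site gives the formula.
\<close>

definition cdot_kernel :: "real \<Rightarrow> real \<Rightarrow> site \<Rightarrow> site \<Rightarrow> real" where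
  "cdot_kernel \<epsilon> t x y = cdot_op \<epsilon> t (indicator {y}) x / \<epsilon>\<^sup>2"

definition c_kernel :: "real \<Rightarrow> real \<Rightarrow> site \<Rightarrow> site \<Rightarrow> real" where
  "c_kernel \<epsilon> t x y = (LBINT s:{0..t}. cdot_kernel \<epsilon> s x y)"

section \<open>Gaussian measures\<close>

text \<open>The centred normal law with variance \<open>v \<ge> 0\<close>; for \<open>v = 0\<close> it is the point mass at 0.\<close>

definition centred_normal :: "real \<Rightarrow> real measure" where
  "centred_normal v =
     (if v = 0 then return borel 0 else density lborel (normal_density 0 (sqrt v)))"

text \<open>Degenerate covariances have to be allowed, since \<open>c_kernel \<epsilon> 0 = 0\<close>.\<close>

definition is_centred_gaussian :: "'i set \<Rightarrow> ('i \<Rightarrow> 'i \<Rightarrow> real) \<Rightarrow> ('i \<Rightarrow> real) measure \<Rightarrow> bool" where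
  "is_centred_gaussian S c \<mu> \<longleftrightarrow>
     prob_space \<mu> \<and> sets \<mu> = sets (PiM S (\<lambda>_. borel)) \<and>
     (\<forall>a :: 'i \<Rightarrow> real. \<exists>v\<ge>0. distr \<mu> borel (\<lambda>\<zeta>. \<Sum>x\<in>S. a x * \<zeta> x) = centred_normal v) \<and>
     (\<forall>x\<in>S. \<forall>y\<in>S. (\<integral>\<zeta>. \<zeta> x * \<zeta> y \<partial>\<mu>) = c x y)"

definition gaussian :: "'i set \<Rightarrow> ('i \<Rightarrow> 'i \<Rightarrow> real) \<Rightarrow> ('i \<Rightarrow> real) measure" where
  "gaussian S c = (THE \<mu>. is_centred_gaussian S c \<mu>)"

section \<open>The renormalised potential\<close>

definition v0_potential :: "real \<Rightarrow> real \<Rightarrow> real \<Rightarrow> (site \<Rightarrow> real) \<Rightarrow> real" where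
  "v0_potential \<epsilon> \<beta> z \<phi> =
     \<epsilon>\<^sup>2 * (\<Sum>x\<in>sites \<epsilon>. 2 * z * \<epsilon> powr (- \<beta> / (4 * pi)) * cos (sqrt \<beta> * \<phi> x))"

definition v_potential :: "real \<Rightarrow> real \<Rightarrow> real \<Rightarrow> real \<Rightarrow> (site \<Rightarrow> real) \<Rightarrow> real" where
  "v_potential \<epsilon> \<beta> z t \<phi> =
     - ln (\<integral>\<zeta>. exp (- v0_potential \<epsilon> \<beta> z (\<lambda>x. \<phi> x + \<zeta> x)) \<partial>gaussian (sites \<epsilon>) (c_kernel \<epsilon> t))"

definition partial_deriv :: "((site \<Rightarrow> real) \<Rightarrow> real) \<Rightarrow> site \<Rightarrow> (site \<Rightarrow> real) \<Rightarrow> real" where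
  "partial_deriv F y \<phi> = deriv (\<lambda>s. F (\<phi>(y := s))) (\<phi> y)"

text \<open>The function \<open>x \<mapsto> \<Sum>\<^sub>y c'\<^sub>t(x,y) \<partial>v\<^sub>t/\<partial>\<phi>(y)\<close>; unlike in \<open>cdot_op\<close>, the sum carries no factor \<open>\<epsilon>\<^sup>2\<close>.\<close>

definition drift ::
    "real \<Rightarrow> real \<Rightarrow> real \<Rightarrow> real \<Rightarrow> (site \<Rightarrow> real) \<Rightarrow> site \<Rightarrow> real" where
  "drift \<epsilon> \<beta> z t \<phi> x =
     (\<Sum>y\<in>sites \<epsilon>. cdot_kernel \<epsilon> t x y * partial_deriv (v_potential \<epsilon> \<beta> z t) y \<phi>)"

section \<open>Brownian motions and the Wiener integral\<close>

text \<open>Processes are indexed by time in \<open>[0, \<infinity>)\<close>; their values at negative times are irrelevant.\<close>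

definition brownian_motion :: "'w measure \<Rightarrow> (real \<Rightarrow> 'w \<Rightarrow> real) \<Rightarrow> bool" where
  "brownian_motion M B \<longleftrightarrow>
     (\<forall>t\<ge>0. B t \<in> borel_measurable M) \<and>
     (AE \<omega> in M. B 0 \<omega> = 0) \<and>
     (AE \<omega> in M. continuous_on {0..} (\<lambda>t. B t \<omega>)) \<and>
     (\<forall>s t. 0 \<le> s \<longrightarrow> s \<le> t \<longrightarrow>
        distr M borel (\<lambda>\<omega>. B t \<omega> - B s \<omega>) = centred_normal (t - s)) \<and>
     (\<forall>(\<tau> :: nat \<Rightarrow> real) n. 0 \<le> \<tau> 0 \<longrightarrow> mono \<tau> \<longrightarrow>
        prob_space.indep_vars M (\<lambda>_. borel) (\<lambda>i \<omega>. B (\<tau> (Suc i)) \<omega> - B (\<tau> i) \<omega>) {..<n})"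

text \<open>
  A Brownian motion with quadratic variation \<open>t / \<epsilon>\<^sup>2\<close> is \<open>1 / \<epsilon>\<close> times a standard one.
\<close>

definition lattice_brownian_motion ::
    "'w measure \<Rightarrow> real \<Rightarrow> (real \<Rightarrow> site \<Rightarrow> 'w \<Rightarrow> real) \<Rightarrow> bool" where
  "lattice_brownian_motion M \<epsilon> W \<longleftrightarrow>
     (\<forall>x\<in>sites \<epsilon>. brownian_motion M (\<lambda>t \<omega>. \<epsilon> * W t x \<omega>)) \<and>
     prob_space.indep_vars M (\<lambda>_. PiM {0..} (\<lambda>_. borel))
       (\<lambda>x \<omega>. \<lambda>t\<in>{0..}. W t x \<omega>) (sites \<epsilon>)"

text \<open>
  A list of triples \<open>(a, r, s)\<close> encodes the step function which is the sum of
  \<open>a * indicator {r<..s}\<close>; its integral against \<open>B\<close> is the sum of \<open>a * (B s - B r)\<close>.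
\<close>

definition step_fun :: "(real \<times> real \<times> real) list \<Rightarrow> real \<Rightarrow> real" where
  "step_fun p u = (\<Sum>(a, r, s)\<leftarrow>p. a * indicator {r<..s} u)"

definition step_integral ::
    "(real \<Rightarrow> 'w \<Rightarrow> real) \<Rightarrow> (real \<times> real \<times> real) list \<Rightarrow> 'w \<Rightarrow> real" where
  "step_integral B p \<omega> = (\<Sum>(a, r, s)\<leftarrow>p. a * (B s \<omega> - B r \<omega>))"

text \<open>
  \<open>J\<close> is a version of \<open>\<integral>\<^sub>t\<^sup>\<infinity> f(u) dB\<^sub>u\<close> for deterministic \<open>f\<close>: the \<open>L\<^sup>2\<close> limit of the integrals of
  step functions on \<open>(t, \<infinity>)\<close> that converge to \<open>f\<close> in \<open>L\<^sup>2\<close>. By the isometry, the limit does not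
  depend on the approximating step functions, up to null sets.
\<close>

definition is_wiener_integral ::
    "'w measure \<Rightarrow> (real \<Rightarrow> 'w \<Rightarrow> real) \<Rightarrow> real \<Rightarrow> (real \<Rightarrow> real) \<Rightarrow> ('w \<Rightarrow> real) \<Rightarrow> bool" where
  "is_wiener_integral M B t f J \<longleftrightarrow>
     J \<in> borel_measurable M \<and>
     (\<exists>p :: nat \<Rightarrow> (real \<times> real \<times> real) list.
        (\<forall>n. \<forall>(a, r, s)\<in>set (p n). t \<le> r \<and> r \<le> s) \<and>
        (\<lambda>n. \<integral>\<^sup>+u\<in>{t..}. ennreal ((f u - step_fun (p n) u)\<^sup>2) \<partial>lborel) \<longlonglongrightarrow> 0 \<and>
        (\<lambda>n. \<integral>\<^sup>+\<omega>. ennreal ((J \<omega> - step_integral B (p n) \<omega>)\<^sup>2) \<partial>M) \<longlonglongrightarrow> 0)"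

definition q_kernel :: "real \<Rightarrow> real \<Rightarrow> site \<Rightarrow> site \<Rightarrow> real" where
  "q_kernel \<epsilon> u = cdot_kernel \<epsilon> (u / 2)"

text \<open>
  \<open>G\<close> is a continuous version of \<open>G\<^sub>t(x) = \<integral>\<^sub>t\<^sup>\<infinity> (q\<^sub>u dW\<^sub>u)(x)\<close>, where an operator acts through its
  kernel as \<open>(q\<^sub>u dW\<^sub>u)(x) = \<epsilon>\<^sup>2 \<Sum>\<^sub>y q\<^sub>u(x,y) dW\<^sub>u(y)\<close>. The random variables are only required to be
  measurable for the completed probability space.
\<close>

definition gff_process ::
    "'w measure \<Rightarrow> real \<Rightarrow> (real \<Rightarrow> site \<Rightarrow> 'w \<Rightarrow> real) \<Rightarrow> (real \<Rightarrow> site \<Rightarrow> 'w \<Rightarrow> real) \<Rightarrow> bool" where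
  "gff_process M \<epsilon> W G \<longleftrightarrow>
     (\<forall>t\<ge>0. \<forall>x\<in>sites \<epsilon>. \<exists>J :: site \<Rightarrow> 'w \<Rightarrow> real.
        (\<forall>y\<in>sites \<epsilon>.
           is_wiener_integral (completion M) (\<lambda>u. W u y) t (\<lambda>u. q_kernel \<epsilon> u x y) (J y)) \<and>
        (AE \<omega> in M. G t x \<omega> = \<epsilon>\<^sup>2 * (\<Sum>y\<in>sites \<epsilon>. J y \<omega>))) \<and>
     (AE \<omega> in M. \<forall>x\<in>sites \<epsilon>. continuous_on {0..} (\<lambda>t. G t x \<omega>))"

definition backward_filtration ::
    "'w measure \<Rightarrow> real \<Rightarrow> (real \<Rightarrow> site \<Rightarrow> 'w \<Rightarrow> real) \<Rightarrow> real \<Rightarrow> 'w measure" where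
  "backward_filtration M \<epsilon> W t =
     sigma (space M)
       ({(\<lambda>\<omega>. W s x \<omega> - W t x \<omega>) -` A \<inter> space M | s x A. t \<le> s \<and> x \<in> sites \<epsilon> \<and> A \<in> sets borel}
        \<union> null_sets (completion M))"

section \<open>The sine-Gordon equation and the sine-Gordon measure\<close>

definition sine_gordon_solution ::
    "'w measure \<Rightarrow> real \<Rightarrow> real \<Rightarrow> real \<Rightarrow> (real \<Rightarrow> site \<Rightarrow> 'w \<Rightarrow> real) \<Rightarrow>
     (real \<Rightarrow> site \<Rightarrow> 'w \<Rightarrow> real) \<Rightarrow> (real \<Rightarrow> site \<Rightarrow> 'w \<Rightarrow> real) \<Rightarrow> bool" where
  "sine_gordon_solution M \<epsilon> \<beta> z W G \<Phi> \<longleftrightarrow>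
     (\<forall>t\<ge>0. \<forall>x\<in>sites \<epsilon>. \<Phi> t x \<in> borel_measurable (backward_filtration M \<epsilon> W t)) \<and>
     (AE \<omega> in M. \<forall>x\<in>sites \<epsilon>. continuous_on {0..} (\<lambda>t. \<Phi> t x \<omega>)) \<and>
     (AE \<omega> in M. \<forall>t\<ge>0. \<forall>x\<in>sites \<epsilon>.
        \<Phi> t x \<omega> = - (LBINT u:{t..}. drift \<epsilon> \<beta> z u (\<lambda>y. \<Phi> u y \<omega>) x) + G t x \<omega>)"

definition sine_gordon_weight :: "real \<Rightarrow> real \<Rightarrow> real \<Rightarrow> (site \<Rightarrow> real) \<Rightarrow> real" where
  "sine_gordon_weight \<epsilon> \<beta> z \<phi> =
     exp (- (\<epsilon>\<^sup>2 * (\<Sum>x\<in>sites \<epsilon>.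
        1 / 2 * \<phi> x * (- lattice_laplacian \<epsilon> \<phi> x) + 1 / 2 * (\<phi> x)\<^sup>2
        + 2 * z * \<epsilon> powr (- \<beta> / (4 * pi)) * cos (sqrt \<beta> * \<phi> x))))"

definition sine_gordon_Z :: "real \<Rightarrow> real \<Rightarrow> real \<Rightarrow> real" where
  "sine_gordon_Z \<epsilon> \<beta> z = (\<integral>\<phi>. sine_gordon_weight \<epsilon> \<beta> z \<phi> \<partial>PiM (sites \<epsilon>) (\<lambda>_. lborel))"

definition sine_gordon_measure :: "real \<Rightarrow> real \<Rightarrow> real \<Rightarrow> (site \<Rightarrow> real) measure" where
  "sine_gordon_measure \<epsilon> \<beta> z =
     density (PiM (sites \<epsilon>) (\<lambda>_. lborel))
       (\<lambda>\<phi>. ennreal (sine_gordon_weight \<epsilon> \<beta> z \<phi> / sine_gordon_Z \<epsilon> \<beta> z))"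

end

theory Submission imports Defs begin

text \<open>
  Write \<open>U\<^sub>t = exp (- v\<^sub>t)\<close>, the average of \<open>exp (- v\<^sub>0)\<close> over the Gaussian measure with covariance
  \<open>c\<^sub>t\<close>. For a trigonometric observable \<open>f\<close> let \<open>H\<^sub>t\<close> be the same average of \<open>exp (- v\<^sub>0) f\<close> and
  \<open>F\<^sub>t = H\<^sub>t / U\<^sub>t\<close>. Both \<open>H\<close> and \<open>U\<close> follow the Gaussian flow, so over a short interval
  \<open>[s, t]\<close> the average of \<open>F\<^sub>s\<close> differs from \<open>F\<^sub>t\<close> by a covariance of \<open>F\<^sub>s\<close> and \<open>U\<^sub>s\<close>, divided by
  \<open>U\<^sub>t\<close>, which to leading order is exactly what the drift of the equation compensates. Since
  \<open>\<Phi>\<^sub>t\<close> is independent of the noise on \<open>[s, t]\<close>, summing these estimates over a fine partition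
  shows, without stochastic calculus, that \<open>E[F\<^sub>t(\<Phi>\<^sub>t)]\<close> does not depend on \<open>t\<close>. At \<open>t = 0\<close> it is
  \<open>E[f(\<Phi>\<^sub>0)]\<close>. As \<open>t \<rightarrow> \<infinity>\<close>, \<open>\<Phi>\<^sub>t \<rightarrow> 0\<close>, and it tends to the quotient of Gaussian averages with
  covariance \<open>(1 - \<Delta>)\<^sup>-\<^sup>1\<close>, that is, to the sine-Gordon expectation of \<open>f\<close>.
\<close>

section \<open>Characteristic functions of finite measures\<close>

text \<open>The obstacle is second-order noise terms. Expanding \<open>F\<close> alone over a step
  of length \<open>h\<close> would call for second derivatives; but \<open>F_s * U_s\<close> is
  again a Gaussian average, so its average over the noise is known exactly, and only a covariance of
  two first-order expansions has to be estimated. Bounds on values and gradients and a quadratic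
  Taylor remainder suffice for this (\<open>C11\<close>). They pass to averages with the same
  constant, hence are uniform in time. A step costs \<open>h * sqrt h\<close>, so
  \<open>T / h\<close> steps cost \<open>T * sqrt h\<close>; the error of freezing the drift comes
  without a rate and is removed by dominated convergence. Wiener integrals are given only as L2
  limits up to null sets, and the filtration contains the null sets of the completion. Laws and
  independence are therefore read off from characteristic functions. The lattice Gaussian density is
  treated in the same way: its covariance is recognised through the Green function of
  \<open>1 - \<Delta>\<close> and translations of Lebesgue measure, without diagonalising the
  Laplacian or evaluating a determinant.\<close>

lemma finite_measure_eqI_char:
  fixes \<mu> \<nu> :: "real measure"
  assumes "finite_measure \<mu>" "finite_measure \<nu>" "sets \<mu> = sets borel" "sets \<nu> = sets borel"
    and eq: "\<And>t. (CLINT x|\<mu>. iexp (t * x)) = (CLINT x|\<nu>. iexp (t * x))"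
  shows "\<mu> = \<nu>"
proof -
  interpret m: finite_measure \<mu> by fact
  interpret n: finite_measure \<nu> by fact
  have sp: "space \<mu> = UNIV" "space \<nu> = UNIV"
    using assms sets_eq_imp_space_eq space_borel by metis+
  \<comment> \<open>Frequency 0 recovers the total mass, so both measures have mass
    \<open>c\<close>; if \<open>c\<close> is positive, dividing by it reduces the claim to
    \<open>Levy_uniqueness\<close>. Masses other than 1 occur because the densities
    \<open>1 + Re h\<close> used below are not normalised.\<close>
  define c where "c = measure \<mu> UNIV"
  have c: "measure \<nu> UNIV = c"
    using eq[of 0] by (simp add: c_def sp scaleR_conv_of_real)
  have c': "emeasure \<mu> UNIV = ennreal c" "emeasure \<nu> UNIV = ennreal c"
    using c by (simp_all add: c_def m.emeasure_eq_measure n.emeasure_eq_measure)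
  show ?thesis
  proof (cases "c = 0")
    case True
    have "emeasure \<mu> A = 0" "emeasure \<nu> A = 0" for A
      using emeasure_space[of \<mu> A] emeasure_space[of \<nu> A] c' True by (simp_all add: sp)
    then show ?thesis by (intro measure_eqI) (auto simp: assms)
  next
    case False
    then have cp: "c > 0" using c_def by (simp add: less_le)
    let ?d = "\<lambda>\<mu>::real measure. density \<mu> (\<lambda>_. ennreal (1 / c))"
    have rd: "real_distribution (?d \<kappa>)" if "sets \<kappa> = sets borel" "emeasure \<kappa> UNIV = ennreal c" for \<kappa>
    proof -
      have sp: "space \<kappa> = UNIV" using that(1) by (metis sets_eq_imp_space_eq space_borel)
      have "prob_space (?d \<kappa>)"
        using cp that sp
        by (intro prob_spaceI) (auto simp: emeasure_density_const emeasure_density nn_integral_cmult ennreal_mult[symmetric])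
      then show ?thesis using that by (simp add: real_distribution_def real_distribution_axioms_def)
    qed
    have ch: "char (?d \<kappa>) t = (1 / c) *\<^sub>R (CLINT x|\<kappa>. iexp (t * x))" if "sets \<kappa> = sets borel" for \<kappa> t
    proof -
      note [measurable_cong] = that
      show ?thesis using cp unfolding char_def by (subst integral_density) auto
    qed
    have "char (?d \<mu>) = char (?d \<nu>)"
      by (rule ext) (simp only: ch[OF assms(3)] ch[OF assms(4)] eq)
    then have "?d \<mu> = ?d \<nu>"
      by (intro Levy_uniqueness rd) (simp_all add: assms c')
    then have "emeasure (?d \<mu>) A = emeasure (?d \<nu>) A" for A by simp
    from this have *: "ennreal (1/c) * emeasure \<mu> A = ennreal (1/c) * emeasure \<nu> A" if "A \<in> sets borel" for A
      using emeasure_density_const[of A \<mu> "ennreal (1/c)"] emeasure_density_const[of A \<nu> "ennreal (1/c)"] that assms(3,4) by simp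
    show ?thesis
    proof (rule measure_eqI)
      fix A assume A: "A \<in> sets \<mu>"
      have "ennreal c * (ennreal (1/c) * emeasure \<mu> A) = ennreal c * (ennreal (1/c) * emeasure \<nu> A)"
        using *[of A] A assms by simp
      then show "emeasure \<mu> A = emeasure \<nu> A"
        using cp by (simp add: mult.assoc[symmetric] ennreal_mult[symmetric])
    qed (simp add: assms)
  qed
qed

lemma (in finite_measure) integrable_complex_bounded:
  fixes f :: "'a \<Rightarrow> complex"
  assumes "f \<in> borel_measurable M" "\<And>x. norm (f x) \<le> B"
  shows "integrable M f"
  using assms by (intro integrable_const_bound[where B=B]) auto

text \<open>Testing against \<open>1 + Re h\<close> and \<open>1 + Im h\<close> reduces a complex weight to nonnegative ones.\<close>

lemma weighted_integral_eqI_char: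
  fixes \<mu> :: "'a measure" and \<nu> :: "'b measure" and h :: "'a \<Rightarrow> complex" and g :: "'b \<Rightarrow> complex"
  assumes "finite_measure \<mu>" "finite_measure \<nu>"
    and [measurable]: "X \<in> borel_measurable \<mu>" "Y \<in> borel_measurable \<nu>"
      "h \<in> borel_measurable \<mu>" "g \<in> borel_measurable \<nu>"
    and hb: "\<And>x. norm (h x) \<le> 1" and gb: "\<And>x. norm (g x) \<le> 1"
    and e1: "\<And>t. (CLINT x|\<mu>. iexp (t * X x)) = (CLINT x|\<nu>. iexp (t * Y x))"
    and e2: "\<And>t. (CLINT x|\<mu>. h x * iexp (t * X x)) = (CLINT x|\<nu>. g x * iexp (t * Y x))"
    and A[measurable]: "A \<in> sets borel"
  shows "(CLINT x|\<mu>. h x * indicator A (X x)) = (CLINT x|\<nu>. g x * indicator A (Y x))"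
proof -
  interpret m: finite_measure \<mu> by fact
  interpret n: finite_measure \<nu> by fact
  \<comment> \<open>A unimodular factor treats both parts at once: \<open>c = 1\<close> yields the
    real part of \<open>h\<close> and \<open>c = -\<i>\<close> the imaginary part.\<close>
  have re: "(LINT x|\<mu>. Re (c * h x) * indicator A (X x)) = (LINT x|\<nu>. Re (c * g x) * indicator A (Y x))"
    if c: "norm c = 1" for c
  proof -
    let ?w = "\<lambda>h x. 1 + Re (c * h x)"
    \<comment> \<open>Since \<open>Re w = (w + cnj w) / 2\<close>, the transform of the weighted law
      involves the weighted transform at \<open>t\<close> and the conjugate of the one at
      \<open>-t\<close>; both are covered by the hypothesis, which holds for all
      frequencies.\<close>
    have key: "(CLINT y|distr (density \<mu> (?w h)) borel X. iexp (t * y)) =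
        (CLINT x|\<mu>. iexp (t * X x)) + c / 2 * (CLINT x|\<mu>. h x * iexp (t * X x))
        + cnj c / 2 * cnj (CLINT x|\<mu>. h x * iexp ((-t) * X x)) \<and> finite_measure (distr (density \<mu> (?w h)) borel X) \<and>
       measure (distr (density \<mu> (?w h)) borel X) A = (LINT x|\<mu>. indicator A (X x)) + (LINT x|\<mu>. Re (c * h x) * indicator A (X x))"
      if "finite_measure \<mu>" and [measurable]: "X \<in> borel_measurable \<mu>" "h \<in> borel_measurable \<mu>"
      and hb: "\<And>x. norm (h x) \<le> 1" for t and \<mu> :: "'z measure" and X h
    proof -
      interpret m: finite_measure \<mu> by fact
      have b: "norm (c * h x) \<le> 1" for x using hb[of x] c by (simp add: norm_mult)
      have w0: "0 \<le> ?w h x" "?w h x \<le> 2" for x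
        using b[of x] abs_Re_le_cmod[of "c * h x"] by linarith+
      have i1: "integrable \<mu> (\<lambda>x. iexp (t * X x))" by (rule m.integrable_complex_bounded[where B=1]) auto
      have i2: "integrable \<mu> (\<lambda>x. h x * iexp (t * X x))" for t
        by (rule m.integrable_complex_bounded[where B=1]) (auto simp: norm_mult hb)
      have "(CLINT y|distr (density \<mu> (?w h)) borel X. iexp (t * y)) = (CLINT x|\<mu>. ?w h x *\<^sub>R iexp (t * X x))"
        using w0 by (subst integral_distr) (auto simp: integral_density)
      also have "\<dots> = (CLINT x|\<mu>. iexp (t * X x) + c / 2 * (h x * iexp (t * X x)) + cnj c / 2 * cnj (h x * iexp ((-t) * X x)))"
      proof (intro Bochner_Integration.integral_cong refl)
        fix x
        have "complex_of_real (Re (c * h x)) = (c * h x + cnj (c * h x)) / 2"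
          by (simp only: complex_add_cnj) simp
        then have "complex_of_real (?w h x) = 1 + (c * h x + cnj (c * h x)) / 2" by (simp only: of_real_add of_real_1)
        moreover have "cnj (iexp ((-t) * X x)) = iexp (t * X x)" by (simp add: exp_cnj)
        ultimately show "?w h x *\<^sub>R iexp (t * X x) = iexp (t * X x) + c / 2 * (h x * iexp (t * X x)) + cnj c / 2 * cnj (h x * iexp ((-t) * X x))"
          unfolding scaleR_conv_of_real complex_cnj_mult by (simp only: algebra_simps) (simp add: field_simps)
      qed
      also have "\<dots> = (CLINT x|\<mu>. iexp (t * X x)) + c / 2 * (CLINT x|\<mu>. h x * iexp (t * X x))
        + cnj c / 2 * cnj (CLINT x|\<mu>. h x * iexp ((-t) * X x))"
        using i1 i2[of t] i2[of "-t"]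
        by (simp only: Bochner_Integration.integral_add Bochner_Integration.integrable_add integrable_mult_right
            integrable_cnj Bochner_Integration.integral_mult_right_zero Bochner_Integration.integral_cnj)
      finally have 1: "(CLINT y|distr (density \<mu> (?w h)) borel X. iexp (t * y)) = (CLINT x|\<mu>. iexp (t * X x)) + c / 2 * (CLINT x|\<mu>. h x * iexp (t * X x))
        + cnj c / 2 * cnj (CLINT x|\<mu>. h x * iexp ((-t) * X x))" .
      have em: "emeasure (distr (density \<mu> (?w h)) borel X) B = ennreal (LINT x|\<mu>. ?w h x * indicator B (X x))" if [measurable]: "B \<in> sets borel" for B
      proof -
        have "emeasure (distr (density \<mu> (?w h)) borel X) B = (\<integral>\<^sup>+x. ennreal (?w h x) * indicator (X -` B \<inter> space \<mu>) x \<partial>\<mu>)"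
          by (subst emeasure_distr) (auto simp: emeasure_density)
        also have "\<dots> = (\<integral>\<^sup>+x. ennreal (?w h x * indicator B (X x)) \<partial>\<mu>)"
          by (intro nn_integral_cong) (auto simp: indicator_def)
        also have "\<dots> = ennreal (LINT x|\<mu>. ?w h x * indicator B (X x))"
          using w0 by (intro nn_integral_eq_integral m.integrable_const_bound[where B=2]) (auto simp: abs_mult indicator_def)
        finally show ?thesis .
      qed
      have 2: "finite_measure (distr (density \<mu> (?w h)) borel X)"
        using em[of UNIV] by (intro finite_measureI) (simp del: times_complex.sel)
      have "measure (distr (density \<mu> (?w h)) borel X) A = (LINT x|\<mu>. ?w h x * indicator A (X x))"
        using em[OF A] w0 by (simp add: measure_def Bochner_Integration.integral_nonneg)
      also have "\<dots> = (LINT x|\<mu>. indicator A (X x) + Re (c * h x) * indicator A (X x))"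
        by (simp add: algebra_simps)
      also have "\<dots> = (LINT x|\<mu>. indicator A (X x)) + (LINT x|\<mu>. Re (c * h x) * indicator A (X x))"
      proof (rule Bochner_Integration.integral_add)
        show "integrable \<mu> (\<lambda>x. indicator A (X x) :: real)"
          by (rule m.integrable_const_bound[where B=1]) (auto simp: indicator_def)
        show "integrable \<mu> (\<lambda>x. Re (c * h x) * indicator A (X x))"
          using b by (intro m.integrable_const_bound[where B=1]) (auto simp: indicator_def intro: order_trans[OF abs_Re_le_cmod] simp del: times_complex.sel)
      qed
      finally show ?thesis using 1 2 by blast
    qed
    have "distr (density \<mu> (?w h)) borel X = distr (density \<nu> (?w g)) borel Y"
    proof (rule finite_measure_eqI_char)
      fix t
      show "(CLINT x|distr (density \<mu> (?w h)) borel X. iexp (t * x)) = (CLINT x|distr (density \<nu> (?w g)) borel Y. iexp (t * x))"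
        using key[of \<mu> X h t, OF assms(1) assms(3) assms(5) hb, THEN conjunct1]
          key[of \<nu> Y g t, OF assms(2) assms(4) assms(6) gb, THEN conjunct1] e1[of t] e2[of t] e2[of "-t"] by metis
    qed (use key[of \<mu> X h] key[of \<nu> Y g] assms in simp_all)
    moreover have "distr \<mu> borel X = distr \<nu> borel Y"
    proof (rule finite_measure_eqI_char)
      fix t
      have "(CLINT x|distr \<mu> borel X. iexp (t * x)) = (CLINT x|\<mu>. iexp (t * X x))"
        by (rule integral_distr) auto
      moreover have "(CLINT x|distr \<nu> borel Y. iexp (t * x)) = (CLINT x|\<nu>. iexp (t * Y x))"
        by (rule integral_distr) auto
      ultimately show "(CLINT x|distr \<mu> borel X. iexp (t * x)) = (CLINT x|distr \<nu> borel Y. iexp (t * x))"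
        using e1[of t] by simp
    qed (auto simp: m.finite_measure_distr n.finite_measure_distr)
    then have "measure (distr \<mu> borel X) A = measure (distr \<nu> borel Y) A" by simp
    then have "(LINT x|\<mu>. indicator A (X x)) = (LINT x|\<nu>. indicator A (Y x) :: real)"
      by (simp add: measure_distr integral_indicator[symmetric] indicator_vimage[symmetric] del: integral_indicator indicator_vimage)
    ultimately show ?thesis
      using key[of \<mu> X h] key[of \<nu> Y g] assms by simp
  qed
  have Re: "Re (CLINT x|\<mu>. h x * indicator A (X x)) = (LINT x|\<mu>. Re (1 * h x) * indicator A (X x))"
    and Im: "Im (CLINT x|\<mu>. h x * indicator A (X x)) = (LINT x|\<mu>. Re (-\<i> * h x) * indicator A (X x))"
    if "finite_measure \<mu>" and [measurable]: "X \<in> borel_measurable \<mu>" "h \<in> borel_measurable \<mu>"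
      and hb: "\<And>x. norm (h x) \<le> 1" for \<mu> :: "'z measure" and X h
  proof -
    interpret m: finite_measure \<mu> by fact
    have i: "integrable \<mu> (\<lambda>x. h x * indicator A (X x))"
      by (rule m.integrable_complex_bounded[where B=1]) (auto simp: norm_mult hb indicator_def)
    show "Re (CLINT x|\<mu>. h x * indicator A (X x)) = (LINT x|\<mu>. Re (1 * h x) * indicator A (X x))"
      using i by (subst integral_Re[symmetric]) (auto intro!: Bochner_Integration.integral_cong simp: indicator_def)
    show "Im (CLINT x|\<mu>. h x * indicator A (X x)) = (LINT x|\<mu>. Re (-\<i> * h x) * indicator A (X x))"
      using i by (subst integral_Im[symmetric]) (auto intro!: Bochner_Integration.integral_cong simp: indicator_def)
  qed
  show ?thesis
    using re[of 1] re[of "-\<i>"] Re[of \<mu> X h] Re[of \<nu> Y g] Im[of \<mu> X h] Im[of \<nu> Y g] assms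
    by (intro complex_eqI) simp_all
qed

text \<open>The one-dimensional theorem is applied to one coordinate at a time. In the induction on
  \<open>J\<close> the exponential in coordinate \<open>k\<close> is traded for an indicator, while
  the indicators already obtained and the remaining exponentials together form the complex weight
  \<open>h\<close> of \<open>weighted_integral_eqI_char\<close>. Setting the remaining frequencies
  to 0 leaves the measures of boxes.\<close>

lemma finite_measure_eqI_char_PiM:
  fixes \<mu> \<nu> :: "('i \<Rightarrow> real) measure"
  assumes I: "finite I" and fin: "finite_measure \<mu>" "finite_measure \<nu>"
    and sets[measurable_cong]: "sets \<mu> = sets (PiM I (\<lambda>_. borel))" "sets \<nu> = sets (PiM I (\<lambda>_. borel))"
    and eq: "\<And>a. (CLINT \<zeta>|\<mu>. iexp (\<Sum>i\<in>I. a i * \<zeta> i)) = (CLINT \<zeta>|\<nu>. iexp (\<Sum>i\<in>I. a i * \<zeta> i))"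
  shows "\<mu> = \<nu>"
proof -
  interpret m: finite_measure \<mu> by fact
  interpret n: finite_measure \<nu> by fact
  have comp: "(\<lambda>\<zeta>. \<zeta> i) \<in> borel_measurable \<mu>" "(\<lambda>\<zeta>. \<zeta> i) \<in> borel_measurable \<nu>" if "i \<in> I" for i
    using measurable_component_singleton[OF that, of "\<lambda>_. borel"] sets by (simp_all cong: measurable_cong_sets)
  have claim: "(CLINT \<zeta>|\<mu>. (\<Prod>j\<in>J. indicator (A j) (\<zeta> j)) * iexp (\<Sum>i\<in>I - J. a i * \<zeta> i))
      = (CLINT \<zeta>|\<nu>. (\<Prod>j\<in>J. indicator (A j) (\<zeta> j)) * iexp (\<Sum>i\<in>I - J. a i * \<zeta> i))"
    if "finite J" "J \<subseteq> I" "\<And>j. j \<in> J \<Longrightarrow> A j \<in> sets borel" for J A a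
    using that
  proof (induction J arbitrary: a)
    case empty
    then show ?case using eq[of a] by simp
  next
    case (insert k J)
    have k: "k \<in> I" "k \<in> I - J" and J: "J \<subseteq> I" and Am: "A k \<in> sets borel" using insert by auto
    have D: "I - J = insert k (I - insert k J)" "finite (I - insert k J)" using k I by auto
    let ?h = "\<lambda>\<zeta>. (\<Prod>j\<in>J. indicator (A j) (\<zeta> j)) * iexp (\<Sum>i\<in>I - insert k J. a i * \<zeta> i)"
    have ind: "(\<lambda>\<zeta>. indicator (A j) (\<zeta> j) :: complex) \<in> borel_measurable \<mu>"
      "(\<lambda>\<zeta>. indicator (A j) (\<zeta> j) :: complex) \<in> borel_measurable \<nu>" if "j \<in> J" for j
    proof -
      have j: "j \<in> I" "A j \<in> sets borel" using that insert.prems by auto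
      show "(\<lambda>\<zeta>. indicator (A j) (\<zeta> j) :: complex) \<in> borel_measurable \<mu>"
        "(\<lambda>\<zeta>. indicator (A j) (\<zeta> j) :: complex) \<in> borel_measurable \<nu>"
        using comp[OF j(1)] j(2) by (auto intro: measurable_compose[OF _ borel_measurable_indicator])
    qed
    have sm[measurable]: "(\<lambda>\<zeta>. \<Sum>i\<in>I - insert k J. a i * \<zeta> i) \<in> borel_measurable \<mu>"
      "(\<lambda>\<zeta>. \<Sum>i\<in>I - insert k J. a i * \<zeta> i) \<in> borel_measurable \<nu>"
      by (auto intro!: borel_measurable_sum borel_measurable_times comp)
    have pm: "(\<lambda>\<zeta>. \<Prod>j\<in>J. indicator (A j) (\<zeta> j) :: complex) \<in> borel_measurable \<mu>"
      "(\<lambda>\<zeta>. \<Prod>j\<in>J. indicator (A j) (\<zeta> j) :: complex) \<in> borel_measurable \<nu>"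
      by (auto intro!: borel_measurable_prod ind)
    have hm: "?h \<in> borel_measurable \<mu>" "?h \<in> borel_measurable \<nu>"
      using pm by measurable
    have hb: "norm (?h \<zeta>) \<le> 1" for \<zeta>
      by (auto simp: norm_mult prod_norm[symmetric] indicator_def intro!: prod_le_1)
    have "(CLINT \<zeta>|\<mu>. ?h \<zeta> * indicator (A k) (\<zeta> k)) = (CLINT \<zeta>|\<nu>. ?h \<zeta> * indicator (A k) (\<zeta> k))"
    proof (rule weighted_integral_eqI_char[OF fin comp[OF k(1)] hm hb hb _ _ Am])
      fix t
      have *: "(\<Sum>i\<in>I. (if i = k then t else 0) * \<zeta> i) = t * \<zeta> k" for \<zeta> :: "'i \<Rightarrow> real"
        using I k by (simp add: if_distrib[of "\<lambda>x. x * _"] sum.delta' cong: if_cong)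
      show "(CLINT \<zeta>|\<mu>. iexp (t * \<zeta> k)) = (CLINT \<zeta>|\<nu>. iexp (t * \<zeta> k))"
        using eq[of "\<lambda>i. if i = k then t else 0"] unfolding * .
      \<comment> \<open>The induction hypothesis is used with the coefficient of \<open>k\<close>
        replaced by the free frequency \<open>t\<close>, which is why the induction generalises over
        \<open>a\<close>.\<close>
      have **: "(\<Sum>i\<in>I - J. (a(k := t)) i * \<zeta> i) = t * \<zeta> k + (\<Sum>i\<in>I - insert k J. a i * \<zeta> i)" for \<zeta> :: "'i \<Rightarrow> real"
        unfolding D(1) using D(2) by (subst sum.insert) (auto intro!: sum.cong)
      have h: "(\<Prod>j\<in>J. indicator (A j) (\<zeta> j)) * iexp (\<Sum>i\<in>I - J. (a(k := t)) i * \<zeta> i) = ?h \<zeta> * iexp (t * \<zeta> k)" for \<zeta>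
        unfolding ** of_real_add distrib_left exp_add by (simp add: mult_ac)
      have "(CLINT \<zeta>|\<mu>. (\<Prod>j\<in>J. indicator (A j) (\<zeta> j)) * iexp (\<Sum>i\<in>I - J. (a(k := t)) i * \<zeta> i))
          = (CLINT \<zeta>|\<nu>. (\<Prod>j\<in>J. indicator (A j) (\<zeta> j)) * iexp (\<Sum>i\<in>I - J. (a(k := t)) i * \<zeta> i))"
        using insert.prems by (intro insert.IH) auto
      then show "(CLINT \<zeta>|\<mu>. ?h \<zeta> * iexp (t * \<zeta> k)) = (CLINT \<zeta>|\<nu>. ?h \<zeta> * iexp (t * \<zeta> k))"
        unfolding h .
    qed
    moreover have "(\<Prod>j\<in>insert k J. indicator (A j) (\<zeta> j)) * iexp (\<Sum>i\<in>I - insert k J. a i * \<zeta> i) = ?h \<zeta> * indicator (A k) (\<zeta> k)" for \<zeta>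
      using insert.hyps by (subst prod.insert) (simp_all add: mult_ac)
    ultimately show ?case by (simp only:)
  qed
  show ?thesis
  proof (rule measure_eqI_PiM_infinite[OF sets])
    fix A :: "'i \<Rightarrow> real set" and J assume J: "finite J" "J \<subseteq> I" and A: "\<And>i. i \<in> J \<Longrightarrow> A i \<in> sets borel"
    let ?E = "prod_emb I (\<lambda>_. borel) J (Pi\<^sub>E J A) :: ('i \<Rightarrow> real) set"
    have E: "?E \<in> sets (PiM I (\<lambda>_. borel))"
      using J A by (intro measurable_prod_emb sets_PiM_I_finite) auto
    have *: "(CLINT \<zeta>|\<kappa>. (\<Prod>j\<in>J. indicator (A j) (\<zeta> j)) * iexp (\<Sum>i\<in>I - J. 0 * \<zeta> i)) = complex_of_real (measure \<kappa> ?E)"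
      if "finite_measure \<kappa>" "sets \<kappa> = sets (PiM I (\<lambda>_. borel))" for \<kappa> :: "('i \<Rightarrow> real) measure"
    proof -
      interpret finite_measure \<kappa> by fact
      have "(CLINT \<zeta>|\<kappa>. (\<Prod>j\<in>J. indicator (A j) (\<zeta> j)) * iexp (\<Sum>i\<in>I - J. 0 * \<zeta> i)) = (CLINT \<zeta>|\<kappa>. of_real (indicator ?E \<zeta>))"
      proof (rule Bochner_Integration.integral_cong[OF refl])
        fix \<zeta> assume "\<zeta> \<in> space \<kappa>"
        then have z: "\<zeta> \<in> extensional I"
          using sets_eq_imp_space_eq[OF that(2)] by (simp add: space_PiM PiE_def)
        have "(\<Prod>j\<in>J. indicator (A j) (\<zeta> j) :: complex) = (if \<forall>j\<in>J. \<zeta> j \<in> A j then 1 else 0)"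
          using J(1) by (induction J) (auto simp: indicator_def)
        then show "(\<Prod>j\<in>J. indicator (A j) (\<zeta> j)) * iexp (\<Sum>i\<in>I - J. 0 * \<zeta> i) = of_real (indicator ?E \<zeta>)"
          using z by (auto simp: indicator_def prod_emb_def PiE_def Pi_iff)
      qed
      also have "\<dots> = of_real (measure \<kappa> ?E)"
      proof -
        have "?E \<in> sets \<kappa>" using E that by simp
        then have "(LINT \<zeta>|\<kappa>. indicator ?E \<zeta>) = measure \<kappa> ?E"
          using sets.sets_into_space by (simp add: Int_absorb2)
        then show ?thesis by simp
      qed
      finally show ?thesis .
    qed
    have "complex_of_real (measure \<mu> ?E) = complex_of_real (measure \<nu> ?E)"
      unfolding *[OF fin(1) sets(1), symmetric] *[OF fin(2) sets(2), symmetric]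
      by (rule claim) (use J A in auto)
    then show "emeasure \<mu> ?E = emeasure \<nu> ?E"
      by (simp add: m.emeasure_eq_measure n.emeasure_eq_measure)
  qed (rule fin)
qed

text \<open>As in the one-dimensional case, \<open>h\<close> enters through the weights \<open>1 + Re h\<close> and \<open>1 + Im h\<close>.\<close>

lemma (in prob_space) expectation_weight_indicator:
  fixes X :: "'a \<Rightarrow> 'i \<Rightarrow> real" and h :: "'a \<Rightarrow> complex"
  assumes I: "finite I" and X[measurable]: "X \<in> M \<rightarrow>\<^sub>M PiM I (\<lambda>_. borel)" and [measurable]: "h \<in> borel_measurable M"
    and hb: "\<And>x. norm (h x) \<le> 1"
    and eq: "\<And>a. (CLINT x|M. h x * iexp (\<Sum>i\<in>I. a i * X x i)) = (CLINT x|M. h x) * (CLINT x|M. iexp (\<Sum>i\<in>I. a i * X x i))"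
    and B[measurable]: "B \<in> sets (PiM I (\<lambda>_. borel))"
  shows "(CLINT x|M. h x * indicator B (X x)) = (CLINT x|M. h x) * prob (X -` B \<inter> space M)"
proof -
  have comp[measurable]: "(\<lambda>x. X x i) \<in> borel_measurable M" if "i \<in> I" for i
    using measurable_compose[OF X measurable_component_singleton[OF that]] .
  have indB: "indicator (X -` B \<inter> space M) x = indicator B (X x)" if "x \<in> space M" for x
    using that by (auto simp: indicator_def)
  have re: "(LINT x|M. Re (c * h x) * indicator B (X x)) = Re (c * (CLINT x|M. h x)) * prob (X -` B \<inter> space M)"
    if c: "norm c = 1" for c
  proof -
    let ?w = "\<lambda>x. 1 + Re (c * h x)"
    define H where "H = (CLINT x|M. h x)"
    have b: "\<bar>Re (c * h x)\<bar> \<le> 1" for x using hb[of x] c abs_Re_le_cmod[of "c * h x"] by (simp add: norm_mult)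
    have w0: "0 \<le> ?w x" "?w x \<le> 2" for x using b[of x] by linarith+
    have ih: "integrable M h" by (rule integrable_complex_bounded[OF _ hb]) simp
    have RH: "(LINT x|M. ?w x) = 1 + Re (c * H)"
      using ih prob_space by (simp add: H_def integral_Re[symmetric] del: times_complex.sel)
    have RH0: "1 + Re (c * H) \<ge> 0" unfolding RH[symmetric] using w0 by (intro Bochner_Integration.integral_nonneg) auto
    let ?\<mu> = "distr (density M ?w) (PiM I (\<lambda>_. borel)) X"
    \<comment> \<open>By \<open>eq\<close>, the weight \<open>1 + Re (c * h)\<close> acts on every
      exponential like the constant \<open>1 + Re (c * H)\<close>, its own mean. Equality of these
      two measures thus expresses that \<open>h\<close> decouples from \<open>X\<close>.\<close>
    let ?\<nu> = "distr (density M (\<lambda>_. ennreal (1 + Re (c * H)))) (PiM I (\<lambda>_. borel)) X"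
    have em: "emeasure (distr (density M w) (PiM I (\<lambda>_. borel)) X) B = ennreal (LINT x|M. w x * indicator B (X x))"
      if [measurable]: "B \<in> sets (PiM I (\<lambda>_. borel))" "w \<in> borel_measurable M" and w0: "\<And>x. 0 \<le> w x" "\<And>x. w x \<le> 2" for B and w :: "'a \<Rightarrow> real"
    proof -
      have "emeasure (distr (density M w) (PiM I (\<lambda>_. borel)) X) B = (\<integral>\<^sup>+x. ennreal (w x) * indicator (X -` B \<inter> space M) x \<partial>M)"
        by (subst emeasure_distr) (auto simp: emeasure_density)
      also have "\<dots> = (\<integral>\<^sup>+x. ennreal (w x * indicator B (X x)) \<partial>M)"
        by (intro nn_integral_cong) (auto simp: indicator_def)
      also have "\<dots> = ennreal (LINT x|M. w x * indicator B (X x))"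
        using w0 by (intro nn_integral_eq_integral integrable_const_bound[where B=2]) (auto simp: abs_mult indicator_def)
      finally show ?thesis .
    qed
    have H1: "1 + Re (c * H) \<le> 2"
    proof -
      have "norm H \<le> (LINT x|M. norm (h x))" unfolding H_def by (rule integral_norm_bound)
      also have "\<dots> \<le> (LINT x|M. 1)" using ih hb by (intro integral_mono) auto
      finally have "norm (c * H) \<le> 1" using c prob_space by (simp add: norm_mult)
      then show ?thesis using abs_Re_le_cmod[of "c * H"] by linarith
    qed
    have ch: "(CLINT \<zeta>|distr (density M w) (PiM I (\<lambda>_. borel)) X. iexp (\<Sum>i\<in>I. a i * \<zeta> i)) = (CLINT x|M. of_real (w x) * iexp (\<Sum>i\<in>I. a i * X x i))"
      if [measurable]: "w \<in> borel_measurable M" and w0: "\<And>x. 0 \<le> w x" for a and w :: "'a \<Rightarrow> real"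
      using w0 by (subst integral_distr) (auto simp: integral_density scaleR_conv_of_real)
    have "?\<mu> = ?\<nu>"
    proof (rule finite_measure_eqI_char_PiM[OF I])
      show "finite_measure ?\<mu>" "finite_measure ?\<nu>"
        using w0 RH0 H1 by (auto intro!: finite_measureI simp: em simp del: sets.top times_complex.sel)
      fix a
      let ?e = "\<lambda>x. iexp (\<Sum>i\<in>I. a i * X x i)"
      let ?f = "\<lambda>x. iexp (\<Sum>i\<in>I. (- a i) * X x i)"
      have i1: "integrable M ?e" by (rule integrable_complex_bounded[where B=1]) auto
      have i2: "integrable M (\<lambda>x. h x * ?e x)" "integrable M (\<lambda>x. h x * ?f x)"
        by (rule integrable_complex_bounded[where B=1]; auto simp: norm_mult hb)+
      have *: "complex_of_real (Re z) = (z + cnj z) / 2" for z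
        by (simp only: complex_add_cnj) simp
      have cf: "cnj (?f x) = ?e x" for x by (simp add: exp_cnj sum_negf)
      have "(CLINT x|M. of_real (?w x) * ?e x) = (CLINT x|M. ?e x + c / 2 * (h x * ?e x) + cnj c / 2 * cnj (h x * ?f x))"
        by (intro Bochner_Integration.integral_cong refl)
          (simp only: of_real_add of_real_1 * complex_cnj_mult cf, simp only: algebra_simps, simp add: field_simps)
      also have "\<dots> = (CLINT x|M. ?e x) + c / 2 * (CLINT x|M. h x * ?e x) + cnj c / 2 * cnj (CLINT x|M. h x * ?f x)"
        using i1 i2
        by (simp only: Bochner_Integration.integral_add Bochner_Integration.integrable_add integrable_mult_right
            integrable_cnj Bochner_Integration.integral_mult_right_zero Bochner_Integration.integral_cnj)
      also have "\<dots> = (CLINT x|M. ?e x) + c / 2 * (H * (CLINT x|M. ?e x)) + cnj c / 2 * (cnj H * (CLINT x|M. ?e x))"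
        unfolding eq H_def[symmetric] complex_cnj_mult Bochner_Integration.integral_cnj[symmetric] cf ..
      also have "\<dots> = of_real (1 + Re (c * H)) * (CLINT x|M. ?e x)"
        by (simp only: of_real_add of_real_1 * complex_cnj_mult) (simp add: field_simps)
      also have "\<dots> = (CLINT x|M. of_real (1 + Re (c * H)) * ?e x)" by simp
      finally show "(CLINT \<zeta>|?\<mu>. iexp (\<Sum>i\<in>I. a i * \<zeta> i)) = (CLINT \<zeta>|?\<nu>. iexp (\<Sum>i\<in>I. a i * \<zeta> i))"
        using w0 RH0 by (subst (1 2) ch) (auto simp del: times_complex.sel)
    qed simp_all
    then have "ennreal (LINT x|M. ?w x * indicator B (X x)) = ennreal (LINT x|M. (1 + Re (c * H)) * indicator B (X x))"
      using em[OF B, of ?w] em[OF B, of "\<lambda>_. 1 + Re (c * H)"] w0 RH0 H1 by (simp del: times_complex.sel)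
    then have "(LINT x|M. ?w x * indicator B (X x)) = (LINT x|M. (1 + Re (c * H)) * indicator B (X x))"
      using w0 RH0 by (subst (asm) ennreal_inj) (auto intro!: Bochner_Integration.integral_nonneg simp del: times_complex.sel)
    moreover have "(LINT x|M. ?w x * indicator B (X x)) = (LINT x|M. indicator B (X x)) + (LINT x|M. Re (c * h x) * indicator B (X x))"
      unfolding distrib_right mult_1_left using b
      by (intro Bochner_Integration.integral_add integrable_const_bound[where B=1])
        (auto simp: indicator_def simp del: times_complex.sel)
    moreover have "(LINT x|M. indicator B (X x)) = prob (X -` B \<inter> space M)"
      by (subst Bochner_Integration.integral_cong[OF refl indB[symmetric]]) auto
    moreover have "(LINT x|M. (1 + Re (c * H)) * indicator B (X x)) = (1 + Re (c * H)) * (LINT x|M. indicator B (X x))"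
      by (rule Bochner_Integration.integral_mult_right_zero)
    ultimately show ?thesis unfolding H_def by (simp add: algebra_simps del: times_complex.sel)
  qed
  have i: "integrable M (\<lambda>x. h x * indicator B (X x))"
    by (rule integrable_complex_bounded[where B=1]) (auto simp: norm_mult hb indicator_def)
  have "Re (CLINT x|M. h x * indicator B (X x)) = (LINT x|M. Re (1 * h x) * indicator B (X x))"
    using i by (subst integral_Re[symmetric]) (auto intro!: Bochner_Integration.integral_cong simp: indicator_def)
  moreover have "Im (CLINT x|M. h x * indicator B (X x)) = (LINT x|M. Re (-\<i> * h x) * indicator B (X x))"
    using i by (subst integral_Im[symmetric]) (auto intro!: Bochner_Integration.integral_cong simp: indicator_def)
  ultimately show ?thesis
    using re[of 1] re[of "-\<i>"] by (intro complex_eqI) simp_all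
qed

section \<open>Normal and Gaussian measures\<close>

lemma measurable_component_borel:
  "sets \<mu> = sets (PiM S (\<lambda>_. borel)) \<Longrightarrow> x \<in> S \<Longrightarrow> (\<lambda>\<zeta>. \<zeta> x) \<in> borel_measurable \<mu>"
  by (simp cong: measurable_cong_sets)

lemma sets_centred_normal [simp, measurable_cong]: "sets (centred_normal v) = sets borel"
  by (simp add: centred_normal_def)

lemma centred_normal_eq_distr:
  assumes "v > 0"
  shows "centred_normal v = distr std_normal_distribution borel (\<lambda>x. sqrt v * x)"
proof -
  interpret p: prob_space std_normal_distribution by (rule prob_space_normal_density) simp
  have "distributed std_normal_distribution lborel (\<lambda>x. x) (normal_density 0 1)"
    by (auto simp: distributed_def distr_id2)
  then have "distributed std_normal_distribution lborel (\<lambda>x. 0 + sqrt v * x) (normal_density (0 + sqrt v * 0) (\<bar>sqrt v\<bar> * 1))"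
    using assms by (intro p.normal_density_affine) auto
  then show ?thesis
    using assms by (simp add: distributed_def centred_normal_def cong: distr_cong)
qed

lemma prob_space_centred_normal: "prob_space (centred_normal v)" if "v \<ge> 0"
  using that by (auto simp: centred_normal_def intro!: prob_space_return prob_space_normal_density)

lemma char_centred_normal:
  assumes "v \<ge> 0"
  shows "(CLINT x|centred_normal v. iexp (t * x)) = of_real (exp (- (t\<^sup>2 * v) / 2))"
proof (cases "v = 0")
  case True
  have "(CLINT x|return borel 0. iexp (t * x)) = iexp (t * 0)"
    by (rule integral_return) auto
  then show ?thesis using True by (simp add: centred_normal_def)
next
  case False
  then have v: "v > 0" using assms by simp
  have "(CLINT x|centred_normal v. iexp (t * x)) = (CLINT x|std_normal_distribution. iexp (t * (sqrt v * x)))"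
    unfolding centred_normal_eq_distr[OF v] by (rule integral_distr) auto
  also have "\<dots> = char std_normal_distribution (t * sqrt v)" by (simp add: char_def mult_ac)
  also have "\<dots> = of_real (exp (- (t\<^sup>2 * v) / 2))"
    using v by (simp add: char_std_normal_distribution power_mult_distrib)
  finally show ?thesis .
qed

lemma centred_normal_moments:
  assumes "v \<ge> 0"
  shows "has_bochner_integral (centred_normal v) (\<lambda>x. x) 0"
    "has_bochner_integral (centred_normal v) (\<lambda>x. x\<^sup>2) v"
    "has_bochner_integral (centred_normal v) (\<lambda>x. x ^ 4) (3 * v\<^sup>2)"
proof -
  have ret: "has_bochner_integral (return borel (0::real)) f (f 0)" if [measurable]: "f \<in> borel_measurable borel" for f :: "real \<Rightarrow> real"
  proof -
    interpret prob_space "return borel (0::real)" by (rule prob_space_return) simp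
    have "integrable (return borel 0) f"
      by (rule integrable_const_bound[where B="\<bar>f 0\<bar>"]) (auto simp: AE_return)
    then show ?thesis by (auto simp: has_bochner_integral_iff integral_return)
  qed
  have dens: "has_bochner_integral (centred_normal v) f y"
    if "v > 0" "has_bochner_integral lborel (\<lambda>x. normal_density 0 (sqrt v) x * f x) y" "f \<in> borel_measurable borel" for f :: "real \<Rightarrow> real" and y
    using that by (auto simp: centred_normal_def intro!: has_bochner_integral_density)
  show "has_bochner_integral (centred_normal v) (\<lambda>x. x) 0"
  proof (cases "v = 0")
    case False with assms show ?thesis
      using normal_moment_odd[of "sqrt v" 0 0] by (intro dens) auto
  qed (use ret[of "\<lambda>x. x"] in \<open>simp add: centred_normal_def\<close>)
  show "has_bochner_integral (centred_normal v) (\<lambda>x. x\<^sup>2) v"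
  proof (cases "v = 0")
    case False with assms show ?thesis
      using normal_moment_even[of "sqrt v" 0 1] by (intro dens) auto
  qed (use ret[of "\<lambda>x. x\<^sup>2"] in \<open>simp add: centred_normal_def\<close>)
  show "has_bochner_integral (centred_normal v) (\<lambda>x. x ^ 4) (3 * v\<^sup>2)"
  proof (cases "v = 0")
    case False with assms show ?thesis
      using normal_moment_even[of "sqrt v" 0 2] by (intro dens) (auto simp: fact_numeral power_divide field_simps)
  qed (use ret[of "\<lambda>x. x ^ 4"] in \<open>simp add: centred_normal_def\<close>)
qed

lemma centred_normal_distr_moments:
  assumes X: "distr M borel X = centred_normal v" and v: "v \<ge> 0" and [measurable]: "X \<in> borel_measurable M"
  shows "has_bochner_integral M X 0"
    "has_bochner_integral M (\<lambda>x. (X x)\<^sup>2) v"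
    "has_bochner_integral M (\<lambda>x. X x ^ 4) (3 * v\<^sup>2)"
  using centred_normal_moments[OF v] unfolding X[symmetric]
  by (auto simp: has_bochner_integral_iff integrable_distr_eq integral_distr)

lemma (in prob_space) distr_eq_centred_normalI:
  assumes [measurable]: "X \<in> borel_measurable M" and "v \<ge> 0"
    and "\<And>t. (CLINT x|M. iexp (t * X x)) = of_real (exp (- (t\<^sup>2 * v) / 2))"
  shows "distr M borel X = centred_normal v"
proof (rule finite_measure_eqI_char)
  fix t
  have "(CLINT x|distr M borel X. iexp (t * x)) = (CLINT x|M. iexp (t * X x))"
    by (rule integral_distr) auto
  then show "(CLINT x|distr M borel X. iexp (t * x)) = (CLINT x|centred_normal v. iexp (t * x))"
    using assms by (simp only: char_centred_normal)
qed (use assms in \<open>auto intro: finite_measure_distr prob_space.finite_measure prob_space_centred_normal\<close>)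

text \<open>The definition of a Gaussian measure provides only some variance for each linear
  combination. Expanding the square of the combination with the given covariances identifies it as
  the quadratic form, which is nonnegative as a by-product. Integrability of the products comes from
  that of the squares.\<close>

lemma centred_gaussian_moments:
  assumes S: "finite S" and g: "is_centred_gaussian S c \<mu>"
  shows "x \<in> S \<Longrightarrow> has_bochner_integral \<mu> (\<lambda>\<zeta>. \<zeta> x) 0"
    and "x \<in> S \<Longrightarrow> has_bochner_integral \<mu> (\<lambda>\<zeta>. \<zeta> x ^ 4) (3 * (c x x)\<^sup>2)"
    and "x \<in> S \<Longrightarrow> y \<in> S \<Longrightarrow> has_bochner_integral \<mu> (\<lambda>\<zeta>. \<zeta> x * \<zeta> y) (c x y)"
    and "distr \<mu> borel (\<lambda>\<zeta>. \<Sum>x\<in>S. a x * \<zeta> x) = centred_normal (\<Sum>x\<in>S. \<Sum>y\<in>S. a x * a y * c x y)"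
    and "0 \<le> (\<Sum>x\<in>S. \<Sum>y\<in>S. a x * a y * c x y)"
proof -
  from g interpret prob_space \<mu> by (simp add: is_centred_gaussian_def)
  have sets_mu[measurable_cong]: "sets \<mu> = sets (PiM S (\<lambda>_. borel))"
    and n: "\<And>a. \<exists>v\<ge>0. distr \<mu> borel (\<lambda>\<zeta>. \<Sum>x\<in>S. a x * \<zeta> x) = centred_normal v"
    and c: "\<And>x y. x \<in> S \<Longrightarrow> y \<in> S \<Longrightarrow> (\<integral>\<zeta>. \<zeta> x * \<zeta> y \<partial>\<mu>) = c x y"
    using g by (auto simp: is_centred_gaussian_def)
  have m[measurable]: "(\<lambda>\<zeta>. \<zeta> x) \<in> borel_measurable \<mu>" if "x \<in> S" for x
    by (rule measurable_component_borel[OF _ that]) (fact sets_mu)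
  have one: "\<exists>v\<ge>0. distr \<mu> borel (\<lambda>\<zeta>. \<zeta> x) = centred_normal v" if "x \<in> S" for x
    using n[of "\<lambda>y. if y = x then 1 else 0"] S that by (simp add: if_distrib[of "\<lambda>x. x * _"] sum.delta' cong: if_cong)
  have sq: "integrable \<mu> (\<lambda>\<zeta>. (\<zeta> x)\<^sup>2)" if "x \<in> S" for x
    using one[OF that] centred_normal_distr_moments(2)[OF _ _ m[OF that]] by (auto simp: has_bochner_integral_iff)
  have pr: "integrable \<mu> (\<lambda>\<zeta>. \<zeta> x * \<zeta> y)" if "x \<in> S" "y \<in> S" for x y
  proof (rule Bochner_Integration.integrable_bound[OF Bochner_Integration.integrable_add[OF sq[OF that(1)] sq[OF that(2)]]])
    have "\<bar>a * b\<bar> \<le> a\<^sup>2 + b\<^sup>2" for a b :: real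
      using sum_squares_bound[of a b] sum_squares_bound[of a "-b"] zero_le_power2[of a] zero_le_power2[of b] by (simp add: abs_le_iff)
    then show "AE \<zeta> in \<mu>. norm (\<zeta> x * \<zeta> y) \<le> norm ((\<zeta> x)\<^sup>2 + (\<zeta> y)\<^sup>2)"
      by (auto intro: order_trans)
  qed (use that in measurable)
  show p: "has_bochner_integral \<mu> (\<lambda>\<zeta>. \<zeta> x * \<zeta> y) (c x y)" if "x \<in> S" "y \<in> S" for x y
    using pr c that by (simp add: has_bochner_integral_iff)
  show "has_bochner_integral \<mu> (\<lambda>\<zeta>. \<zeta> x) 0" if "x \<in> S" for x
    using one[OF that] centred_normal_distr_moments(1)[OF _ _ m[OF that]] by auto
  show "has_bochner_integral \<mu> (\<lambda>\<zeta>. \<zeta> x ^ 4) (3 * (c x x)\<^sup>2)" if "x \<in> S" for x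
  proof -
    obtain v where v: "v \<ge> 0" "distr \<mu> borel (\<lambda>\<zeta>. \<zeta> x) = centred_normal v" using one[OF \<open>x \<in> S\<close>] by auto
    have "c x x = v"
      using centred_normal_distr_moments(2)[OF v(2,1) m[OF that]] c[OF that that]
      by (simp add: has_bochner_integral_iff power2_eq_square)
    then show ?thesis using centred_normal_distr_moments(3)[OF v(2,1) m[OF that]] by simp
  qed
  obtain v where v: "v \<ge> 0" "distr \<mu> borel (\<lambda>\<zeta>. \<Sum>x\<in>S. a x * \<zeta> x) = centred_normal v" using n by blast
  have "has_bochner_integral \<mu> (\<lambda>\<zeta>. \<Sum>x\<in>S. \<Sum>y\<in>S. a x * a y * (\<zeta> x * \<zeta> y)) (\<Sum>x\<in>S. \<Sum>y\<in>S. a x * a y * c x y)"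
    by (intro has_bochner_integral_sum has_bochner_integral_mult_right p) auto
  moreover have "(\<lambda>\<zeta>. \<Sum>x\<in>S. \<Sum>y\<in>S. a x * a y * (\<zeta> x * \<zeta> y)) = (\<lambda>\<zeta>. (\<Sum>x\<in>S. a x * \<zeta> x)\<^sup>2)"
    by (simp add: power2_eq_square sum_product mult_ac)
  moreover have "has_bochner_integral \<mu> (\<lambda>\<zeta>. (\<Sum>x\<in>S. a x * \<zeta> x)\<^sup>2) v"
    by (rule centred_normal_distr_moments(2)[OF v(2,1)]) measurable
  ultimately have "v = (\<Sum>x\<in>S. \<Sum>y\<in>S. a x * a y * c x y)"
    using has_bochner_integral_eq[of \<mu> "\<lambda>\<zeta>. (\<Sum>x\<in>S. a x * \<zeta> x)\<^sup>2"] by simp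
  then show "distr \<mu> borel (\<lambda>\<zeta>. \<Sum>x\<in>S. a x * \<zeta> x) = centred_normal (\<Sum>x\<in>S. \<Sum>y\<in>S. a x * a y * c x y)"
    "0 \<le> (\<Sum>x\<in>S. \<Sum>y\<in>S. a x * a y * c x y)"
    using v by auto
qed

lemma char_centred_gaussian:
  assumes S: "finite S" and g: "is_centred_gaussian S c \<mu>"
  shows "(CLINT \<zeta>|\<mu>. iexp (\<Sum>x\<in>S. a x * \<zeta> x)) = of_real (exp (- (\<Sum>x\<in>S. \<Sum>y\<in>S. a x * a y * c x y) / 2))"
proof -
  have sets_mu[measurable_cong]: "sets \<mu> = sets (PiM S (\<lambda>_. borel))" using g by (auto simp: is_centred_gaussian_def)
  have [measurable]: "(\<lambda>\<zeta>. \<zeta> x) \<in> borel_measurable \<mu>" if "x \<in> S" for x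
    by (rule measurable_component_borel[OF _ that]) (fact sets_mu)
  have "(CLINT y|distr \<mu> borel (\<lambda>\<zeta>. \<Sum>x\<in>S. a x * \<zeta> x). iexp (1 * y)) = (CLINT \<zeta>|\<mu>. iexp (1 * (\<Sum>x\<in>S. a x * \<zeta> x)))"
    by (rule integral_distr) auto
  then show ?thesis
    unfolding centred_gaussian_moments(4)[OF S g] char_centred_normal[OF centred_gaussian_moments(5)[OF S g]] by simp
qed

lemma is_centred_gaussian_unique:
  assumes "finite S" "is_centred_gaussian S c \<mu>" "is_centred_gaussian S c \<nu>"
  shows "\<mu> = \<nu>"
proof (rule finite_measure_eqI_char_PiM[OF assms(1)])
  show "(CLINT \<zeta>|\<mu>. iexp (\<Sum>i\<in>S. a i * \<zeta> i)) = (CLINT \<zeta>|\<nu>. iexp (\<Sum>i\<in>S. a i * \<zeta> i))" for a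
    unfolding char_centred_gaussian[OF assms(1,2)] char_centred_gaussian[OF assms(1,3)] ..
qed (use assms in \<open>auto simp: is_centred_gaussian_def intro: prob_space.finite_measure\<close>)

lemma gaussian_eqI: "finite S \<Longrightarrow> is_centred_gaussian S c \<mu> \<Longrightarrow> gaussian S c = \<mu>"
  unfolding gaussian_def by (blast intro: is_centred_gaussian_unique)

text \<open>Rescaling \<open>a\<close> turns the joint characteristic function into that of each
  linear combination, so these are normal with the expected variances. The covariances are then
  recovered from variances by polarisation, which uses the symmetry of \<open>c\<close>.\<close>

lemma is_centred_gaussianI_char:
  fixes c :: "'i \<Rightarrow> 'i \<Rightarrow> real"
  assumes S: "finite S" and \<mu>: "prob_space \<mu>" and sets_mu[measurable_cong]: "sets \<mu> = sets (PiM S (\<lambda>_. borel))"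
    and sym: "\<And>x y. x \<in> S \<Longrightarrow> y \<in> S \<Longrightarrow> c x y = c y x"
    and pos: "\<And>a. 0 \<le> (\<Sum>x\<in>S. \<Sum>y\<in>S. a x * a y * c x y)"
    and ch: "\<And>a. (CLINT \<zeta>|\<mu>. iexp (\<Sum>x\<in>S. a x * \<zeta> x)) = of_real (exp (- (\<Sum>x\<in>S. \<Sum>y\<in>S. a x * a y * c x y) / 2))"
  shows "is_centred_gaussian S c \<mu>"
proof -
  interpret prob_space \<mu> by fact
  let ?Q = "\<lambda>a. \<Sum>x\<in>S. \<Sum>y\<in>S. a x * a y * c x y"
  have [measurable]: "(\<lambda>\<zeta>. \<zeta> x) \<in> borel_measurable \<mu>" if "x \<in> S" for x
    by (rule measurable_component_borel[OF _ that]) (fact sets_mu)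
  have n: "distr \<mu> borel (\<lambda>\<zeta>. \<Sum>x\<in>S. a x * \<zeta> x) = centred_normal (?Q a)" for a
  proof (rule distr_eq_centred_normalI[OF _ pos])
    fix t
    have "(CLINT \<zeta>|\<mu>. iexp (t * (\<Sum>x\<in>S. a x * \<zeta> x))) = (CLINT \<zeta>|\<mu>. iexp (\<Sum>x\<in>S. (t * a x) * \<zeta> x))"
      by (simp only: sum_distrib_left mult.assoc)
    also have "\<dots> = of_real (exp (- ?Q (\<lambda>x. t * a x) / 2))" by (rule ch)
    also have "?Q (\<lambda>x. t * a x) = t\<^sup>2 * ?Q a"
      by (simp add: sum_distrib_left power2_eq_square mult_ac)
    finally show "(CLINT \<zeta>|\<mu>. iexp (t * (\<Sum>x\<in>S. a x * \<zeta> x))) = of_real (exp (- (t\<^sup>2 * ?Q a) / 2))" .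
  qed measurable
  have mom: "has_bochner_integral \<mu> (\<lambda>\<zeta>. (\<Sum>x\<in>S. a x * \<zeta> x)\<^sup>2) (?Q a)" for a
    by (rule centred_normal_distr_moments(2)[OF n pos]) measurable
  have cov: "(\<integral>\<zeta>. \<zeta> x * \<zeta> y \<partial>\<mu>) = c x y" if xy: "x \<in> S" "y \<in> S" for x y
  proof -
    define e where "e = (\<lambda>(x :: 'i) u. if u = x then 1 else 0 :: real)"
    have e: "(\<Sum>u\<in>S. e x u * f u) = f x" if "x \<in> S" for x f
      using S that by (simp add: e_def if_distrib[of "\<lambda>x. x * _"] sum.delta' cong: if_cong)
    have Q: "?Q (\<lambda>u. s * e x u + t * e y u) = s\<^sup>2 * c x x + t\<^sup>2 * c y y + 2 * s * t * c x y" if xy: "x \<in> S" "y \<in> S" for s t x y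
    proof -
      have "?Q (\<lambda>u. s * e x u + t * e y u) = s\<^sup>2 * (\<Sum>u\<in>S. e x u * (\<Sum>w\<in>S. e x w * c u w)) + t\<^sup>2 * (\<Sum>u\<in>S. e y u * (\<Sum>w\<in>S. e y w * c u w))
          + s * t * (\<Sum>u\<in>S. e x u * (\<Sum>w\<in>S. e y w * c u w)) + s * t * (\<Sum>u\<in>S. e y u * (\<Sum>w\<in>S. e x w * c u w))"
        by (simp add: sum_distrib_left sum.distrib[symmetric] power2_eq_square algebra_simps)
      then show ?thesis using xy sym[OF xy] by (simp add: e)
    qed
    have L: "(\<Sum>u\<in>S. (s * e x u + t * e y u) * \<zeta> u) = s * \<zeta> x + t * \<zeta> y" if "x \<in> S" "y \<in> S" for s t \<zeta> x y
      using that e[of x \<zeta>] e[of y \<zeta>] by (simp add: distrib_right sum.distrib mult.assoc sum_distrib_left[symmetric])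
    have 1: "has_bochner_integral \<mu> (\<lambda>\<zeta>. (1 * \<zeta> x + 1 * \<zeta> y)\<^sup>2) (c x x + c y y + 2 * c x y)"
      using mom[of "\<lambda>u. 1 * e x u + 1 * e y u"] unfolding L[OF xy] Q[OF xy] by simp
    have 2: "has_bochner_integral \<mu> (\<lambda>\<zeta>. (1 * \<zeta> x + (-1) * \<zeta> y)\<^sup>2) (c x x + c y y - 2 * c x y)"
      using mom[of "\<lambda>u. 1 * e x u + (-1) * e y u"] unfolding L[OF xy] Q[OF xy] by simp
    have "has_bochner_integral \<mu> (\<lambda>\<zeta>. (1/4) * ((1 * \<zeta> x + 1 * \<zeta> y)\<^sup>2 - (1 * \<zeta> x + (-1) * \<zeta> y)\<^sup>2))
       ((1/4) * (c x x + c y y + 2 * c x y - (c x x + c y y - 2 * c x y)))"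
      by (intro has_bochner_integral_mult_right has_bochner_integral_diff 1 2)
    moreover have "(1/4) * ((1 * a + 1 * b)\<^sup>2 - (1 * a + (-1) * b)\<^sup>2) = a * b" for a b :: real
      by (simp add: power2_eq_square algebra_simps)
    ultimately have "has_bochner_integral \<mu> (\<lambda>\<zeta>. \<zeta> x * \<zeta> y) (c x y)" by simp
    then show ?thesis by (simp add: has_bochner_integral_iff)
  qed
  show ?thesis
    unfolding is_centred_gaussian_def using \<mu> sets_mu n pos cov by blast
qed

section \<open>Wiener integrals\<close>

lemma step_fun_simps [simp]:
  "step_fun [] u = 0"
  "step_fun ((a, r, s) # p) u = a * indicator {r<..s} u + step_fun p u"
  "step_fun (p @ q) u = step_fun p u + step_fun q u"
  by (simp_all add: step_fun_def)

lemma step_integral_simps [simp]: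
  "step_integral B [] \<omega> = 0"
  "step_integral B ((a, r, s) # p) \<omega> = a * (B s \<omega> - B r \<omega>) + step_integral B p \<omega>"
  "step_integral B (p @ q) \<omega> = step_integral B p \<omega> + step_integral B q \<omega>"
  by (simp_all add: step_integral_def)

definition scale_steps :: "real \<Rightarrow> (real \<times> real \<times> real) list \<Rightarrow> (real \<times> real \<times> real) list" where
  "scale_steps c = map (\<lambda>(a, r, s). (c * a, r, s))"

lemma scale_steps_simps [simp]:
  "scale_steps c [] = []"
  "scale_steps c ((a, r, s) # p) = (c * a, r, s) # scale_steps c p"
  by (simp_all add: scale_steps_def)

lemma step_fun_scale_steps [simp]: "step_fun (scale_steps c p) u = c * step_fun p u"
  by (induction p) (auto simp: algebra_simps)

lemma step_integral_scale_steps [simp]: "step_integral B (scale_steps c p) \<omega> = c * step_integral B p \<omega>"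
  by (induction p) (auto simp: algebra_simps)

text \<open>Times below 0 are excluded because nothing is known about the processes there.\<close>

definition valid_steps :: "(real \<times> real \<times> real) list \<Rightarrow> bool" where
  "valid_steps p \<longleftrightarrow> (\<forall>(a, r, s)\<in>set p. 0 \<le> r \<and> r \<le> s)"

lemma valid_steps_simps [simp]:
  "valid_steps []"
  "valid_steps ((a, r, s) # p) \<longleftrightarrow> 0 \<le> r \<and> r \<le> s \<and> valid_steps p"
  "valid_steps (p @ q) \<longleftrightarrow> valid_steps p \<and> valid_steps q"
  "valid_steps (scale_steps c p) \<longleftrightarrow> valid_steps p"
  by (simp_all add: valid_steps_def scale_steps_def ball_Un split_beta)

lemma borel_measurable_step_fun [measurable]: "step_fun p \<in> borel_measurable borel"
proof (induction p)
  case Nil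
  then show ?case by (simp add: step_fun_def[abs_def])
next
  case (Cons x p)
  obtain a r s where [simp]: "x = (a, r, s)" by (cases x)
  have "step_fun (x # p) = (\<lambda>u. a * indicator {r<..s} u + step_fun p u)" by auto
  then show ?case using Cons by simp
qed

lemma borel_measurable_step_integral:
  assumes "valid_steps p" "\<And>t. t \<ge> 0 \<Longrightarrow> B t \<in> borel_measurable M"
  shows "step_integral B p \<in> borel_measurable M"
  using assms(1)
proof (induction p)
  case Nil
  then show ?case by (simp add: step_integral_def[abs_def])
next
  case (Cons x p)
  obtain a r s where [simp]: "x = (a, r, s)" by (cases x)
  have "step_integral B (x # p) = (\<lambda>\<omega>. a * (B s \<omega> - B r \<omega>) + step_integral B p \<omega>)" by auto
  then show ?case using Cons assms(2)[of r] assms(2)[of s] by simp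
qed

text \<open>The intervals of a step list may overlap; cutting them at a grid containing all
  endpoints turns each difference into a telescoping sum. Intervals are open on the left, so the
  value on a cell is read at its right end. With \<open>b\<close> a path this rewrites a step
  integral, with \<open>b\<close> the function \<open>s \<mapsto> of_bool (u \<le> s)\<close> the
  step function itself.\<close>

lemma sum_list_telescope_partition:
  fixes b :: "real \<Rightarrow> real"
  assumes \<tau>: "strict_mono_on {..n} \<tau>"
    and p: "\<forall>(a, r, s)\<in>set p. r \<in> \<tau> ` {..n} \<and> s \<in> \<tau> ` {..n} \<and> r \<le> s"
  shows "(\<Sum>(a, r, s)\<leftarrow>p. a * (b s - b r)) = (\<Sum>i<n. step_fun p (\<tau> (Suc i)) * (b (\<tau> (Suc i)) - b (\<tau> i)))"
  using p
proof (induction p)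
  case (Cons x p)
  obtain a r s where x: "x = (a, r, s)" by (cases x)
  obtain j k where jk: "r = \<tau> j" "s = \<tau> k" "j \<le> n" "k \<le> n" and "r \<le> s" using Cons.prems x by auto
  then have "j \<le> k" using \<tau> by (metis atMost_iff linorder_not_less strict_mono_onD)
  have iff: "\<tau> i < \<tau> l \<longleftrightarrow> i < l" if "i \<le> n" "l \<le> n" for i l
    using \<tau> that by (metis atMost_iff linorder_neqE_nat order_less_imp_not_less strict_mono_onD)
  have "(\<Sum>i<n. indicator {r<..s} (\<tau> (Suc i)) * (b (\<tau> (Suc i)) - b (\<tau> i))) = (\<Sum>i\<in>{j..<k}. b (\<tau> (Suc i)) - b (\<tau> i))"
  proof (rule sum.mono_neutral_cong_right)
    show "{j..<k} \<subseteq> {..<n}" using jk by auto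
    show "\<forall>i\<in>{..<n} - {j..<k}. indicator {r<..s} (\<tau> (Suc i)) * (b (\<tau> (Suc i)) - b (\<tau> i)) = 0"
    proof
      fix i assume i: "i \<in> {..<n} - {j..<k}"
      then have "\<not> (\<tau> j < \<tau> (Suc i) \<and> \<not> \<tau> k < \<tau> (Suc i))" using jk by (subst (1 2) iff) auto
      then have "\<tau> (Suc i) \<notin> {r<..s}" using jk by auto
      then show "indicator {r<..s} (\<tau> (Suc i)) * (b (\<tau> (Suc i)) - b (\<tau> i)) = 0" by simp
    qed
    fix i assume i: "i \<in> {j..<k}"
    then have "\<tau> j < \<tau> (Suc i) \<and> \<not> \<tau> k < \<tau> (Suc i)" using jk by (subst (1 2) iff) auto
    then have "\<tau> (Suc i) \<in> {r<..s}" using jk by auto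
    then show "indicator {r<..s} (\<tau> (Suc i)) * (b (\<tau> (Suc i)) - b (\<tau> i)) = b (\<tau> (Suc i)) - b (\<tau> i)" by simp
  qed simp
  also have "\<dots> = b s - b r" using sum_Suc_diff'[OF \<open>j \<le> k\<close>, of "\<lambda>i. b (\<tau> i)"] jk by simp
  finally have "a * (b s - b r) = (\<Sum>i<n. a * indicator {r<..s} (\<tau> (Suc i)) * (b (\<tau> (Suc i)) - b (\<tau> i)))"
    by (simp only: mult.assoc sum_distrib_left[symmetric])
  then show ?case using Cons x by (simp add: distrib_right sum.distrib)
qed simp

text \<open>The enumeration is strictly increasing up to \<open>n\<close> and constant afterwards:
  the definition of Brownian motion asks for a sequence that is monotone on all natural
  numbers.\<close>

lemma ex_partition:
  fixes T :: "real set"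
  assumes "finite T" "T \<noteq> {}"
  obtains \<tau> :: "nat \<Rightarrow> real" and n where "mono \<tau>" "strict_mono_on {..n} \<tau>" "\<tau> ` {..n} = T"
proof -
  define l where "l = sorted_list_of_set T"
  define n where "n = length l - 1"
  have l: "sorted_wrt (<) l" "set l = T" "l \<noteq> []" using assms by (auto simp: l_def)
  then have n: "length l = Suc n" by (simp add: n_def)
  define \<tau> where "\<tau> i = l ! min i n" for i
  have "strict_mono_on {..n} \<tau>"
    using l n by (auto simp: strict_mono_on_def \<tau>_def sorted_wrt_iff_nth_less min_def)
  moreover have "mono \<tau>"
    using l n by (auto simp: mono_def \<tau>_def min_def intro!: sorted_nth_mono strict_sorted_imp_sorted)
  moreover have "\<tau> ` {..n} = T"
    using l(2) n by (auto simp: \<tau>_def set_conv_nth image_iff min_def less_Suc_eq_le)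
  ultimately show ?thesis using that by blast
qed

lemma step_fun_partition:
  assumes "strict_mono_on {..n} \<tau>"
    and "\<forall>(a, r, s)\<in>set p. r \<in> \<tau> ` {..n} \<and> s \<in> \<tau> ` {..n} \<and> r \<le> s"
  shows "step_fun p u = (\<Sum>i<n. step_fun p (\<tau> (Suc i)) * indicator {\<tau> i<..\<tau> (Suc i)} u)"
proof -
  have "step_fun p u = (\<Sum>(a, r, s)\<leftarrow>p. a * (of_bool (u \<le> s) - of_bool (u \<le> r)))"
    using assms(2) by (induction p) (auto simp: indicator_def)
  also have "\<dots> = (\<Sum>i<n. step_fun p (\<tau> (Suc i)) * (of_bool (u \<le> \<tau> (Suc i)) - of_bool (u \<le> \<tau> i)))"
    by (rule sum_list_telescope_partition[OF assms])
  also have "\<dots> = (\<Sum>i<n. step_fun p (\<tau> (Suc i)) * indicator {\<tau> i<..\<tau> (Suc i)} u)"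
  proof (rule sum.cong[OF refl])
    fix i assume "i \<in> {..<n}"
    then have "\<tau> i < \<tau> (Suc i)" using assms(1) by (auto simp: strict_mono_on_def)
    then show "step_fun p (\<tau> (Suc i)) * (of_bool (u \<le> \<tau> (Suc i)) - of_bool (u \<le> \<tau> i)) = step_fun p (\<tau> (Suc i)) * indicator {\<tau> i<..\<tau> (Suc i)} u"
      by (auto simp: indicator_def)
  qed
  finally show ?thesis .
qed

lemma has_bochner_integral_step_fun_square:
  assumes \<tau>: "strict_mono_on {..n} \<tau>"
    and p: "\<forall>(a, r, s)\<in>set p. r \<in> \<tau> ` {..n} \<and> s \<in> \<tau> ` {..n} \<and> r \<le> s"
  shows "has_bochner_integral lborel (\<lambda>u. (step_fun p u)\<^sup>2) (\<Sum>i<n. (step_fun p (\<tau> (Suc i)))\<^sup>2 * (\<tau> (Suc i) - \<tau> i))"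
proof -
  have le: "\<tau> i \<le> \<tau> j" if "i \<le> j" "j \<le> n" for i j
    using strict_mono_on_leD[OF \<tau>, of i j] that by simp
  have sq: "(step_fun p u)\<^sup>2 = (\<Sum>i<n. (step_fun p (\<tau> (Suc i)))\<^sup>2 * indicator {\<tau> i<..\<tau> (Suc i)} u)" for u
  proof -
    let ?c = "\<lambda>i. step_fun p (\<tau> (Suc i))" and ?x = "\<lambda>i. indicator {\<tau> i<..\<tau> (Suc i)} u :: real"
    have "(step_fun p u)\<^sup>2 = (\<Sum>i<n. \<Sum>j<n. (?c i * ?x i) * (?c j * ?x j))"
      unfolding power2_eq_square by (subst (1 2) step_fun_partition[OF assms]) (rule sum_product)
    also have "\<dots> = (\<Sum>i<n. \<Sum>j<n. if j = i then (?c i)\<^sup>2 * ?x i else 0)"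
    proof (intro sum.cong refl)
      fix i j assume ij: "i \<in> {..<n}" "j \<in> {..<n}"
      show "(?c i * ?x i) * (?c j * ?x j) = (if j = i then (?c i)\<^sup>2 * ?x i else 0)"
        using ij le[of "Suc i" j] le[of "Suc j" i]
        by (cases i j rule: linorder_cases) (auto simp: indicator_def power2_eq_square)
    qed
    also have "\<dots> = (\<Sum>i<n. (?c i)\<^sup>2 * ?x i)" by simp
    finally show ?thesis .
  qed
  have one: "has_bochner_integral lborel (\<lambda>u. indicator {\<tau> i<..\<tau> (Suc i)} u) (\<tau> (Suc i) - \<tau> i)" if "i < n" for i
    using has_bochner_integral_real_indicator[of "{\<tau> i<..\<tau> (Suc i)}" lborel] le[of i "Suc i"] that by simp
  have eq: "(\<lambda>u. (step_fun p u)\<^sup>2) = (\<lambda>u. \<Sum>i<n. (step_fun p (\<tau> (Suc i)))\<^sup>2 * indicator {\<tau> i<..\<tau> (Suc i)} u)"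
    by (rule ext) (rule sq)
  show ?thesis unfolding eq
    by (intro has_bochner_integral_sum has_bochner_integral_mult_right one) auto
qed

text \<open>On a common grid the integral is a combination of independent normal increments, so the
  characteristic function is a product of Gaussian factors, and the exponents add up to the squared
  L2 norm of the step function.\<close>

lemma (in prob_space) char_step_integral:
  assumes B: "brownian_motion M B" and p: "valid_steps p"
  shows "integrable lborel (\<lambda>u. (step_fun p u)\<^sup>2)"
    "(CLINT \<omega>|M. iexp (step_integral B p \<omega>)) = of_real (exp (- (\<integral>u. (step_fun p u)\<^sup>2 \<partial>lborel) / 2))"
proof -
  have Bm: "\<And>t. t \<ge> 0 \<Longrightarrow> B t \<in> borel_measurable M"
    and Bd: "\<And>s t. 0 \<le> s \<Longrightarrow> s \<le> t \<Longrightarrow> distr M borel (\<lambda>\<omega>. B t \<omega> - B s \<omega>) = centred_normal (t - s)"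
    and Bi: "\<And>(\<tau> :: nat \<Rightarrow> real) n. 0 \<le> \<tau> 0 \<Longrightarrow> mono \<tau> \<Longrightarrow> indep_vars (\<lambda>_. borel) (\<lambda>i \<omega>. B (\<tau> (Suc i)) \<omega> - B (\<tau> i) \<omega>) {..<n}"
    using B unfolding brownian_motion_def by blast+
  \<comment> \<open>Adding 0 keeps the grid nonempty even for the empty list.\<close>
  define T where "T = insert 0 (\<Union>(a, r, s)\<in>set p. {r, s})"
  have T: "finite T" "T \<noteq> {}" by (auto simp: T_def)
  obtain \<tau> :: "nat \<Rightarrow> real" and n where \<tau>: "mono \<tau>" "strict_mono_on {..n} \<tau>" "\<tau> ` {..n} = T" by (rule ex_partition[OF T])
  have p': "\<forall>(a, r, s)\<in>set p. r \<in> \<tau> ` {..n} \<and> s \<in> \<tau> ` {..n} \<and> r \<le> s"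
    using p unfolding \<tau>(3) T_def valid_steps_def by blast
  have "\<tau> 0 \<in> T" unfolding \<tau>(3)[symmetric] by simp
  then have "\<tau> 0 \<ge> 0" using p by (force simp: T_def valid_steps_def)
  then have \<tau>0: "\<tau> i \<ge> 0" for i using \<tau>(1) by (meson le0 monoD order_trans)
  note sq = has_bochner_integral_step_fun_square[OF \<tau>(2) p']
  show "integrable lborel (\<lambda>u. (step_fun p u)\<^sup>2)" using sq by (simp add: has_bochner_integral_iff)
  let ?c = "\<lambda>i. step_fun p (\<tau> (Suc i))" and ?d = "\<lambda>i \<omega>. B (\<tau> (Suc i)) \<omega> - B (\<tau> i) \<omega>"
  have I: "step_integral B p \<omega> = (\<Sum>i<n. ?c i * ?d i \<omega>)" for \<omega>
    unfolding step_integral_def by (rule sum_list_telescope_partition[OF \<tau>(2) p'])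
  have dm[measurable]: "?d i \<in> borel_measurable M" for i using Bm[OF \<tau>0] by simp
  have ind: "indep_vars (\<lambda>_. borel) (\<lambda>i \<omega>. iexp (?c i * ?d i \<omega>)) {..<n}"
    by (rule indep_vars_compose2[OF Bi]) (use \<tau>0 \<tau>(1) in auto)
  have one: "(CLINT \<omega>|M. iexp (t * ?d i \<omega>)) = of_real (exp (- (t\<^sup>2 * (\<tau> (Suc i) - \<tau> i)) / 2))" for t i
  proof -
    have "(CLINT x|distr M borel (?d i). iexp (t * x)) = (CLINT \<omega>|M. iexp (t * ?d i \<omega>))"
      by (rule integral_distr) auto
    then show ?thesis
      using Bd[OF \<tau>0, of i "\<tau> (Suc i)"] char_centred_normal[of "\<tau> (Suc i) - \<tau> i" t] monoD[OF \<tau>(1), of i "Suc i"] by simp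
  qed
  have "(CLINT \<omega>|M. iexp (step_integral B p \<omega>)) = (CLINT \<omega>|M. (\<Prod>i<n. iexp (?c i * ?d i \<omega>)))"
    unfolding I by (simp only: of_real_sum sum_distrib_left exp_sum finite_lessThan)
  also have "\<dots> = (\<Prod>i<n. CLINT \<omega>|M. iexp (?c i * ?d i \<omega>))"
  proof (rule indep_vars_lebesgue_integral[OF _ ind])
    show "integrable M (\<lambda>\<omega>. iexp (?c i * ?d i \<omega>))" for i
      by (rule integrable_complex_bounded[where B=1]) (simp_all add: Bm \<tau>0 del: of_real_mult of_real_diff)
  qed simp
  also have "\<dots> = (\<Prod>i<n. of_real (exp (- ((?c i)\<^sup>2 * (\<tau> (Suc i) - \<tau> i)) / 2)))"
    by (simp only: one)
  also have "\<dots> = of_real (exp (\<Sum>i<n. - ((?c i)\<^sup>2 * (\<tau> (Suc i) - \<tau> i)) / 2))"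
    by (simp only: exp_sum finite_lessThan of_real_prod)
  also have "(\<Sum>i<n. - ((?c i)\<^sup>2 * (\<tau> (Suc i) - \<tau> i)) / 2) = - (\<integral>u. (step_fun p u)\<^sup>2 \<partial>lborel) / 2"
    using sq by (simp add: has_bochner_integral_iff sum_negf sum_divide_distrib)
  finally show "(CLINT \<omega>|M. iexp (step_integral B p \<omega>)) = of_real (exp (- (\<integral>u. (step_fun p u)\<^sup>2 \<partial>lborel) / 2))" .
qed

section \<open>Convergence in L2\<close>

lemma L2_tendsto_zero:
  fixes h :: "nat \<Rightarrow> 'a \<Rightarrow> real"
  assumes [measurable]: "\<And>n. h n \<in> borel_measurable M"
    and lim: "(\<lambda>n. \<integral>\<^sup>+x. ennreal ((h n x)\<^sup>2) \<partial>M) \<longlonglongrightarrow> 0"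
  shows "\<forall>\<^sub>F n in sequentially. integrable M (\<lambda>x. (h n x)\<^sup>2)"
    and "(\<lambda>n. \<integral>x. (h n x)\<^sup>2 \<partial>M) \<longlonglongrightarrow> 0"
proof -
  have "\<forall>\<^sub>F n in sequentially. (\<integral>\<^sup>+x. ennreal ((h n x)\<^sup>2) \<partial>M) < \<infinity>"
    using lim by (rule order_tendstoD) simp
  then show ev: "\<forall>\<^sub>F n in sequentially. integrable M (\<lambda>x. (h n x)\<^sup>2)"
    by eventually_elim (auto simp: integrable_iff_bounded)
  have "\<forall>\<^sub>F n in sequentially. (\<integral>\<^sup>+x. ennreal ((h n x)\<^sup>2) \<partial>M) = ennreal (\<integral>x. (h n x)\<^sup>2 \<partial>M)"
    using ev by eventually_elim (auto intro: nn_integral_eq_integral)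
  then have "(\<lambda>n. ennreal (\<integral>x. (h n x)\<^sup>2 \<partial>M)) \<longlonglongrightarrow> ennreal 0"
    using lim by (simp add: tendsto_cong)
  then show "(\<lambda>n. \<integral>x. (h n x)\<^sup>2 \<partial>M) \<longlonglongrightarrow> 0"
    by (subst (asm) tendsto_ennreal_iff) auto
qed

text \<open>The inequality \<open>pw\<close> of Young type bounds the difference of the squares by a
  large multiple of the squared distance, which tends to 0, and a small multiple of the limit
  itself.\<close>

lemma L2_tendsto_norm:
  fixes g :: "nat \<Rightarrow> 'a \<Rightarrow> real"
  assumes [measurable]: "f \<in> borel_measurable M" "\<And>n. g n \<in> borel_measurable M"
    and g: "\<And>n. integrable M (\<lambda>x. (g n x)\<^sup>2)"
    and lim: "(\<lambda>n. \<integral>\<^sup>+x. ennreal ((f x - g n x)\<^sup>2) \<partial>M) \<longlonglongrightarrow> 0"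
  shows "integrable M (\<lambda>x. (f x)\<^sup>2)"
    and "(\<lambda>n. \<integral>x. (g n x)\<^sup>2 \<partial>M) \<longlonglongrightarrow> (\<integral>x. (f x)\<^sup>2 \<partial>M)"
proof -
  let ?d = "\<lambda>n. \<integral>x. (f x - g n x)\<^sup>2 \<partial>M"
  have ev: "\<forall>\<^sub>F n in sequentially. integrable M (\<lambda>x. (f x - g n x)\<^sup>2)" and d0: "?d \<longlonglongrightarrow> 0"
    using L2_tendsto_zero[OF _ lim] by auto
  obtain n where n: "integrable M (\<lambda>x. (f x - g n x)\<^sup>2)"
    using eventually_happens[OF ev] by auto
  have sq: "(a + b)\<^sup>2 \<le> 2 * a\<^sup>2 + 2 * b\<^sup>2" for a b :: real
    using sum_squares_bound[of a b] by (simp add: power2_sum)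
  have "integrable M (\<lambda>x. 2 * (f x - g n x)\<^sup>2 + 2 * (g n x)\<^sup>2)" using n g[of n] by auto
  then show f: "integrable M (\<lambda>x. (f x)\<^sup>2)"
  proof (rule Bochner_Integration.integrable_bound)
    show "AE x in M. norm ((f x)\<^sup>2) \<le> norm (2 * (f x - g n x)\<^sup>2 + 2 * (g n x)\<^sup>2)"
      using sq[of "f x - g n x" "g n x" for x] by simp
  qed simp
  define A where "A = (\<integral>x. (f x)\<^sup>2 \<partial>M)"
  have A: "A \<ge> 0" by (simp add: A_def)
  show "(\<lambda>n. \<integral>x. (g n x)\<^sup>2 \<partial>M) \<longlonglongrightarrow> (\<integral>x. (f x)\<^sup>2 \<partial>M)"
  proof (rule tendstoI)
    fix e :: real assume e: "e > 0"
    \<comment> \<open>Chosen so that \<open>\<delta> * A\<close> stays below \<open>e\<close>; the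
      added 1 covers the case \<open>A = 0\<close>.\<close>
    define \<delta> where "\<delta> = e / (2 * (A + 1))"
    have \<delta>: "\<delta> > 0" "\<delta> * A < e"
      using e A mult_nonneg_nonneg[OF A less_imp_le[OF e]]
      by (auto simp: \<delta>_def field_simps add_pos_nonneg intro: add_nonneg_pos)
    have "(\<lambda>n. (1 + 1 / \<delta>) * ?d n + \<delta> * A) \<longlonglongrightarrow> (1 + 1 / \<delta>) * 0 + \<delta> * A"
      by (intro tendsto_intros d0)
    then have "\<forall>\<^sub>F n in sequentially. (1 + 1 / \<delta>) * ?d n + \<delta> * A < e"
      using \<delta> by (intro order_tendstoD) auto
    with ev show "\<forall>\<^sub>F n in sequentially. dist (\<integral>x. (g n x)\<^sup>2 \<partial>M) (\<integral>x. (f x)\<^sup>2 \<partial>M) < e"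
    proof eventually_elim
      case (elim n)
      have pw: "\<bar>(g n x)\<^sup>2 - (f x)\<^sup>2\<bar> \<le> (1 + 1 / \<delta>) * (f x - g n x)\<^sup>2 + \<delta> * (f x)\<^sup>2" for x
      proof -
        define a b where "a = f x - g n x" and "b = f x"
        have "2 * \<bar>a * b\<bar> \<le> a\<^sup>2 / \<delta> + \<delta> * b\<^sup>2"
        proof -
          have "0 \<le> (\<bar>a\<bar> / sqrt \<delta> - sqrt \<delta> * \<bar>b\<bar>)\<^sup>2" by simp
          also have "\<dots> = a\<^sup>2 / \<delta> + \<delta> * b\<^sup>2 - 2 * \<bar>a * b\<bar>"
            using \<delta> by (simp add: power2_diff power_divide power_mult_distrib abs_mult)
          finally show ?thesis by simp
        qed
        moreover have "(g n x)\<^sup>2 - (f x)\<^sup>2 = a\<^sup>2 - 2 * (a * b)"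
          by (simp add: a_def b_def power2_eq_square algebra_simps)
        moreover have "(1 + 1 / \<delta>) * a\<^sup>2 = a\<^sup>2 + a\<^sup>2 / \<delta>" by (simp add: distrib_right)
        moreover have "(f x - g n x)\<^sup>2 = a\<^sup>2" "(f x)\<^sup>2 = b\<^sup>2" "0 \<le> a\<^sup>2" "0 \<le> \<delta> * b\<^sup>2"
          using \<delta> by (simp_all add: a_def b_def)
        ultimately show ?thesis by (simp only: abs_le_iff) linarith
      qed
      have "\<bar>(\<integral>x. (g n x)\<^sup>2 \<partial>M) - (\<integral>x. (f x)\<^sup>2 \<partial>M)\<bar> = \<bar>\<integral>x. (g n x)\<^sup>2 - (f x)\<^sup>2 \<partial>M\<bar>"
        using f g by simp
      also have "\<dots> \<le> (\<integral>x. \<bar>(g n x)\<^sup>2 - (f x)\<^sup>2\<bar> \<partial>M)" by (rule integral_abs_bound)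
      also have "\<dots> \<le> (\<integral>x. (1 + 1 / \<delta>) * (f x - g n x)\<^sup>2 + \<delta> * (f x)\<^sup>2 \<partial>M)"
        using f g elim pw by (intro integral_mono) auto
      also have "\<dots> = (1 + 1 / \<delta>) * ?d n + \<delta> * A" using f elim by (simp add: A_def)
      finally show ?case using elim by (simp add: dist_real_def)
    qed
  qed
qed

lemma (in prob_space) L2_tendsto_L1:
  fixes h :: "nat \<Rightarrow> 'a \<Rightarrow> real"
  assumes [measurable]: "\<And>n. h n \<in> borel_measurable M"
    and lim: "(\<lambda>n. \<integral>\<^sup>+x. ennreal ((h n x)\<^sup>2) \<partial>M) \<longlonglongrightarrow> 0"
  shows "\<forall>\<^sub>F n in sequentially. integrable M (h n)" "(\<lambda>n. \<integral>x. \<bar>h n x\<bar> \<partial>M) \<longlonglongrightarrow> 0"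
proof -
  note L2 = L2_tendsto_zero[OF assms]
  \<comment> \<open>Used in place of the Cauchy-Schwarz inequality; the first term is later taken to
    be \<open>e / 2\<close>.\<close>
  have pw: "\<bar>a\<bar> \<le> \<delta> + a\<^sup>2 / \<delta>" if "\<delta> > 0" for a \<delta> :: real
  proof (cases "\<bar>a\<bar> \<le> \<delta>")
    case False
    then have "\<bar>a\<bar> * \<delta> \<le> \<bar>a\<bar> * \<bar>a\<bar>" by (intro mult_left_mono) auto
    then have "\<bar>a\<bar> \<le> a\<^sup>2 / \<delta>" using that by (simp add: field_simps power2_eq_square abs_mult_self_eq)
    then show ?thesis using that by simp
  qed (use that in \<open>auto intro: order_trans simp: add_increasing2\<close>)
  show ev: "\<forall>\<^sub>F n in sequentially. integrable M (h n)"
    using L2(1)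
  proof eventually_elim
    case (elim n)
    then have "integrable M (\<lambda>x. 1 + (h n x)\<^sup>2 / 1)" by auto
    then show ?case by (rule Bochner_Integration.integrable_bound) (use pw[of 1] in auto)
  qed
  show "(\<lambda>n. \<integral>x. \<bar>h n x\<bar> \<partial>M) \<longlonglongrightarrow> 0"
  proof (rule tendstoI)
    fix e :: real assume e: "e > 0"
    have "(\<lambda>n. e / 2 + (\<integral>x. (h n x)\<^sup>2 \<partial>M) / (e / 2)) \<longlonglongrightarrow> e / 2 + 0 / (e / 2)"
      using e by (intro tendsto_intros L2(2)) auto
    from order_tendstoD(2)[OF this, of e] have "\<forall>\<^sub>F n in sequentially. e / 2 + (\<integral>x. (h n x)\<^sup>2 \<partial>M) / (e / 2) < e"
      using e by simp
    with ev L2(1) show "\<forall>\<^sub>F n in sequentially. dist (\<integral>x. \<bar>h n x\<bar> \<partial>M) 0 < e"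
    proof eventually_elim
      case (elim n)
      have "(\<integral>x. \<bar>h n x\<bar> \<partial>M) \<le> (\<integral>x. e / 2 + (h n x)\<^sup>2 / (e / 2) \<partial>M)"
        using elim e pw[of "e / 2"] by (intro integral_mono) auto
      also have "\<dots> = e / 2 + (\<integral>x. (h n x)\<^sup>2 \<partial>M) / (e / 2)" using elim prob_space by simp
      finally show ?case using elim by simp
    qed
  qed
qed

lemma norm_iexp_diff_le: "norm (iexp a - iexp b) \<le> \<bar>a - b\<bar>"
proof -
  have "iexp a - iexp b = iexp b * (iexp (a - b) - 1)"
    by (simp add: right_diff_distrib exp_add[symmetric])
  then have "norm (iexp a - iexp b) = norm (iexp (a - b) - 1)" by (simp add: norm_mult)
  also have "\<dots> \<le> \<bar>a - b\<bar>" using iexp_approx1[of "a - b" 0] by simp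
  finally show ?thesis .
qed

text \<open>
  Unlike in \<open>is_wiener_integral\<close>, a restriction to \<open>[t, \<infinity>)\<close> is part of the integrand, so that
  integrals over different domains can be added.
\<close>

definition wiener_limit :: "'w measure \<Rightarrow> (real \<Rightarrow> 'w \<Rightarrow> real) \<Rightarrow> (real \<Rightarrow> real) \<Rightarrow> ('w \<Rightarrow> real) \<Rightarrow> bool" where
  "wiener_limit M B f J \<longleftrightarrow> f \<in> borel_measurable borel \<and> J \<in> borel_measurable M \<and>
     (\<exists>p. (\<forall>n. valid_steps (p n)) \<and>
        (\<lambda>n. \<integral>\<^sup>+u. ennreal ((f u - step_fun (p n) u)\<^sup>2) \<partial>lborel) \<longlonglongrightarrow> 0 \<and>
        (\<lambda>n. \<integral>\<^sup>+\<omega>. ennreal ((J \<omega> - step_integral B (p n) \<omega>)\<^sup>2) \<partial>M) \<longlonglongrightarrow> 0)"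

lemma wiener_limit_measurable: "wiener_limit M B f J \<Longrightarrow> f \<in> borel_measurable borel" "wiener_limit M B f J \<Longrightarrow> J \<in> borel_measurable M"
  by (simp_all add: wiener_limit_def)

lemma wiener_limit_increment:
  assumes "0 \<le> r" "r \<le> s" "B r \<in> borel_measurable M" "B s \<in> borel_measurable M"
  shows "wiener_limit M B (indicator {r<..s}) (\<lambda>\<omega>. B s \<omega> - B r \<omega>)"
  unfolding wiener_limit_def
  by (intro conjI exI[of _ "\<lambda>_. [(1, r, s)]"]) (use assms in auto)

lemma nn_integral_square_tendsto_zero_mult:
  assumes "(\<lambda>n. \<integral>\<^sup>+x. ennreal ((h n x)\<^sup>2) \<partial>M) \<longlonglongrightarrow> 0" and [measurable]: "\<And>n. h n \<in> borel_measurable M"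
  shows "(\<lambda>n. \<integral>\<^sup>+x. ennreal ((c * h n x)\<^sup>2) \<partial>M) \<longlonglongrightarrow> 0"
proof -
  have "(\<integral>\<^sup>+x. ennreal ((c * h n x)\<^sup>2) \<partial>M) = ennreal (c\<^sup>2) * (\<integral>\<^sup>+x. ennreal ((h n x)\<^sup>2) \<partial>M)" for n
    by (subst nn_integral_cmult[symmetric]) (auto simp: power_mult_distrib ennreal_mult)
  moreover have "(\<lambda>n. ennreal (c\<^sup>2) * (\<integral>\<^sup>+x. ennreal ((h n x)\<^sup>2) \<partial>M)) \<longlonglongrightarrow> ennreal (c\<^sup>2) * 0"
    using assms(1) by (rule ennreal_tendsto_cmult[rotated]) simp
  ultimately show ?thesis by simp
qed

lemma nn_integral_square_tendsto_zero_add: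
  assumes "(\<lambda>n. \<integral>\<^sup>+x. ennreal ((h n x)\<^sup>2) \<partial>M) \<longlonglongrightarrow> 0" and [measurable]: "\<And>n. h n \<in> borel_measurable M"
    and "(\<lambda>n. \<integral>\<^sup>+x. ennreal ((g n x)\<^sup>2) \<partial>M) \<longlonglongrightarrow> 0" and [measurable]: "\<And>n. g n \<in> borel_measurable M"
  shows "(\<lambda>n. \<integral>\<^sup>+x. ennreal ((h n x + g n x)\<^sup>2) \<partial>M) \<longlonglongrightarrow> 0"
proof (rule tendsto_sandwich[OF always_eventually always_eventually tendsto_const])
  show "\<forall>n. (\<integral>\<^sup>+x. ennreal ((h n x + g n x)\<^sup>2) \<partial>M) \<le> 2 * (\<integral>\<^sup>+x. ennreal ((h n x)\<^sup>2) \<partial>M) + 2 * (\<integral>\<^sup>+x. ennreal ((g n x)\<^sup>2) \<partial>M)"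
  proof
    fix n
    have sq: "(a + b)\<^sup>2 \<le> 2 * a\<^sup>2 + 2 * b\<^sup>2" for a b :: real
      using sum_squares_bound[of a b] by (simp add: power2_sum)
    have "(\<integral>\<^sup>+x. ennreal ((h n x + g n x)\<^sup>2) \<partial>M) \<le> (\<integral>\<^sup>+x. 2 * ennreal ((h n x)\<^sup>2) + 2 * ennreal ((g n x)\<^sup>2) \<partial>M)"
    proof (rule nn_integral_mono)
      fix x
      have "ennreal ((h n x + g n x)\<^sup>2) \<le> ennreal (2 * (h n x)\<^sup>2 + 2 * (g n x)\<^sup>2)" by (intro ennreal_leI sq)
      also have "\<dots> = 2 * ennreal ((h n x)\<^sup>2) + 2 * ennreal ((g n x)\<^sup>2)"
        by (simp add: ennreal_plus ennreal_mult)
      finally show "ennreal ((h n x + g n x)\<^sup>2) \<le> 2 * ennreal ((h n x)\<^sup>2) + 2 * ennreal ((g n x)\<^sup>2)" .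
    qed
    also have "\<dots> = 2 * (\<integral>\<^sup>+x. ennreal ((h n x)\<^sup>2) \<partial>M) + 2 * (\<integral>\<^sup>+x. ennreal ((g n x)\<^sup>2) \<partial>M)"
      by (simp add: nn_integral_add nn_integral_cmult)
    finally show "(\<integral>\<^sup>+x. ennreal ((h n x + g n x)\<^sup>2) \<partial>M) \<le> 2 * (\<integral>\<^sup>+x. ennreal ((h n x)\<^sup>2) \<partial>M) + 2 * (\<integral>\<^sup>+x. ennreal ((g n x)\<^sup>2) \<partial>M)" .
  qed
  have "(\<lambda>n. 2 * (\<integral>\<^sup>+x. ennreal ((h n x)\<^sup>2) \<partial>M) + 2 * (\<integral>\<^sup>+x. ennreal ((g n x)\<^sup>2) \<partial>M)) \<longlonglongrightarrow> 2 * 0 + 2 * 0"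
    using assms by (intro tendsto_add ennreal_tendsto_cmult) auto
  then show "(\<lambda>n. 2 * (\<integral>\<^sup>+x. ennreal ((h n x)\<^sup>2) \<partial>M) + 2 * (\<integral>\<^sup>+x. ennreal ((g n x)\<^sup>2) \<partial>M)) \<longlonglongrightarrow> 0" by simp
qed simp

lemma wiener_limit_scale:
  assumes "wiener_limit M B f J" and B: "\<And>t. t \<ge> 0 \<Longrightarrow> B t \<in> borel_measurable M"
  shows "wiener_limit M B (\<lambda>u. c * f u) (\<lambda>\<omega>. c * J \<omega>)"
proof -
  from assms(1) obtain p where [measurable]: "f \<in> borel_measurable borel" "J \<in> borel_measurable M"
    and p: "\<And>n. valid_steps (p n)"
      "(\<lambda>n. \<integral>\<^sup>+u. ennreal ((f u - step_fun (p n) u)\<^sup>2) \<partial>lborel) \<longlonglongrightarrow> 0"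
      "(\<lambda>n. \<integral>\<^sup>+\<omega>. ennreal ((J \<omega> - step_integral B (p n) \<omega>)\<^sup>2) \<partial>M) \<longlonglongrightarrow> 0"
    unfolding wiener_limit_def by blast
  have [measurable]: "step_integral B (p n) \<in> borel_measurable M" for n by (rule borel_measurable_step_integral[OF p(1) B])
  show ?thesis unfolding wiener_limit_def
    using nn_integral_square_tendsto_zero_mult[OF p(2), of c] nn_integral_square_tendsto_zero_mult[OF p(3), of c] p(1)
    by (intro conjI exI[of _ "\<lambda>n. scale_steps c (p n)"]) (auto simp: right_diff_distrib)
qed

lemma wiener_limit_add:
  assumes "wiener_limit M B f J" "wiener_limit M B g K" and B: "\<And>t. t \<ge> 0 \<Longrightarrow> B t \<in> borel_measurable M"
  shows "wiener_limit M B (\<lambda>u. f u + g u) (\<lambda>\<omega>. J \<omega> + K \<omega>)"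
proof -
  from assms(1) obtain p where [measurable]: "f \<in> borel_measurable borel" "J \<in> borel_measurable M"
    and p: "\<And>n. valid_steps (p n)"
      "(\<lambda>n. \<integral>\<^sup>+u. ennreal ((f u - step_fun (p n) u)\<^sup>2) \<partial>lborel) \<longlonglongrightarrow> 0"
      "(\<lambda>n. \<integral>\<^sup>+\<omega>. ennreal ((J \<omega> - step_integral B (p n) \<omega>)\<^sup>2) \<partial>M) \<longlonglongrightarrow> 0"
    unfolding wiener_limit_def by blast
  from assms(2) obtain q where [measurable]: "g \<in> borel_measurable borel" "K \<in> borel_measurable M"
    and q: "\<And>n. valid_steps (q n)"
      "(\<lambda>n. \<integral>\<^sup>+u. ennreal ((g u - step_fun (q n) u)\<^sup>2) \<partial>lborel) \<longlonglongrightarrow> 0"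
      "(\<lambda>n. \<integral>\<^sup>+\<omega>. ennreal ((K \<omega> - step_integral B (q n) \<omega>)\<^sup>2) \<partial>M) \<longlonglongrightarrow> 0"
    unfolding wiener_limit_def by blast
  have [measurable]: "step_integral B (p n) \<in> borel_measurable M" "step_integral B (q n) \<in> borel_measurable M" for n
    using borel_measurable_step_integral[OF _ B] p(1) q(1) by auto
  show ?thesis unfolding wiener_limit_def
    using nn_integral_square_tendsto_zero_add[OF p(2) _ q(2)] nn_integral_square_tendsto_zero_add[OF p(3) _ q(3)] p(1) q(1)
    by (intro conjI exI[of _ "\<lambda>n. p n @ q n"]) (auto simp: add_diff_add)
qed

lemma wiener_limit_zero: "wiener_limit M B (\<lambda>u. 0) (\<lambda>\<omega>. 0)"
  unfolding wiener_limit_def by (intro conjI exI[of _ "\<lambda>_. []"]) auto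

lemma wiener_limit_sum:
  assumes "\<And>i. i \<in> I \<Longrightarrow> wiener_limit M B (f i) (J i)" and B: "\<And>t. t \<ge> 0 \<Longrightarrow> B t \<in> borel_measurable M"
  shows "wiener_limit M B (\<lambda>u. \<Sum>i\<in>I. f i u) (\<lambda>\<omega>. \<Sum>i\<in>I. J i \<omega>)"
  using assms(1) by (induction I rule: infinite_finite_induct) (auto intro!: wiener_limit_zero wiener_limit_add B)

text \<open>The approximating step functions live on times after \<open>t\<close> and vanish before,
  so extending the integrand by zero does not change the L2 distances.\<close>

lemma is_wiener_integral_imp_wiener_limit:
  assumes "is_wiener_integral M B t f J" "0 \<le> t" and [measurable]: "f \<in> borel_measurable borel"
  shows "wiener_limit M B (\<lambda>u. indicator {t..} u * f u) J"
proof -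
  from assms(1) obtain p where [measurable]: "J \<in> borel_measurable M"
    and p: "\<And>n. \<forall>(a, r, s)\<in>set (p n). t \<le> r \<and> r \<le> s"
      "(\<lambda>n. \<integral>\<^sup>+u\<in>{t..}. ennreal ((f u - step_fun (p n) u)\<^sup>2) \<partial>lborel) \<longlonglongrightarrow> 0"
      "(\<lambda>n. \<integral>\<^sup>+\<omega>. ennreal ((J \<omega> - step_integral B (p n) \<omega>)\<^sup>2) \<partial>M) \<longlonglongrightarrow> 0"
    unfolding is_wiener_integral_def by blast
  have z: "step_fun q u = 0" if "\<forall>(a, r, s)\<in>set q. t \<le> r \<and> r \<le> s" "u < t" for q u
    using that by (induction q) auto
  have "(\<integral>\<^sup>+u\<in>{t..}. ennreal ((f u - step_fun (p n) u)\<^sup>2) \<partial>lborel) = (\<integral>\<^sup>+u. ennreal ((indicator {t..} u * f u - step_fun (p n) u)\<^sup>2) \<partial>lborel)" for n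
    by (intro nn_integral_cong) (use z[OF p(1)] in \<open>auto simp: indicator_def\<close>)
  moreover have "valid_steps (p n)" for n
    unfolding valid_steps_def
  proof clarify
    fix a r s assume "(a, r, s) \<in> set (p n)"
    then show "0 \<le> r \<and> r \<le> s" using p(1)[of n] assms(2) by auto
  qed
  ultimately show ?thesis
    unfolding wiener_limit_def using p(2,3) by (intro conjI exI[of _ p]) auto
qed

section \<open>Independence from the backward filtration\<close>

lemma (in finite_measure) integral_complex_indicator:
  assumes [measurable]: "A \<in> sets M"
  shows "(CLINT x|M. indicator A x) = complex_of_real (measure M A)"
proof -
  have "(CLINT x|M. indicator A x) = (CLINT x|M. complex_of_real (indicator A x))"
    by (simp only: of_real_indicator)
  also have "\<dots> = complex_of_real (LINT x|M. indicator A x)" 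
    by (rule integral_of_real) (auto intro!: integrable_const_bound[where B=1] simp: indicator_def)
  finally show ?thesis by simp
qed

text \<open>This locale is later instantiated with the completed probability space, on which the
  Wiener integrals and the filtration live. The factor \<open>\<epsilon>\<close> makes the motions
  standard, so variances of integrals against \<open>W\<close> carry
  \<open>1 / \<epsilon>^2\<close>.\<close>

locale lattice_brownian = prob_space +
  fixes S :: "'i set" and \<epsilon> :: real and W :: "real \<Rightarrow> 'i \<Rightarrow> 'a \<Rightarrow> real"
  assumes finite_S: "finite S" and eps: "\<epsilon> > 0"
    and bm: "x \<in> S \<Longrightarrow> brownian_motion M (\<lambda>t \<omega>. \<epsilon> * W t x \<omega>)"
    and indep_paths: "indep_vars (\<lambda>_. PiM {0..} (\<lambda>_. borel)) (\<lambda>x \<omega>. \<lambda>t\<in>{0..}. W t x \<omega>) S"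
begin

lemma W_measurable: "t \<ge> 0 \<Longrightarrow> x \<in> S \<Longrightarrow> W t x \<in> borel_measurable M"
proof -
  assume "t \<ge> 0" "x \<in> S"
  then have "(\<lambda>\<omega>. \<epsilon> * W t x \<omega>) \<in> borel_measurable M" using bm[of x] by (auto simp: brownian_motion_def)
  then have "(\<lambda>\<omega>. (1 / \<epsilon>) * (\<epsilon> * W t x \<omega>)) \<in> borel_measurable M" by (rule borel_measurable_times[OF borel_measurable_const])
  moreover have "(\<lambda>\<omega>. (1 / \<epsilon>) * (\<epsilon> * W t x \<omega>)) = W t x" using eps by auto
  ultimately show "W t x \<in> borel_measurable M" by (simp only:)
qed

lemma step_integral_measurable:
  "valid_steps p \<Longrightarrow> y \<in> S \<Longrightarrow> step_integral (\<lambda>t. W t y) p \<in> borel_measurable M"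
  by (rule borel_measurable_step_integral) (auto intro: W_measurable)

lemma integrable_iexp_measurable: "X \<in> borel_measurable M \<Longrightarrow> integrable M (\<lambda>\<omega>. iexp (X \<omega>))"
  by (rule integrable_complex_bounded[where B=1]) simp_all

lemma integrable_step_fun_square: "valid_steps p \<Longrightarrow> y \<in> S \<Longrightarrow> integrable lborel (\<lambda>u. (step_fun p u)\<^sup>2)"
  using char_step_integral(1)[OF bm] .

text \<open>A step integral is a measurable functional of the path restricted to
  \<open>[0, \<infinity>)\<close>, so independence of the paths at different sites passes to the
  integrals and the characteristic function factorises. Rescaling the steps by
  \<open>1 / \<epsilon>\<close> accounts for the variance of \<open>W\<close>.\<close>

lemma char_sum_step_integral:
  assumes p: "\<And>y. y \<in> S \<Longrightarrow> valid_steps (p y)"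
  shows "(CLINT \<omega>|M. iexp (\<Sum>y\<in>S. step_integral (\<lambda>t. W t y) (p y) \<omega>))
     = of_real (exp (- (\<Sum>y\<in>S. \<integral>u. (step_fun (p y) u)\<^sup>2 \<partial>lborel) / (2 * \<epsilon>\<^sup>2)))"
proof -
  let ?s = "\<lambda>y. step_integral (\<lambda>t. W t y) (p y)"
  have path: "step_integral (\<lambda>t. W t y) q \<omega> = step_integral (\<lambda>t w. w t) q (\<lambda>t\<in>{0..}. W t y \<omega>)" if "valid_steps q" for y q \<omega>
    using that by (induction q) auto
  have pm: "step_integral (\<lambda>t w. w t) q \<in> borel_measurable (PiM {0..} (\<lambda>_. borel))" if "valid_steps q" for q
    using that by (rule borel_measurable_step_integral) auto
  have "indep_vars (\<lambda>_. borel) (\<lambda>y \<omega>. iexp (step_integral (\<lambda>t w. w t) (p y) (\<lambda>t\<in>{0..}. W t y \<omega>))) S"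
    using indep_paths
  proof (rule indep_vars_compose2[where Y="\<lambda>y w. iexp (step_integral (\<lambda>t w. w t) (p y) w)"])
    fix y assume "y \<in> S"
    have [measurable]: "step_integral (\<lambda>t w. w t) (p y) \<in> borel_measurable (PiM {0..} (\<lambda>_. borel))"
      by (rule pm) (rule p[OF \<open>y \<in> S\<close>])
    show "(\<lambda>w. iexp (step_integral (\<lambda>t w. w t) (p y) w)) \<in> borel_measurable (PiM {0..} (\<lambda>_. borel))"
      by measurable
  qed
  then have ind: "indep_vars (\<lambda>_. borel) (\<lambda>y \<omega>. iexp (?s y \<omega>)) S"
    by (rule indep_vars_cong[THEN iffD1, rotated -1]) (auto simp: path p)
  have one: "(CLINT \<omega>|M. iexp (?s y \<omega>)) = of_real (exp (- (\<integral>u. (step_fun (p y) u)\<^sup>2 \<partial>lborel) / (2 * \<epsilon>\<^sup>2)))" if y: "y \<in> S" for y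
  proof -
    have "step_integral (\<lambda>t \<omega>. \<epsilon> * W t y \<omega>) q \<omega> = \<epsilon> * step_integral (\<lambda>t. W t y) q \<omega>" for q \<omega>
      by (induction q) (auto simp: algebra_simps)
    then have eq: "?s y \<omega> = step_integral (\<lambda>t \<omega>. \<epsilon> * W t y \<omega>) (scale_steps (1 / \<epsilon>) (p y)) \<omega>" for \<omega>
      using eps by simp
    show ?thesis unfolding eq
      by (subst char_step_integral(2)[OF bm[OF y]]) (use p[OF y] in \<open>simp_all add: power_divide\<close>)
  qed
  have "(CLINT \<omega>|M. iexp (\<Sum>y\<in>S. ?s y \<omega>)) = (CLINT \<omega>|M. (\<Prod>y\<in>S. iexp (?s y \<omega>)))"
    by (simp only: of_real_sum sum_distrib_left exp_sum finite_S)
  also have "\<dots> = (\<Prod>y\<in>S. CLINT \<omega>|M. iexp (?s y \<omega>))"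
    by (rule indep_vars_lebesgue_integral[OF finite_S ind]) (intro integrable_iexp_measurable step_integral_measurable p)
  also have "\<dots> = (\<Prod>y\<in>S. of_real (exp (- (\<integral>u. (step_fun (p y) u)\<^sup>2 \<partial>lborel) / (2 * \<epsilon>\<^sup>2))))"
    by (rule prod.cong) (simp_all only: one)
  also have "\<dots> = of_real (exp (\<Sum>y\<in>S. - (\<integral>u. (step_fun (p y) u)\<^sup>2 \<partial>lborel) / (2 * \<epsilon>\<^sup>2)))"
    by (simp only: exp_sum finite_S of_real_prod)
  finally show ?thesis by (simp add: sum_negf sum_divide_distrib)
qed

text \<open>Both sides are limits of the identity for step integrals: the exponents converge because
  L2 norms of the integrands do, the expectations because \<open>iexp\<close> is 1-Lipschitz and L2
  convergence implies L1 convergence. This determines all joint laws of Wiener integrals, since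
  linear combinations of them are again of this form.\<close>

lemma char_sum_wiener_limit:
  assumes J: "\<And>y. y \<in> S \<Longrightarrow> wiener_limit M (\<lambda>t. W t y) (f y) (J y)"
  shows "\<And>y. y \<in> S \<Longrightarrow> integrable lborel (\<lambda>u. (f y u)\<^sup>2)"
    and "(CLINT \<omega>|M. iexp (\<Sum>y\<in>S. J y \<omega>)) = of_real (exp (- (\<Sum>y\<in>S. \<integral>u. (f y u)\<^sup>2 \<partial>lborel) / (2 * \<epsilon>\<^sup>2)))"
proof -
  have "\<forall>y\<in>S. \<exists>p. (\<forall>n. valid_steps (p n)) \<and>
        (\<lambda>n. \<integral>\<^sup>+u. ennreal ((f y u - step_fun (p n) u)\<^sup>2) \<partial>lborel) \<longlonglongrightarrow> 0 \<and>
        (\<lambda>n. \<integral>\<^sup>+\<omega>. ennreal ((J y \<omega> - step_integral (\<lambda>t. W t y) (p n) \<omega>)\<^sup>2) \<partial>M) \<longlonglongrightarrow> 0"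
    using J by (auto simp: wiener_limit_def)
  from bchoice[OF this] obtain p where p: "\<And>y n. y \<in> S \<Longrightarrow> valid_steps (p y n)"
      "\<And>y. y \<in> S \<Longrightarrow> (\<lambda>n. \<integral>\<^sup>+u. ennreal ((f y u - step_fun (p y n) u)\<^sup>2) \<partial>lborel) \<longlonglongrightarrow> 0"
      "\<And>y. y \<in> S \<Longrightarrow> (\<lambda>n. \<integral>\<^sup>+\<omega>. ennreal ((J y \<omega> - step_integral (\<lambda>t. W t y) (p y n) \<omega>)\<^sup>2) \<partial>M) \<longlonglongrightarrow> 0"
    by blast
  let ?s = "\<lambda>y n. step_integral (\<lambda>t. W t y) (p y n)"
  have fm: "f y \<in> borel_measurable lborel" and Jm[measurable]: "J y \<in> borel_measurable M" if "y \<in> S" for y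
    using wiener_limit_measurable[OF J[OF that]] by auto
  have sm[measurable]: "?s y n \<in> borel_measurable M" if "y \<in> S" for y n
    using step_integral_measurable p(1) that by blast
  have sf: "integrable lborel (\<lambda>u. (step_fun (p y n) u)\<^sup>2)" if "y \<in> S" for y n
    using integrable_step_fun_square p(1) that by blast
  have L2: "integrable lborel (\<lambda>u. (f y u)\<^sup>2)"
    "(\<lambda>n. \<integral>u. (step_fun (p y n) u)\<^sup>2 \<partial>lborel) \<longlonglongrightarrow> (\<integral>u. (f y u)\<^sup>2 \<partial>lborel)" if "y \<in> S" for y
    using L2_tendsto_norm[OF fm[OF that] _ sf[OF that] p(2)[OF that]] by simp_all
  show "integrable lborel (\<lambda>u. (f y u)\<^sup>2)" if "y \<in> S" for y using L2(1)[OF that] .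
  have lim1: "(\<lambda>n. exp (- (\<Sum>y\<in>S. \<integral>u. (step_fun (p y n) u)\<^sup>2 \<partial>lborel) / (2 * \<epsilon>\<^sup>2))) \<longlonglongrightarrow> exp (- (\<Sum>y\<in>S. \<integral>u. (f y u)\<^sup>2 \<partial>lborel) / (2 * \<epsilon>\<^sup>2))"
    using eps by (intro tendsto_exp tendsto_divide tendsto_minus tendsto_sum L2(2) tendsto_const) auto
  have L1: "\<forall>\<^sub>F n in sequentially. integrable M (\<lambda>\<omega>. J y \<omega> - ?s y n \<omega>)"
      "(\<lambda>n. \<integral>\<omega>. \<bar>J y \<omega> - ?s y n \<omega>\<bar> \<partial>M) \<longlonglongrightarrow> 0" if "y \<in> S" for y
    using L2_tendsto_L1[OF _ p(3)[OF that]] that by auto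
  have lim2: "(\<lambda>n. CLINT \<omega>|M. iexp (\<Sum>y\<in>S. ?s y n \<omega>)) \<longlonglongrightarrow> (CLINT \<omega>|M. iexp (\<Sum>y\<in>S. J y \<omega>))"
  proof (subst tendsto_dist_iff, rule tendsto_sandwich[OF always_eventually _ tendsto_const])
    show "\<forall>n. 0 \<le> dist (CLINT \<omega>|M. iexp (\<Sum>y\<in>S. ?s y n \<omega>)) (CLINT \<omega>|M. iexp (\<Sum>y\<in>S. J y \<omega>))" by simp
    have "\<forall>\<^sub>F n in sequentially. \<forall>y\<in>S. integrable M (\<lambda>\<omega>. J y \<omega> - ?s y n \<omega>)"
      using finite_S L1(1) by (simp add: eventually_ball_finite_distrib)
    then show "\<forall>\<^sub>F n in sequentially. dist (CLINT \<omega>|M. iexp (\<Sum>y\<in>S. ?s y n \<omega>)) (CLINT \<omega>|M. iexp (\<Sum>y\<in>S. J y \<omega>))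
       \<le> (\<Sum>y\<in>S. \<integral>\<omega>. \<bar>J y \<omega> - ?s y n \<omega>\<bar> \<partial>M)"
    proof eventually_elim
      case (elim n)
      have m: "(\<lambda>\<omega>. \<Sum>y\<in>S. ?s y n \<omega>) \<in> borel_measurable M" "(\<lambda>\<omega>. \<Sum>y\<in>S. J y \<omega>) \<in> borel_measurable M"
        by (auto intro!: borel_measurable_sum sm Jm)
      note i = integrable_iexp_measurable[OF m(1)] integrable_iexp_measurable[OF m(2)]
      have "dist (CLINT \<omega>|M. iexp (\<Sum>y\<in>S. ?s y n \<omega>)) (CLINT \<omega>|M. iexp (\<Sum>y\<in>S. J y \<omega>))
         = norm (CLINT \<omega>|M. iexp (\<Sum>y\<in>S. J y \<omega>) - iexp (\<Sum>y\<in>S. ?s y n \<omega>))"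
        by (simp only: dist_norm norm_minus_commute Bochner_Integration.integral_diff[OF i(2,1)])
      also have "\<dots> \<le> (\<integral>\<omega>. norm (iexp (\<Sum>y\<in>S. J y \<omega>) - iexp (\<Sum>y\<in>S. ?s y n \<omega>)) \<partial>M)"
        by (rule integral_norm_bound)
      also have "\<dots> \<le> (\<integral>\<omega>. (\<Sum>y\<in>S. \<bar>J y \<omega> - ?s y n \<omega>\<bar>) \<partial>M)"
      proof (rule integral_mono)
        show "integrable M (\<lambda>\<omega>. norm (iexp (\<Sum>y\<in>S. J y \<omega>) - iexp (\<Sum>y\<in>S. ?s y n \<omega>)))"
          by (intro integrable_norm Bochner_Integration.integrable_diff i)
        show "integrable M (\<lambda>\<omega>. \<Sum>y\<in>S. \<bar>J y \<omega> - ?s y n \<omega>\<bar>)" using elim by auto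
        fix \<omega>
        have "norm (iexp (\<Sum>y\<in>S. J y \<omega>) - iexp (\<Sum>y\<in>S. ?s y n \<omega>)) \<le> \<bar>(\<Sum>y\<in>S. J y \<omega>) - (\<Sum>y\<in>S. ?s y n \<omega>)\<bar>"
          by (rule norm_iexp_diff_le)
        also have "\<dots> \<le> (\<Sum>y\<in>S. \<bar>J y \<omega> - ?s y n \<omega>\<bar>)"
          unfolding sum_subtractf[symmetric] by (rule sum_abs)
        finally show "norm (iexp (\<Sum>y\<in>S. J y \<omega>) - iexp (\<Sum>y\<in>S. ?s y n \<omega>)) \<le> (\<Sum>y\<in>S. \<bar>J y \<omega> - ?s y n \<omega>\<bar>)" .
      qed
      also have "\<dots> = (\<Sum>y\<in>S. \<integral>\<omega>. \<bar>J y \<omega> - ?s y n \<omega>\<bar> \<partial>M)"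
        using elim by (intro Bochner_Integration.integral_sum) auto
      finally show ?case .
    qed
    have "(\<lambda>n. \<Sum>y\<in>S. \<integral>\<omega>. \<bar>J y \<omega> - ?s y n \<omega>\<bar> \<partial>M) \<longlonglongrightarrow> (\<Sum>y\<in>S. 0)"
      by (intro tendsto_sum L1(2))
    then show "(\<lambda>n. \<Sum>y\<in>S. \<integral>\<omega>. \<bar>J y \<omega> - ?s y n \<omega>\<bar> \<partial>M) \<longlonglongrightarrow> 0" by simp
  qed
  have steps: "(CLINT \<omega>|M. iexp (\<Sum>y\<in>S. ?s y n \<omega>)) = of_real (exp (- (\<Sum>y\<in>S. \<integral>u. (step_fun (p y n) u)\<^sup>2 \<partial>lborel) / (2 * \<epsilon>\<^sup>2)))" for n
    by (rule char_sum_step_integral) (rule p(1))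
  show "(CLINT \<omega>|M. iexp (\<Sum>y\<in>S. J y \<omega>)) = of_real (exp (- (\<Sum>y\<in>S. \<integral>u. (f y u)\<^sup>2 \<partial>lborel) / (2 * \<epsilon>\<^sup>2)))"
    using lim2 tendsto_of_real[OF lim1, where 'a=complex] unfolding steps by (rule LIMSEQ_unique)
qed

text \<open>The exponent is quadratic, and the cross term vanishes when the integrands have disjoint
  supports. This is the source of all independence between different time intervals.\<close>

lemma char_sum_wiener_limit_orthogonal:
  assumes J: "\<And>y. y \<in> S \<Longrightarrow> wiener_limit M (\<lambda>t. W t y) (f y) (J y)"
    and K: "\<And>y. y \<in> S \<Longrightarrow> wiener_limit M (\<lambda>t. W t y) (g y) (K y)"
    and disj: "\<And>y u. y \<in> S \<Longrightarrow> f y u * g y u = 0"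
  shows "(CLINT \<omega>|M. iexp (\<Sum>y\<in>S. J y \<omega>) * iexp (\<Sum>y\<in>S. K y \<omega>)) =
     (CLINT \<omega>|M. iexp (\<Sum>y\<in>S. J y \<omega>)) * (CLINT \<omega>|M. iexp (\<Sum>y\<in>S. K y \<omega>))"
proof -
  have JK: "wiener_limit M (\<lambda>t. W t y) (\<lambda>u. f y u + g y u) (\<lambda>\<omega>. J y \<omega> + K y \<omega>)" if "y \<in> S" for y
    using that by (intro wiener_limit_add J K W_measurable)
  have sq: "(\<integral>u. (f y u + g y u)\<^sup>2 \<partial>lborel) = (\<integral>u. (f y u)\<^sup>2 \<partial>lborel) + (\<integral>u. (g y u)\<^sup>2 \<partial>lborel)" if "y \<in> S" for y
  proof -
    have "(f y u + g y u)\<^sup>2 = (f y u)\<^sup>2 + (g y u)\<^sup>2" for u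
      using disj[OF that, of u] by (auto simp: power2_sum)
    then show ?thesis
      using char_sum_wiener_limit(1)[OF J that] char_sum_wiener_limit(1)[OF K that] by simp
  qed
  have "(CLINT \<omega>|M. iexp (\<Sum>y\<in>S. J y \<omega>) * iexp (\<Sum>y\<in>S. K y \<omega>)) = (CLINT \<omega>|M. iexp (\<Sum>y\<in>S. J y \<omega> + K y \<omega>))"
    by (simp only: exp_add[symmetric] distrib_left[symmetric] of_real_add[symmetric] sum.distrib)
  also have "\<dots> = of_real (exp (- (\<Sum>y\<in>S. \<integral>u. (f y u + g y u)\<^sup>2 \<partial>lborel) / (2 * \<epsilon>\<^sup>2)))"
    by (rule char_sum_wiener_limit(2)[OF JK])
  also have "- (\<Sum>y\<in>S. \<integral>u. (f y u + g y u)\<^sup>2 \<partial>lborel) / (2 * \<epsilon>\<^sup>2) =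
      - (\<Sum>y\<in>S. \<integral>u. (f y u)\<^sup>2 \<partial>lborel) / (2 * \<epsilon>\<^sup>2) + - (\<Sum>y\<in>S. \<integral>u. (g y u)\<^sup>2 \<partial>lborel) / (2 * \<epsilon>\<^sup>2)"
    by (simp add: sq sum.distrib add_divide_distrib diff_divide_distrib)
  finally show ?thesis
    by (simp only: exp_add of_real_mult char_sum_wiener_limit(2)[OF J] char_sum_wiener_limit(2)[OF K])
qed

text \<open>When \<open>M\<close> is a completion, its null sets are the ones added in
  \<open>backward_filtration\<close>, and the two notions coincide.\<close>

definition future :: "real \<Rightarrow> 'a measure" where
  "future t = sigma (space M)
     ({(\<lambda>\<omega>. W s x \<omega> - W t x \<omega>) -` A \<inter> space M | s x A. t \<le> s \<and> x \<in> S \<and> A \<in> sets borel} \<union> null_sets M)"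

text \<open>A generator of the filtration that is stable under intersection. The null sets form a
  separate kind of member; an intersection with one of them is again null, so stability
  survives.\<close>

definition future_cylinders :: "real \<Rightarrow> 'a set set" where
  "future_cylinders t =
     {{\<omega>\<in>space M. \<forall>k\<in>K. W (fst k) (snd k) \<omega> - W t (snd k) \<omega> \<in> B k} | K B.
        finite K \<and> K \<subseteq> {t..} \<times> S \<and> (\<forall>k\<in>K. B k \<in> sets borel)} \<union> null_sets M"

lemma future_cylindersI:
  "finite K \<Longrightarrow> K \<subseteq> {t..} \<times> S \<Longrightarrow> \<forall>k\<in>K. B k \<in> sets borel \<Longrightarrow>
    {\<omega>\<in>space M. \<forall>k\<in>K. W (fst k) (snd k) \<omega> - W t (snd k) \<omega> \<in> B k} \<in> future_cylinders t"
  unfolding future_cylinders_def by (intro UnI1 CollectI exI[of _ K] exI[of _ B] conjI refl)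

lemma future_cylinders_sets:
  assumes t: "0 \<le> t" shows "future_cylinders t \<subseteq> events"
proof
  fix A assume "A \<in> future_cylinders t"
  then consider "A \<in> null_sets M" | K B where "finite K" "K \<subseteq> {t..} \<times> S" "\<forall>k\<in>K. B k \<in> sets borel"
    "A = {\<omega>\<in>space M. \<forall>k\<in>K. W (fst k) (snd k) \<omega> - W t (snd k) \<omega> \<in> B k}"
    unfolding future_cylinders_def by blast
  then show "A \<in> events"
  proof cases
    case 2
    have "{\<omega>\<in>space M. W (fst k) (snd k) \<omega> - W t (snd k) \<omega> \<in> B k} \<in> events" if "k \<in> K" for k
    proof -
      have "(\<lambda>\<omega>. W (fst k) (snd k) \<omega> - W t (snd k) \<omega>) \<in> borel_measurable M"
        using that 2 t by (intro borel_measurable_diff W_measurable) force+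
      from measurable_sets[OF this, of "B k"] show ?thesis
        using 2 that by (simp add: vimage_def Int_def conj_commute)
    qed
    then show ?thesis unfolding 2(4) using 2(1) by (intro sets.sets_Collect_finite_All) auto
  qed auto
qed

lemma Int_stable_future_cylinders:
  assumes t: "0 \<le> t" shows "Int_stable (future_cylinders t)"
proof (rule Int_stableI)
  fix A A' assume A: "A \<in> future_cylinders t" and A': "A' \<in> future_cylinders t"
  show "A \<inter> A' \<in> future_cylinders t"
  proof (cases "A \<in> null_sets M \<or> A' \<in> null_sets M")
    case True
    then have "A \<inter> A' \<in> null_sets M"
    proof
      assume "A \<in> null_sets M"
      then show ?thesis using A' future_cylinders_sets[OF t] by (intro null_set_Int2) auto
    next
      assume "A' \<in> null_sets M"
      then show ?thesis using A future_cylinders_sets[OF t] by (intro null_set_Int1) auto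
    qed
    then show ?thesis by (simp add: future_cylinders_def)
  next
    case False
    then obtain K B where K: "finite K" "K \<subseteq> {t..} \<times> S" "\<forall>k\<in>K. B k \<in> sets borel"
      "A = {\<omega>\<in>space M. \<forall>k\<in>K. W (fst k) (snd k) \<omega> - W t (snd k) \<omega> \<in> B k}"
      using A unfolding future_cylinders_def by blast
    obtain K' B' where K': "finite K'" "K' \<subseteq> {t..} \<times> S" "\<forall>k\<in>K'. B' k \<in> sets borel"
      "A' = {\<omega>\<in>space M. \<forall>k\<in>K'. W (fst k) (snd k) \<omega> - W t (snd k) \<omega> \<in> B' k}"
      using False A' unfolding future_cylinders_def by blast
    let ?B = "\<lambda>k. (if k \<in> K then B k else UNIV) \<inter> (if k \<in> K' then B' k else UNIV)"
    have "A \<inter> A' = {\<omega>\<in>space M. \<forall>k\<in>K \<union> K'. W (fst k) (snd k) \<omega> - W t (snd k) \<omega> \<in> ?B k}"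
      unfolding K(4) K'(4) by auto
    moreover have "finite (K \<union> K')" "K \<union> K' \<subseteq> {t..} \<times> S" "\<forall>k\<in>K \<union> K'. ?B k \<in> sets borel"
      using K K' by auto
    ultimately show ?thesis using future_cylindersI[of "K \<union> K'" t ?B] by simp
  qed
qed

lemma sets_future_subset:
  assumes t: "0 \<le> t" shows "sets (future t) \<subseteq> sigma_sets (space M) (future_cylinders t)"
proof -
  have sub: "{(\<lambda>\<omega>. W s x \<omega> - W t x \<omega>) -` A \<inter> space M | s x A. t \<le> s \<and> x \<in> S \<and> A \<in> sets borel} \<union> null_sets M \<subseteq> future_cylinders t"
  proof (rule Un_least)
    show "{(\<lambda>\<omega>. W s x \<omega> - W t x \<omega>) -` A \<inter> space M | s x A. t \<le> s \<and> x \<in> S \<and> A \<in> sets borel} \<subseteq> future_cylinders t"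
    proof clarify
      fix s x and A :: "real set" assume *: "t \<le> s" "x \<in> S" "A \<in> sets borel"
      have "(\<lambda>\<omega>. W s x \<omega> - W t x \<omega>) -` A \<inter> space M = {\<omega>\<in>space M. \<forall>k\<in>{(s, x)}. W (fst k) (snd k) \<omega> - W t (snd k) \<omega> \<in> (\<lambda>_. A) k}"
        by auto
      moreover have "finite {(s, x)}" "{(s, x)} \<subseteq> {t..} \<times> S" "\<forall>k\<in>{(s, x)}. (\<lambda>_. A) k \<in> sets borel" using * by auto
      ultimately show "(\<lambda>\<omega>. W s x \<omega> - W t x \<omega>) -` A \<inter> space M \<in> future_cylinders t"
        using future_cylindersI[of "{(s, x)}" t "\<lambda>_. A"] by simp
    qed
  qed (simp add: future_cylinders_def)
  then have "sets (future t) = sigma_sets (space M)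
     ({(\<lambda>\<omega>. W s x \<omega> - W t x \<omega>) -` A \<inter> space M | s x A. t \<le> s \<and> x \<in> S \<and> A \<in> sets borel} \<union> null_sets M)"
    unfolding future_def using future_cylinders_sets[OF t] sets.sets_into_space by (intro sets_measure_of) blast
  also have "\<dots> \<subseteq> sigma_sets (space M) (future_cylinders t)"
    by (rule sigma_sets_mono'[OF sub])
  finally show ?thesis .
qed

lemma space_future [simp]: "space (future t) = space M"
  by (simp add: future_def space_measure_of_conv)

lemma sets_future_events:
  assumes t: "0 \<le> t" shows "sets (future t) \<subseteq> events"
  using sets_future_subset[OF t] sets.sigma_sets_subset[OF future_cylinders_sets[OF t]] by blast

lemma measurable_future_imp_measurable: "0 \<le> t \<Longrightarrow> f \<in> future t \<rightarrow>\<^sub>M N \<Longrightarrow> f \<in> M \<rightarrow>\<^sub>M N"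
  using sets_future_events[of t] by (auto simp: measurable_def)

text \<open>Finitely many increments after \<open>t\<close> are Wiener integrals over times in
  \<open>(t, \<infinity>)\<close> and hence decouple, at the level of exponentials, from
  \<open>J\<close>, which only sees times up to \<open>t\<close>. With the exponential of
  \<open>J\<close> as weight, \<open>expectation_weight_indicator\<close> upgrades the exponentials
  of the increments to the indicator of the cylinder.\<close>

lemma future_cylinders_char:
  assumes t: "0 \<le> t" and A: "A \<in> future_cylinders t"
    and J: "\<And>y. y \<in> S \<Longrightarrow> wiener_limit M (\<lambda>t. W t y) (f y) (J y)"
    and past: "\<And>y u. y \<in> S \<Longrightarrow> u > t \<Longrightarrow> f y u = 0"
  shows "(CLINT \<omega>|M. indicator A \<omega> * iexp (\<Sum>y\<in>S. J y \<omega>)) = prob A * (CLINT \<omega>|M. iexp (\<Sum>y\<in>S. J y \<omega>))"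
proof -
  have Jm[measurable]: "(\<lambda>\<omega>. \<Sum>y\<in>S. J y \<omega>) \<in> borel_measurable M"
    by (intro borel_measurable_sum wiener_limit_measurable(2)[OF J])
  consider "A \<in> null_sets M" | K B where "finite K" "K \<subseteq> {t..} \<times> S" "\<forall>k\<in>K. B k \<in> sets borel"
    "A = {\<omega>\<in>space M. \<forall>k\<in>K. W (fst k) (snd k) \<omega> - W t (snd k) \<omega> \<in> B k}"
    using A unfolding future_cylinders_def by blast
  then show ?thesis
  proof cases
    case 1
    then have "AE \<omega> in M. \<omega> \<notin> A" by (rule AE_not_in)
    then have "(CLINT \<omega>|M. indicator A \<omega> * iexp (\<Sum>y\<in>S. J y \<omega>)) = (CLINT \<omega>|M. 0)"
    proof (intro integral_cong_AE)
      have "A \<in> events" using 1 by auto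
      then show "(\<lambda>\<omega>. indicator A \<omega> * iexp (\<Sum>y\<in>S. J y \<omega>)) \<in> borel_measurable M" by measurable
    qed auto
    then show ?thesis using 1 by (simp add: measure_eq_0_null_sets)
  next
    case 2
    define X where "X = (\<lambda>\<omega>. \<lambda>k\<in>K. W (fst k) (snd k) \<omega> - W t (snd k) \<omega>)"
    have Wm: "W (fst k) (snd k) \<in> borel_measurable M" "W t (snd k) \<in> borel_measurable M" if "k \<in> K" for k
      using that 2(2) t by (auto intro!: W_measurable)
    have X: "X \<in> M \<rightarrow>\<^sub>M PiM K (\<lambda>_. borel)"
      unfolding X_def by (intro measurable_restrict borel_measurable_diff Wm)
    have B: "Pi\<^sub>E K B \<in> sets (PiM K (\<lambda>_. borel))" using 2 by (intro sets_PiM_I_finite) auto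
    have XA: "X -` Pi\<^sub>E K B \<inter> space M = A" unfolding 2(4) X_def by (rule set_eqI) (simp add: PiE_iff conj_commute cong: conj_cong)
    have "(CLINT \<omega>|M. iexp (\<Sum>y\<in>S. J y \<omega>) * indicator (Pi\<^sub>E K B) (X \<omega>)) = (CLINT \<omega>|M. iexp (\<Sum>y\<in>S. J y \<omega>)) * prob (X -` Pi\<^sub>E K B \<inter> space M)"
    proof (rule expectation_weight_indicator[OF 2(1) X _ _ _ B])
      show "(\<lambda>\<omega>. iexp (\<Sum>y\<in>S. J y \<omega>)) \<in> borel_measurable M" by measurable
      fix a :: "real \<times> 'i \<Rightarrow> real"
      let ?Y = "\<lambda>y \<omega>. \<Sum>k | k \<in> K \<and> snd k = y. a k * (W (fst k) y \<omega> - W t y \<omega>)"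
      have Y: "wiener_limit M (\<lambda>t. W t y) (\<lambda>u. \<Sum>k | k \<in> K \<and> snd k = y. a k * indicator {t<..fst k} u) (?Y y)" if "y \<in> S" for y
        using 2(2) t that
        by (intro wiener_limit_sum wiener_limit_scale wiener_limit_increment W_measurable) force+
      have sX: "(\<Sum>k\<in>K. a k * X \<omega> k) = (\<Sum>y\<in>S. ?Y y \<omega>)" for \<omega>
      proof -
        have "(\<Sum>y\<in>S. ?Y y \<omega>) = (\<Sum>y\<in>S. \<Sum>k\<in>{k\<in>K. snd k = y}. a k * (W (fst k) (snd k) \<omega> - W t (snd k) \<omega>))"
          by (intro sum.cong) auto
        also have "\<dots> = (\<Sum>k\<in>K. a k * (W (fst k) (snd k) \<omega> - W t (snd k) \<omega>))"
          using 2 finite_S by (intro sum.group) auto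
        finally show ?thesis unfolding X_def by simp
      qed
      \<comment> \<open>The integrand of \<open>J\<close> may be nonzero at \<open>u = t\<close>
        itself; the increments after \<open>t\<close> exclude that point.\<close>
      have disj: "f y u * (\<Sum>k | k \<in> K \<and> snd k = y. a k * indicator {t<..fst k} u) = 0" if "y \<in> S" for y u
        using past[OF that, of u] by (cases "u > t") auto
      show "(CLINT \<omega>|M. iexp (\<Sum>y\<in>S. J y \<omega>) * iexp (\<Sum>k\<in>K. a k * X \<omega> k)) = (CLINT \<omega>|M. iexp (\<Sum>y\<in>S. J y \<omega>)) * (CLINT \<omega>|M. iexp (\<Sum>k\<in>K. a k * X \<omega> k))"
        unfolding sX by (rule char_sum_wiener_limit_orthogonal[OF J Y disj])
    qed simp_all
    moreover have "(CLINT \<omega>|M. iexp (\<Sum>y\<in>S. J y \<omega>) * indicator (Pi\<^sub>E K B) (X \<omega>)) = (CLINT \<omega>|M. indicator A \<omega> * iexp (\<Sum>y\<in>S. J y \<omega>))"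
      unfolding XA[symmetric] by (intro Bochner_Integration.integral_cong refl) (simp add: indicator_def)
    ultimately show ?thesis unfolding XA by (simp add: mult.commute)
  qed
qed

text \<open>Both sides are countably additive in \<open>A\<close>, so Dynkin's theorem extends the
  identity from the cylinders to the generated sigma-algebra.\<close>

lemma future_char:
  assumes t: "0 \<le> t" and A: "A \<in> sets (future t)"
    and J: "\<And>y. y \<in> S \<Longrightarrow> wiener_limit M (\<lambda>t. W t y) (f y) (J y)"
    and past: "\<And>y u. y \<in> S \<Longrightarrow> u > t \<Longrightarrow> f y u = 0"
  shows "(CLINT \<omega>|M. indicator A \<omega> * iexp (\<Sum>y\<in>S. J y \<omega>)) = prob A * (CLINT \<omega>|M. iexp (\<Sum>y\<in>S. J y \<omega>))"
proof -
  define h where "h = (\<lambda>\<omega>. iexp (\<Sum>y\<in>S. J y \<omega>))"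
  have Jm: "(\<lambda>\<omega>. \<Sum>y\<in>S. J y \<omega>) \<in> borel_measurable M"
    by (intro borel_measurable_sum wiener_limit_measurable(2)[OF J])
  have h: "integrable M h" unfolding h_def by (rule integrable_iexp_measurable[OF Jm])
  then have [measurable]: "h \<in> borel_measurable M" by simp
  have hi: "integrable M (\<lambda>\<omega>. indicator A \<omega> * h \<omega>)" if [measurable]: "A \<in> events" for A
    by (rule Bochner_Integration.integrable_bound[OF h]) (auto simp: indicator_def norm_mult)
  have G: "future_cylinders t \<subseteq> Pow (space M)" using future_cylinders_sets[OF t] sets.sets_into_space by blast
  have ev: "sigma_sets (space M) (future_cylinders t) \<subseteq> events"
    using sets.sigma_sets_subset[OF future_cylinders_sets[OF t]] .
  have "A \<in> sigma_sets (space M) (future_cylinders t)" using A sets_future_subset[OF t] by blast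
  with Int_stable_future_cylinders[OF t] G
  have "(CLINT \<omega>|M. indicator A \<omega> * h \<omega>) = prob A * (CLINT \<omega>|M. h \<omega>)"
  proof (induction A rule: sigma_sets_induct_disjoint)
    case (basic A)
    then show ?case unfolding h_def using future_cylinders_char[OF t _ J past] by simp
  next
    case empty
    then show ?case by simp
  next
    case (compl A)
    then have A[measurable]: "A \<in> events" using ev by blast
    have "(CLINT \<omega>|M. indicator (space M - A) \<omega> * h \<omega>) = (CLINT \<omega>|M. h \<omega> - indicator A \<omega> * h \<omega>)"
      by (intro Bochner_Integration.integral_cong) (auto simp: indicator_def)
    also have "\<dots> = (CLINT \<omega>|M. h \<omega>) - prob A * (CLINT \<omega>|M. h \<omega>)"
      using compl h hi[OF A] by simp
    also have "\<dots> = prob (space M - A) * (CLINT \<omega>|M. h \<omega>)"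
      by (simp add: prob_compl left_diff_distrib)
    finally show ?case .
  next
    case (union F)
    then have F: "range F \<subseteq> events" using ev by auto
    then have "(CLINT \<omega>:(\<Union>i. F i)|M. h \<omega>) = (\<Sum>i. (CLINT \<omega>:(F i)|M. h \<omega>))"
      using union(1) hi[of "\<Union>i. F i"]
      by (intro lebesgue_integral_countable_add) (auto simp: disjoint_family_on_def set_integrable_def scaleR_conv_of_real of_real_indicator)
    then have "(CLINT \<omega>|M. indicator (\<Union>i. F i) \<omega> * h \<omega>) = (\<Sum>i. (CLINT \<omega>|M. indicator (F i) \<omega> * h \<omega>))"
      by (simp add: set_lebesgue_integral_def scaleR_conv_of_real of_real_indicator)
    also have "\<dots> = (\<Sum>i. of_real (prob (F i)) * (CLINT \<omega>|M. h \<omega>))" using union by simp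
    also have "\<dots> = of_real (prob (\<Union>i. F i)) * (CLINT \<omega>|M. h \<omega>)"
      by (intro sums_unique[symmetric] sums_mult2 sums_of_real finite_measure_UNION F union)
    finally show ?case .
  qed
  then show ?thesis by (simp add: h_def)
qed

text \<open>Here \<open>expectation_weight_indicator\<close> is used with exchanged roles: the
  indicator of an event of the future is the weight, and the exponentials of \<open>Z\<close> are
  upgraded to indicators. As only expectations enter, \<open>Z\<close> has to agree with the
  integrals merely almost everywhere.\<close>

lemma indep_var_future:
  fixes Z :: "'a \<Rightarrow> 'j \<Rightarrow> real"
  assumes t: "0 \<le> t" and Y: "Y \<in> future t \<rightarrow>\<^sub>M N" and I: "finite I" and Z: "Z \<in> M \<rightarrow>\<^sub>M PiM I (\<lambda>_. borel)"
    and J: "\<And>x y. x \<in> I \<Longrightarrow> y \<in> S \<Longrightarrow> wiener_limit M (\<lambda>t. W t y) (f x y) (J x y)"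
    and past: "\<And>x y u. x \<in> I \<Longrightarrow> y \<in> S \<Longrightarrow> u > t \<Longrightarrow> f x y u = 0"
    and ZJ: "AE \<omega> in M. \<forall>x\<in>I. Z \<omega> x = (\<Sum>y\<in>S. J x y \<omega>)"
  shows "indep_var N Y (PiM I (\<lambda>_. borel)) Z"
proof -
  note [measurable] = measurable_future_imp_measurable[OF t Y] Z
  have comp[measurable]: "(\<lambda>\<omega>. Z \<omega> x) \<in> borel_measurable M" if "x \<in> I" for x
    using measurable_compose[OF Z measurable_component_singleton[OF that]] .
  have Jm[measurable]: "J x y \<in> borel_measurable M" if "x \<in> I" "y \<in> S" for x y
    using wiener_limit_measurable(2)[OF J[OF that]] .
  have key: "prob (A \<inter> (Z -` B \<inter> space M)) = prob A * prob (Z -` B \<inter> space M)"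
    if A: "A \<in> sets (future t)" and B: "B \<in> sets (PiM I (\<lambda>_. borel))" for A B
  proof -
    have [measurable]: "A \<in> events" using A sets_future_events[OF t] by blast
    have "(CLINT \<omega>|M. indicator A \<omega> * indicator B (Z \<omega>)) = (CLINT \<omega>|M. indicator A \<omega>) * prob (Z -` B \<inter> space M)"
    proof (rule expectation_weight_indicator[OF I Z _ _ _ B])
      fix a :: "'j \<Rightarrow> real"
      let ?L = "\<lambda>y \<omega>. \<Sum>x\<in>I. a x * J x y \<omega>"
      have L: "wiener_limit M (\<lambda>t. W t y) (\<lambda>u. \<Sum>x\<in>I. a x * f x y u) (?L y)" if "y \<in> S" for y
        using that by (intro wiener_limit_sum wiener_limit_scale J W_measurable)
      have Lm[measurable]: "(\<lambda>\<omega>. \<Sum>y\<in>S. ?L y \<omega>) \<in> borel_measurable M"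
        by (intro borel_measurable_sum borel_measurable_times borel_measurable_const Jm)
      have Zm[measurable]: "(\<lambda>\<omega>. \<Sum>x\<in>I. a x * Z \<omega> x) \<in> borel_measurable M"
        by (intro borel_measurable_sum borel_measurable_times borel_measurable_const comp)
      have eq: "AE \<omega> in M. (\<Sum>x\<in>I. a x * Z \<omega> x) = (\<Sum>y\<in>S. ?L y \<omega>)"
        using ZJ
      proof eventually_elim
        case (elim \<omega>)
        then have "(\<Sum>x\<in>I. a x * Z \<omega> x) = (\<Sum>x\<in>I. \<Sum>y\<in>S. a x * J x y \<omega>)" by (simp add: sum_distrib_left)
        also have "\<dots> = (\<Sum>y\<in>S. ?L y \<omega>)" by (rule sum.swap)
        finally show ?case .
      qed
      have "(CLINT \<omega>|M. indicator A \<omega> * iexp (\<Sum>x\<in>I. a x * Z \<omega> x)) = (CLINT \<omega>|M. indicator A \<omega> * iexp (\<Sum>y\<in>S. ?L y \<omega>))"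
      proof (intro integral_cong_AE)
        show "AE \<omega> in M. indicator A \<omega> * iexp (\<Sum>x\<in>I. a x * Z \<omega> x) = (indicator A \<omega> * iexp (\<Sum>y\<in>S. ?L y \<omega>))"
          using eq by eventually_elim (simp only:)
      qed measurable
      also have "\<dots> = prob A * (CLINT \<omega>|M. iexp (\<Sum>y\<in>S. ?L y \<omega>))"
        by (rule future_char[OF t A L]) (simp_all add: past)
      also have "(CLINT \<omega>|M. iexp (\<Sum>y\<in>S. ?L y \<omega>)) = (CLINT \<omega>|M. iexp (\<Sum>x\<in>I. a x * Z \<omega> x))"
      proof (intro integral_cong_AE)
        show "AE \<omega> in M. iexp (\<Sum>y\<in>S. ?L y \<omega>) = iexp (\<Sum>x\<in>I. a x * Z \<omega> x)"
          using eq by eventually_elim (simp only:)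
      qed measurable
      finally show "(CLINT \<omega>|M. indicator A \<omega> * iexp (\<Sum>x\<in>I. a x * Z \<omega> x)) = (CLINT \<omega>|M. indicator A \<omega>) * (CLINT \<omega>|M. iexp (\<Sum>x\<in>I. a x * Z \<omega> x))"
        by (simp only: integral_complex_indicator[OF \<open>A \<in> events\<close>])
    qed (simp_all add: indicator_def)
    moreover have "indicator A \<omega> * indicator B (Z \<omega>) = (indicator (A \<inter> (Z -` B \<inter> space M)) \<omega> :: complex)" if "\<omega> \<in> space M" for \<omega>
      using that by (auto simp: indicator_def)
    then have "(CLINT \<omega>|M. indicator A \<omega> * indicator B (Z \<omega>)) = (CLINT \<omega>|M. indicator (A \<inter> (Z -` B \<inter> space M)) \<omega>)"
      by (rule Bochner_Integration.integral_cong[OF refl])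
    ultimately have "complex_of_real (prob (A \<inter> (Z -` B \<inter> space M))) = complex_of_real (prob A * prob (Z -` B \<inter> space M))"
      using B by (simp add: integral_complex_indicator)
    then show ?thesis by (simp only: of_real_eq_iff)
  qed
  show ?thesis
    unfolding indep_var_distribution_eq
  proof (intro conjI)
    interpret Y: prob_space "distr M N Y" by (rule prob_space_distr) simp
    interpret Z: prob_space "distr M (PiM I (\<lambda>_. borel)) Z" by (rule prob_space_distr) simp
    show "distr M N Y \<Otimes>\<^sub>M distr M (PiM I (\<lambda>_. borel)) Z = distr M (N \<Otimes>\<^sub>M PiM I (\<lambda>_. borel)) (\<lambda>\<omega>. (Y \<omega>, Z \<omega>))"
    proof (rule pair_measure_eqI)
      fix A B assume "A \<in> sets (distr M N Y)" "B \<in> sets (distr M (PiM I (\<lambda>_. borel)) Z)"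
      then have A[measurable]: "A \<in> sets N" and B[measurable]: "B \<in> sets (PiM I (\<lambda>_. borel))" by auto
      have "Y -` A \<inter> space M \<in> sets (future t)" using measurable_sets[OF Y A] by simp
      moreover have pre: "(\<lambda>\<omega>. (Y \<omega>, Z \<omega>)) -` (A \<times> B) \<inter> space M = Y -` A \<inter> space M \<inter> (Z -` B \<inter> space M)" by auto
      ultimately show "emeasure (distr M N Y) A * emeasure (distr M (PiM I (\<lambda>_. borel)) Z) B
          = emeasure (distr M (N \<Otimes>\<^sub>M PiM I (\<lambda>_. borel)) (\<lambda>\<omega>. (Y \<omega>, Z \<omega>))) (A \<times> B)"
        using key[OF _ B] by (simp add: emeasure_distr emeasure_eq_measure ennreal_mult[symmetric] pre)
    qed (simp_all add: Y.sigma_finite_measure_axioms Z.sigma_finite_measure_axioms cong: sets_pair_measure_cong)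
  qed simp_all
qed

end

section \<open>The lattice heat kernel\<close>

locale torus =
  fixes \<epsilon> :: real
  assumes eps: "\<epsilon> > 0" and inv_eps: "1 / \<epsilon> \<in> \<nat>"
begin

abbreviation "S \<equiv> sites \<epsilon>"
abbreviation "\<Delta> \<equiv> lattice_laplacian \<epsilon>"
abbreviation "heat \<equiv> heat_semigroup \<epsilon>"

definition dirs :: "(int \<times> int) set" where "dirs = {(1, 0), (-1, 0), (0, 1), (0, -1)}"

definition shift :: "site \<Rightarrow> site \<Rightarrow> site" where
  "shift d x = ((fst x + fst d) mod side \<epsilon>, (snd x + snd d) mod side \<epsilon>)"

lemma finite_S [simp]: "finite S"
  by (simp add: sites_def)

lemma side_pos: "side \<epsilon> > 0"
proof -
  obtain n where n: "1 / \<epsilon> = real n" using inv_eps by (auto simp: Nats_def)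
  then have "n > 0" using eps by (cases n) auto
  then show ?thesis by (simp add: side_def n)
qed

lemma shift_in [simp]: "shift d x \<in> S"
  using side_pos by (simp add: shift_def sites_def)

lemma finite_dirs [simp]: "finite dirs" and card_dirs: "card dirs = 4"
  by (simp_all add: dirs_def)

lemma laplacian_def: "\<Delta> f x = (\<Sum>d\<in>dirs. f (shift d x) - f x) / \<epsilon>\<^sup>2"
  by (simp add: lattice_laplacian_def dirs_def shift_def)

lemma laplacian_cong: "(\<And>y. y \<in> S \<Longrightarrow> f y = g y) \<Longrightarrow> x \<in> S \<Longrightarrow> \<Delta> f x = \<Delta> g x"
  by (simp add: laplacian_def)

lemma laplacian_sum: "\<Delta> (\<lambda>x. \<Sum>i\<in>I. f i x) x = (\<Sum>i\<in>I. \<Delta> (f i) x)"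
proof -
  have "(\<Sum>d\<in>dirs. \<Sum>i\<in>I. f i (shift d x) - f i x) = (\<Sum>i\<in>I. \<Sum>d\<in>dirs. f i (shift d x) - f i x)" by (rule sum.swap)
  then show ?thesis by (simp add: laplacian_def sum_subtractf[symmetric] sum_divide_distrib[symmetric])
qed

lemma laplacian_mult: "\<Delta> (\<lambda>x. f x * c) x = \<Delta> f x * c"
  by (simp add: laplacian_def sum_distrib_right left_diff_distrib)

text \<open>Each of the four directions contributes at most \<open>2 * C\<close>.\<close>

lemma laplacian_bound:
  assumes "\<And>y. y \<in> S \<Longrightarrow> \<bar>f y\<bar> \<le> C" "x \<in> S"
  shows "\<bar>\<Delta> f x\<bar> \<le> 8 / \<epsilon>\<^sup>2 * C"
proof -
  have "\<bar>\<Sum>d\<in>dirs. f (shift d x) - f x\<bar> \<le> (\<Sum>d\<in>dirs. 2 * C)"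
  proof (rule order_trans[OF sum_abs], rule sum_mono)
    fix d
    show "\<bar>f (shift d x) - f x\<bar> \<le> 2 * C"
      using assms(1)[of "shift d x"] assms(1)[OF assms(2)] by simp
  qed
  then show ?thesis using eps by (simp add: laplacian_def card_dirs abs_mult field_simps)
qed

lemma laplacian_pow_bound:
  assumes "\<And>y. y \<in> S \<Longrightarrow> \<bar>f y\<bar> \<le> C" "x \<in> S"
  shows "\<bar>(\<Delta> ^^ n) f x\<bar> \<le> (8 / \<epsilon>\<^sup>2) ^ n * C"
  using assms(2)
proof (induction n arbitrary: x)
  case (Suc n)
  then show ?case using laplacian_bound[where f="(\<Delta> ^^ n) f" and C="(8 / \<epsilon>\<^sup>2) ^ n * C" and x=x] by (simp add: mult.assoc)
qed (use assms in simp)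

lemma summable_heat:
  assumes "x \<in> S" shows "summable (\<lambda>n. (\<Delta> ^^ n) f x / fact n * t ^ n)"
proof -
  define C where "C = Max ((\<lambda>y. \<bar>f y\<bar>) ` S)"
  have C: "\<bar>f y\<bar> \<le> C" if "y \<in> S" for y using that by (auto simp: C_def intro!: Max_ge)
  show ?thesis
  proof (rule summable_comparison_test)
    show "\<exists>N. \<forall>n\<ge>N. norm ((\<Delta> ^^ n) f x / fact n * t ^ n) \<le> C * (inverse (fact n) * (8 / \<epsilon>\<^sup>2 * \<bar>t\<bar>) ^ n)"
    proof (intro exI[of _ 0] allI impI)
      fix n
      have "norm ((\<Delta> ^^ n) f x / fact n * t ^ n) = \<bar>(\<Delta> ^^ n) f x\<bar> * (inverse (fact n) * \<bar>t\<bar> ^ n)"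
        by (simp add: abs_mult power_abs field_simps)
      also have "\<dots> \<le> (8 / \<epsilon>\<^sup>2) ^ n * C * (inverse (fact n) * \<bar>t\<bar> ^ n)"
        using laplacian_pow_bound[OF C assms, where n=n] by (intro mult_right_mono) auto
      finally show "norm ((\<Delta> ^^ n) f x / fact n * t ^ n) \<le> C * (inverse (fact n) * (8 / \<epsilon>\<^sup>2 * \<bar>t\<bar>) ^ n)"
        by (simp only: power_mult_distrib mult_ac)
    qed
    show "summable (\<lambda>n. C * (inverse (fact n) * (8 / \<epsilon>\<^sup>2 * \<bar>t\<bar>) ^ n))"
      by (intro summable_mult summable_exp)
  qed
qed

lemma heat_sums: "x \<in> S \<Longrightarrow> (\<lambda>n. (\<Delta> ^^ n) f x / fact n * t ^ n) sums heat t f x"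
  using summable_heat[of x f t] by (simp add: heat_semigroup_def summable_sums mult.commute)

lemma laplacian_heat_sums:
  assumes "x \<in> S" shows "(\<lambda>n. (\<Delta> ^^ Suc n) f x / fact n * t ^ n) sums \<Delta> (heat t f) x"
proof -
  have "(\<lambda>n. (\<Sum>d\<in>dirs. (\<Delta> ^^ n) f (shift d x) / fact n * t ^ n - (\<Delta> ^^ n) f x / fact n * t ^ n) / \<epsilon>\<^sup>2) sums \<Delta> (heat t f) x"
    unfolding laplacian_def[of "heat t f" x] using assms by (intro sums_divide sums_sum sums_diff heat_sums) auto
  moreover have "(\<Sum>d\<in>dirs. (\<Delta> ^^ n) f (shift d x) / fact n * t ^ n - (\<Delta> ^^ n) f x / fact n * t ^ n) / \<epsilon>\<^sup>2 = (\<Delta> ^^ Suc n) f x / fact n * t ^ n" for n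
  proof -
    have "(\<Sum>d\<in>dirs. (\<Delta> ^^ n) f (shift d x) / fact n * t ^ n - (\<Delta> ^^ n) f x / fact n * t ^ n)
       = (\<Sum>d\<in>dirs. (\<Delta> ^^ n) f (shift d x) - (\<Delta> ^^ n) f x) * (t ^ n / fact n)"
      unfolding sum_distrib_right by (intro sum.cong refl) (simp add: field_simps)
    then show ?thesis by (simp add: laplacian_def[of "(\<Delta> ^^ n) f" x])
  qed
  ultimately show ?thesis by simp
qed

lemma heat_has_derivative:
  assumes "x \<in> S" shows "((\<lambda>t. heat t f x) has_real_derivative \<Delta> (heat t f) x) (at t)"
proof -
  let ?c = "\<lambda>n. (\<Delta> ^^ n) f x / fact n"
  have "((\<lambda>t. \<Sum>n. ?c n * t ^ n) has_real_derivative (\<Sum>n. diffs ?c n * t ^ n)) (at t)"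
    by (rule termdiffs_strong_converges_everywhere) (rule summable_heat[OF assms])
  moreover have "diffs ?c n * t ^ n = (\<Delta> ^^ Suc n) f x / fact n * t ^ n" for n
  proof -
    have "real (Suc n) * (a / fact (Suc n)) = a / fact n" for a :: real
      unfolding fact_Suc by (simp del: of_nat_Suc)
    then show ?thesis unfolding diffs_def by simp
  qed
  ultimately show ?thesis
    using laplacian_heat_sums[OF assms, of f t, THEN sums_unique] heat_sums[OF assms, of f, THEN sums_unique] by simp
qed

lemma heat_0 [simp]: "heat 0 f x = f x"
  unfolding heat_semigroup_def by (subst suminf_finite[of "{0}"]) auto

lemma sum_shift: "(\<Sum>x\<in>S. f (shift d x)) = (\<Sum>x\<in>S. f x)"
proof (rule sum.reindex_bij_witness[where j="shift d" and i="shift (- fst d, - snd d)"])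
  fix x assume "x \<in> S"
  then show "shift (- fst d, - snd d) (shift d x) = x" "shift d (shift (- fst d, - snd d) x) = x"
    by (auto simp: shift_def sites_def mod_simps)
qed auto

lemma sum_shift_mult: "(\<Sum>x\<in>S. f x * g (shift d x)) = (\<Sum>x\<in>S. f (shift (- fst d, - snd d) x) * g x)"
proof -
  have "(\<Sum>x\<in>S. f x * g (shift d x)) = (\<Sum>x\<in>S. f (shift (- fst d, - snd d) (shift d x)) * g (shift d x))"
    by (intro sum.cong) (auto simp: shift_def sites_def mod_simps)
  also have "\<dots> = (\<Sum>x\<in>S. f (shift (- fst d, - snd d) x) * g x)" by (rule sum_shift[of "\<lambda>x. f (shift (- fst d, - snd d) x) * g x"])
  finally show ?thesis .
qed

text \<open>The adjoint of a shift is the opposite shift, and the set of directions is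
  symmetric.\<close>

lemma laplacian_selfadjoint: "(\<Sum>x\<in>S. f x * \<Delta> g x) = (\<Sum>x\<in>S. \<Delta> f x * g x)"
proof -
  have "(\<Sum>x\<in>S. f x * (\<Sum>d\<in>dirs. g (shift d x) - g x)) = (\<Sum>d\<in>dirs. (\<Sum>x\<in>S. f x * g (shift d x)) - (\<Sum>x\<in>S. f x * g x))"
    by (simp add: sum_distrib_left right_diff_distrib sum_subtractf sum.swap[of _ S] mult.left_commute)
  also have "\<dots> = (\<Sum>d\<in>dirs. (\<Sum>x\<in>S. f (shift (- fst d, - snd d) x) * g x) - (\<Sum>x\<in>S. f x * g x))"
    by (simp only: sum_shift_mult)
  also have "\<dots> = (\<Sum>d\<in>dirs. (\<Sum>x\<in>S. f (shift d x) * g x) - (\<Sum>x\<in>S. f x * g x))"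
    by (rule sum.reindex_bij_witness[where i="\<lambda>d. (- fst d, - snd d)" and j="\<lambda>d. (- fst d, - snd d)"]) (auto simp: dirs_def)
  also have "\<dots> = (\<Sum>x\<in>S. (\<Sum>d\<in>dirs. f (shift d x) - f x) * g x)"
    by (simp add: sum_distrib_right left_diff_distrib sum_subtractf sum.swap[of _ S] sum_distrib_left mult.assoc)
  finally show ?thesis by (simp add: laplacian_def sum_divide_distrib[symmetric])
qed

text \<open>By shift invariance, the sum of \<open>f x * f (shift d x)\<close> is at most the sum of
  squares in every direction \<open>d\<close>. This sign drives both the decay of the heat flow and
  the integrability of the Gaussian weight.\<close>

lemma dirichlet_nonpos: "(\<Sum>x\<in>S. f x * \<Delta> f x) \<le> 0"
proof -
  have "(\<Sum>x\<in>S. f x * f (shift d x)) \<le> (\<Sum>x\<in>S. (f x)\<^sup>2)" for d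
  proof -
    have "(\<Sum>x\<in>S. f x * f (shift d x)) \<le> (\<Sum>x\<in>S. ((f x)\<^sup>2 + (f (shift d x))\<^sup>2) / 2)"
    proof (rule sum_mono)
      fix x show "f x * f (shift d x) \<le> ((f x)\<^sup>2 + (f (shift d x))\<^sup>2) / 2"
        using sum_squares_bound[of "f x" "f (shift d x)"] by simp
    qed
    also have "\<dots> = (\<Sum>x\<in>S. (f x)\<^sup>2)"
      using sum_shift[of "\<lambda>x. (f x)\<^sup>2" d] by (simp add: sum_divide_distrib[symmetric] sum.distrib)
    finally show ?thesis .
  qed
  then have "(\<Sum>d\<in>dirs. (\<Sum>x\<in>S. f x * f (shift d x)) - (\<Sum>x\<in>S. (f x)\<^sup>2)) \<le> 0" by (intro sum_nonpos) simp
  moreover have "(\<Sum>x\<in>S. f x * (\<Sum>d\<in>dirs. f (shift d x) - f x)) = (\<Sum>d\<in>dirs. (\<Sum>x\<in>S. f x * f (shift d x)) - (\<Sum>x\<in>S. (f x)\<^sup>2))"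
    by (simp add: sum_distrib_left right_diff_distrib sum_subtractf sum.swap[of _ S] power2_eq_square mult.left_commute)
  ultimately show ?thesis
    by (simp add: laplacian_def sum_divide_distrib[symmetric] divide_nonpos_nonneg)
qed

lemma heat_energy: "t \<ge> 0 \<Longrightarrow> (\<Sum>x\<in>S. (heat t f x)\<^sup>2) \<le> (\<Sum>x\<in>S. (f x)\<^sup>2)"
proof -
  assume t: "t \<ge> 0"
  have "((\<lambda>t. \<Sum>x\<in>S. (heat t f x)\<^sup>2) has_real_derivative 2 * (\<Sum>x\<in>S. heat t f x * \<Delta> (heat t f) x)) (at t)" for t
    by (auto intro!: derivative_eq_intros heat_has_derivative simp: sum_distrib_left mult_ac)
  then have "(\<Sum>x\<in>S. (heat t f x)\<^sup>2) \<le> (\<Sum>x\<in>S. (heat 0 f x)\<^sup>2)"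
    using dirichlet_nonpos[of "heat _ f"]
    by (intro DERIV_nonpos_imp_nonincreasing[OF t]) (force intro: mult_nonneg_nonpos)
  then show ?thesis by simp
qed

text \<open>Moving time from one factor to the other leaves the pairing constant, because its
  derivative vanishes by self-adjointness. Symmetry of the heat kernel and the Chapman-Kolmogorov
  identity are both special cases.\<close>

lemma heat_pairing: "(\<Sum>y\<in>S. heat s f y * heat u g y) = (\<Sum>y\<in>S. heat (s + u) f y * g y)"
proof -
  let ?P = "\<lambda>r. \<Sum>y\<in>S. heat r f y * heat (s + u - r) g y"
  have "(?P has_real_derivative 0) (at r)" for r
  proof -
    have "((\<lambda>r. heat (s + u - r) g y) has_real_derivative \<Delta> (heat (s + u - r) g) y * (-1)) (at r)" if "y \<in> S" for y
      by (rule DERIV_chain2[OF heat_has_derivative[OF that]]) (auto intro!: derivative_eq_intros)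
    then have "(?P has_real_derivative (\<Sum>y\<in>S. \<Delta> (heat r f) y * heat (s + u - r) g y + \<Delta> (heat (s + u - r) g) y * (-1) * heat r f y)) (at r)"
      by (intro DERIV_sum DERIV_mult heat_has_derivative)
    moreover have "(\<Sum>y\<in>S. \<Delta> (heat r f) y * heat (s + u - r) g y + \<Delta> (heat (s + u - r) g) y * (-1) * heat r f y) = 0"
      using laplacian_selfadjoint[of "heat r f" "heat (s + u - r) g"] by (simp add: sum_subtractf mult.commute)
    ultimately show ?thesis by simp
  qed
  then have "?P s = ?P (s + u)" by (intro DERIV_isconst_all[of ?P s "s + u"] allI)
  then show ?thesis by simp
qed

lemma sum_indicator_mult: "x \<in> S \<Longrightarrow> (\<Sum>y\<in>S. h y * indicator {x} y) = (h x :: real)"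
  by (simp add: indicator_def if_distrib[of "\<lambda>z. _ * z"] sum.delta cong: if_cong)

lemma heat_symmetric:
  assumes "x \<in> S" "y \<in> S" shows "heat t (indicator {x}) y = heat t (indicator {y}) x"
proof -
  have "heat t (indicator {x}) y = (\<Sum>w\<in>S. heat t (indicator {x}) w * heat 0 (indicator {y}) w)"
    by (simp only: sum_indicator_mult[OF assms(2)] heat_0)
  also have "\<dots> = (\<Sum>w\<in>S. heat 0 (indicator {x}) w * heat t (indicator {y}) w)"
    by (simp only: heat_pairing add_0 add_0_right)
  also have "\<dots> = heat t (indicator {y}) x"
    by (simp only: sum_indicator_mult[OF assms(1)] heat_0 mult.commute[of "indicator {x} _"])
  finally show ?thesis .
qed

lemma heat_chapman:
  assumes "x \<in> S" "y \<in> S"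
  shows "(\<Sum>w\<in>S. heat t (indicator {x}) w * heat t (indicator {y}) w) = heat (2 * t) (indicator {x}) y"
  by (simp only: heat_pairing sum_indicator_mult[OF assms(2)] mult_2)

text \<open>Decay of the sum of squares takes the place of a maximum principle: an indicator starts
  with energy 1.\<close>

lemma heat_indicator_bound:
  assumes "t \<ge> 0" "x \<in> S" "y \<in> S" shows "\<bar>heat t (indicator {y}) x\<bar> \<le> 1"
proof -
  have "(heat t (indicator {y}) x)\<^sup>2 \<le> (\<Sum>x\<in>S. (heat t (indicator {y}) x)\<^sup>2)"
    using assms by (intro member_le_sum) auto
  also have "\<dots> \<le> (\<Sum>x\<in>S. (indicator {y} x)\<^sup>2)" by (rule heat_energy[OF assms(1)])
  also have "\<dots> = 1"
    using sum_indicator_mult[OF assms(3), of "indicator {y}"] by (simp add: power2_eq_square)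
  finally show ?thesis by (simp add: abs_square_le_1)
qed

abbreviation "K \<equiv> cdot_kernel \<epsilon>"

lemma K_def: "K t x y = heat t (indicator {y}) x * exp (- t) / \<epsilon>\<^sup>2"
  by (simp add: cdot_kernel_def cdot_op_def)

lemma K_symmetric: "x \<in> S \<Longrightarrow> y \<in> S \<Longrightarrow> K t x y = K t y x"
  using heat_symmetric[of x y t] by (simp add: K_def)

lemma K_bound: "t \<ge> 0 \<Longrightarrow> x \<in> S \<Longrightarrow> y \<in> S \<Longrightarrow> \<bar>K t x y\<bar> \<le> exp (- t) / \<epsilon>\<^sup>2"
  using heat_indicator_bound[of t x y] by (simp add: K_def abs_mult divide_right_mono)

lemma K_has_derivative:
  assumes "x \<in> S" shows "((\<lambda>t. K t x y) has_real_derivative \<Delta> (\<lambda>x. K t x y) x - K t x y) (at t)"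
proof -
  have "((\<lambda>t. K t x y) has_real_derivative (\<Delta> (heat t (indicator {y})) x * exp (- t) - heat t (indicator {y}) x * exp (- t)) / \<epsilon>\<^sup>2) (at t)"
    unfolding K_def
    by (rule DERIV_cdivide) (auto intro!: derivative_eq_intros heat_has_derivative assms)
  moreover have "\<Delta> (\<lambda>x. K t x y) x = \<Delta> (heat t (indicator {y})) x * (exp (- t) / \<epsilon>\<^sup>2)"
    unfolding K_def times_divide_eq_right[symmetric] by (rule laplacian_mult)
  ultimately show ?thesis by (simp add: K_def diff_divide_distrib)
qed

lemma K_continuous: "x \<in> S \<Longrightarrow> continuous_on A (\<lambda>t. K t x y)"
  by (intro continuous_at_imp_continuous_on ballI DERIV_isCont[OF K_has_derivative])

lemma K_measurable [measurable]: "x \<in> S \<Longrightarrow> (\<lambda>t. K t x y) \<in> borel_measurable borel"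
  by (intro borel_measurable_continuous_onI K_continuous)

text \<open>Bounds the time derivative \<open>\<Delta> K - K\<close>, given that \<open>K\<close> is
  at most \<open>1 / \<epsilon>^2\<close> and that \<open>\<Delta>\<close> costs a factor
  \<open>8 / \<epsilon>^2\<close>.\<close>

definition K_lip :: real where "K_lip = (8 / \<epsilon>\<^sup>2 + 1) / \<epsilon>\<^sup>2"

lemma K_lipschitz:
  assumes "s \<ge> 0" "t \<ge> 0" "x \<in> S" "y \<in> S" shows "\<bar>K t x y - K s x y\<bar> \<le> K_lip * \<bar>t - s\<bar>"
proof -
  have "norm (K t x y - K s x y) \<le> K_lip * norm (t - s)"
  proof (rule field_differentiable_bound[where S="{0..}" and f'="\<lambda>t. \<Delta> (\<lambda>x. K t x y) x - K t x y"])
    fix r :: real assume r: "r \<in> {0..}"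
    show "((\<lambda>t. K t x y) has_field_derivative \<Delta> (\<lambda>x. K r x y) x - K r x y) (at r within {0..})"
      using K_has_derivative[OF assms(3)] by (rule has_field_derivative_at_within)
    have b: "\<bar>K r x' y\<bar> \<le> 1 / \<epsilon>\<^sup>2" if "x' \<in> S" for x'
    proof -
      have "exp (- r) / \<epsilon>\<^sup>2 \<le> 1 / \<epsilon>\<^sup>2" using r by (intro divide_right_mono) auto
      then show ?thesis using K_bound[of r x' y] r that assms(4) by simp
    qed
    have "\<bar>\<Delta> (\<lambda>x. K r x y) x - K r x y\<bar> \<le> 8 / \<epsilon>\<^sup>2 * (1 / \<epsilon>\<^sup>2) + 1 / \<epsilon>\<^sup>2"
      using laplacian_bound[of "\<lambda>x. K r x y", OF b assms(3)] b[OF assms(3)] by linarith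
    then show "norm (\<Delta> (\<lambda>x. K r x y) x - K r x y) \<le> K_lip"
      by (simp add: K_lip_def add_divide_distrib)
  qed (use assms in auto)
  then show ?thesis by simp
qed

text \<open>As an operator \<open>q\<close> at time \<open>u\<close> is the square root of
  \<open>cdot\<close> at time \<open>u\<close>, since it runs the semigroup for half the time. The
  factor \<open>\<epsilon>^2\<close> belongs to composition of kernels. This is what makes
  \<open>K\<close> the rate at which the field gains covariance.\<close>

lemma q_chapman: "x \<in> S \<Longrightarrow> y \<in> S \<Longrightarrow> \<epsilon>\<^sup>2 * (\<Sum>w\<in>S. q_kernel \<epsilon> u x w * q_kernel \<epsilon> u y w) = K u x y"
proof -
  assume x: "x \<in> S" and y: "y \<in> S"
  have "(\<Sum>w\<in>S. q_kernel \<epsilon> u x w * q_kernel \<epsilon> u y w) =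
      (\<Sum>w\<in>S. heat (u / 2) (indicator {x}) w * heat (u / 2) (indicator {y}) w) * (exp (- u) / \<epsilon> ^ 4)"
    unfolding sum_distrib_right
  proof (intro sum.cong refl)
    fix w assume w: "w \<in> S"
    have "exp (- u) = exp (- (u / 2)) * exp (- (u / 2))" by (simp add: exp_add[symmetric])
    then show "q_kernel \<epsilon> u x w * q_kernel \<epsilon> u y w = heat (u / 2) (indicator {x}) w * heat (u / 2) (indicator {y}) w * (exp (- u) / \<epsilon> ^ 4)"
      unfolding q_kernel_def K_def heat_symmetric[OF x w] heat_symmetric[OF y w]
      by (simp add: power4_eq_xxxx power2_eq_square mult_ac)
  qed
  also have "\<dots> = heat u (indicator {x}) y * (exp (- u) / \<epsilon> ^ 4)"
    using heat_chapman[OF x y, of "u / 2"] by simp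
  finally show ?thesis
    using eps heat_symmetric[OF x y, of u] by (simp add: K_def power4_eq_xxxx power2_eq_square)
qed

lemma integrable_exp_neg: "set_integrable lborel {0..} (\<lambda>u::real. exp (- u))"
proof -
  have "integrable lborel (\<lambda>u::real. indicator {0<..} u *\<^sub>R exp (- u))"
    using integrable_I0i_exp_mscale[of 1] by (simp add: set_integrable_def)
  then show ?thesis unfolding set_integrable_def
    by (rule integrable_cong_AE_imp) (use AE_lborel_singleton[of "0::real"] in \<open>auto simp: indicator_def\<close>)
qed

lemma K_integrable: "x \<in> S \<Longrightarrow> y \<in> S \<Longrightarrow> set_integrable lborel {0..} (\<lambda>u. K u x y)"
proof -
  assume x: "x \<in> S" and y: "y \<in> S"
  have "set_integrable lborel {0..} (\<lambda>u::real. exp (- u) / \<epsilon>\<^sup>2)"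
    using integrable_exp_neg by (rule set_integrable_divide[rotated])
  then show ?thesis unfolding set_integrable_def
    by (rule Bochner_Integration.integrable_bound) (use K_bound[OF _ x y] x in \<open>auto simp: indicator_def\<close>)
qed

definition c_inf :: "site \<Rightarrow> site \<Rightarrow> real" where
  "c_inf x y = (LBINT u:{0..}. K u x y)"

text \<open>So \<open>c_inf\<close> is the Green function of \<open>1 - \<Delta>\<close>. The
  integrand \<open>\<Delta> K - K\<close> is the time derivative of \<open>K\<close>, and its
  integral is minus the initial value, a lattice delta function. The mass term makes
  \<open>K\<close> decay exponentially, which gives integrability and kills the boundary term at
  infinity.\<close>

lemma laplacian_c_inf:
  assumes x: "x \<in> S" and y: "y \<in> S"
  shows "c_inf x y - \<Delta> (\<lambda>x. c_inf x y) x = (if x = y then 1 / \<epsilon>\<^sup>2 else 0)"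
proof -
  have KI: "has_bochner_integral lborel (\<lambda>u. indicator {0..} u * K u x y) (c_inf x y)" if "x \<in> S" for x
    using K_integrable[OF that y]
    by (simp add: c_inf_def set_lebesgue_integral_def set_integrable_def has_bochner_integral_iff)
  have "has_bochner_integral lborel (\<lambda>u. (\<Sum>d\<in>dirs. indicator {0..} u * K u (shift d x) y - indicator {0..} u * K u x y) / \<epsilon>\<^sup>2 - indicator {0..} u * K u x y)
     ((\<Sum>d\<in>dirs. c_inf (shift d x) y - c_inf x y) / \<epsilon>\<^sup>2 - c_inf x y)"
    using x by (intro has_bochner_integral_diff has_bochner_integral_divide has_bochner_integral_sum KI) auto
  also have "(\<lambda>u. (\<Sum>d\<in>dirs. indicator {0..} u * K u (shift d x) y - indicator {0..} u * K u x y) / \<epsilon>\<^sup>2 - indicator {0..} u * K u x y)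
     = (\<lambda>u. indicator {0..} u *\<^sub>R (\<Delta> (\<lambda>x. K u x y) x - K u x y))"
    by (simp add: laplacian_def indicator_def fun_eq_iff)
  also have "(\<Sum>d\<in>dirs. c_inf (shift d x) y - c_inf x y) / \<epsilon>\<^sup>2 - c_inf x y = \<Delta> (\<lambda>x. c_inf x y) x - c_inf x y"
    by (simp add: laplacian_def)
  finally have D: "set_integrable lborel {0..} (\<lambda>u. \<Delta> (\<lambda>x. K u x y) x - K u x y)"
    and L: "(LBINT u:{0..}. \<Delta> (\<lambda>x. K u x y) x - K u x y) = \<Delta> (\<lambda>x. c_inf x y) x - c_inf x y"
    by (simp_all add: set_integrable_def set_lebesgue_integral_def has_bochner_integral_iff)
  have lim: "((\<lambda>t. K t x y) \<longlongrightarrow> 0) at_top"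
  proof (rule Lim_null_comparison)
    show "\<forall>\<^sub>F t in at_top. norm (K t x y) \<le> exp (- t) / \<epsilon>\<^sup>2"
      using eventually_ge_at_top[of 0] by eventually_elim (use K_bound x y in auto)
    have "((\<lambda>t::real. exp (- t)) \<longlongrightarrow> 0) at_top"
      by (rule filterlim_compose[OF exp_at_bot filterlim_uminus_at_bot_at_top])
    then show "((\<lambda>t. exp (- t) / \<epsilon>\<^sup>2) \<longlongrightarrow> 0) at_top"
      using tendsto_divide[OF _ tendsto_const[of "\<epsilon>\<^sup>2"]] eps by force
  qed
  have "(LBINT u=0..\<infinity>. \<Delta> (\<lambda>x. K u x y) x - K u x y) = 0 - K 0 x y"
  proof (rule interval_integral_FTC_integrable[where F="\<lambda>t. K t x y"])
    show "((\<lambda>t. K t x y) has_vector_derivative \<Delta> (\<lambda>x. K u x y) x - K u x y) (at u)" for u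
      using K_has_derivative[OF x] by (simp add: has_real_derivative_iff_has_vector_derivative)
    show "isCont (\<lambda>u. \<Delta> (\<lambda>x. K u x y) x - K u x y) u" for u
      unfolding laplacian_def using DERIV_isCont[OF K_has_derivative] x eps
      by (intro continuous_intros) auto
    show "set_integrable lborel (einterval 0 \<infinity>) (\<lambda>u. \<Delta> (\<lambda>x. K u x y) x - K u x y)"
      by (rule set_integrable_subset[OF D]) (auto simp: einterval_iff)
    show "(((\<lambda>t. K t x y) \<circ> real_of_ereal) \<longlongrightarrow> K 0 x y) (at_right 0)"
    proof -
      have "isCont (\<lambda>t. K t x y) 0" by (rule DERIV_isCont[OF K_has_derivative[OF x]])
      then show ?thesis
        by (simp add: zero_ereal_def ereal_tendsto_simps isCont_def filterlim_at_split)
    qed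
    show "(((\<lambda>t. K t x y) \<circ> real_of_ereal) \<longlongrightarrow> 0) (at_left \<infinity>)"
      using lim by (simp add: ereal_tendsto_simps)
  qed simp
  also have "(LBINT u=0..\<infinity>. \<Delta> (\<lambda>x. K u x y) x - K u x y) = (LBINT u:{0<..}. \<Delta> (\<lambda>x. K u x y) x - K u x y)"
    by (simp add: interval_lebesgue_integral_0_infty)
  also have "\<dots> = (LBINT u:{0..}. \<Delta> (\<lambda>x. K u x y) x - K u x y)"
    unfolding set_lebesgue_integral_def using D AE_lborel_singleton[of "0::real"]
    by (intro integral_cong_AE) (auto simp: indicator_def set_integrable_def laplacian_def x)
  also have "\<dots> = \<Delta> (\<lambda>x. c_inf x y) x - c_inf x y"
    by (rule L)
  finally show ?thesis by (auto simp: K_def indicator_def)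
qed

end

section \<open>The Gaussian free field\<close>

text \<open>
  Tilting by \<open>exp (\<tau> X)\<close> shifts \<open>X\<close> by \<open>\<tau> q\<close>. Since
  \<open>exp (\<i> h X) - 1 = \<i> (exp (h X) - 1) + O(h\<^sup>2)\<close>, the characteristic function solves \<open>\<chi>' = - s q \<chi>\<close>.
\<close>

lemma (in prob_space) char_eq_normal_of_tilt:
  assumes [measurable]: "X \<in> borel_measurable M"
    and int: "\<And>\<tau>. integrable M (\<lambda>x. exp (\<tau> * X x))"
    and tilt: "\<And>\<tau> s. (CLINT x|M. exp (\<tau> * X x) *\<^sub>R iexp (s * X x)) = exp (of_real (\<tau>\<^sup>2 * q / 2) + \<i> * of_real (\<tau> * s * q)) * (CLINT x|M. iexp (s * X x))"
  shows "(CLINT x|M. iexp (s * X x)) = of_real (exp (- (s\<^sup>2 * q) / 2))"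
proof -
  define ch where "ch s = (CLINT x|M. iexp (s * X x))" for s
  \<comment> \<open>By \<open>tilt\<close>, \<open>A s h * ch s\<close> is \<open>\<i>\<close> times
    the mean of \<open>(exp (h * X) - 1) * iexp (s * X)\<close>, hence a first-order substitute for
    \<open>ch (s + h) - ch s\<close>. Its derivative at \<open>h = 0\<close> is
    \<open>- s * q * ch s\<close>.\<close>
  define A where "A s h = \<i> * (exp (of_real (h\<^sup>2 * q / 2) + \<i> * of_real (h * s * q)) - 1)" for s h :: real
  \<comment> \<open>Majorant of the remainder: \<open>y^2\<close> and
    \<open>exp \<bar>h * y\<bar>\<close> are each controlled by \<open>exp \<bar>y\<bar>\<close>,
    and \<open>exp (2 * \<bar>y\<bar>)\<close> by the sum of the two exponentials, which is
    integrable by \<open>int\<close>.\<close>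
  define C where "C = (LINT x|M. 2 * (exp (2 * X x) + exp (-2 * X x)))"
  have e1: "integrable M (\<lambda>x. iexp (s * X x))" for s
    by (rule integrable_complex_bounded[where B=1]) simp_all
  have e2: "integrable M (\<lambda>x. exp (\<tau> * X x) *\<^sub>R iexp (s * X x))" for \<tau> s
    by (rule Bochner_Integration.integrable_bound[OF int[of \<tau>]]) simp_all
  have iC: "integrable M (\<lambda>x. 2 * (exp (2 * X x) + exp (-2 * X x)))"
    using int[of 2] int[of "-2"] by auto
  have R: "norm (ch (s + h) - ch s - A s h * ch s) \<le> C * h\<^sup>2" if h: "\<bar>h\<bar> \<le> 1" for s h
  proof -
    have "ch (s + h) - ch s - A s h * ch s = ch (s + h) - ch s - \<i> * ((CLINT x|M. exp (h * X x) *\<^sub>R iexp (s * X x)) - ch s)"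
      unfolding tilt A_def ch_def by (simp only: algebra_simps mult_1_left)
    also have "\<dots> = (CLINT x|M. iexp ((s + h) * X x) - iexp (s * X x) - \<i> * (exp (h * X x) *\<^sub>R iexp (s * X x) - iexp (s * X x)))"
      unfolding ch_def using e1[of s] e1[of "s + h"] e2[of h s]
      by (simp only: Bochner_Integration.integral_diff Bochner_Integration.integrable_diff integrable_mult_right Bochner_Integration.integral_mult_right_zero)
    finally have eqn: "ch (s + h) - ch s - A s h * ch s = (CLINT x|M. iexp ((s + h) * X x) - iexp (s * X x) - \<i> * (exp (h * X x) *\<^sub>R iexp (s * X x) - iexp (s * X x)))" .
    have "norm (ch (s + h) - ch s - A s h * ch s) \<le> (LINT x|M. h\<^sup>2 * (2 * (exp (2 * X x) + exp (-2 * X x))))"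
      unfolding eqn
    proof (rule order_trans[OF integral_norm_bound], rule integral_mono)
      show "integrable M (\<lambda>x. norm (iexp ((s + h) * X x) - iexp (s * X x) - \<i> * (exp (h * X x) *\<^sub>R iexp (s * X x) - iexp (s * X x))))"
        by (intro integrable_norm Bochner_Integration.integrable_diff integrable_mult_right e1 e2)
      show "integrable M (\<lambda>x. h\<^sup>2 * (2 * (exp (2 * X x) + exp (-2 * X x))))" by (intro integrable_mult_right iC)
      fix x
      define y where "y = X x"
      have "iexp ((s + h) * y) - iexp (s * y) - \<i> * (exp (h * y) *\<^sub>R iexp (s * y) - iexp (s * y))
         = iexp (s * y) * ((iexp (h * y) - 1 - \<i> * (h * y)) - \<i> * of_real (exp (h * y) - 1 - h * y))"
        unfolding distrib_right of_real_add distrib_left exp_add scaleR_conv_of_real by (simp add: algebra_simps)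
      then have "norm (iexp ((s + h) * y) - iexp (s * y) - \<i> * (exp (h * y) *\<^sub>R iexp (s * y) - iexp (s * y)))
         = norm ((iexp (h * y) - 1 - \<i> * (h * y)) - \<i> * of_real (exp (h * y) - 1 - h * y))"
        by (simp only: norm_mult norm_exp_i_times mult_1_left)
      also have "\<dots> \<le> norm (iexp (h * y) - 1 - \<i> * (h * y)) + norm (\<i> * of_real (exp (h * y) - 1 - h * y))"
        by (rule norm_triangle_ineq4)
      finally have n0: "norm (iexp ((s + h) * y) - iexp (s * y) - \<i> * (exp (h * y) *\<^sub>R iexp (s * y) - iexp (s * y)))
         \<le> norm (iexp (h * y) - 1 - \<i> * (h * y)) + norm (\<i> * of_real (exp (h * y) - 1 - h * y))" .
      have n1: "norm (\<i> * of_real (exp (h * y) - 1 - h * y)) = \<bar>exp (h * y) - 1 - h * y\<bar>"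
        by (simp only: norm_mult norm_ii norm_of_real mult_1_left)
      have n2: "norm (iexp (h * y) - 1 - \<i> * (h * y)) \<le> (h * y)\<^sup>2 / 2"
        using iexp_approx1[of "h * y" 1] by (simp add: fact_numeral diff_diff_eq numeral_2_eq_2)
      have n3: "\<bar>exp (h * y) - 1 - h * y\<bar> \<le> (h * y)\<^sup>2 / 2 * exp \<bar>h * y\<bar>"
      proof -
        obtain t where t: "\<bar>t\<bar> \<le> \<bar>h * y\<bar>" "exp (h * y) = (\<Sum>m<2. (h * y) ^ m / fact m) + exp t / fact 2 * (h * y) ^ 2"
          using Maclaurin_exp_le[of "h * y" 2] by blast
        then have eq: "exp (h * y) - 1 - h * y = exp t / 2 * (h * y)\<^sup>2" by (simp add: numeral_2_eq_2)
        have "exp t \<le> exp \<bar>h * y\<bar>" using t(1) by simp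
        then have "exp t / 2 * (h * y)\<^sup>2 \<le> exp \<bar>h * y\<bar> / 2 * (h * y)\<^sup>2" by (intro mult_right_mono) auto
        then show ?thesis unfolding eq by (simp add: mult_ac)
      qed
      have n4: "(h * y)\<^sup>2 / 2 + (h * y)\<^sup>2 / 2 * exp \<bar>h * y\<bar> \<le> h\<^sup>2 * (2 * (exp (2 * y) + exp (-2 * y)))"
      proof -
        have hy: "\<bar>h * y\<bar> \<le> \<bar>y\<bar>" using h by (simp add: abs_mult mult_left_le_one_le)
        have y2: "y\<^sup>2 \<le> 2 * exp \<bar>y\<bar>"
          using exp_lower_Taylor_quadratic[of "\<bar>y\<bar>"] by simp
        have "(h * y)\<^sup>2 / 2 + (h * y)\<^sup>2 / 2 * exp \<bar>h * y\<bar> = h\<^sup>2 * (y\<^sup>2 * ((1 + exp \<bar>h * y\<bar>) / 2))"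
          by (simp add: power_mult_distrib algebra_simps)
        also have "\<dots> \<le> h\<^sup>2 * ((2 * exp \<bar>y\<bar>) * exp \<bar>y\<bar>)"
        proof (intro mult_left_mono mult_mono y2)
          have "(1 + a) / 2 \<le> b" if "a \<le> b" "1 \<le> b" for a b :: real using that by simp
          then show "(1 + exp \<bar>h * y\<bar>) / 2 \<le> exp \<bar>y\<bar>" by this (use hy in auto)
        qed auto
        also have "\<dots> = h\<^sup>2 * (2 * exp (2 * \<bar>y\<bar>))"
          using exp_double[of "\<bar>y\<bar>"] by (simp add: power2_eq_square)
        also have "\<dots> \<le> h\<^sup>2 * (2 * (exp (2 * y) + exp (-2 * y)))"
          by (intro mult_left_mono) (cases "y \<ge> 0"; simp)+
        finally show ?thesis .
      qed
      have "norm (iexp ((s + h) * y) - iexp (s * y) - \<i> * (exp (h * y) *\<^sub>R iexp (s * y) - iexp (s * y))) \<le> h\<^sup>2 * (2 * (exp (2 * y) + exp (-2 * y)))"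
        by (rule order_trans[OF n0], rule order_trans[OF add_mono n4], rule n2, unfold n1, rule n3)
      then show "norm (iexp ((s + h) * X x) - iexp (s * X x) - \<i> * (exp (h * X x) *\<^sub>R iexp (s * X x) - iexp (s * X x)))
         \<le> h\<^sup>2 * (2 * (exp (2 * X x) + exp (-2 * X x)))" by (simp only: y_def)
    qed
    also have "\<dots> = C * h\<^sup>2" unfolding C_def by simp
    finally show ?thesis .
  qed
  have D: "(ch has_vector_derivative - (of_real (s * q)) * ch s) (at s)" for s
  proof -
    define r where "r h = ch (s + h) - ch s - A s h * ch s" for h
    have "(r has_vector_derivative 0) (at 0)"
      unfolding has_vector_derivative_def has_derivative_at
    proof (intro conjI)
      show "(\<lambda>h. norm (r (0 + h) - r 0 - h *\<^sub>R 0) / norm h) \<midarrow>0\<rightarrow> 0"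
      proof (rule Lim_null_comparison)
        have r0: "r 0 = 0" by (simp add: r_def A_def)
        show "\<forall>\<^sub>F h in at 0. norm (norm (r (0 + h) - r 0 - h *\<^sub>R 0) / norm h) \<le> C * \<bar>h\<bar>"
          unfolding eventually_at
        proof (intro exI[of _ 1] conjI ballI impI)
          fix h :: real assume "h \<noteq> 0 \<and> dist h 0 < 1"
          then have h: "h \<noteq> 0" "\<bar>h\<bar> \<le> 1" by auto
          have "norm (r h) / \<bar>h\<bar> \<le> (C * h\<^sup>2) / \<bar>h\<bar>"
            unfolding r_def by (intro divide_right_mono R h) simp
          also have "(C * h\<^sup>2) / \<bar>h\<bar> = C * \<bar>h\<bar>" using h(1) by (simp add: power2_eq_square abs_if)
          finally show "norm (norm (r (0 + h) - r 0 - h *\<^sub>R 0) / norm h) \<le> C * \<bar>h\<bar>" by (simp add: r0)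
        qed simp
        show "(\<lambda>h. C * \<bar>h\<bar>) \<midarrow>0\<rightarrow> 0" by (auto intro!: tendsto_eq_intros)
      qed
    qed simp
    moreover have "((\<lambda>h. A s h * ch s) has_vector_derivative - (of_real (s * q)) * ch s) (at 0)"
    proof -
      let ?z = "\<lambda>h::real. complex_of_real (h\<^sup>2 * q / 2) + \<i> * of_real (h * s * q)"
      have "(?z has_vector_derivative (of_real 0 + \<i> * of_real (s * q))) (at 0)"
        by (intro has_vector_derivative_add has_vector_derivative_mult_right has_vector_derivative_of_real)
          (auto intro!: derivative_eq_intros)
      then have "((exp \<circ> ?z) has_vector_derivative (of_real 0 + \<i> * of_real (s * q)) * exp (?z 0)) (at 0)"
        by (rule field_vector_diff_chain_at) (rule DERIV_exp)
      then have "((\<lambda>h. \<i> * ((exp \<circ> ?z) h - 1)) has_vector_derivative \<i> * ((of_real 0 + \<i> * of_real (s * q)) * exp (?z 0) - 0)) (at 0)"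
        by (intro has_vector_derivative_mult_right has_vector_derivative_diff has_vector_derivative_const)
      moreover have "\<i> * ((of_real 0 + \<i> * of_real (s * q)) * exp (?z 0) - 0) = - (of_real (s * q))"
        by (simp add: mult.assoc[symmetric])
      ultimately have "((\<lambda>h::real. \<i> * (exp (of_real (h\<^sup>2 * q / 2) + \<i> * of_real (h * s * q)) - 1)) has_vector_derivative - (of_real (s * q))) (at 0)"
        by (simp only: o_def)
      then show ?thesis unfolding A_def by (rule has_vector_derivative_mult_left)
    qed
    ultimately have "((\<lambda>h. r h + A s h * ch s + ch s) has_vector_derivative 0 + - (of_real (s * q)) * ch s + 0) (at 0)"
      by (intro has_vector_derivative_add has_vector_derivative_const)
    then have "((\<lambda>h. ch (s + h)) has_vector_derivative - (of_real (s * q)) * ch s) (at 0)" by (simp add: r_def)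
    then show ?thesis
      by (simp add: has_vector_derivative_def has_derivative_at)
  qed
  \<comment> \<open>Integrating factor of the differential equation \<open>D\<close>; the constant
    is then fixed by \<open>ch 0 = 1\<close>.\<close>
  have "((\<lambda>s. ch s * of_real (exp (s\<^sup>2 * q / 2))) has_vector_derivative 0) (at s)" for s
  proof -
    have "((\<lambda>s. exp (s\<^sup>2 * q / 2)) has_real_derivative s * q * exp (s\<^sup>2 * q / 2)) (at s)"
      by (auto intro!: derivative_eq_intros)
    then have "((\<lambda>s. complex_of_real (exp (s\<^sup>2 * q / 2))) has_vector_derivative of_real (s * q * exp (s\<^sup>2 * q / 2))) (at s)"
      by (rule has_vector_derivative_of_real)
    from has_vector_derivative_mult[OF D this] show ?thesis by (simp add: algebra_simps)
  qed
  then obtain c where c: "\<And>s. ch s * of_real (exp (s\<^sup>2 * q / 2)) = c"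
    using has_vector_derivative_zero_constant[of UNIV "\<lambda>s. ch s * of_real (exp (s\<^sup>2 * q / 2))"] by auto
  have "ch 0 = 1" by (simp add: ch_def prob_space)
  with c[of 0] have "c = 1" by simp
  with c[of s] have "ch s * of_real (exp (s\<^sup>2 * q / 2)) = 1" by simp
  then have "ch s = of_real (inverse (exp (s\<^sup>2 * q / 2)))"
    by (metis inverse_unique mult.commute of_real_inverse)
  then show ?thesis by (simp add: ch_def exp_minus)
qed


lemma distr_PiM_lborel_translate:
  fixes w :: "'i \<Rightarrow> real"
  assumes "finite I"
  shows "distr (PiM I (\<lambda>_. lborel)) (PiM I (\<lambda>_. lborel)) (\<lambda>\<phi>. \<lambda>x\<in>I. \<phi> x + w x) = PiM I (\<lambda>_. lborel)"
proof -
  interpret product_sigma_finite "\<lambda>_ :: 'i. lborel :: real measure" by standard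
  show ?thesis
  proof (rule PiM_eqI[OF assms])
    fix A :: "'i \<Rightarrow> real set" assume A: "\<And>i. i \<in> I \<Longrightarrow> A i \<in> sets lborel"
    have m: "(\<lambda>\<phi>. \<lambda>x\<in>I. \<phi> x + w x) \<in> PiM I (\<lambda>_. lborel) \<rightarrow>\<^sub>M PiM I (\<lambda>_. lborel)"
      by measurable
    have "emeasure (distr (PiM I (\<lambda>_. lborel)) (PiM I (\<lambda>_. lborel)) (\<lambda>\<phi>. \<lambda>x\<in>I. \<phi> x + w x)) (Pi\<^sub>E I A)
       = emeasure (PiM I (\<lambda>_. lborel)) ((\<lambda>\<phi>. \<lambda>x\<in>I. \<phi> x + w x) -` Pi\<^sub>E I A \<inter> space (PiM I (\<lambda>_. lborel)))"
      using A assms by (intro emeasure_distr m sets_PiM_I_finite) auto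
    also have "(\<lambda>\<phi>. \<lambda>x\<in>I. \<phi> x + w x) -` Pi\<^sub>E I A \<inter> space (PiM I (\<lambda>_. lborel)) = (\<Pi>\<^sub>E x\<in>I. (+) (w x) -` A x)"
      by (auto simp: space_PiM PiE_iff extensional_def add.commute)
    also have "emeasure (PiM I (\<lambda>_. lborel)) (\<Pi>\<^sub>E x\<in>I. (+) (w x) -` A x) = (\<Prod>x\<in>I. emeasure lborel ((+) (w x) -` A x))"
    proof (rule emeasure_PiM[OF assms])
      fix i assume "i \<in> I"
      then show "(+) (w i) -` A i \<in> sets lborel"
        using measurable_sets[of "(+) (w i)" borel borel "A i"] A by simp
    qed
    also have "\<dots> = (\<Prod>x\<in>I. emeasure lborel (A x))"
    proof (rule prod.cong[OF refl])
      fix x assume "x \<in> I"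
      then have "emeasure (distr lborel borel ((+) (w x))) (A x) = emeasure lborel ((+) (w x) -` A x)"
        using A by (subst emeasure_distr) auto
      then show "emeasure lborel ((+) (w x) -` A x) = emeasure lborel (A x)" by (simp add: lborel_distr_plus)
    qed
    finally show "emeasure (distr (PiM I (\<lambda>_. lborel)) (PiM I (\<lambda>_. lborel)) (\<lambda>\<phi>. \<lambda>x\<in>I. \<phi> x + w x)) (Pi\<^sub>E I A) = (\<Prod>x\<in>I. emeasure lborel (A x))" .
  qed simp
qed

section \<open>The lattice Gaussian density and its covariance\<close>

context torus
begin

abbreviation "Leb \<equiv> PiM S (\<lambda>_. lborel :: real measure)"

definition quad :: "(site \<Rightarrow> real) \<Rightarrow> real" where
  "quad \<phi> = \<epsilon>\<^sup>2 * (\<Sum>x\<in>S. \<phi> x * (- \<Delta> \<phi> x) + (\<phi> x)\<^sup>2)"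

definition gauss_weight :: "(site \<Rightarrow> real) \<Rightarrow> real" where
  "gauss_weight \<phi> = exp (- quad \<phi> / 2)"

definition gauss_Z :: real where "gauss_Z = (\<integral>\<phi>. gauss_weight \<phi> \<partial>Leb)"

lemma component_measurable [measurable]: "x \<in> S \<Longrightarrow> (\<lambda>\<phi>. \<phi> x) \<in> borel_measurable Leb"
  using measurable_component_singleton[of x S "\<lambda>_. lborel"] by simp

lemma laplacian_measurable [measurable]: "x \<in> S \<Longrightarrow> (\<lambda>\<phi>. \<Delta> \<phi> x) \<in> borel_measurable Leb"
  unfolding laplacian_def by (intro borel_measurable_divide borel_measurable_sum borel_measurable_diff component_measurable) auto

lemma quad_measurable [measurable]: "quad \<in> borel_measurable Leb"
  unfolding quad_def[abs_def] by measurable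

lemma gauss_weight_measurable [measurable]: "gauss_weight \<in> borel_measurable Leb"
  unfolding gauss_weight_def[abs_def] by measurable

lemma quad_lower: "\<epsilon>\<^sup>2 * (\<Sum>x\<in>S. (\<phi> x)\<^sup>2) \<le> quad \<phi>"
  using dirichlet_nonpos[of \<phi>] by (auto simp: quad_def sum.distrib sum_negf sum_subtractf intro!: mult_left_mono)

text \<open>As \<open>- \<Delta>\<close> is nonnegative, the mass term alone bounds the weight by a
  product of one-dimensional Gaussians of variance \<open>1 / \<epsilon>^2\<close>.\<close>

lemma gauss_weight_integrable: "integrable Leb gauss_weight"
proof -
  interpret product_sigma_finite "\<lambda>_ :: site. lborel :: real measure" by standard
  have 1: "integrable lborel (\<lambda>t::real. exp (- (\<epsilon>\<^sup>2 * t\<^sup>2) / 2))"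
  proof -
    have "integrable lborel (\<lambda>t. sqrt (2 * pi * (1 / \<epsilon>)\<^sup>2) * normal_density 0 (1 / \<epsilon>) t)"
      using eps by (intro integrable_mult_right integrable_normal_density) auto
    moreover have "sqrt (2 * pi * (1 / \<epsilon>)\<^sup>2) * normal_density 0 (1 / \<epsilon>) t = exp (- (\<epsilon>\<^sup>2 * t\<^sup>2) / 2)" for t
      using eps by (simp add: normal_density_def field_simps)
    ultimately show ?thesis by simp
  qed
  have "integrable Leb (\<lambda>\<phi>. \<Prod>x\<in>S. exp (- (\<epsilon>\<^sup>2 * (\<phi> x)\<^sup>2) / 2))"
    by (rule product_integrable_prod) (use 1 in simp_all)
  then show ?thesis
  proof (rule Bochner_Integration.integrable_bound)
    show "AE \<phi> in Leb. norm (gauss_weight \<phi>) \<le> norm (\<Prod>x\<in>S. exp (- (\<epsilon>\<^sup>2 * (\<phi> x)\<^sup>2) / 2))"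
    proof (rule AE_I2)
      fix \<phi>
      have "gauss_weight \<phi> \<le> exp (\<Sum>x\<in>S. - (\<epsilon>\<^sup>2 * (\<phi> x)\<^sup>2) / 2)"
        using quad_lower[of \<phi>] by (simp add: gauss_weight_def sum_negf sum_divide_distrib[symmetric] sum_distrib_left)
      also have "\<dots> = (\<Prod>x\<in>S. exp (- (\<epsilon>\<^sup>2 * (\<phi> x)\<^sup>2) / 2))" by (simp add: exp_sum)
      finally show "norm (gauss_weight \<phi>) \<le> norm (\<Prod>x\<in>S. exp (- (\<epsilon>\<^sup>2 * (\<phi> x)\<^sup>2) / 2))"
        by (simp add: gauss_weight_def prod_nonneg)
    qed
  qed simp
qed

lemma emeasure_Leb_space: "emeasure Leb (space Leb) \<noteq> 0"
proof -
  interpret product_sigma_finite "\<lambda>_ :: site. lborel :: real measure" by standard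
  have "emeasure Leb (Pi\<^sub>E S (\<lambda>_. UNIV)) = (\<Prod>x\<in>S. emeasure lborel (UNIV :: real set))"
    by (rule emeasure_PiM) auto
  then show ?thesis by (simp add: space_PiM)
qed

lemma integral_Leb_pos:
  assumes "integrable Leb f" "\<And>\<phi>. f \<phi> > 0"
  shows "(\<integral>\<phi>. f \<phi> \<partial>Leb) > (0 :: real)"
proof -
  have "(\<integral>\<phi>. f \<phi> \<partial>Leb) \<noteq> 0"
  proof
    assume "(\<integral>\<phi>. f \<phi> \<partial>Leb) = 0"
    then have "AE \<phi> in Leb. f \<phi> = 0"
      using assms by (subst (asm) integral_nonneg_eq_0_iff_AE) (auto intro: less_imp_le)
    then have "AE \<phi> in Leb. False" by eventually_elim (metis assms(2) less_irrefl)
    then show False using emeasure_Leb_space by (simp add: AE_iff_measurable[OF _ refl])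
  qed
  moreover have "(\<integral>\<phi>. f \<phi> \<partial>Leb) \<ge> 0" using assms by (intro Bochner_Integration.integral_nonneg) (auto intro: less_imp_le)
  ultimately show ?thesis by simp
qed

lemma gauss_Z_pos: "gauss_Z > 0"
  unfolding gauss_Z_def by (rule integral_Leb_pos[OF gauss_weight_integrable]) (simp add: gauss_weight_def)

definition gauss_density :: "(site \<Rightarrow> real) measure" where
  "gauss_density = density Leb (\<lambda>\<phi>. ennreal (gauss_weight \<phi> / gauss_Z))"

lemma sets_gauss_density [measurable_cong]: "sets gauss_density = sets (PiM S (\<lambda>_. borel))"
  by (simp add: gauss_density_def cong: sets_PiM_cong)

lemma prob_space_gauss_density: "prob_space gauss_density"
proof (rule prob_spaceI)
  have "emeasure gauss_density (space gauss_density) = (\<integral>\<^sup>+\<phi>. ennreal (gauss_weight \<phi> / gauss_Z) \<partial>Leb)"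
    unfolding gauss_density_def by (simp add: emeasure_density cong: nn_integral_cong)
  also have "\<dots> = ennreal (\<integral>\<phi>. gauss_weight \<phi> / gauss_Z \<partial>Leb)"
  proof (rule nn_integral_eq_integral)
    show "integrable Leb (\<lambda>\<phi>. gauss_weight \<phi> / gauss_Z)" by (rule integrable_divide[OF gauss_weight_integrable])
  qed (use gauss_Z_pos in \<open>simp add: gauss_weight_def\<close>)
  also have "\<dots> = 1" using gauss_Z_pos by (simp add: gauss_Z_def)
  finally show "emeasure gauss_density (space gauss_density) = 1" .
qed

lemma integral_gauss_density:
  fixes f :: "_ \<Rightarrow> 'b :: {banach, second_countable_topology}"
  assumes "f \<in> borel_measurable Leb"
  shows "(\<integral>\<phi>. f \<phi> \<partial>gauss_density) = (\<integral>\<phi>. (gauss_weight \<phi> / gauss_Z) *\<^sub>R f \<phi> \<partial>Leb)"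
  unfolding gauss_density_def using assms gauss_Z_pos
  by (intro integral_density) (auto simp: gauss_weight_def intro!: divide_nonneg_nonneg less_imp_le)

lemma quad_cong: "(\<And>x. x \<in> S \<Longrightarrow> \<phi> x = \<psi> x) \<Longrightarrow> quad \<phi> = quad \<psi>"
  by (simp add: quad_def cong: laplacian_cong)

context
  fixes k :: "site \<Rightarrow> real"
begin

text \<open>The solution \<open>w\<close> of \<open>\<epsilon>^2 * (w - \<Delta> w) = k\<close>,
  hence the translation that absorbs a tilt by the linear functional with coefficients
  \<open>k\<close>.\<close>

definition "cov_apply x = (\<Sum>y\<in>S. c_inf x y * k y)"
definition "cov_quad = (\<Sum>x\<in>S. \<Sum>y\<in>S. k x * k y * c_inf x y)"

lemma laplacian_cov_apply: "x \<in> S \<Longrightarrow> cov_apply x - \<Delta> cov_apply x = k x / \<epsilon>\<^sup>2"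
proof -
  assume x: "x \<in> S"
  have "cov_apply x - \<Delta> cov_apply x = (\<Sum>y\<in>S. (c_inf x y - \<Delta> (\<lambda>x. c_inf x y) x) * k y)"
    unfolding cov_apply_def[abs_def] laplacian_sum laplacian_mult by (simp add: sum_subtractf left_diff_distrib)
  also have "\<dots> = (\<Sum>y\<in>S. (if x = y then 1 / \<epsilon>\<^sup>2 else 0) * k y)"
    by (intro sum.cong refl) (simp add: laplacian_c_inf x)
  also have "\<dots> = k x / \<epsilon>\<^sup>2" using x by (simp add: if_distrib[of "\<lambda>c. c * _"] sum.delta' cong: if_cong)
  finally show ?thesis .
qed

lemma sum_k_cov_apply: "(\<Sum>x\<in>S. k x * cov_apply x) = cov_quad"
  by (simp add: cov_apply_def cov_quad_def sum_distrib_left mult_ac)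

text \<open>Completion of the square: self-adjointness doubles the cross term, and the equation for
  \<open>cov_apply\<close> turns it into the pairing of \<open>\<phi>\<close> with
  \<open>k\<close>.\<close>

lemma quad_translate:
  "quad (\<lambda>x. \<phi> x + \<tau> * cov_apply x) = quad \<phi> + 2 * \<tau> * (\<Sum>x\<in>S. k x * \<phi> x) + \<tau>\<^sup>2 * cov_quad"
proof -
  let ?w = cov_apply
  have L: "\<Delta> (\<lambda>x. \<phi> x + \<tau> * ?w x) x = \<Delta> \<phi> x + \<tau> * \<Delta> ?w x" for x
    by (simp add: laplacian_def sum.distrib[symmetric] sum_distrib_left add_divide_distrib[symmetric] algebra_simps)
  have "quad (\<lambda>x. \<phi> x + \<tau> * ?w x) = quad \<phi> + \<tau> * \<epsilon>\<^sup>2 * ((\<Sum>x\<in>S. \<phi> x * (?w x - \<Delta> ?w x)) + ((\<Sum>x\<in>S. ?w x * \<phi> x) - (\<Sum>x\<in>S. ?w x * \<Delta> \<phi> x)))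
      + \<tau>\<^sup>2 * \<epsilon>\<^sup>2 * (\<Sum>x\<in>S. ?w x * (?w x - \<Delta> ?w x))"
    unfolding quad_def L
    by (simp add: sum_distrib_left sum.distrib[symmetric] sum_subtractf[symmetric] power2_eq_square algebra_simps)
  also have "(\<Sum>x\<in>S. ?w x * \<Delta> \<phi> x) = (\<Sum>x\<in>S. \<Delta> ?w x * \<phi> x)" by (rule laplacian_selfadjoint)
  also have "(\<Sum>x\<in>S. ?w x * \<phi> x) - (\<Sum>x\<in>S. \<Delta> ?w x * \<phi> x) = (\<Sum>x\<in>S. \<phi> x * (?w x - \<Delta> ?w x))"
    by (simp add: sum_subtractf[symmetric] algebra_simps)
  finally show ?thesis
    using eps by (simp add: laplacian_cov_apply sum_k_cov_apply[symmetric] sum_distrib_left mult_ac)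
qed

lemma gauss_weight_tilt:
  "gauss_weight \<phi> * exp (\<tau> * (\<Sum>x\<in>S. k x * \<phi> x)) = exp (\<tau>\<^sup>2 * cov_quad / 2) * gauss_weight (\<lambda>x. \<phi> x + (- \<tau>) * cov_apply x)"
  unfolding gauss_weight_def quad_translate by (simp add: exp_add[symmetric] field_simps)

text \<open>Change of variables by the translation. The translated field has to be restricted to the
  sites to stay in the product space; \<open>quad_cong\<close> shows that the weight does not notice
  this.\<close>

lemma integral_Leb_tilt:
  fixes f :: "real \<Rightarrow> 'b :: {banach, second_countable_topology}"
  assumes [measurable]: "f \<in> borel_measurable borel"
  shows "(\<integral>\<phi>. gauss_weight (\<lambda>x. \<phi> x + (- \<tau>) * cov_apply x) *\<^sub>R f (\<Sum>x\<in>S. k x * \<phi> x) \<partial>Leb) = (\<integral>\<phi>. gauss_weight \<phi> *\<^sub>R f ((\<Sum>x\<in>S. k x * \<phi> x) + \<tau> * cov_quad) \<partial>Leb)"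
proof -
  let ?T = "\<lambda>\<phi>. \<lambda>x\<in>S. \<phi> x + (- \<tau>) * cov_apply x"
  have T: "?T \<in> Leb \<rightarrow>\<^sub>M Leb" by measurable
  have g: "gauss_weight (?T \<phi>) = gauss_weight (\<lambda>x. \<phi> x + (- \<tau>) * cov_apply x)" for \<phi>
    unfolding gauss_weight_def by (subst quad_cong[where \<psi>="\<lambda>x. \<phi> x + (- \<tau>) * cov_apply x"]) auto
  have s: "(\<Sum>x\<in>S. k x * ?T \<phi> x) + \<tau> * cov_quad = (\<Sum>x\<in>S. k x * \<phi> x)" for \<phi>
    by (simp add: sum_k_cov_apply[symmetric] algebra_simps sum.distrib sum_subtractf sum_distrib_left)
  have "(\<integral>\<phi>. gauss_weight \<phi> *\<^sub>R f ((\<Sum>x\<in>S. k x * \<phi> x) + \<tau> * cov_quad) \<partial>distr Leb Leb ?T)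
      = (\<integral>\<phi>. gauss_weight (?T \<phi>) *\<^sub>R f ((\<Sum>x\<in>S. k x * ?T \<phi> x) + \<tau> * cov_quad) \<partial>Leb)"
    by (rule integral_distr[OF T]) measurable
  then show ?thesis
    unfolding distr_PiM_lborel_translate[OF finite_S] g s by simp
qed

lemma gauss_weight_translate_integrable: "integrable Leb (\<lambda>\<phi>. gauss_weight (\<lambda>x. \<phi> x + (- \<tau>) * cov_apply x))"
proof -
  let ?T = "\<lambda>\<phi>. \<lambda>x\<in>S. \<phi> x + (- \<tau>) * cov_apply x"
  have T: "?T \<in> Leb \<rightarrow>\<^sub>M Leb" by measurable
  have g: "gauss_weight (?T \<phi>) = gauss_weight (\<lambda>x. \<phi> x + (- \<tau>) * cov_apply x)" for \<phi>
    unfolding gauss_weight_def by (subst quad_cong[where \<psi>="\<lambda>x. \<phi> x + (- \<tau>) * cov_apply x"]) auto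
  have "integrable (distr Leb Leb ?T) gauss_weight"
    unfolding distr_PiM_lborel_translate[OF finite_S] by (rule gauss_weight_integrable)
  then have "integrable Leb (\<lambda>\<phi>. gauss_weight (?T \<phi>))"
    by (subst (asm) integrable_distr_eq[OF T]) auto
  then show ?thesis unfolding g .
qed

text \<open>Tilting by the functional equals, up to a constant, translating the weight; translating
  back shifts the functional by \<open>\<tau> * cov_quad\<close>. This is the hypothesis of
  \<open>char_eq_normal_of_tilt\<close>, and the value of \<open>gauss_Z\<close> never has to be
  known.\<close>

lemma char_gauss_density: "(CLINT \<phi>|gauss_density. iexp (\<Sum>x\<in>S. k x * \<phi> x)) = of_real (exp (- cov_quad / 2))"
proof -
  interpret prob_space gauss_density by (rule prob_space_gauss_density)
  let ?X = "\<lambda>\<phi>. \<Sum>x\<in>S. k x * \<phi> x"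
  have XL: "?X \<in> borel_measurable Leb" by measurable
  have X: "?X \<in> borel_measurable gauss_density" using XL by (simp add: gauss_density_def)
  have "(CLINT \<phi>|gauss_density. iexp (1 * ?X \<phi>)) = of_real (exp (- (1\<^sup>2 * cov_quad) / 2))"
  proof (rule char_eq_normal_of_tilt[OF X])
    fix \<tau> :: real
    have "integrable Leb (\<lambda>\<phi>. exp (\<tau>\<^sup>2 * cov_quad / 2) * gauss_weight (\<lambda>x. \<phi> x + (- \<tau>) * cov_apply x) / gauss_Z)"
      by (intro integrable_divide integrable_mult_right gauss_weight_translate_integrable)
    then have "integrable Leb (\<lambda>\<phi>. (gauss_weight \<phi> / gauss_Z) *\<^sub>R exp (\<tau> * ?X \<phi>))"
      unfolding gauss_weight_tilt[symmetric] by simp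
    then show "integrable gauss_density (\<lambda>\<phi>. exp (\<tau> * ?X \<phi>))"
      unfolding gauss_density_def using gauss_Z_pos
      by (subst integrable_density) (auto simp: gauss_weight_def intro!: divide_nonneg_nonneg less_imp_le)
    fix s :: real
    have "(CLINT \<phi>|gauss_density. exp (\<tau> * ?X \<phi>) *\<^sub>R iexp (s * ?X \<phi>))
        = (CLINT \<phi>|Leb. (gauss_weight \<phi> / gauss_Z) *\<^sub>R (exp (\<tau> * ?X \<phi>) *\<^sub>R iexp (s * ?X \<phi>)))"
      by (rule integral_gauss_density) measurable
    also have "\<dots> = (CLINT \<phi>|Leb. (exp (\<tau>\<^sup>2 * cov_quad / 2) / gauss_Z) *\<^sub>R (gauss_weight (\<lambda>x. \<phi> x + (- \<tau>) * cov_apply x) *\<^sub>R iexp (s * ?X \<phi>)))"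
    proof (intro Bochner_Integration.integral_cong refl)
      fix \<phi>
      have "gauss_weight \<phi> / gauss_Z * exp (\<tau> * ?X \<phi>) = exp (\<tau>\<^sup>2 * cov_quad / 2) / gauss_Z * gauss_weight (\<lambda>x. \<phi> x + (- \<tau>) * cov_apply x)"
        using gauss_weight_tilt[of \<phi> \<tau>] by simp
      then show "(gauss_weight \<phi> / gauss_Z) *\<^sub>R (exp (\<tau> * ?X \<phi>) *\<^sub>R iexp (s * ?X \<phi>)) = (exp (\<tau>\<^sup>2 * cov_quad / 2) / gauss_Z) *\<^sub>R (gauss_weight (\<lambda>x. \<phi> x + (- \<tau>) * cov_apply x) *\<^sub>R iexp (s * ?X \<phi>))"
        by (simp only: scaleR_scaleR)
    qed
    also have "\<dots> = (exp (\<tau>\<^sup>2 * cov_quad / 2) / gauss_Z) *\<^sub>R (CLINT \<phi>|Leb. gauss_weight (\<lambda>x. \<phi> x + (- \<tau>) * cov_apply x) *\<^sub>R iexp (s * ?X \<phi>))"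
      by (rule integral_scaleR_right)
    also have "(CLINT \<phi>|Leb. gauss_weight (\<lambda>x. \<phi> x + (- \<tau>) * cov_apply x) *\<^sub>R iexp (s * ?X \<phi>)) = (CLINT \<phi>|Leb. gauss_weight \<phi> *\<^sub>R iexp (s * (?X \<phi> + \<tau> * cov_quad)))"
      by (rule integral_Leb_tilt) measurable
    also have "\<dots> = (CLINT \<phi>|Leb. gauss_Z *\<^sub>R (iexp (\<tau> * s * cov_quad) * ((gauss_weight \<phi> / gauss_Z) *\<^sub>R iexp (s * ?X \<phi>))))"
    proof (intro Bochner_Integration.integral_cong refl)
      fix \<phi>
      have "s * (?X \<phi> + \<tau> * cov_quad) = \<tau> * s * cov_quad + s * ?X \<phi>" by (simp add: algebra_simps)
      then have "iexp (s * (?X \<phi> + \<tau> * cov_quad)) = iexp (\<tau> * s * cov_quad) * iexp (s * ?X \<phi>)"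
        by (simp only: of_real_add distrib_left exp_add)
      then show "gauss_weight \<phi> *\<^sub>R iexp (s * (?X \<phi> + \<tau> * cov_quad)) = gauss_Z *\<^sub>R (iexp (\<tau> * s * cov_quad) * ((gauss_weight \<phi> / gauss_Z) *\<^sub>R iexp (s * ?X \<phi>)))"
        using gauss_Z_pos by (simp only: mult_scaleR_right scaleR_scaleR) simp
    qed
    also have "\<dots> = gauss_Z *\<^sub>R (iexp (\<tau> * s * cov_quad) * (CLINT \<phi>|Leb. (gauss_weight \<phi> / gauss_Z) *\<^sub>R iexp (s * ?X \<phi>)))"
      by (simp only: integral_scaleR_right Bochner_Integration.integral_mult_right_zero)
    also have "(CLINT \<phi>|Leb. (gauss_weight \<phi> / gauss_Z) *\<^sub>R iexp (s * ?X \<phi>)) = (CLINT \<phi>|gauss_density. iexp (s * ?X \<phi>))"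
      by (rule integral_gauss_density[symmetric]) measurable
    finally show "(CLINT \<phi>|gauss_density. exp (\<tau> * ?X \<phi>) *\<^sub>R iexp (s * ?X \<phi>))
        = exp (of_real (\<tau>\<^sup>2 * cov_quad / 2) + \<i> * of_real (\<tau> * s * cov_quad)) * (CLINT \<phi>|gauss_density. iexp (s * ?X \<phi>))"
      using gauss_Z_pos unfolding exp_add scaleR_scaleR exp_of_real
      by (simp add: scaleR_conv_of_real)
  qed
  then show ?thesis by simp
qed

end

end

section \<open>Functionals with Lipschitz gradient\<close>

definition l1 :: "'i set \<Rightarrow> ('i \<Rightarrow> real) \<Rightarrow> real" where
  "l1 S \<zeta> = (\<Sum>x\<in>S. \<bar>\<zeta> x\<bar>)"

lemma l1_nonneg [simp]: "0 \<le> l1 S \<zeta>"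
  by (simp add: l1_def sum_nonneg)

lemma abs_le_l1: "finite S \<Longrightarrow> x \<in> S \<Longrightarrow> \<bar>\<zeta> x\<bar> \<le> l1 S \<zeta>"
  unfolding l1_def by (rule member_le_sum[of x S "\<lambda>x. \<bar>\<zeta> x\<bar>"]) auto

lemma abs_sum_mult_le_l1:
  assumes "\<And>x. x \<in> S \<Longrightarrow> \<bar>a x\<bar> \<le> K" shows "\<bar>\<Sum>x\<in>S. a x * \<zeta> x\<bar> \<le> K * l1 S \<zeta>"
proof -
  have "\<bar>\<Sum>x\<in>S. a x * \<zeta> x\<bar> \<le> (\<Sum>x\<in>S. \<bar>a x * \<zeta> x\<bar>)" by (rule sum_abs)
  also have "\<dots> \<le> (\<Sum>x\<in>S. K * \<bar>\<zeta> x\<bar>)" using assms by (intro sum_mono) (auto simp: abs_mult intro: mult_right_mono)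
  finally show ?thesis by (simp add: l1_def sum_distrib_left)
qed

text \<open>Bounded Lipschitz functionals. The distance sees only the coordinates in
  \<open>S\<close>, so such a functional ignores all others; this allows passing freely between
  fields and their restrictions to \<open>S\<close>.\<close>

definition blip :: "'i set \<Rightarrow> real \<Rightarrow> (('i \<Rightarrow> real) \<Rightarrow> real) \<Rightarrow> bool" where
  "blip S K f \<longleftrightarrow> (\<forall>\<phi>. \<bar>f \<phi>\<bar> \<le> K) \<and> (\<forall>\<phi> \<psi>. \<bar>f \<psi> - f \<phi>\<bar> \<le> K * l1 S (\<lambda>x. \<psi> x - \<phi> x))"

lemma blipD:
  assumes "blip S K f"
  shows "\<bar>f \<phi>\<bar> \<le> K" "\<bar>f \<psi> - f \<phi>\<bar> \<le> K * l1 S (\<lambda>x. \<psi> x - \<phi> x)" "0 \<le> K"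
  using assms abs_ge_zero[of "f \<phi>"] unfolding blip_def by (blast intro: order_trans)+

lemma blip_mono: "blip S K f \<Longrightarrow> K \<le> L \<Longrightarrow> blip S L f"
  unfolding blip_def by (meson l1_nonneg mult_right_mono order_trans)

lemma blip_cong:
  assumes "blip S K f" "\<And>x. x \<in> S \<Longrightarrow> \<phi> x = \<psi> x" shows "f \<phi> = f \<psi>"
  using blipD(2)[OF assms(1), of \<psi> \<phi>] assms(2) by (simp add: l1_def)

lemma blip_continuous:
  fixes f :: "('i \<Rightarrow> real) \<Rightarrow> real"
  assumes f: "blip S K f"
  shows "continuous_on UNIV f"
  unfolding continuous_on_def
proof (rule ballI)
  fix \<phi> :: "'i \<Rightarrow> real"
  have c: "continuous_on UNIV (\<lambda>\<psi> :: 'i \<Rightarrow> real. l1 S (\<lambda>x. \<psi> x - \<phi> x))"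
    unfolding l1_def by (intro continuous_intros continuous_on_product_coordinates)
  then have "((\<lambda>\<psi>. l1 S (\<lambda>x. \<psi> x - \<phi> x)) \<longlongrightarrow> l1 S (\<lambda>x. \<phi> x - \<phi> x)) (at \<phi>)"
    unfolding continuous_on_def by blast
  then have l: "((\<lambda>\<psi>. K * l1 S (\<lambda>x. \<psi> x - \<phi> x)) \<longlongrightarrow> K * 0) (at \<phi>)"
    by (intro tendsto_mult tendsto_const) (simp add: l1_def)
  have "((\<lambda>\<psi>. f \<psi> - f \<phi>) \<longlongrightarrow> 0) (at \<phi>)"
  proof (rule Lim_null_comparison)
    show "\<forall>\<^sub>F \<psi> in at \<phi>. norm (f \<psi> - f \<phi>) \<le> K * l1 S (\<lambda>x. \<psi> x - \<phi> x)"
      using blipD(2)[OF f] by (intro always_eventually) simp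
  qed (use l in simp)
  then show "(f \<longlongrightarrow> f \<phi>) (at \<phi>)" by (rule LIM_zero_cancel)
qed

text \<open>The functional is defined on all functions rather than on the product over
  \<open>S\<close>. Setting the other coordinates to 0 lands in the full product, where continuity
  gives Borel measurability, and for a countable index type the Borel sets are those of the product
  sigma-algebra.\<close>

lemma blip_measurable:
  fixes f :: "('i :: countable \<Rightarrow> real) \<Rightarrow> real"
  assumes f: "blip S K f" and X: "\<And>x. x \<in> S \<Longrightarrow> (\<lambda>\<omega>. X \<omega> x) \<in> borel_measurable M"
  shows "(\<lambda>\<omega>. f (X \<omega>)) \<in> borel_measurable M"
proof -
  let ?r = "\<lambda>\<omega> x. if x \<in> S then X \<omega> x else 0"
  have "?r \<in> M \<rightarrow>\<^sub>M PiM UNIV (\<lambda>_. borel)"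
  proof (rule measurable_PiM_single')
    show "(\<lambda>\<omega>. if x \<in> S then X \<omega> x else 0) \<in> borel_measurable M" for x
      using X by (cases "x \<in> S") simp_all
  qed auto
  then have "?r \<in> M \<rightarrow>\<^sub>M borel"
    using measurable_cong_sets[OF refl sets_PiM_equal_borel] by blast
  moreover have "f \<in> borel_measurable borel"
    by (rule borel_measurable_continuous_onI[OF blip_continuous[OF f]])
  ultimately have "(\<lambda>\<omega>. f (?r \<omega>)) \<in> borel_measurable M" by (rule measurable_compose)
  moreover have "f (?r \<omega>) = f (X \<omega>)" for \<omega> by (rule blip_cong[OF f]) simp
  ultimately show ?thesis by simp
qed

text \<open>\<open>f'\<close> is the gradient. The quadratic Taylor remainder replaces a bound on
  second derivatives and, unlike it, passes directly through averages. A single constant for all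
  bounds keeps track of uniformity in time.\<close>

definition C11 :: "'i set \<Rightarrow> real \<Rightarrow> (('i \<Rightarrow> real) \<Rightarrow> real) \<Rightarrow> ('i \<Rightarrow> ('i \<Rightarrow> real) \<Rightarrow> real) \<Rightarrow> bool" where
  "C11 S K f f' \<longleftrightarrow> (\<forall>\<phi>. \<bar>f \<phi>\<bar> \<le> K) \<and> (\<forall>x\<in>S. blip S K (f' x)) \<and>
     (\<forall>\<phi> \<psi>. \<bar>f \<psi> - f \<phi> - (\<Sum>x\<in>S. f' x \<phi> * (\<psi> x - \<phi> x))\<bar> \<le> K * (l1 S (\<lambda>x. \<psi> x - \<phi> x))\<^sup>2)"

lemma C11D:
  assumes "C11 S K f f'"
  shows "\<bar>f \<phi>\<bar> \<le> K" "x \<in> S \<Longrightarrow> blip S K (f' x)"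
    "\<bar>f \<psi> - f \<phi> - (\<Sum>x\<in>S. f' x \<phi> * (\<psi> x - \<phi> x))\<bar> \<le> K * (l1 S (\<lambda>x. \<psi> x - \<phi> x))\<^sup>2" "0 \<le> K"
  using assms abs_ge_zero[of "f \<phi>"] unfolding C11_def by (blast intro: order_trans)+

lemma C11_gradient_le: "C11 S K f f' \<Longrightarrow> \<bar>\<Sum>x\<in>S. f' x \<phi> * \<zeta> x\<bar> \<le> K * l1 S \<zeta>"
  by (rule abs_sum_mult_le_l1) (metis C11D(2) blipD(1))

lemma C11_mono: "C11 S K f f' \<Longrightarrow> K \<le> L \<Longrightarrow> C11 S L f f'"
  unfolding C11_def by (meson blip_mono mult_right_mono order_trans zero_le_power2)

text \<open>The Taylor estimate serves for distances up to 1, boundedness of \<open>f\<close> for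
  larger ones; both give the factor 2.\<close>

lemma C11_blip: assumes "C11 S K f f'" shows "blip S (2 * K) f"
  unfolding blip_def
proof (intro conjI allI)
  fix \<phi> \<psi>
  let ?l = "l1 S (\<lambda>x. \<psi> x - \<phi> x)"
  show "\<bar>f \<phi>\<bar> \<le> 2 * K" using C11D(1)[OF assms, of \<phi>] C11D(4)[OF assms] by linarith
  show "\<bar>f \<psi> - f \<phi>\<bar> \<le> 2 * K * ?l"
  proof (cases "?l \<le> 1")
    case True
    then have "K * ?l\<^sup>2 \<le> K * ?l"
      by (intro mult_left_mono C11D(4)[OF assms]) (simp add: power2_eq_square mult_left_le)
    then show ?thesis
      using C11D(3)[OF assms, of \<psi> \<phi>] C11_gradient_le[OF assms, of \<phi> "\<lambda>x. \<psi> x - \<phi> x"] by linarith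
  next
    case False
    have "\<bar>f \<psi> - f \<phi>\<bar> \<le> 2 * K * 1" using C11D(1)[OF assms, of \<phi>] C11D(1)[OF assms, of \<psi>] by linarith
    also have "\<dots> \<le> 2 * K * ?l" using False C11D(4)[OF assms] by (intro mult_left_mono) auto
    finally show ?thesis .
  qed
qed

text \<open>The 6 arises twice: in the Taylor remainder as \<open>1 + 1 + 4\<close>, where 4 stems
  from the product of the two increments, and in the Lipschitz bound of the gradient as
  \<open>1 + 2 + 2 + 1\<close>.\<close>

lemma C11_mult:
  assumes f: "C11 S K f f'" and g: "C11 S L g g'"
  shows "C11 S (6 * (K * L)) (\<lambda>\<phi>. f \<phi> * g \<phi>) (\<lambda>x \<phi>. f' x \<phi> * g \<phi> + f \<phi> * g' x \<phi>)"
proof -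
  have K: "0 \<le> K" "0 \<le> L" "0 \<le> K * L" using C11D(4)[OF f] C11D(4)[OF g] by auto
  note fl = C11_blip[OF f] and gl = C11_blip[OF g]
  show ?thesis
    unfolding C11_def blip_def
  proof (intro conjI allI ballI)
    fix \<phi> \<psi>
    let ?l = "l1 S (\<lambda>x. \<psi> x - \<phi> x)"
    have fb: "\<bar>f \<phi>\<bar> \<le> K" "\<bar>f \<psi>\<bar> \<le> K" and gb: "\<bar>g \<phi>\<bar> \<le> L" "\<bar>g \<psi>\<bar> \<le> L"
      using C11D(1)[OF f] C11D(1)[OF g] by auto
    show "\<bar>f \<phi> * g \<phi>\<bar> \<le> 6 * (K * L)"
      using mult_mono[OF fb(1) gb(1)] K unfolding abs_mult by linarith
    have fd: "\<bar>f \<psi> - f \<phi>\<bar> \<le> 2 * K * ?l" and gd: "\<bar>g \<psi> - g \<phi>\<bar> \<le> 2 * L * ?l"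
      using blipD(2)[OF fl] blipD(2)[OF gl] by auto
    show "\<bar>f \<psi> * g \<psi> - f \<phi> * g \<phi> - (\<Sum>x\<in>S. (f' x \<phi> * g \<phi> + f \<phi> * g' x \<phi>) * (\<psi> x - \<phi> x))\<bar> \<le> 6 * (K * L) * ?l\<^sup>2"
    proof -
      define rf where "rf = f \<psi> - f \<phi> - (\<Sum>x\<in>S. f' x \<phi> * (\<psi> x - \<phi> x))"
      define rg where "rg = g \<psi> - g \<phi> - (\<Sum>x\<in>S. g' x \<phi> * (\<psi> x - \<phi> x))"
      have eq: "f \<psi> * g \<psi> - f \<phi> * g \<phi> - (\<Sum>x\<in>S. (f' x \<phi> * g \<phi> + f \<phi> * g' x \<phi>) * (\<psi> x - \<phi> x)) = rf * g \<phi> + f \<phi> * rg + (f \<psi> - f \<phi>) * (g \<psi> - g \<phi>)"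
        unfolding rf_def rg_def
        by (simp add: algebra_simps sum.distrib sum_distrib_left sum_subtractf)
      have "\<bar>f \<psi> * g \<psi> - f \<phi> * g \<phi> - (\<Sum>x\<in>S. (f' x \<phi> * g \<phi> + f \<phi> * g' x \<phi>) * (\<psi> x - \<phi> x))\<bar> \<le> \<bar>rf\<bar> * \<bar>g \<phi>\<bar> + \<bar>f \<phi>\<bar> * \<bar>rg\<bar> + \<bar>f \<psi> - f \<phi>\<bar> * \<bar>g \<psi> - g \<phi>\<bar>"
        unfolding eq abs_mult[symmetric] by linarith
      also have "\<dots> \<le> (K * ?l\<^sup>2) * L + K * (L * ?l\<^sup>2) + (2 * K * ?l) * (2 * L * ?l)"
        using C11D(3)[OF f, of \<psi> \<phi>] C11D(3)[OF g, of \<psi> \<phi>] K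
        by (intro add_mono mult_mono fb gb fd gd) (auto simp: rf_def rg_def)
      also have "\<dots> = 6 * (K * L) * ?l\<^sup>2" by (simp add: power2_eq_square algebra_simps)
      finally show ?thesis .
    qed
    fix x assume x: "x \<in> S"
    have f'b: "\<bar>f' x \<phi>\<bar> \<le> K" "\<bar>f' x \<psi>\<bar> \<le> K" and g'b: "\<bar>g' x \<phi>\<bar> \<le> L" "\<bar>g' x \<psi>\<bar> \<le> L"
      using blipD(1)[OF C11D(2)[OF f x]] blipD(1)[OF C11D(2)[OF g x]] by auto
    have f'd: "\<bar>f' x \<psi> - f' x \<phi>\<bar> \<le> K * ?l" and g'd: "\<bar>g' x \<psi> - g' x \<phi>\<bar> \<le> L * ?l"
      using blipD(2)[OF C11D(2)[OF f x]] blipD(2)[OF C11D(2)[OF g x]] by auto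
    have "\<bar>f' x \<phi> * g \<phi> + f \<phi> * g' x \<phi>\<bar> \<le> \<bar>f' x \<phi>\<bar> * \<bar>g \<phi>\<bar> + \<bar>f \<phi>\<bar> * \<bar>g' x \<phi>\<bar>"
      unfolding abs_mult[symmetric] by linarith
    also have "\<dots> \<le> K * L + K * L" using K by (intro add_mono mult_mono f'b fb gb g'b) auto
    finally show "\<bar>f' x \<phi> * g \<phi> + f \<phi> * g' x \<phi>\<bar> \<le> 6 * (K * L)" using K by linarith
    have eq: "f' x \<psi> * g \<psi> + f \<psi> * g' x \<psi> - (f' x \<phi> * g \<phi> + f \<phi> * g' x \<phi>) = (f' x \<psi> - f' x \<phi>) * g \<psi> + f' x \<phi> * (g \<psi> - g \<phi>) + (f \<psi> - f \<phi>) * g' x \<psi> + f \<phi> * (g' x \<psi> - g' x \<phi>)"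
      by (simp add: algebra_simps)
    have "\<bar>f' x \<psi> * g \<psi> + f \<psi> * g' x \<psi> - (f' x \<phi> * g \<phi> + f \<phi> * g' x \<phi>)\<bar> \<le> \<bar>f' x \<psi> - f' x \<phi>\<bar> * \<bar>g \<psi>\<bar> + \<bar>f' x \<phi>\<bar> * \<bar>g \<psi> - g \<phi>\<bar> + \<bar>f \<psi> - f \<phi>\<bar> * \<bar>g' x \<psi>\<bar> + \<bar>f \<phi>\<bar> * \<bar>g' x \<psi> - g' x \<phi>\<bar>"
      unfolding eq abs_mult[symmetric] by linarith
    also have "\<dots> \<le> (K * ?l) * L + K * (2 * L * ?l) + (2 * K * ?l) * L + K * (L * ?l)"
      using K by (intro add_mono mult_mono f'b fb gb g'b fd gd f'd g'd) auto
    also have "\<dots> = 6 * (K * L) * ?l" by (simp add: algebra_simps)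
    finally show "\<bar>f' x \<psi> * g \<psi> + f \<psi> * g' x \<psi> - (f' x \<phi> * g \<phi> + f \<phi> * g' x \<phi>)\<bar> \<le> 6 * (K * L) * ?l" .
  qed
qed

text \<open>Everything follows from the exact identity \<open>id\<close> for a difference of
  reciprocals. The three terms of the constant stem from the value, from the first-order part and
  from the square of the increment of \<open>g\<close>, each with its power of the lower bound
  \<open>\<kappa>\<close>.\<close>

lemma C11_inverse:
  assumes g: "C11 S K g g'" and \<kappa>: "\<kappa> > 0" "\<And>\<phi>. g \<phi> \<ge> \<kappa>"
  shows "C11 S (1 / \<kappa> + K / \<kappa>\<^sup>2 + 4 * K\<^sup>2 / \<kappa> ^ 3) (\<lambda>\<phi>. 1 / g \<phi>) (\<lambda>x \<phi>. - g' x \<phi> / (g \<phi>)\<^sup>2)"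
proof -
  have K: "0 \<le> K" using C11D(4)[OF g] .
  note gl = C11_blip[OF g]
  let ?K1 = "K / \<kappa>\<^sup>2" and ?K2 = "4 * K\<^sup>2 / \<kappa> ^ 3"
  have pos: "0 \<le> 1 / \<kappa>" "0 \<le> ?K1" "0 \<le> ?K2" using K \<kappa> by auto
  have gp: "g \<phi> > 0" for \<phi> using \<kappa>(1) \<kappa>(2)[of \<phi>] by linarith
  define i where "i \<phi> = 1 / g \<phi>" for \<phi>
  have i: "0 \<le> i \<phi>" "i \<phi> \<le> 1 / \<kappa>" for \<phi>
    using gp[of \<phi>] \<kappa> by (auto simp: i_def intro: divide_left_mono)
  have gi: "g \<phi> * i \<phi> = 1" for \<phi> using gp[of \<phi>] by (simp add: i_def)
  have id: "i \<psi> - i \<phi> = - ((g \<psi> - g \<phi>) * i \<psi> * i \<phi>)" for \<phi> \<psi>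
    using gp[of \<phi>] gp[of \<psi>] by (simp add: i_def field_simps)
  have i2: "i \<phi> * i \<psi> \<le> 1 / \<kappa>\<^sup>2" for \<phi> \<psi>
    using mult_mono[OF i(2)[of \<phi>] i(2)[of \<psi>]] i pos by (simp add: power2_eq_square)
  have G: "- g' x \<phi> / (g \<phi>)\<^sup>2 = - (g' x \<phi> * (i \<phi> * i \<phi>))" for x \<phi>
    by (simp add: i_def power2_eq_square)
  show ?thesis
    unfolding C11_def blip_def G i_def[symmetric]
  proof (intro conjI allI ballI)
    fix \<phi> \<psi>
    let ?l = "l1 S (\<lambda>x. \<psi> x - \<phi> x)"
    show "\<bar>i \<phi>\<bar> \<le> 1 / \<kappa> + ?K1 + ?K2" using i[of \<phi>] pos by linarith
    have gd: "\<bar>g \<psi> - g \<phi>\<bar> \<le> 2 * K * ?l" using blipD(2)[OF gl] by auto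
    show "\<bar>i \<psi> - i \<phi> - (\<Sum>x\<in>S. - (g' x \<phi> * (i \<phi> * i \<phi>)) * (\<psi> x - \<phi> x))\<bar> \<le> (1 / \<kappa> + ?K1 + ?K2) * ?l\<^sup>2"
    proof -
      define r where "r = g \<psi> - g \<phi> - (\<Sum>x\<in>S. g' x \<phi> * (\<psi> x - \<phi> x))"
      have "(\<Sum>x\<in>S. - (g' x \<phi> * (i \<phi> * i \<phi>)) * (\<psi> x - \<phi> x)) = - ((g \<psi> - g \<phi> - r) * (i \<phi> * i \<phi>))"
        by (simp add: r_def sum_negf sum_distrib_right sum_distrib_left mult_ac)
      \<comment> \<open>Inserting \<open>id\<close> into itself once produces the second-order
        expansion of the reciprocal with an explicit remainder.\<close>
      moreover have "i \<psi> - i \<phi> = - ((g \<psi> - g \<phi>) * (i \<phi> * i \<phi>)) + (g \<psi> - g \<phi>)\<^sup>2 * (i \<phi> * i \<phi>) * i \<psi>"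
      proof -
        have "i \<psi> * i \<phi> = i \<phi> * i \<phi> - (g \<psi> - g \<phi>) * i \<psi> * i \<phi> * i \<phi>"
          using arg_cong[OF id[of \<psi> \<phi>], of "\<lambda>t. t * i \<phi>"] by (simp add: algebra_simps)
        then have "(g \<psi> - g \<phi>) * (i \<psi> * i \<phi>) = (g \<psi> - g \<phi>) * (i \<phi> * i \<phi> - (g \<psi> - g \<phi>) * i \<psi> * i \<phi> * i \<phi>)" by simp
        with id[of \<psi> \<phi>] show ?thesis by (simp add: power2_eq_square algebra_simps)
      qed
      ultimately have "\<bar>i \<psi> - i \<phi> - (\<Sum>x\<in>S. - (g' x \<phi> * (i \<phi> * i \<phi>)) * (\<psi> x - \<phi> x))\<bar> = \<bar>- (r * (i \<phi> * i \<phi>)) + (g \<psi> - g \<phi>)\<^sup>2 * (i \<phi> * i \<phi>) * i \<psi>\<bar>"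
        by (simp add: algebra_simps)
      also have "\<dots> \<le> \<bar>r\<bar> * (i \<phi> * i \<phi>) + (g \<psi> - g \<phi>)\<^sup>2 * (i \<phi> * i \<phi>) * i \<psi>"
        using i[of \<phi>] i[of \<psi>] by (intro order_trans[OF abs_triangle_ineq]) (simp add: abs_mult)
      also have "\<dots> \<le> (K * ?l\<^sup>2) * (1 / \<kappa>\<^sup>2) + (2 * K * ?l)\<^sup>2 * (1 / \<kappa>\<^sup>2) * (1 / \<kappa>)"
      proof (intro add_mono mult_mono i i2)
        show "\<bar>r\<bar> \<le> K * ?l\<^sup>2" using C11D(3)[OF g, of \<psi> \<phi>] by (simp add: r_def)
        show "(g \<psi> - g \<phi>)\<^sup>2 \<le> (2 * K * ?l)\<^sup>2" using gd by (simp add: abs_le_square_iff[symmetric] K)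
      qed (use K i[of \<phi>] i[of \<psi>] \<kappa> in auto)
      also have "\<dots> = (?K1 + ?K2) * ?l\<^sup>2"
        by (simp add: power2_eq_square power3_eq_cube distrib_right) 
      also have "\<dots> \<le> (1 / \<kappa> + ?K1 + ?K2) * ?l\<^sup>2" using pos by (intro mult_right_mono) auto
      finally show ?thesis .
    qed
    fix x assume x: "x \<in> S"
    have g'b: "\<bar>g' x \<phi>\<bar> \<le> K" "\<bar>g' x \<psi>\<bar> \<le> K" using blipD(1)[OF C11D(2)[OF g x]] by auto
    have g'd: "\<bar>g' x \<psi> - g' x \<phi>\<bar> \<le> K * ?l" using blipD(2)[OF C11D(2)[OF g x]] by auto
    have "\<bar>- (g' x \<phi> * (i \<phi> * i \<phi>))\<bar> \<le> K * (1 / \<kappa>\<^sup>2)"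
      using i[of \<phi>] unfolding abs_minus_cancel abs_mult by (intro mult_mono g'b) (use i2[of \<phi> \<phi>] K in auto)
    then show "\<bar>- (g' x \<phi> * (i \<phi> * i \<phi>))\<bar> \<le> 1 / \<kappa> + ?K1 + ?K2" using pos by (simp only: mult_1_right times_divide_eq_right)
    have di: "\<bar>i \<psi> - i \<phi>\<bar> \<le> 2 * K * ?l * (1 / \<kappa>\<^sup>2)"
      unfolding id[of \<psi> \<phi>] abs_minus_cancel mult.assoc[of _ "i \<psi>"] abs_mult[of _ "i \<psi> * i \<phi>"]
      by (intro mult_mono gd) (use i i2[of \<psi> \<phi>] K in \<open>auto simp: abs_mult\<close>)
    have eq: "- (g' x \<psi> * (i \<psi> * i \<psi>)) - - (g' x \<phi> * (i \<phi> * i \<phi>)) = - ((g' x \<psi> - g' x \<phi>) * (i \<psi> * i \<psi>) + g' x \<phi> * (i \<psi> - i \<phi>) * (i \<psi> + i \<phi>))"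
      by (simp add: algebra_simps)
    have "\<bar>- (g' x \<psi> * (i \<psi> * i \<psi>)) - - (g' x \<phi> * (i \<phi> * i \<phi>))\<bar> \<le> \<bar>g' x \<psi> - g' x \<phi>\<bar> * (i \<psi> * i \<psi>) + \<bar>g' x \<phi>\<bar> * \<bar>i \<psi> - i \<phi>\<bar> * (i \<psi> + i \<phi>)"
      unfolding eq
      using i[of \<phi>] i[of \<psi>] unfolding abs_minus_cancel
      by (intro order_trans[OF abs_triangle_ineq]) (simp add: abs_mult)
    also have "\<dots> \<le> (K * ?l) * (1 / \<kappa>\<^sup>2) + K * (2 * K * ?l * (1 / \<kappa>\<^sup>2)) * (1 / \<kappa> + 1 / \<kappa>)"
      by (intro add_mono mult_mono g'b g'd di i i2) (use K i[of \<phi>] i[of \<psi>] \<kappa> in auto)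
    also have "\<dots> = (?K1 + ?K2) * ?l"
      by (simp add: power2_eq_square power3_eq_cube distrib_right)
    also have "\<dots> \<le> (1 / \<kappa> + ?K1 + ?K2) * ?l" using pos by (intro mult_right_mono) auto
    finally show "\<bar>- (g' x \<psi> * (i \<psi> * i \<psi>)) - - (g' x \<phi> * (i \<phi> * i \<phi>))\<bar> \<le> (1 / \<kappa> + ?K1 + ?K2) * ?l" .
  qed
qed

text \<open>The factor \<open>(1 + \<alpha>)^2\<close> dominates 1, \<open>\<alpha>\<close> and
  \<open>\<alpha>^2\<close>, the factors acquired by the value, the gradient and the second-order
  terms.\<close>

lemma C11_linear_compose:
  fixes g g' g'' :: "real \<Rightarrow> real"
  assumes d: "\<And>t. (g has_real_derivative g' t) (at t)" "\<And>t. (g' has_real_derivative g'' t) (at t)"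
    and b: "\<And>t. \<bar>g t\<bar> \<le> B" "\<And>t. \<bar>g' t\<bar> \<le> B" "\<And>t. \<bar>g'' t\<bar> \<le> B"
    and a: "\<And>x. x \<in> S \<Longrightarrow> \<bar>a x\<bar> \<le> \<alpha>" and \<alpha>: "\<alpha> \<ge> 0"
  shows "C11 S (B * (1 + \<alpha>)\<^sup>2) (\<lambda>\<phi>. g (c + (\<Sum>x\<in>S. a x * \<phi> x))) (\<lambda>x \<phi>. a x * g' (c + (\<Sum>x\<in>S. a x * \<phi> x)))"
proof -
  have B: "B \<ge> 0" using b(1)[of 0] by linarith
  let ?L = "\<lambda>\<phi>. c + (\<Sum>x\<in>S. a x * \<phi> x)"
  have le: "B \<le> B * (1 + \<alpha>)\<^sup>2" "\<alpha> * B \<le> B * (1 + \<alpha>)\<^sup>2" "B * \<alpha>\<^sup>2 \<le> B * (1 + \<alpha>)\<^sup>2"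
    using B \<alpha> by (auto simp: power2_eq_square algebra_simps intro!: add_nonneg_nonneg)
  have dL: "\<bar>?L \<psi> - ?L \<phi>\<bar> \<le> \<alpha> * l1 S (\<lambda>x. \<psi> x - \<phi> x)" for \<phi> \<psi>
    using abs_sum_mult_le_l1[of S a \<alpha> "\<lambda>x. \<psi> x - \<phi> x"] a by (simp add: right_diff_distrib sum_subtractf)
  have g'l: "\<bar>g' s - g' t\<bar> \<le> B * \<bar>s - t\<bar>" for s t
    using field_differentiable_bound[of UNIV g' g'' B s t] d(2) b(3) by simp
  have rem: "\<bar>g s - g t - g' t * (s - t)\<bar> \<le> B * (s - t)\<^sup>2" for s t
  proof (cases "s = t")
    case False
    obtain r where r: "\<bar>r - t\<bar> \<le> \<bar>s - t\<bar>" "g s - g t = g' r * (s - t)"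
    proof (cases "t < s")
      case True
      obtain r where "r > t" "r < s" "g s - g t = (s - t) * g' r" using MVT2[OF True, of g g'] d(1) by blast
      then show ?thesis using that[of r] by (simp add: mult.commute)
    next
      case False
      with \<open>s \<noteq> t\<close> have "s < t" by simp
      obtain r where "r > s" "r < t" "g t - g s = (t - s) * g' r" using MVT2[OF \<open>s < t\<close>, of g g'] d(1) by blast
      then show ?thesis using that[of r] by (simp add: algebra_simps)
    qed
    have "\<bar>g s - g t - g' t * (s - t)\<bar> = \<bar>g' r - g' t\<bar> * \<bar>s - t\<bar>"
      unfolding r(2) by (simp add: abs_mult[symmetric] left_diff_distrib)
    also have "\<dots> \<le> (B * \<bar>s - t\<bar>) * \<bar>s - t\<bar>"
      using g'l[of r t] r(1) B by (intro mult_right_mono) (auto intro: order_trans mult_left_mono)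
    finally show ?thesis by (simp add: power2_eq_square)
  qed simp
  show ?thesis
    unfolding C11_def blip_def
  proof (intro conjI allI ballI)
    fix \<phi> \<psi>
    let ?l = "l1 S (\<lambda>x. \<psi> x - \<phi> x)"
    show "\<bar>g (?L \<phi>)\<bar> \<le> B * (1 + \<alpha>)\<^sup>2" using b(1)[of "?L \<phi>"] le(1) by linarith
    have "(\<Sum>x\<in>S. a x * g' (?L \<phi>) * (\<psi> x - \<phi> x)) = g' (?L \<phi>) * (?L \<psi> - ?L \<phi>)"
      by (simp add: sum_distrib_left sum_subtractf[symmetric] algebra_simps)
    then have "\<bar>g (?L \<psi>) - g (?L \<phi>) - (\<Sum>x\<in>S. a x * g' (?L \<phi>) * (\<psi> x - \<phi> x))\<bar> \<le> B * (?L \<psi> - ?L \<phi>)\<^sup>2"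
      using rem[of "?L \<psi>" "?L \<phi>"] by simp
    also have "\<dots> \<le> B * (\<alpha> * ?l)\<^sup>2"
      using dL[of \<psi> \<phi>] \<alpha> by (intro mult_left_mono B) (simp add: abs_le_square_iff[symmetric])
    also have "\<dots> \<le> B * (1 + \<alpha>)\<^sup>2 * ?l\<^sup>2"
      using mult_right_mono[OF le(3), of "?l\<^sup>2"] by (simp add: power_mult_distrib mult.assoc)
    finally show "\<bar>g (?L \<psi>) - g (?L \<phi>) - (\<Sum>x\<in>S. a x * g' (?L \<phi>) * (\<psi> x - \<phi> x))\<bar> \<le> B * (1 + \<alpha>)\<^sup>2 * ?l\<^sup>2" .
    fix x assume x: "x \<in> S"
    have "\<bar>a x * g' (?L \<phi>)\<bar> \<le> \<alpha> * B" unfolding abs_mult using a[OF x] b(2) \<alpha> by (intro mult_mono) auto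
    then show "\<bar>a x * g' (?L \<phi>)\<bar> \<le> B * (1 + \<alpha>)\<^sup>2" using le(2) by linarith
    have "\<bar>a x * g' (?L \<psi>) - a x * g' (?L \<phi>)\<bar> = \<bar>a x\<bar> * \<bar>g' (?L \<psi>) - g' (?L \<phi>)\<bar>"
      by (simp add: abs_mult[symmetric] right_diff_distrib)
    also have "\<dots> \<le> \<alpha> * (B * (\<alpha> * ?l))"
      using a[OF x] \<alpha> g'l[of "?L \<psi>" "?L \<phi>"] mult_left_mono[OF dL[of \<psi> \<phi>] B]
      by (intro mult_mono) (auto intro: order_trans)
    also have "\<dots> \<le> B * (1 + \<alpha>)\<^sup>2 * ?l"
      using mult_right_mono[OF le(3), of "?l"] by (simp add: power2_eq_square mult_ac)
    finally show "\<bar>a x * g' (?L \<psi>) - a x * g' (?L \<phi>)\<bar> \<le> B * (1 + \<alpha>)\<^sup>2 * ?l" .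
  qed
qed

text \<open>A change of one coordinate by \<open>h\<close> has distance
  \<open>\<bar>h\<bar>\<close>, so the Taylor remainder leaves an error
  \<open>K * \<bar>h\<bar>\<close> in the difference quotient. This links \<open>f'\<close> to the
  partial derivatives occurring in the drift.\<close>

lemma C11_has_partial_derivative:
  assumes f: "C11 S K f f'" and y: "y \<in> S" "finite S"
  shows "((\<lambda>s. f (\<phi>(y := s))) has_real_derivative f' y \<phi>) (at (\<phi> y))"
  unfolding DERIV_def
proof (rule LIM_zero_cancel, rule Lim_null_comparison)
  show "\<forall>\<^sub>F h in at 0. norm ((f (\<phi>(y := \<phi> y + h)) - f (\<phi>(y := \<phi> y))) / h - f' y \<phi>) \<le> K * \<bar>h\<bar>"
    unfolding eventually_at
  proof (intro exI[of _ 1] conjI ballI impI)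
    fix h :: real assume "h \<noteq> 0 \<and> dist h 0 < 1"
    then have h: "h \<noteq> 0" by simp
    have s: "(\<Sum>x\<in>S. f' x \<phi> * ((\<phi>(y := \<phi> y + h)) x - \<phi> x)) = f' y \<phi> * h"
      using y by (simp add: if_distrib[of "\<lambda>t. _ * t"] if_distrib[of "\<lambda>t. t - _"] fun_upd_def sum.delta' cong: if_cong)
    have l: "l1 S (\<lambda>x. (\<phi>(y := \<phi> y + h)) x - \<phi> x) = \<bar>h\<bar>"
      using y by (simp add: l1_def fun_upd_def if_distrib[of abs] if_distrib[of "\<lambda>t. t - _"] sum.delta' cong: if_cong)
    have "\<bar>f (\<phi>(y := \<phi> y + h)) - f \<phi> - f' y \<phi> * h\<bar> \<le> K * \<bar>h\<bar>\<^sup>2"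
      using C11D(3)[OF f, of "\<phi>(y := \<phi> y + h)" \<phi>] unfolding s l .
    then have "\<bar>f (\<phi>(y := \<phi> y + h)) - f \<phi> - f' y \<phi> * h\<bar> / \<bar>h\<bar> \<le> K * \<bar>h\<bar>"
      using h by (simp add: divide_le_eq power2_eq_square mult.assoc)
    moreover have "(f (\<phi>(y := \<phi> y + h)) - f (\<phi>(y := \<phi> y))) / h - f' y \<phi> = (f (\<phi>(y := \<phi> y + h)) - f \<phi> - f' y \<phi> * h) / h"
      using h by (simp add: field_simps)
    ultimately show "norm ((f (\<phi>(y := \<phi> y + h)) - f (\<phi>(y := \<phi> y))) / h - f' y \<phi>) \<le> K * \<bar>h\<bar>" by simp
  qed simp
  show "((\<lambda>h. K * \<bar>h\<bar>) \<longlongrightarrow> 0) (at 0)" by (auto intro!: tendsto_eq_intros)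
qed

section \<open>Averages over random shifts\<close>

definition shift_avg :: "('i \<Rightarrow> real) measure \<Rightarrow> (('i \<Rightarrow> real) \<Rightarrow> real) \<Rightarrow> ('i \<Rightarrow> real) \<Rightarrow> real" where
  "shift_avg \<mu> f \<phi> = (\<integral>\<zeta>. f (\<lambda>x. \<phi> x + \<zeta> x) \<partial>\<mu>)"

locale prob_PiM = prob_space \<mu> for \<mu> :: "('i :: countable \<Rightarrow> real) measure" +
  fixes S :: "'i set"
  assumes finite_index: "finite S" and sets_mu [measurable_cong]: "sets \<mu> = sets (PiM S (\<lambda>_. borel))"
begin

lemma comp_measurable [measurable]: "x \<in> S \<Longrightarrow> (\<lambda>\<zeta>. \<zeta> x) \<in> borel_measurable \<mu>"
  by (rule measurable_component_borel[OF sets_mu])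

lemma l1_measurable [measurable]: "l1 S \<in> borel_measurable \<mu>"
  unfolding l1_def[abs_def] by measurable

lemma shifted_measurable: "blip S K f \<Longrightarrow> (\<lambda>\<zeta>. f (\<lambda>x. \<phi> x + \<zeta> x)) \<in> borel_measurable \<mu>"
  by (rule blip_measurable, assumption) (intro borel_measurable_add borel_measurable_const comp_measurable)

lemma shifted_integrable: "blip S K f \<Longrightarrow> integrable \<mu> (\<lambda>\<zeta>. f (\<lambda>x. \<phi> x + \<zeta> x))"
  by (rule integrable_const_bound[where B=K]) (simp_all add: blipD(1) shifted_measurable)

lemma blip_shift_avg:
  assumes f: "blip S K f" shows "blip S K (shift_avg \<mu> f)"
  unfolding blip_def shift_avg_def
proof (intro conjI allI)
  fix \<phi> \<psi>
  have "\<bar>\<integral>\<zeta>. f (\<lambda>x. \<phi> x + \<zeta> x) \<partial>\<mu>\<bar> \<le> (\<integral>\<zeta>. \<bar>f (\<lambda>x. \<phi> x + \<zeta> x)\<bar> \<partial>\<mu>)" by (rule integral_abs_bound)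
  also have "\<dots> \<le> (\<integral>\<zeta>. K \<partial>\<mu>)" using shifted_integrable[OF f] blipD(1)[OF f] by (intro integral_mono) auto
  finally show "\<bar>\<integral>\<zeta>. f (\<lambda>x. \<phi> x + \<zeta> x) \<partial>\<mu>\<bar> \<le> K" by (simp add: prob_space)
  have "\<bar>(\<integral>\<zeta>. f (\<lambda>x. \<psi> x + \<zeta> x) \<partial>\<mu>) - (\<integral>\<zeta>. f (\<lambda>x. \<phi> x + \<zeta> x) \<partial>\<mu>)\<bar> = \<bar>\<integral>\<zeta>. f (\<lambda>x. \<psi> x + \<zeta> x) - f (\<lambda>x. \<phi> x + \<zeta> x) \<partial>\<mu>\<bar>"
    using shifted_integrable[OF f] by simp
  also have "\<dots> \<le> (\<integral>\<zeta>. \<bar>f (\<lambda>x. \<psi> x + \<zeta> x) - f (\<lambda>x. \<phi> x + \<zeta> x)\<bar> \<partial>\<mu>)" by (rule integral_abs_bound)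
  also have "\<dots> \<le> (\<integral>\<zeta>. K * l1 S (\<lambda>x. \<psi> x - \<phi> x) \<partial>\<mu>)"
  proof (rule integral_mono)
    show "integrable \<mu> (\<lambda>\<zeta>. \<bar>f (\<lambda>x. \<psi> x + \<zeta> x) - f (\<lambda>x. \<phi> x + \<zeta> x)\<bar>)" using shifted_integrable[OF f] by auto
    fix \<zeta> show "\<bar>f (\<lambda>x. \<psi> x + \<zeta> x) - f (\<lambda>x. \<phi> x + \<zeta> x)\<bar> \<le> K * l1 S (\<lambda>x. \<psi> x - \<phi> x)"
      using blipD(2)[OF f, of "\<lambda>x. \<psi> x + \<zeta> x" "\<lambda>x. \<phi> x + \<zeta> x"] by simp
  qed simp
  finally show "\<bar>(\<integral>\<zeta>. f (\<lambda>x. \<psi> x + \<zeta> x) \<partial>\<mu>) - (\<integral>\<zeta>. f (\<lambda>x. \<phi> x + \<zeta> x) \<partial>\<mu>)\<bar> \<le> K * l1 S (\<lambda>x. \<psi> x - \<phi> x)"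
    by (simp add: prob_space)
qed

lemma shift_avg_bound:
  assumes f: "blip S K f" and b: "\<And>\<phi>. \<bar>f \<phi>\<bar> \<le> B" shows "\<bar>shift_avg \<mu> f \<phi>\<bar> \<le> B"
proof -
  have "\<bar>\<integral>\<zeta>. f (\<lambda>x. \<phi> x + \<zeta> x) \<partial>\<mu>\<bar> \<le> (\<integral>\<zeta>. \<bar>f (\<lambda>x. \<phi> x + \<zeta> x)\<bar> \<partial>\<mu>)" by (rule integral_abs_bound)
  also have "\<dots> \<le> (\<integral>\<zeta>. B \<partial>\<mu>)" using shifted_integrable[OF f] b by (intro integral_mono) auto
  finally show ?thesis by (simp add: prob_space shift_avg_def)
qed

lemma shift_avg_ge:
  assumes f: "blip S K f" and b: "\<And>\<phi>. \<kappa> \<le> f \<phi>" shows "\<kappa> \<le> shift_avg \<mu> f \<phi>"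
proof -
  have "(\<integral>\<zeta>. \<kappa> \<partial>\<mu>) \<le> (\<integral>\<zeta>. f (\<lambda>x. \<phi> x + \<zeta> x) \<partial>\<mu>)"
    using shifted_integrable[OF f] b by (intro integral_mono) auto
  then show ?thesis by (simp add: prob_space shift_avg_def)
qed

text \<open>Every inequality in \<open>C11\<close> holds for all translates of \<open>f\<close> with
  the same \<open>K\<close> and is linear in \<open>f\<close> and \<open>f'\<close>, so it survives
  averaging without loss. This is what makes the later constants independent of time.\<close>

lemma C11_shift_avg:
  assumes f: "C11 S K f f'" shows "C11 S K (shift_avg \<mu> f) (\<lambda>x. shift_avg \<mu> (f' x))"
  unfolding C11_def
proof (intro conjI allI ballI)
  note fb = C11_blip[OF f]
  fix \<phi> \<psi>
  show "\<bar>shift_avg \<mu> f \<phi>\<bar> \<le> K" by (rule shift_avg_bound[OF fb C11D(1)[OF f]])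
  let ?l = "l1 S (\<lambda>x. \<psi> x - \<phi> x)"
  let ?r = "\<lambda>\<zeta>. f (\<lambda>x. \<psi> x + \<zeta> x) - f (\<lambda>x. \<phi> x + \<zeta> x) - (\<Sum>x\<in>S. f' x (\<lambda>x. \<phi> x + \<zeta> x) * (\<psi> x - \<phi> x))"
  have gi: "integrable \<mu> (\<lambda>\<zeta>. f' x (\<lambda>x. \<phi> x + \<zeta> x) * (\<psi> x - \<phi> x))" if "x \<in> S" for x
    using shifted_integrable[OF C11D(2)[OF f that]] by simp
  have si: "integrable \<mu> (\<lambda>\<zeta>. \<Sum>x\<in>S. f' x (\<lambda>x. \<phi> x + \<zeta> x) * (\<psi> x - \<phi> x))"
    using gi by auto
  have eq: "shift_avg \<mu> f \<psi> - shift_avg \<mu> f \<phi> - (\<Sum>x\<in>S. shift_avg \<mu> (f' x) \<phi> * (\<psi> x - \<phi> x)) = (\<integral>\<zeta>. ?r \<zeta> \<partial>\<mu>)"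
    unfolding shift_avg_def using shifted_integrable[OF fb] gi si by (simp add: Bochner_Integration.integral_sum)
  have "\<bar>shift_avg \<mu> f \<psi> - shift_avg \<mu> f \<phi> - (\<Sum>x\<in>S. shift_avg \<mu> (f' x) \<phi> * (\<psi> x - \<phi> x))\<bar> \<le> (\<integral>\<zeta>. \<bar>?r \<zeta>\<bar> \<partial>\<mu>)"
    unfolding eq by (rule integral_abs_bound)
  also have "\<dots> \<le> (\<integral>\<zeta>. K * ?l\<^sup>2 \<partial>\<mu>)"
  proof (rule integral_mono)
    show "integrable \<mu> (\<lambda>\<zeta>. \<bar>?r \<zeta>\<bar>)" using shifted_integrable[OF fb] si by auto
    fix \<zeta> show "\<bar>?r \<zeta>\<bar> \<le> K * ?l\<^sup>2"
      using C11D(3)[OF f, of "\<lambda>x. \<psi> x + \<zeta> x" "\<lambda>x. \<phi> x + \<zeta> x"] by simp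
  qed simp
  finally show "\<bar>shift_avg \<mu> f \<psi> - shift_avg \<mu> f \<phi> - (\<Sum>x\<in>S. shift_avg \<mu> (f' x) \<phi> * (\<psi> x - \<phi> x))\<bar> \<le> K * ?l\<^sup>2"
    by (simp add: prob_space)
qed (use C11D(2)[OF f] in \<open>blast intro: blip_shift_avg\<close>)

lemma shift_avg_diff_le:
  assumes f: "blip S K f" and i: "integrable \<mu> (l1 S)"
  shows "\<bar>shift_avg \<mu> f \<phi> - f \<phi>\<bar> \<le> K * (\<integral>\<zeta>. l1 S \<zeta> \<partial>\<mu>)"
proof -
  have "\<bar>shift_avg \<mu> f \<phi> - f \<phi>\<bar> = \<bar>\<integral>\<zeta>. f (\<lambda>x. \<phi> x + \<zeta> x) - f \<phi> \<partial>\<mu>\<bar>"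
    unfolding shift_avg_def using shifted_integrable[OF f] by (simp add: prob_space)
  also have "\<dots> \<le> (\<integral>\<zeta>. \<bar>f (\<lambda>x. \<phi> x + \<zeta> x) - f \<phi>\<bar> \<partial>\<mu>)" by (rule integral_abs_bound)
  also have "\<dots> \<le> (\<integral>\<zeta>. K * l1 S \<zeta> \<partial>\<mu>)"
  proof (rule integral_mono)
    show "integrable \<mu> (\<lambda>\<zeta>. \<bar>f (\<lambda>x. \<phi> x + \<zeta> x) - f \<phi>\<bar>)" using shifted_integrable[OF f] by auto
    show "integrable \<mu> (\<lambda>\<zeta>. K * l1 S \<zeta>)" using i by simp
    fix \<zeta> show "\<bar>f (\<lambda>x. \<phi> x + \<zeta> x) - f \<phi>\<bar> \<le> K * l1 S \<zeta>"
      using blipD(2)[OF f, of "\<lambda>x. \<phi> x + \<zeta> x" \<phi>] by simp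
  qed
  finally show ?thesis by simp
qed

text \<open>This estimate takes the place of the second-order term in the formula of Ito.\<close>

lemma covariance_linearisation:
  assumes g: "is_centred_gaussian S c \<mu>"
    and F: "C11 S K F F'" and U: "C11 S K U U'"
    and i: "integrable \<mu> (\<lambda>\<zeta>. (l1 S \<zeta>)\<^sup>2)" "integrable \<mu> (\<lambda>\<zeta>. l1 S \<zeta> ^ 3)" "integrable \<mu> (\<lambda>\<zeta>. l1 S \<zeta> ^ 4)"
  shows "\<bar>shift_avg \<mu> (\<lambda>\<phi>. F \<phi> * U \<phi>) \<phi> - shift_avg \<mu> F \<phi> * shift_avg \<mu> U \<phi> - (\<Sum>x\<in>S. \<Sum>y\<in>S. F' x \<phi> * U' y \<phi> * c x y)\<bar>
    \<le> K\<^sup>2 * (2 * (\<integral>\<zeta>. l1 S \<zeta> ^ 3 \<partial>\<mu>) + (\<integral>\<zeta>. l1 S \<zeta> ^ 4 \<partial>\<mu>) + (\<integral>\<zeta>. (l1 S \<zeta>)\<^sup>2 \<partial>\<mu>)\<^sup>2)"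
proof -
  define X where "X \<zeta> = F (\<lambda>x. \<phi> x + \<zeta> x) - F \<phi>" for \<zeta>
  define Y where "Y \<zeta> = U (\<lambda>x. \<phi> x + \<zeta> x) - U \<phi>" for \<zeta>
  define A where "A \<zeta> = (\<Sum>x\<in>S. F' x \<phi> * \<zeta> x)" for \<zeta>
  define B where "B \<zeta> = (\<Sum>x\<in>S. U' x \<phi> * \<zeta> x)" for \<zeta>
  have K: "0 \<le> K" using C11D(4)[OF F] .
  note Fb = C11_blip[OF F] and Ub = C11_blip[OF U]
  have Fi: "integrable \<mu> (\<lambda>\<zeta>. F (\<lambda>x. \<phi> x + \<zeta> x))" "integrable \<mu> (\<lambda>\<zeta>. U (\<lambda>x. \<phi> x + \<zeta> x))"
    using shifted_integrable[OF Fb] shifted_integrable[OF Ub] by auto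
  have Xi: "integrable \<mu> X" "integrable \<mu> Y" unfolding X_def Y_def using Fi by auto
  have [measurable]: "X \<in> borel_measurable \<mu>" "Y \<in> borel_measurable \<mu>" using Xi by auto
  have XYi: "integrable \<mu> (\<lambda>\<zeta>. X \<zeta> * Y \<zeta>)"
  proof (rule integrable_const_bound[where B="(2 * K) * (2 * K)"])
    have "\<bar>X \<zeta>\<bar> \<le> 2 * K" "\<bar>Y \<zeta>\<bar> \<le> 2 * K" for \<zeta>
      using C11D(1)[OF F, of "\<lambda>x. \<phi> x + \<zeta> x"] C11D(1)[OF F, of \<phi>] C11D(1)[OF U, of "\<lambda>x. \<phi> x + \<zeta> x"] C11D(1)[OF U, of \<phi>]
      unfolding X_def Y_def by linarith+
    then show "AE \<zeta> in \<mu>. norm (X \<zeta> * Y \<zeta>) \<le> (2 * K) * (2 * K)"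
      using K by (intro AE_I2) (simp only: real_norm_def abs_mult, intro mult_mono, auto)
  qed measurable
  have A0: "has_bochner_integral \<mu> A 0" "has_bochner_integral \<mu> B 0"
    using has_bochner_integral_sum[of S \<mu> "\<lambda>x \<zeta>. F' x \<phi> * \<zeta> x" "\<lambda>_. 0"] has_bochner_integral_sum[of S \<mu> "\<lambda>x \<zeta>. U' x \<phi> * \<zeta> x" "\<lambda>_. 0"]
      has_bochner_integral_mult_right[OF centred_gaussian_moments(1)[OF finite_index g]]
    unfolding A_def B_def by force+
  have AB: "has_bochner_integral \<mu> (\<lambda>\<zeta>. A \<zeta> * B \<zeta>) (\<Sum>x\<in>S. \<Sum>y\<in>S. F' x \<phi> * U' y \<phi> * c x y)"
  proof -
    have "has_bochner_integral \<mu> (\<lambda>\<zeta>. \<Sum>x\<in>S. \<Sum>y\<in>S. F' x \<phi> * U' y \<phi> * (\<zeta> x * \<zeta> y)) (\<Sum>x\<in>S. \<Sum>y\<in>S. F' x \<phi> * U' y \<phi> * c x y)"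
      by (intro has_bochner_integral_sum has_bochner_integral_mult_right centred_gaussian_moments(3)[OF finite_index g])
    moreover have "A \<zeta> * B \<zeta> = (\<Sum>x\<in>S. \<Sum>y\<in>S. F' x \<phi> * U' y \<phi> * (\<zeta> x * \<zeta> y))" for \<zeta>
      unfolding A_def B_def sum_product by (simp add: mult_ac)
    ultimately show ?thesis by simp
  qed
  have FU: "F (\<lambda>x. \<phi> x + \<zeta> x) * U (\<lambda>x. \<phi> x + \<zeta> x) = X \<zeta> * Y \<zeta> + F \<phi> * Y \<zeta> + X \<zeta> * U \<phi> + F \<phi> * U \<phi>" for \<zeta>
    by (simp add: X_def Y_def algebra_simps)
  have avgs: "shift_avg \<mu> F \<phi> = F \<phi> + (\<integral>\<zeta>. X \<zeta> \<partial>\<mu>)" "shift_avg \<mu> U \<phi> = U \<phi> + (\<integral>\<zeta>. Y \<zeta> \<partial>\<mu>)"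
    unfolding shift_avg_def X_def Y_def using Fi by (simp_all add: prob_space)
  have "shift_avg \<mu> (\<lambda>\<phi>. F \<phi> * U \<phi>) \<phi> = (\<integral>\<zeta>. X \<zeta> * Y \<zeta> \<partial>\<mu>) + F \<phi> * (\<integral>\<zeta>. Y \<zeta> \<partial>\<mu>) + (\<integral>\<zeta>. X \<zeta> \<partial>\<mu>) * U \<phi> + F \<phi> * U \<phi>"
    unfolding shift_avg_def FU using XYi Xi by (simp add: prob_space)
  \<comment> \<open>The covariance of \<open>F\<close> and \<open>U\<close> is that of their
    increments \<open>X\<close> and \<open>Y\<close>. As the linear parts \<open>A\<close> and
    \<open>B\<close> are centred, the means of \<open>X\<close> and \<open>Y\<close> are those of
    the remainders, which are of second order.\<close>
  then have eq: "shift_avg \<mu> (\<lambda>\<phi>. F \<phi> * U \<phi>) \<phi> - shift_avg \<mu> F \<phi> * shift_avg \<mu> U \<phi> - (\<Sum>x\<in>S. \<Sum>y\<in>S. F' x \<phi> * U' y \<phi> * c x y)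
      = (\<integral>\<zeta>. X \<zeta> * Y \<zeta> - A \<zeta> * B \<zeta> \<partial>\<mu>) - (\<integral>\<zeta>. X \<zeta> - A \<zeta> \<partial>\<mu>) * (\<integral>\<zeta>. Y \<zeta> - B \<zeta> \<partial>\<mu>)"
    using XYi Xi AB A0 unfolding avgs has_bochner_integral_iff by (simp add: algebra_simps)
  have r: "\<bar>X \<zeta> - A \<zeta>\<bar> \<le> K * (l1 S \<zeta>)\<^sup>2" "\<bar>Y \<zeta> - B \<zeta>\<bar> \<le> K * (l1 S \<zeta>)\<^sup>2" for \<zeta>
    using C11D(3)[OF F, of "\<lambda>x. \<phi> x + \<zeta> x" \<phi>] C11D(3)[OF U, of "\<lambda>x. \<phi> x + \<zeta> x" \<phi>]
    by (simp_all add: X_def Y_def A_def B_def)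
  have lin: "\<bar>A \<zeta>\<bar> \<le> K * l1 S \<zeta>" "\<bar>B \<zeta>\<bar> \<le> K * l1 S \<zeta>" for \<zeta>
    unfolding A_def B_def using C11_gradient_le[OF F] C11_gradient_le[OF U] by auto
  have e1: "\<bar>\<integral>\<zeta>. X \<zeta> * Y \<zeta> - A \<zeta> * B \<zeta> \<partial>\<mu>\<bar> \<le> K\<^sup>2 * (2 * (\<integral>\<zeta>. l1 S \<zeta> ^ 3 \<partial>\<mu>) + (\<integral>\<zeta>. l1 S \<zeta> ^ 4 \<partial>\<mu>))"
  proof -
    have "\<bar>\<integral>\<zeta>. X \<zeta> * Y \<zeta> - A \<zeta> * B \<zeta> \<partial>\<mu>\<bar> \<le> (\<integral>\<zeta>. \<bar>X \<zeta> * Y \<zeta> - A \<zeta> * B \<zeta>\<bar> \<partial>\<mu>)" by (rule integral_abs_bound)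
    also have "\<dots> \<le> (\<integral>\<zeta>. K\<^sup>2 * (2 * l1 S \<zeta> ^ 3 + l1 S \<zeta> ^ 4) \<partial>\<mu>)"
    proof (rule integral_mono)
      show "integrable \<mu> (\<lambda>\<zeta>. \<bar>X \<zeta> * Y \<zeta> - A \<zeta> * B \<zeta>\<bar>)" using XYi AB by (auto simp: has_bochner_integral_iff)
      show "integrable \<mu> (\<lambda>\<zeta>. K\<^sup>2 * (2 * l1 S \<zeta> ^ 3 + l1 S \<zeta> ^ 4))" using i by auto
      fix \<zeta>
      let ?l = "l1 S \<zeta>"
      have "X \<zeta> * Y \<zeta> - A \<zeta> * B \<zeta> = A \<zeta> * (Y \<zeta> - B \<zeta>) + (X \<zeta> - A \<zeta>) * B \<zeta> + (X \<zeta> - A \<zeta>) * (Y \<zeta> - B \<zeta>)"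
        by (simp add: algebra_simps)
      then have "\<bar>X \<zeta> * Y \<zeta> - A \<zeta> * B \<zeta>\<bar> \<le> \<bar>A \<zeta>\<bar> * \<bar>Y \<zeta> - B \<zeta>\<bar> + \<bar>X \<zeta> - A \<zeta>\<bar> * \<bar>B \<zeta>\<bar> + \<bar>X \<zeta> - A \<zeta>\<bar> * \<bar>Y \<zeta> - B \<zeta>\<bar>"
        unfolding abs_mult[symmetric] by linarith
      also have "\<dots> \<le> (K * ?l) * (K * ?l\<^sup>2) + (K * ?l\<^sup>2) * (K * ?l) + (K * ?l\<^sup>2) * (K * ?l\<^sup>2)"
        using K by (intro add_mono mult_mono r lin) auto
      also have "\<dots> = K\<^sup>2 * (2 * ?l ^ 3 + ?l ^ 4)"
        by (simp add: power2_eq_square power3_eq_cube power4_eq_xxxx algebra_simps)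
      finally show "\<bar>X \<zeta> * Y \<zeta> - A \<zeta> * B \<zeta>\<bar> \<le> K\<^sup>2 * (2 * ?l ^ 3 + ?l ^ 4)" .
    qed
    finally show ?thesis using i by simp
  qed
  have e2: "\<bar>\<integral>\<zeta>. V \<zeta> \<partial>\<mu>\<bar> \<le> K * (\<integral>\<zeta>. (l1 S \<zeta>)\<^sup>2 \<partial>\<mu>)" if "integrable \<mu> V" "\<And>\<zeta>. \<bar>V \<zeta>\<bar> \<le> K * (l1 S \<zeta>)\<^sup>2" for V
  proof -
    have "\<bar>\<integral>\<zeta>. V \<zeta> \<partial>\<mu>\<bar> \<le> (\<integral>\<zeta>. \<bar>V \<zeta>\<bar> \<partial>\<mu>)" by (rule integral_abs_bound)
    also have "\<dots> \<le> (\<integral>\<zeta>. K * (l1 S \<zeta>)\<^sup>2 \<partial>\<mu>)" using that i by (intro integral_mono) auto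
    finally show ?thesis by simp
  qed
  have "\<bar>\<integral>\<zeta>. X \<zeta> - A \<zeta> \<partial>\<mu>\<bar> * \<bar>\<integral>\<zeta>. Y \<zeta> - B \<zeta> \<partial>\<mu>\<bar> \<le> (K * (\<integral>\<zeta>. (l1 S \<zeta>)\<^sup>2 \<partial>\<mu>)) * (K * (\<integral>\<zeta>. (l1 S \<zeta>)\<^sup>2 \<partial>\<mu>))"
    using Xi A0 K by (intro mult_mono e2 r) (auto simp: has_bochner_integral_iff)
  then have "\<bar>(\<integral>\<zeta>. X \<zeta> - A \<zeta> \<partial>\<mu>) * (\<integral>\<zeta>. Y \<zeta> - B \<zeta> \<partial>\<mu>)\<bar> \<le> K\<^sup>2 * (\<integral>\<zeta>. (l1 S \<zeta>)\<^sup>2 \<partial>\<mu>)\<^sup>2"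
    by (simp add: abs_mult power2_eq_square mult_ac)
  with e1 show ?thesis unfolding eq distrib_left by linarith
qed

text \<open>The \<open>k\<close>-th moment scales like \<open>h\<close> to the power
  \<open>k / 2\<close>. Even moments reduce to Gaussian ones by the inequality between a squared sum
  and a sum of squares. The crude \<open>C\<close> dominates 1, \<open>card S ^ 2 * a\<close> and
  \<open>3 * card S ^ 4 * a^2\<close> at once.\<close>

lemma l1_moments:
  assumes g: "is_centred_gaussian S c \<mu>" and c: "\<And>x. x \<in> S \<Longrightarrow> c x x \<le> a * h" and a: "a \<ge> 0" and h: "h > 0"
  defines "C \<equiv> 3 * (1 + real (card S)) ^ 4 * (1 + a)\<^sup>2"
  shows "integrable \<mu> (l1 S)" "integrable \<mu> (\<lambda>\<zeta>. (l1 S \<zeta>)\<^sup>2)" "integrable \<mu> (\<lambda>\<zeta>. l1 S \<zeta> ^ 3)" "integrable \<mu> (\<lambda>\<zeta>. l1 S \<zeta> ^ 4)"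
    and "(\<integral>\<zeta>. l1 S \<zeta> \<partial>\<mu>) \<le> C * sqrt h" "(\<integral>\<zeta>. (l1 S \<zeta>)\<^sup>2 \<partial>\<mu>) \<le> C * h"
      "(\<integral>\<zeta>. l1 S \<zeta> ^ 3 \<partial>\<mu>) \<le> C * (h * sqrt h)" "(\<integral>\<zeta>. l1 S \<zeta> ^ 4 \<partial>\<mu>) \<le> C * h\<^sup>2"
proof -
  let ?n = "real (card S)"
  have cpos: "0 \<le> c x x" if "x \<in> S" for x
  proof -
    have "0 \<le> (\<integral>\<zeta>. \<zeta> x * \<zeta> x \<partial>\<mu>)" by (intro Bochner_Integration.integral_nonneg) simp
    then show ?thesis unfolding has_bochner_integral_integral_eq[OF centred_gaussian_moments(3)[OF finite_index g that that]] .
  qed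
  have l2: "(l1 S \<zeta>)\<^sup>2 \<le> ?n * (\<Sum>x\<in>S. (\<zeta> x)\<^sup>2)" for \<zeta>
    using sum_squared_le_sum_of_squares[of "\<lambda>x. \<bar>\<zeta> x\<bar>" S] by (simp add: l1_def mult.commute)
  have l4: "l1 S \<zeta> ^ 4 \<le> ?n ^ 3 * (\<Sum>x\<in>S. \<zeta> x ^ 4)" for \<zeta>
  proof -
    have "l1 S \<zeta> ^ 4 = ((l1 S \<zeta>)\<^sup>2)\<^sup>2" by (simp add: power_mult[symmetric])
    also have "\<dots> \<le> (?n * (\<Sum>x\<in>S. (\<zeta> x)\<^sup>2))\<^sup>2" by (intro power_mono l2) simp
    also have "\<dots> = ?n\<^sup>2 * (\<Sum>x\<in>S. (\<zeta> x)\<^sup>2)\<^sup>2" by (simp add: power_mult_distrib)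
    also have "\<dots> \<le> ?n\<^sup>2 * (?n * (\<Sum>x\<in>S. ((\<zeta> x)\<^sup>2)\<^sup>2))"
      using sum_squared_le_sum_of_squares[of "\<lambda>x. (\<zeta> x)\<^sup>2" S] by (intro mult_left_mono) (auto simp: mult.commute)
    finally show ?thesis by (simp add: power2_eq_square power3_eq_cube power4_eq_xxxx mult_ac)
  qed
  have s2: "has_bochner_integral \<mu> (\<lambda>\<zeta>. ?n * (\<Sum>x\<in>S. (\<zeta> x)\<^sup>2)) (?n * (\<Sum>x\<in>S. c x x))"
    using centred_gaussian_moments(3)[OF finite_index g]
    by (intro has_bochner_integral_mult_right has_bochner_integral_sum) (auto simp: power2_eq_square)
  have s4: "has_bochner_integral \<mu> (\<lambda>\<zeta>. ?n ^ 3 * (\<Sum>x\<in>S. \<zeta> x ^ 4)) (?n ^ 3 * (\<Sum>x\<in>S. 3 * (c x x)\<^sup>2))"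
    using centred_gaussian_moments(2)[OF finite_index g]
    by (intro has_bochner_integral_mult_right has_bochner_integral_sum)
  show i2: "integrable \<mu> (\<lambda>\<zeta>. (l1 S \<zeta>)\<^sup>2)"
  proof (rule Bochner_Integration.integrable_bound[OF integrable.intros[OF s2]])
    show "AE \<zeta> in \<mu>. norm ((l1 S \<zeta>)\<^sup>2) \<le> norm (?n * (\<Sum>x\<in>S. (\<zeta> x)\<^sup>2))"
      by (intro AE_I2, simp only: real_norm_def abs_power2) (rule order_trans[OF l2 abs_ge_self])
  qed measurable
  show i4: "integrable \<mu> (\<lambda>\<zeta>. l1 S \<zeta> ^ 4)"
  proof (rule Bochner_Integration.integrable_bound[OF integrable.intros[OF s4]])
    show "AE \<zeta> in \<mu>. norm (l1 S \<zeta> ^ 4) \<le> norm (?n ^ 3 * (\<Sum>x\<in>S. \<zeta> x ^ 4))"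
      by (intro AE_I2, simp only: real_norm_def power_abs abs_of_nonneg[OF l1_nonneg]) (rule order_trans[OF l4 abs_ge_self])
  qed measurable
  have m: "1 \<le> (1 + ?n) ^ 4" "?n\<^sup>2 \<le> (1 + ?n) ^ 4" "?n ^ 4 \<le> (1 + ?n) ^ 4" "1 \<le> (1 + a)\<^sup>2" "a \<le> (1 + a)\<^sup>2" "a\<^sup>2 \<le> (1 + a)\<^sup>2"
  proof -
    have "?n\<^sup>2 \<le> (1 + ?n)\<^sup>2" by (intro power_mono) auto
    also have "\<dots> \<le> (1 + ?n) ^ 4" by (intro power_increasing) auto
    finally show "?n\<^sup>2 \<le> (1 + ?n) ^ 4" .
    show "1 \<le> (1 + ?n) ^ 4" by (rule one_le_power) simp
    show "?n ^ 4 \<le> (1 + ?n) ^ 4" by (intro power_mono) auto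
    show "1 \<le> (1 + a)\<^sup>2" using a by (intro one_le_power) simp
    show "a\<^sup>2 \<le> (1 + a)\<^sup>2" using a by (intro power_mono) auto
    show "a \<le> (1 + a)\<^sup>2" using a by (simp add: power2_eq_square algebra_simps)
  qed
  have C1: "1 * 1 \<le> (1 + ?n) ^ 4 * (1 + a)\<^sup>2" "?n\<^sup>2 * a \<le> (1 + ?n) ^ 4 * (1 + a)\<^sup>2" "?n ^ 4 * a\<^sup>2 \<le> (1 + ?n) ^ 4 * (1 + a)\<^sup>2"
    using m a by (intro mult_mono; simp)+
  have C: "1 \<le> C" "?n\<^sup>2 * a \<le> C" "?n ^ 4 * (3 * a\<^sup>2) \<le> C" unfolding C_def using C1 by linarith+
  show b2: "(\<integral>\<zeta>. (l1 S \<zeta>)\<^sup>2 \<partial>\<mu>) \<le> C * h"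
  proof -
    have "(\<integral>\<zeta>. (l1 S \<zeta>)\<^sup>2 \<partial>\<mu>) \<le> (\<integral>\<zeta>. ?n * (\<Sum>x\<in>S. (\<zeta> x)\<^sup>2) \<partial>\<mu>)"
      using i2 s2 l2 by (intro integral_mono) (auto simp: has_bochner_integral_iff)
    also have "\<dots> = ?n * (\<Sum>x\<in>S. c x x)" using s2 by (simp add: has_bochner_integral_iff)
    also have "\<dots> \<le> ?n * (\<Sum>x\<in>S. a * h)" using c by (intro mult_left_mono sum_mono) auto
    also have "\<dots> = (?n\<^sup>2 * a) * h" by (simp add: power2_eq_square)
    also have "\<dots> \<le> C * h" using C h by (intro mult_right_mono) auto
    finally show ?thesis .
  qed
  show b4: "(\<integral>\<zeta>. l1 S \<zeta> ^ 4 \<partial>\<mu>) \<le> C * h\<^sup>2"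
  proof -
    have "(\<integral>\<zeta>. l1 S \<zeta> ^ 4 \<partial>\<mu>) \<le> (\<integral>\<zeta>. ?n ^ 3 * (\<Sum>x\<in>S. \<zeta> x ^ 4) \<partial>\<mu>)"
      using i4 s4 l4 by (intro integral_mono) (auto simp: has_bochner_integral_iff)
    also have "\<dots> = ?n ^ 3 * (\<Sum>x\<in>S. 3 * (c x x)\<^sup>2)" using s4 by (simp add: has_bochner_integral_iff)
    also have "\<dots> \<le> ?n ^ 3 * (\<Sum>x\<in>S. 3 * (a * h)\<^sup>2)"
      using c cpos by (intro mult_left_mono sum_mono power_mono) auto
    also have "\<dots> = (?n ^ 4 * (3 * a\<^sup>2)) * h\<^sup>2" by (simp add: power_mult_distrib power3_eq_cube power4_eq_xxxx mult_ac)
    also have "\<dots> \<le> C * h\<^sup>2" using C by (intro mult_right_mono) auto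
    finally show ?thesis .
  qed
  have sh: "sqrt h > 0" "sqrt h * sqrt h = h" using h by auto
  \<comment> \<open>The odd moments are interpolated between the even ones; the weight
    \<open>sqrt h\<close> is the typical size of the variable, so both terms have the right
    order.\<close>
  have y1: "y \<le> (sqrt h + y\<^sup>2 / sqrt h) / 2" for y :: real
    using sum_squares_bound[of "sqrt h" y] sh h by (simp add: field_simps power2_eq_square)
  have y3: "y ^ 3 \<le> (sqrt h * y\<^sup>2 + y ^ 4 / sqrt h) / 2" if "y \<ge> 0" for y :: real
    using mult_left_mono[OF y1[of y] zero_le_power2[of y]]
    by (simp add: power2_eq_square power3_eq_cube power4_eq_xxxx algebra_simps)
  have j1: "integrable \<mu> (\<lambda>\<zeta>. (sqrt h + (l1 S \<zeta>)\<^sup>2 / sqrt h) / 2)" using i2 by auto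
  have j3: "integrable \<mu> (\<lambda>\<zeta>. (sqrt h * (l1 S \<zeta>)\<^sup>2 + l1 S \<zeta> ^ 4 / sqrt h) / 2)" using i2 i4 by auto
  show i1: "integrable \<mu> (l1 S)"
  proof (rule Bochner_Integration.integrable_bound[OF j1])
    show "AE \<zeta> in \<mu>. norm (l1 S \<zeta>) \<le> norm ((sqrt h + (l1 S \<zeta>)\<^sup>2 / sqrt h) / 2)"
      by (intro AE_I2, simp only: real_norm_def abs_of_nonneg[OF l1_nonneg]) (rule order_trans[OF y1 abs_ge_self])
  qed measurable
  show i3: "integrable \<mu> (\<lambda>\<zeta>. l1 S \<zeta> ^ 3)"
  proof (rule Bochner_Integration.integrable_bound[OF j3])
    show "AE \<zeta> in \<mu>. norm (l1 S \<zeta> ^ 3) \<le> norm ((sqrt h * (l1 S \<zeta>)\<^sup>2 + l1 S \<zeta> ^ 4 / sqrt h) / 2)"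
      by (intro AE_I2, simp only: real_norm_def power_abs abs_of_nonneg[OF l1_nonneg]) (rule order_trans[OF y3[OF l1_nonneg] abs_ge_self])
  qed measurable
  show "(\<integral>\<zeta>. l1 S \<zeta> \<partial>\<mu>) \<le> C * sqrt h"
  proof -
    have "(\<integral>\<zeta>. l1 S \<zeta> \<partial>\<mu>) \<le> (\<integral>\<zeta>. (sqrt h + (l1 S \<zeta>)\<^sup>2 / sqrt h) / 2 \<partial>\<mu>)"
      by (intro integral_mono i1 j1 y1)
    also have "\<dots> = (sqrt h + (\<integral>\<zeta>. (l1 S \<zeta>)\<^sup>2 \<partial>\<mu>) / sqrt h) / 2" using i2 by (simp add: prob_space)
    also have "\<dots> \<le> (sqrt h + (C * h) / sqrt h) / 2"
      using b2 sh by (intro divide_right_mono add_left_mono) auto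
    also have "(C * h) / sqrt h = C * sqrt h" by (simp only: times_divide_eq_right[symmetric] real_div_sqrt[OF less_imp_le[OF h]])
    also have "(sqrt h + C * sqrt h) / 2 \<le> C * sqrt h"
      using mult_right_mono[OF C(1), of "sqrt h"] sh by simp
    finally show ?thesis .
  qed
  show "(\<integral>\<zeta>. l1 S \<zeta> ^ 3 \<partial>\<mu>) \<le> C * (h * sqrt h)"
  proof -
    have "(\<integral>\<zeta>. l1 S \<zeta> ^ 3 \<partial>\<mu>) \<le> (\<integral>\<zeta>. (sqrt h * (l1 S \<zeta>)\<^sup>2 + l1 S \<zeta> ^ 4 / sqrt h) / 2 \<partial>\<mu>)"
      by (intro integral_mono i3 j3 y3) simp
    also have "\<dots> = (sqrt h * (\<integral>\<zeta>. (l1 S \<zeta>)\<^sup>2 \<partial>\<mu>) + (\<integral>\<zeta>. l1 S \<zeta> ^ 4 \<partial>\<mu>) / sqrt h) / 2" using i2 i4 by simp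
    also have "\<dots> \<le> (sqrt h * (C * h) + (C * h\<^sup>2) / sqrt h) / 2"
      using b2 b4 sh by (intro divide_right_mono add_mono mult_left_mono) auto
    also have "(C * h\<^sup>2) / sqrt h = C * (h * sqrt h)" by (simp only: power2_eq_square times_divide_eq_right[symmetric] real_div_sqrt[OF less_imp_le[OF h]])
    finally show ?thesis by (simp add: mult_ac)
  qed
qed

end

section \<open>Increments of the Gaussian process\<close>

lemma is_centred_gaussian_cong:
  assumes "\<And>x y. x \<in> S \<Longrightarrow> y \<in> S \<Longrightarrow> c x y = c' x y"
  shows "is_centred_gaussian S c \<mu> \<longleftrightarrow> is_centred_gaussian S c' \<mu>"
  using assms by (simp add: is_centred_gaussian_def cong: ball_cong)

lemma prob_PiM_gaussian:
  fixes \<mu> :: "('i :: countable \<Rightarrow> real) measure"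
  shows "finite S \<Longrightarrow> is_centred_gaussian S c \<mu> \<Longrightarrow> prob_PiM \<mu> S"
  by (simp add: prob_PiM_def prob_PiM_axioms_def is_centred_gaussian_def)

text \<open>The sum of independent Gaussian fields has the product of the characteristic functions,
  so its covariance is the sum. Fubini's theorem then turns the average over the sum into iterated
  averages.\<close>

lemma shift_avg_gaussian_add:
  fixes f :: "('i :: countable \<Rightarrow> real) \<Rightarrow> real"
  assumes S: "finite S" and \<mu>: "is_centred_gaussian S c \<mu>" and \<nu>: "is_centred_gaussian S d \<nu>" and \<kappa>: "is_centred_gaussian S e \<kappa>"
    and e: "\<And>x y. x \<in> S \<Longrightarrow> y \<in> S \<Longrightarrow> e x y = c x y + d x y" and f: "blip S K f"
  shows "shift_avg \<nu> (shift_avg \<mu> f) = shift_avg \<kappa> f"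
proof
  fix \<phi>
  interpret m: prob_PiM \<mu> S by (rule prob_PiM_gaussian[OF S \<mu>])
  interpret n: prob_PiM \<nu> S by (rule prob_PiM_gaussian[OF S \<nu>])
  interpret k: prob_PiM \<kappa> S by (rule prob_PiM_gaussian[OF S \<kappa>])
  interpret nm: pair_prob_space \<nu> \<mu> ..
  let ?P = "\<lambda>p. \<lambda>x\<in>S. fst p x + snd p x"
  have c1[measurable]: "(\<lambda>p. fst p x) \<in> borel_measurable (\<nu> \<Otimes>\<^sub>M \<mu>)" "(\<lambda>p. snd p x) \<in> borel_measurable (\<nu> \<Otimes>\<^sub>M \<mu>)" if "x \<in> S" for x
    using measurable_compose[OF measurable_fst n.comp_measurable[OF that]] measurable_compose[OF measurable_snd m.comp_measurable[OF that]] by auto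
  have P: "?P \<in> (\<nu> \<Otimes>\<^sub>M \<mu>) \<rightarrow>\<^sub>M PiM S (\<lambda>_. borel)" by measurable
  have "distr (\<nu> \<Otimes>\<^sub>M \<mu>) (PiM S (\<lambda>_. borel)) ?P = \<kappa>"
  proof (rule finite_measure_eqI_char_PiM[OF S])
    fix a :: "'i \<Rightarrow> real"
    let ?e = "\<lambda>\<zeta>. iexp (\<Sum>x\<in>S. a x * \<zeta> x)"
    have em: "?e \<in> borel_measurable \<mu>" "?e \<in> borel_measurable \<nu>" by measurable
    have ei: "integrable \<mu> ?e" "integrable \<nu> ?e"
      using m.integrable_complex_bounded[OF em(1), of 1] n.integrable_complex_bounded[OF em(2), of 1] by (simp_all only: norm_exp_i_times order_refl simp_thms)
    have "(CLINT \<zeta>|distr (\<nu> \<Otimes>\<^sub>M \<mu>) (PiM S (\<lambda>_. borel)) ?P. ?e \<zeta>) = (CLINT p|\<nu> \<Otimes>\<^sub>M \<mu>. ?e (?P p))"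
      by (rule integral_distr[OF P]) measurable
    also have "\<dots> = (CLINT p|\<nu> \<Otimes>\<^sub>M \<mu>. ?e (fst p) * ?e (snd p))"
    proof (intro Bochner_Integration.integral_cong refl)
      fix p
      have "(\<Sum>x\<in>S. a x * ?P p x) = (\<Sum>x\<in>S. a x * fst p x) + (\<Sum>x\<in>S. a x * snd p x)"
        by (simp add: sum.distrib[symmetric] distrib_left)
      then show "?e (?P p) = ?e (fst p) * ?e (snd p)" by (simp only: of_real_add distrib_left exp_add)
    qed
    also have "\<dots> = (CLINT \<xi>|\<nu>. CLINT \<zeta>|\<mu>. ?e \<xi> * ?e \<zeta>)"
    proof (subst nm.integral_fst'[symmetric])
      show "complex_integrable (\<nu> \<Otimes>\<^sub>M \<mu>) (\<lambda>p. ?e (fst p) * ?e (snd p))"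
        by (rule nm.integrable_complex_bounded[where B=1], measurable) (simp only: norm_mult norm_exp_i_times mult_1 order_refl)
    qed simp
    also have "\<dots> = (CLINT \<xi>|\<nu>. ?e \<xi>) * (CLINT \<zeta>|\<mu>. ?e \<zeta>)"
      by (simp only: Bochner_Integration.integral_mult_right_zero Bochner_Integration.integral_mult_left_zero)
    also have "\<dots> = (CLINT \<zeta>|\<kappa>. ?e \<zeta>)"
      unfolding char_centred_gaussian[OF S \<mu>] char_centred_gaussian[OF S \<nu>] char_centred_gaussian[OF S \<kappa>] of_real_mult[symmetric] exp_add[symmetric]
      by (simp add: e sum.distrib distrib_left add_divide_distrib add.commute cong: sum.cong)
    finally show "(CLINT \<zeta>|distr (\<nu> \<Otimes>\<^sub>M \<mu>) (PiM S (\<lambda>_. borel)) ?P. ?e \<zeta>) = (CLINT \<zeta>|\<kappa>. ?e \<zeta>)" .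
  qed (auto simp: k.sets_mu k.finite_measure_axioms intro!: nm.P.finite_measure_distr P)
  then have "shift_avg \<kappa> f \<phi> = (\<integral>\<zeta>. f (\<lambda>x. \<phi> x + \<zeta> x) \<partial>distr (\<nu> \<Otimes>\<^sub>M \<mu>) (PiM S (\<lambda>_. borel)) ?P)"
    by (simp add: shift_avg_def)
  also have "\<dots> = (\<integral>p. f (\<lambda>x. \<phi> x + ?P p x) \<partial>(\<nu> \<Otimes>\<^sub>M \<mu>))"
    by (rule integral_distr[OF P], rule blip_measurable[OF f]) measurable
  also have "\<dots> = (\<integral>p. f (\<lambda>x. (\<phi> x + fst p x) + snd p x) \<partial>(\<nu> \<Otimes>\<^sub>M \<mu>))"
    by (intro Bochner_Integration.integral_cong refl blip_cong[OF f]) simp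
  also have "\<dots> = (\<integral>\<xi>. \<integral>\<zeta>. f (\<lambda>x. (\<phi> x + \<xi> x) + \<zeta> x) \<partial>\<mu> \<partial>\<nu>)"
  proof (subst nm.integral_fst'[symmetric])
    show "integrable (\<nu> \<Otimes>\<^sub>M \<mu>) (\<lambda>p. f (\<lambda>x. (\<phi> x + fst p x) + snd p x))"
    proof (rule nm.integrable_const_bound[where B=K])
      show "(\<lambda>p. f (\<lambda>x. (\<phi> x + fst p x) + snd p x)) \<in> borel_measurable (\<nu> \<Otimes>\<^sub>M \<mu>)"
        by (rule blip_measurable[OF f]) measurable
    qed (simp add: blipD(1)[OF f])
  qed simp
  finally show "shift_avg \<nu> (shift_avg \<mu> f) \<phi> = shift_avg \<kappa> f \<phi>" by (simp add: shift_avg_def)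
qed

lemma has_bochner_integral_exp_tail:
  "has_bochner_integral lborel (\<lambda>u. exp (- u) * indicator {t..} u) (exp (- t) :: real)"
proof -
  have "has_bochner_integral lborel (\<lambda>u. exp (- u) * indicator {t..} u) (0 - - exp (- t))"
  proof (rule has_bochner_integral_nn_integral)
    have "(\<integral>\<^sup>+u. ennreal (exp (- u)) * indicator {t..} u \<partial>lborel) = ennreal (0 - - exp (- t))"
    proof (rule nn_integral_FTC_atLeast)
      show "((\<lambda>u::real. - exp (- u)) \<longlongrightarrow> 0) at_top"
        using tendsto_minus[OF filterlim_compose[OF exp_at_bot filterlim_uminus_at_bot_at_top]] by simp
    qed (auto intro!: derivative_eq_intros)
    then show "(\<integral>\<^sup>+u. ennreal (exp (- u) * indicator {t..} u) \<partial>lborel) = ennreal (0 - - exp (- t))"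
      by (simp add: ennreal_mult' ennreal_indicator)
  qed auto
  then show ?thesis by simp
qed

section \<open>Covariances accumulated over sets of times\<close>

context torus
begin

text \<open>One notion for the three covariances in play: the set \<open>[0, t)\<close> gives
  \<open>c_kernel\<close>, \<open>[0, \<infinity>)\<close> gives \<open>c_inf\<close>, and
  \<open>[s, t)\<close> gives an increment. Half-open intervals make the decompositions
  disjoint.\<close>

definition cov_on :: "real set \<Rightarrow> site \<Rightarrow> site \<Rightarrow> real" where
  "cov_on A x y = (\<integral>u. indicator A u * K u x y \<partial>lborel)"

lemma cov_on_integrable:
  assumes "A \<in> sets borel" "A \<subseteq> {0..}" "x \<in> S" "y \<in> S"
  shows "integrable lborel (\<lambda>u. indicator A u * K u x y)"
  using set_integrable_subset[OF K_integrable[OF assms(3,4)], of A] assms by (simp add: set_integrable_def)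

lemma cov_on_symmetric: "x \<in> S \<Longrightarrow> y \<in> S \<Longrightarrow> cov_on A x y = cov_on A y x"
  by (simp add: cov_on_def K_symmetric)

lemma cov_on_Un:
  assumes "A \<in> sets borel" "A \<subseteq> {0..}" "B \<in> sets borel" "B \<subseteq> {0..}" "A \<inter> B = {}" "x \<in> S" "y \<in> S"
  shows "cov_on (A \<union> B) x y = cov_on A x y + cov_on B x y"
proof -
  have "indicator (A \<union> B) u * K u x y = indicator A u * K u x y + indicator B u * K u x y" for u
    using assms(5) by (auto simp: indicator_def)
  then show ?thesis unfolding cov_on_def using assms by (simp add: cov_on_integrable)
qed

text \<open>By \<open>q_chapman\<close> the rate \<open>K\<close> is a Gram matrix, so the quadratic
  form is an integral of squares. This yields positivity and is the expression appearing in the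
  characteristic function of Wiener integrals.\<close>

lemma cov_on_quadratic:
  assumes A: "A \<in> sets borel" "A \<subseteq> {0..}"
  shows "(\<Sum>x\<in>S. \<Sum>y\<in>S. a x * a y * cov_on A x y)
    = (\<integral>u. \<epsilon>\<^sup>2 * (\<Sum>w\<in>S. (\<Sum>x\<in>S. a x * (indicator A u * q_kernel \<epsilon> u x w))\<^sup>2) \<partial>lborel)"
proof -
  have "(\<Sum>x\<in>S. \<Sum>y\<in>S. a x * a y * cov_on A x y) = (\<integral>u. (\<Sum>x\<in>S. \<Sum>y\<in>S. a x * a y * (indicator A u * K u x y)) \<partial>lborel)"
    unfolding cov_on_def using cov_on_integrable[OF A] by (simp add: Bochner_Integration.integral_sum)
  also have "\<dots> = (\<integral>u. \<epsilon>\<^sup>2 * (\<Sum>w\<in>S. (\<Sum>x\<in>S. a x * (indicator A u * q_kernel \<epsilon> u x w))\<^sup>2) \<partial>lborel)"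
  proof (intro Bochner_Integration.integral_cong refl)
    fix u
    have "(\<Sum>x\<in>S. \<Sum>y\<in>S. a x * a y * (indicator A u * K u x y)) = (\<Sum>x\<in>S. \<Sum>y\<in>S. \<Sum>w\<in>S. \<epsilon>\<^sup>2 * (a x * (indicator A u * q_kernel \<epsilon> u x w) * (a y * (indicator A u * q_kernel \<epsilon> u y w))))"
      by (intro sum.cong refl) (simp add: q_chapman[symmetric] sum_distrib_left indicator_def mult_ac)
    also have "\<dots> = (\<Sum>w\<in>S. \<Sum>x\<in>S. \<Sum>y\<in>S. \<epsilon>\<^sup>2 * (a x * (indicator A u * q_kernel \<epsilon> u x w) * (a y * (indicator A u * q_kernel \<epsilon> u y w))))"
      by (subst sum.swap[of _ S], subst (2) sum.swap, rule sum.cong) (auto intro: sum.swap)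
    also have "\<dots> = \<epsilon>\<^sup>2 * (\<Sum>w\<in>S. (\<Sum>x\<in>S. a x * (indicator A u * q_kernel \<epsilon> u x w))\<^sup>2)"
      by (simp only: power2_eq_square sum_product) (simp only: sum_distrib_left)
    finally show "(\<Sum>x\<in>S. \<Sum>y\<in>S. a x * a y * (indicator A u * K u x y)) = \<epsilon>\<^sup>2 * (\<Sum>w\<in>S. (\<Sum>x\<in>S. a x * (indicator A u * q_kernel \<epsilon> u x w))\<^sup>2)" .
  qed
  finally show ?thesis .
qed

lemma cov_on_nonneg:
  assumes A: "A \<in> sets borel" "A \<subseteq> {0..}" shows "0 \<le> (\<Sum>x\<in>S. \<Sum>y\<in>S. a x * a y * cov_on A x y)"
  unfolding cov_on_quadratic[OF A] by (intro Bochner_Integration.integral_nonneg mult_nonneg_nonneg sum_nonneg) auto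

lemma c_kernel_eq_cov_on: "0 \<le> t \<Longrightarrow> x \<in> S \<Longrightarrow> y \<in> S \<Longrightarrow> c_kernel \<epsilon> t x y = cov_on {0..<t} x y"
  unfolding c_kernel_def cov_on_def set_lebesgue_integral_def
  by (intro integral_cong_AE) (use AE_lborel_singleton[of t] in \<open>auto simp: indicator_def\<close>)

lemma c_inf_eq_cov_on: "c_inf x y = cov_on {0..} x y"
  by (simp add: c_inf_def cov_on_def set_lebesgue_integral_def)

lemma cov_on_interval:
  assumes "0 \<le> s" "s \<le> t" "x \<in> S" "y \<in> S"
  shows "\<bar>cov_on {s..<t} x y\<bar> \<le> (t - s) / \<epsilon>\<^sup>2"
    and "\<bar>(t - s) * K t x y - cov_on {s..<t} x y\<bar> \<le> K_lip * (t - s)\<^sup>2"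
proof -
  have iK: "integrable lborel (\<lambda>u. indicator {s..<t} u * K u x y)" by (rule cov_on_integrable) (use assms in auto)
  have ci: "integrable lborel (\<lambda>u. indicator {s..<t} u * c)" "(\<integral>u. indicator {s..<t} u * c \<partial>lborel) = (t - s) * c" for c :: real
    using assms(2) by simp_all
  have "\<bar>cov_on {s..<t} x y\<bar> \<le> (\<integral>u. \<bar>indicator {s..<t} u * K u x y\<bar> \<partial>lborel)" unfolding cov_on_def by (rule integral_abs_bound)
  also have "\<dots> \<le> (\<integral>u. indicator {s..<t} u * (1 / \<epsilon>\<^sup>2) \<partial>lborel)"
  proof (rule integral_mono)
    fix u
    have "\<bar>K u x y\<bar> \<le> 1 / \<epsilon>\<^sup>2" if "u \<ge> 0"
    proof -
      have "exp (- u) / \<epsilon>\<^sup>2 \<le> 1 / \<epsilon>\<^sup>2" using that by (intro divide_right_mono) auto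
      then show ?thesis using K_bound[OF that assms(3,4)] by simp
    qed
    then show "\<bar>indicator {s..<t} u * K u x y\<bar> \<le> indicator {s..<t} u * (1 / \<epsilon>\<^sup>2)"
      using assms(1) by (auto simp: indicator_def)
  qed (use iK ci in auto)
  also have "\<dots> = (t - s) / \<epsilon>\<^sup>2" by (subst ci(2)) simp
  finally show "\<bar>cov_on {s..<t} x y\<bar> \<le> (t - s) / \<epsilon>\<^sup>2" .
  have "(t - s) * K t x y - cov_on {s..<t} x y = (\<integral>u. indicator {s..<t} u * K t x y - indicator {s..<t} u * K u x y \<partial>lborel)"
    unfolding cov_on_def ci(2)[of "K t x y", symmetric]
    by (rule Bochner_Integration.integral_diff[symmetric, OF ci(1) iK])
  then have "\<bar>(t - s) * K t x y - cov_on {s..<t} x y\<bar> \<le> (\<integral>u. \<bar>indicator {s..<t} u * K t x y - indicator {s..<t} u * K u x y\<bar> \<partial>lborel)"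
    by (simp only: integral_abs_bound)
  also have "\<dots> \<le> (\<integral>u. indicator {s..<t} u * (K_lip * (t - s)) \<partial>lborel)"
  proof (rule integral_mono)
    fix u
    have "\<bar>K t x y - K u x y\<bar> \<le> K_lip * (t - s)" if "s \<le> u" "u < t"
    proof -
      have "\<bar>K t x y - K u x y\<bar> \<le> K_lip * \<bar>t - u\<bar>" using that assms by (intro K_lipschitz) auto
      also have "\<dots> \<le> K_lip * (t - s)" using that by (intro mult_left_mono) (auto simp: K_lip_def)
      finally show ?thesis .
    qed
    then show "\<bar>indicator {s..<t} u * K t x y - indicator {s..<t} u * K u x y\<bar> \<le> indicator {s..<t} u * (K_lip * (t - s))"
      by (auto simp: indicator_def)
  qed (use iK ci in auto)
  also have "\<dots> = K_lip * (t - s)\<^sup>2" by (subst ci(2)) (simp add: power2_eq_square)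
  finally show "\<bar>(t - s) * K t x y - cov_on {s..<t} x y\<bar> \<le> K_lip * (t - s)\<^sup>2" .
qed

lemma cov_on_tail: 
  assumes "0 \<le> t" "x \<in> S" "y \<in> S" shows "\<bar>cov_on {t..} x y\<bar> \<le> exp (- t) / \<epsilon>\<^sup>2"
proof -
  note e = has_bochner_integral_exp_tail[of t]
  have "\<bar>cov_on {t..} x y\<bar> \<le> (\<integral>u. \<bar>indicator {t..} u * K u x y\<bar> \<partial>lborel)" unfolding cov_on_def by (rule integral_abs_bound)
  also have "\<dots> \<le> (\<integral>u. exp (- u) * indicator {t..} u / \<epsilon>\<^sup>2 \<partial>lborel)"
  proof (rule integral_mono)
    show "integrable lborel (\<lambda>u. \<bar>indicator {t..} u * K u x y\<bar>)" using assms by (intro integrable_abs cov_on_integrable) auto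
    show "integrable lborel (\<lambda>u. exp (- u) * indicator {t..} u / \<epsilon>\<^sup>2)" using e by (auto simp: has_bochner_integral_iff)
    show "\<bar>indicator {t..} u * K u x y\<bar> \<le> exp (- u) * indicator {t..} u / \<epsilon>\<^sup>2" for u
      using K_bound[of u x y] assms by (auto simp: indicator_def)
  qed
  also have "\<dots> = exp (- t) / \<epsilon>\<^sup>2" using e by (simp add: has_bochner_integral_iff)
  finally show ?thesis .
qed

lemma gauss_density_gaussian: "is_centred_gaussian S (cov_on {0..}) gauss_density"
  using char_gauss_density sets_gauss_density
  by (intro is_centred_gaussianI_char finite_S prob_space_gauss_density cov_on_symmetric cov_on_nonneg)
    (auto simp: cov_quad_def c_inf_eq_cov_on)

end

text \<open>\<open>J\<close> fixes one version of the Wiener integral for every time and pair of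
  sites, so that increments can be formed as differences of actual functions.\<close>

locale noise = torus \<epsilon> + B: lattice_brownian M "sites \<epsilon>" \<epsilon> W for \<epsilon> :: real and M :: "'a measure" and W +
  fixes J :: "real \<Rightarrow> site \<Rightarrow> site \<Rightarrow> 'a \<Rightarrow> real"
  assumes J: "t \<ge> 0 \<Longrightarrow> x \<in> sites \<epsilon> \<Longrightarrow> y \<in> sites \<epsilon> \<Longrightarrow>
    wiener_limit M (\<lambda>t. W t y) (\<lambda>u. indicator {t..} u * q_kernel \<epsilon> u x y) (J t x y)"
begin

text \<open>The kernel normalisation enters squared as \<open>\<epsilon>^4\<close>, the variance of
  \<open>W\<close> contributes \<open>1 / \<epsilon>^2\<close>, and the remaining
  \<open>\<epsilon>^2\<close> is the one in \<open>cov_on_quadratic\<close>.\<close>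

lemma gaussian_of_wiener:
  assumes A: "A \<in> sets borel" "A \<subseteq> {0..}"
    and L: "\<And>x y. x \<in> S \<Longrightarrow> y \<in> S \<Longrightarrow> wiener_limit M (\<lambda>t. W t y) (\<lambda>u. indicator A u * q_kernel \<epsilon> u x y) (L x y)"
  shows "is_centred_gaussian S (cov_on A) (distr M (PiM S (\<lambda>_. borel)) (\<lambda>\<omega>. \<lambda>x\<in>S. \<epsilon>\<^sup>2 * (\<Sum>y\<in>S. L x y \<omega>)))"
proof (rule is_centred_gaussianI_char[OF finite_S])
  let ?Z = "\<lambda>\<omega>. \<lambda>x\<in>S. \<epsilon>\<^sup>2 * (\<Sum>y\<in>S. L x y \<omega>)"
  have [measurable]: "L x y \<in> borel_measurable M" if "x \<in> S" "y \<in> S" for x y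
    using wiener_limit_measurable(2)[OF L[OF that]] .
  have Z: "?Z \<in> M \<rightarrow>\<^sub>M PiM S (\<lambda>_. borel)" by measurable
  show "prob_space (distr M (PiM S (\<lambda>_. borel)) ?Z)" by (rule B.prob_space_distr[OF Z])
  show "0 \<le> (\<Sum>x\<in>S. \<Sum>y\<in>S. a x * a y * cov_on A x y)" for a by (rule cov_on_nonneg[OF A])
  fix a :: "site \<Rightarrow> real"
  let ?f = "\<lambda>y u. \<Sum>x\<in>S. \<epsilon>\<^sup>2 * a x * (indicator A u * q_kernel \<epsilon> u x y)"
  have W: "wiener_limit M (\<lambda>t. W t y) (?f y) (\<lambda>\<omega>. \<Sum>x\<in>S. \<epsilon>\<^sup>2 * a x * L x y \<omega>)" if "y \<in> S" for y
    using that by (intro wiener_limit_sum wiener_limit_scale L B.W_measurable)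
  have "(CLINT \<zeta>|distr M (PiM S (\<lambda>_. borel)) ?Z. iexp (\<Sum>x\<in>S. a x * \<zeta> x)) = (CLINT \<omega>|M. iexp (\<Sum>x\<in>S. a x * ?Z \<omega> x))"
    by (rule integral_distr[OF Z]) measurable
  also have "\<dots> = (CLINT \<omega>|M. iexp (\<Sum>y\<in>S. \<Sum>x\<in>S. \<epsilon>\<^sup>2 * a x * L x y \<omega>))"
  proof (intro Bochner_Integration.integral_cong refl)
    fix \<omega>
    have "(\<Sum>x\<in>S. a x * ?Z \<omega> x) = (\<Sum>x\<in>S. \<Sum>y\<in>S. \<epsilon>\<^sup>2 * a x * L x y \<omega>)"
      by (simp add: sum_distrib_left mult_ac)
    also have "\<dots> = (\<Sum>y\<in>S. \<Sum>x\<in>S. \<epsilon>\<^sup>2 * a x * L x y \<omega>)" by (rule sum.swap)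
    finally show "iexp (\<Sum>x\<in>S. a x * ?Z \<omega> x) = iexp (\<Sum>y\<in>S. \<Sum>x\<in>S. \<epsilon>\<^sup>2 * a x * L x y \<omega>)"
      by (simp only:)
  qed
  also have "\<dots> = of_real (exp (- (\<Sum>y\<in>S. \<integral>u. (?f y u)\<^sup>2 \<partial>lborel) / (2 * \<epsilon>\<^sup>2)))"
    by (rule B.char_sum_wiener_limit(2)[OF W])
  also have "(\<Sum>y\<in>S. \<integral>u. (?f y u)\<^sup>2 \<partial>lborel) = \<epsilon>\<^sup>2 * (\<Sum>x\<in>S. \<Sum>y\<in>S. a x * a y * cov_on A x y)"
  proof -
    have "?f y u = \<epsilon>\<^sup>2 * (\<Sum>x\<in>S. a x * (indicator A u * q_kernel \<epsilon> u x y))" for y u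
      by (simp add: sum_distrib_left mult_ac)
    then have sq: "(?f y u)\<^sup>2 = \<epsilon>\<^sup>2 * (\<epsilon>\<^sup>2 * (\<Sum>x\<in>S. a x * (indicator A u * q_kernel \<epsilon> u x y))\<^sup>2)" for y u
      by (simp add: power2_eq_square mult_ac)
    have "(\<Sum>y\<in>S. \<integral>u. (?f y u)\<^sup>2 \<partial>lborel) = (\<integral>u. (\<Sum>y\<in>S. (?f y u)\<^sup>2) \<partial>lborel)"
      using B.char_sum_wiener_limit(1)[OF W] by (intro Bochner_Integration.integral_sum[symmetric])
    also have "\<dots> = (\<integral>u. \<epsilon>\<^sup>2 * (\<epsilon>\<^sup>2 * (\<Sum>y\<in>S. (\<Sum>x\<in>S. a x * (indicator A u * q_kernel \<epsilon> u x y))\<^sup>2)) \<partial>lborel)"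
      unfolding sq by (simp only: sum_distrib_left)
    finally show ?thesis unfolding cov_on_quadratic[OF A] by simp
  qed
  also have "- (\<epsilon>\<^sup>2 * (\<Sum>x\<in>S. \<Sum>y\<in>S. a x * a y * cov_on A x y)) / (2 * \<epsilon>\<^sup>2) = - (\<Sum>x\<in>S. \<Sum>y\<in>S. a x * a y * cov_on A x y) / 2"
    using eps by simp
  finally show "(CLINT \<zeta>|distr M (PiM S (\<lambda>_. borel)) ?Z. iexp (\<Sum>x\<in>S. a x * \<zeta> x)) = of_real (exp (- (\<Sum>x\<in>S. \<Sum>y\<in>S. a x * a y * cov_on A x y) / 2))" .
qed (simp_all add: cov_on_symmetric)

definition gff :: "real \<Rightarrow> site \<Rightarrow> 'a \<Rightarrow> real" where
  "gff t x \<omega> = \<epsilon>\<^sup>2 * (\<Sum>y\<in>S. J t x y \<omega>)"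

lemma gff_measurable: "t \<ge> 0 \<Longrightarrow> x \<in> S \<Longrightarrow> gff t x \<in> borel_measurable M"
  unfolding gff_def[abs_def]
  by (intro borel_measurable_times borel_measurable_const borel_measurable_sum wiener_limit_measurable(2)[OF J])

definition incr_law :: "real \<Rightarrow> real \<Rightarrow> (site \<Rightarrow> real) measure" where
  "incr_law s t = distr M (PiM S (\<lambda>_. borel)) (\<lambda>\<omega>. \<lambda>x\<in>S. gff s x \<omega> - gff t x \<omega>)"

lemma J_increment:
  assumes "0 \<le> s" "s \<le> t" "x \<in> S" "y \<in> S"
  shows "wiener_limit M (\<lambda>t. W t y) (\<lambda>u. indicator {s..<t} u * q_kernel \<epsilon> u x y) (\<lambda>\<omega>. J s x y \<omega> - J t x y \<omega>)"
proof -
  have "wiener_limit M (\<lambda>t. W t y) (\<lambda>u. indicator {s..} u * q_kernel \<epsilon> u x y + (-1) * (indicator {t..} u * q_kernel \<epsilon> u x y))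
     (\<lambda>\<omega>. J s x y \<omega> + (-1) * J t x y \<omega>)"
    using assms by (intro wiener_limit_add wiener_limit_scale J B.W_measurable) auto
  moreover have "(\<lambda>u. indicator {s..} u * q_kernel \<epsilon> u x y + (-1) * (indicator {t..} u * q_kernel \<epsilon> u x y)) = (\<lambda>u. indicator {s..<t} u * q_kernel \<epsilon> u x y)"
    using assms by (auto simp: indicator_def fun_eq_iff)
  ultimately show ?thesis by simp
qed

lemma incr_law_gaussian:
  assumes "0 \<le> s" "s \<le> t" shows "is_centred_gaussian S (cov_on {s..<t}) (incr_law s t)"
proof -
  have "(\<lambda>\<omega>. \<lambda>x\<in>S. gff s x \<omega> - gff t x \<omega>) = (\<lambda>\<omega>. \<lambda>x\<in>S. \<epsilon>\<^sup>2 * (\<Sum>y\<in>S. J s x y \<omega> - J t x y \<omega>))"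
    by (simp add: gff_def right_diff_distrib sum_subtractf)
  moreover have "{s..<t} \<subseteq> {0..}" using assms by auto
  ultimately show ?thesis
    unfolding incr_law_def using gaussian_of_wiener[OF _ _ J_increment[OF assms]] by simp
qed

lemma gff_gaussian:
  assumes "0 \<le> t" shows "is_centred_gaussian S (cov_on {t..}) (distr M (PiM S (\<lambda>_. borel)) (\<lambda>\<omega>. \<lambda>x\<in>S. gff t x \<omega>))"
  unfolding gff_def using assms by (intro gaussian_of_wiener J) auto

lemma indep_increment:
  assumes s: "0 \<le> s" "s \<le> t" and X: "X \<in> B.future t \<rightarrow>\<^sub>M N"
  shows "B.indep_var N X (PiM S (\<lambda>_. borel)) (\<lambda>\<omega>. \<lambda>x\<in>S. gff s x \<omega> - gff t x \<omega>)"
proof (rule B.indep_var_future[OF _ X finite_S])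
  show "(\<lambda>\<omega>. \<lambda>x\<in>S. gff s x \<omega> - gff t x \<omega>) \<in> M \<rightarrow>\<^sub>M PiM S (\<lambda>_. borel)"
    using s by (intro measurable_restrict borel_measurable_diff gff_measurable) auto
  show "wiener_limit M (\<lambda>t. W t y) (\<lambda>u. \<epsilon>\<^sup>2 * (indicator {s..<t} u * q_kernel \<epsilon> u x y)) (\<lambda>\<omega>. \<epsilon>\<^sup>2 * (J s x y \<omega> - J t x y \<omega>))"
    if "x \<in> S" "y \<in> S" for x y
    using that s by (intro wiener_limit_scale J_increment B.W_measurable)
  show "AE \<omega> in M. \<forall>x\<in>S. (\<lambda>x\<in>S. gff s x \<omega> - gff t x \<omega>) x = (\<Sum>y\<in>S. \<epsilon>\<^sup>2 * (J s x y \<omega> - J t x y \<omega>))"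
    by (intro AE_I2) (simp add: gff_def sum_distrib_left right_diff_distrib sum_subtractf)
qed (use s in \<open>auto simp: indicator_def\<close>)

end

section \<open>The renormalised semigroup along the flow\<close>

text \<open>\<open>U0\<close> stands for \<open>exp (- v0)\<close>. The estimates use only its class
  and its positive lower bound; the potential itself enters when the drift is identified.\<close>

locale renormalised = noise \<epsilon> M W J for \<epsilon> M W J +
  fixes U0 :: "(site \<Rightarrow> real) \<Rightarrow> real" and U0' :: "site \<Rightarrow> (site \<Rightarrow> real) \<Rightarrow> real" and L \<kappa> :: real
  assumes U0: "C11 (sites \<epsilon>) L U0 U0'" and kappa: "\<kappa> > 0" "\<And>\<phi>. U0 \<phi> \<ge> \<kappa>"
begin

definition "U t = shift_avg (incr_law 0 t) U0"
definition "U' t y = shift_avg (incr_law 0 t) (U0' y)"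

text \<open>Minus the drift, since \<open>\<nabla>v = - \<nabla>U / U\<close>.\<close>

definition b :: "real \<Rightarrow> (site \<Rightarrow> real) \<Rightarrow> site \<Rightarrow> real" where
  "b t \<phi> x = (\<Sum>y\<in>S. K t x y * (U' t y \<phi> / U t \<phi>))"

text \<open>The constant of \<open>l1_moments\<close> with \<open>a = 1 / \<epsilon>^2\<close>, the
  bound for \<open>K\<close> on the diagonal.\<close>

definition C1 :: real where "C1 = 3 * (1 + real (card S)) ^ 4 * (1 + 1 / \<epsilon>\<^sup>2)\<^sup>2"

lemma C1_nonneg: "0 \<le> C1"
  by (simp add: C1_def)

lemma L_nonneg: "0 \<le> L"
  by (rule C11D(4)[OF U0])

lemma prob_PiM_incr: "0 \<le> s \<Longrightarrow> s \<le> t \<Longrightarrow> prob_PiM (incr_law s t) S"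
  by (rule prob_PiM_gaussian[OF finite_S incr_law_gaussian])

text \<open>Averages compose because covariances over adjacent intervals add. Applied to
  \<open>U0\<close> and to the numerator, this makes both known exactly after a step.\<close>

lemma shift_avg_flow:
  assumes "0 \<le> s" "s \<le> t" "blip S R f"
  shows "shift_avg (incr_law s t) (shift_avg (incr_law 0 s) f) = shift_avg (incr_law 0 t) f"
proof (rule shift_avg_gaussian_add[OF finite_S incr_law_gaussian incr_law_gaussian incr_law_gaussian _ assms(3)])
  fix x y assume xy: "x \<in> S" "y \<in> S"
  have "{0..<t} = {0..<s} \<union> {s..<t}" using assms by auto
  moreover have "{0..<s} \<subseteq> {0..}" "{s..<t} \<subseteq> {0..}" "{0..<s} \<inter> {s..<t} = {}" using assms by auto
  ultimately show "cov_on {0..<t} x y = cov_on {0..<s} x y + cov_on {s..<t} x y"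
    using cov_on_Un[of "{0..<s}" "{s..<t}" x y] xy by simp
qed (use assms in auto)

lemma incr_moments:
  assumes "0 \<le> s" "s < t"
  shows "integrable (incr_law s t) (l1 S)" "integrable (incr_law s t) (\<lambda>\<zeta>. (l1 S \<zeta>)\<^sup>2)"
    "integrable (incr_law s t) (\<lambda>\<zeta>. l1 S \<zeta> ^ 3)" "integrable (incr_law s t) (\<lambda>\<zeta>. l1 S \<zeta> ^ 4)"
    "(\<integral>\<zeta>. l1 S \<zeta> \<partial>incr_law s t) \<le> C1 * sqrt (t - s)" "(\<integral>\<zeta>. (l1 S \<zeta>)\<^sup>2 \<partial>incr_law s t) \<le> C1 * (t - s)"
    "(\<integral>\<zeta>. l1 S \<zeta> ^ 3 \<partial>incr_law s t) \<le> C1 * ((t - s) * sqrt (t - s))" "(\<integral>\<zeta>. l1 S \<zeta> ^ 4 \<partial>incr_law s t) \<le> C1 * (t - s)\<^sup>2"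
proof -
  interpret I: prob_PiM "incr_law s t" S by (rule prob_PiM_incr) (use assms in auto)
  have c: "cov_on {s..<t} x x \<le> 1 / \<epsilon>\<^sup>2 * (t - s)" if "x \<in> S" for x
    using cov_on_interval(1)[of s t x x] that assms by auto
  note m = I.l1_moments[OF incr_law_gaussian c]
  show "integrable (incr_law s t) (l1 S)" "integrable (incr_law s t) (\<lambda>\<zeta>. (l1 S \<zeta>)\<^sup>2)"
    "integrable (incr_law s t) (\<lambda>\<zeta>. l1 S \<zeta> ^ 3)" "integrable (incr_law s t) (\<lambda>\<zeta>. l1 S \<zeta> ^ 4)"
    "(\<integral>\<zeta>. l1 S \<zeta> \<partial>incr_law s t) \<le> C1 * sqrt (t - s)" "(\<integral>\<zeta>. (l1 S \<zeta>)\<^sup>2 \<partial>incr_law s t) \<le> C1 * (t - s)"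
    "(\<integral>\<zeta>. l1 S \<zeta> ^ 3 \<partial>incr_law s t) \<le> C1 * ((t - s) * sqrt (t - s))" "(\<integral>\<zeta>. l1 S \<zeta> ^ 4 \<partial>incr_law s t) \<le> C1 * (t - s)\<^sup>2"
    using m assms unfolding C1_def by auto
qed

text \<open>Only the mean size of the increment is used, so the regularity in time is that of a
  square root. This is enough, since in a step the difference is multiplied by a covariance of order
  \<open>t - s\<close>.\<close>

lemma shift_avg_time_lip:
  assumes "0 \<le> s" "s \<le> t" "blip S R f"
  shows "\<bar>shift_avg (incr_law 0 t) f \<psi> - shift_avg (incr_law 0 s) f \<phi>\<bar> \<le> R * (l1 S (\<lambda>x. \<psi> x - \<phi> x) + C1 * sqrt (t - s))"
proof -
  interpret I0: prob_PiM "incr_law 0 s" S by (rule prob_PiM_incr) (use assms in auto)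
  note f = I0.blip_shift_avg[OF assms(3)]
  have R: "0 \<le> R" by (rule blipD(3)[OF assms(3)])
  have 1: "\<bar>shift_avg (incr_law 0 s) f \<psi> - shift_avg (incr_law 0 s) f \<phi>\<bar> \<le> R * l1 S (\<lambda>x. \<psi> x - \<phi> x)"
    by (rule blipD(2)[OF f])
  have 2: "\<bar>shift_avg (incr_law 0 t) f \<psi> - shift_avg (incr_law 0 s) f \<psi>\<bar> \<le> R * (C1 * sqrt (t - s))"
  proof (cases "s = t")
    case False
    then have st: "s < t" using assms by simp
    interpret I: prob_PiM "incr_law s t" S by (rule prob_PiM_incr) (use assms in auto)
    have "\<bar>shift_avg (incr_law s t) (shift_avg (incr_law 0 s) f) \<psi> - shift_avg (incr_law 0 s) f \<psi>\<bar> \<le> R * (\<integral>\<zeta>. l1 S \<zeta> \<partial>incr_law s t)"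
      by (rule I.shift_avg_diff_le[OF f incr_moments(1)[OF assms(1) st]])
    also have "\<dots> \<le> R * (C1 * sqrt (t - s))"
      by (intro mult_left_mono incr_moments(5)[OF assms(1) st] R)
    finally show ?thesis by (simp add: shift_avg_flow[OF assms])
  qed simp
  show ?thesis using 1 2 unfolding distrib_left by linarith
qed

lemma shift_avg_time_continuous:
  fixes \<phi> :: "real \<Rightarrow> site \<Rightarrow> real"
  assumes f: "blip S R f" and \<phi>: "\<And>x. x \<in> S \<Longrightarrow> continuous_on {0..} (\<lambda>u. \<phi> u x)"
  shows "continuous_on {0..} (\<lambda>u. shift_avg (incr_law 0 u) f (\<phi> u))"
  unfolding continuous_on_def
proof (rule ballI, rule LIM_zero_cancel, rule Lim_null_comparison)
  fix t :: real assume t: "t \<in> {0..}"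
  show "\<forall>\<^sub>F u in at t within {0..}. norm (shift_avg (incr_law 0 u) f (\<phi> u) - shift_avg (incr_law 0 t) f (\<phi> t))
     \<le> R * ((\<Sum>x\<in>S. \<bar>\<phi> u x - \<phi> t x\<bar>) + C1 * sqrt \<bar>u - t\<bar>)"
    unfolding eventually_at
  proof (intro exI[of _ 1] conjI ballI impI)
    fix u :: real assume u: "u \<in> {0..}"
    show "norm (shift_avg (incr_law 0 u) f (\<phi> u) - shift_avg (incr_law 0 t) f (\<phi> t)) \<le> R * ((\<Sum>x\<in>S. \<bar>\<phi> u x - \<phi> t x\<bar>) + C1 * sqrt \<bar>u - t\<bar>)"
    proof (cases "t \<le> u")
      case True
      then show ?thesis using shift_avg_time_lip[OF _ True f, of "\<phi> u" "\<phi> t"] t by (simp add: l1_def)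
    next
      case False
      then show ?thesis using shift_avg_time_lip[OF _ _ f, of u t "\<phi> t" "\<phi> u"] u
        by (simp add: l1_def abs_minus_commute)
    qed
  qed simp
  have "((\<lambda>u. \<phi> u x - \<phi> t x) \<longlongrightarrow> 0) (at t within {0..})" if "x \<in> S" for x
    using \<phi>[OF that] t unfolding continuous_on_def by (simp add: LIM_zero)
  then have "((\<lambda>u. R * ((\<Sum>x\<in>S. \<bar>\<phi> u x - \<phi> t x\<bar>) + C1 * sqrt \<bar>u - t\<bar>)) \<longlongrightarrow> R * ((\<Sum>x\<in>S. \<bar>0\<bar>) + C1 * sqrt \<bar>t - t\<bar>)) (at t within {0..})"
    by (intro tendsto_intros tendsto_rabs) auto
  then show "((\<lambda>u. R * ((\<Sum>x\<in>S. \<bar>\<phi> u x - \<phi> t x\<bar>) + C1 * sqrt \<bar>u - t\<bar>)) \<longlongrightarrow> 0) (at t within {0..})" by simp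
qed

lemma C11_U: "0 \<le> t \<Longrightarrow> C11 S L (U t) (U' t)"
  unfolding U_def U'_def by (rule prob_PiM.C11_shift_avg[OF prob_PiM_incr U0]) auto

lemma U_ge: "0 \<le> t \<Longrightarrow> \<kappa> \<le> U t \<phi>"
  unfolding U_def by (rule prob_PiM.shift_avg_ge[OF prob_PiM_incr C11_blip[OF U0] kappa(2)]) auto

lemma U_pos: "0 \<le> t \<Longrightarrow> 0 < U t \<phi>"
  using U_ge[of t \<phi>] kappa(1) by linarith

text \<open>Sums over all sites the kernel bound times \<open>L / \<kappa>\<close>, which bounds the
  logarithmic gradient of \<open>U\<close>. The decay \<open>exp (- t)\<close> comes from the mass
  and makes the infinite drift integral converge.\<close>

definition Cb :: real where "Cb = real (card S) * (1 / \<epsilon>\<^sup>2 * (L / \<kappa>))"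

lemma Cb_nonneg: "0 \<le> Cb"
  using L_nonneg kappa by (simp add: Cb_def)

lemma b_bound:
  assumes "0 \<le> t" "x \<in> S" shows "\<bar>b t \<phi> x\<bar> \<le> Cb * exp (- t)"
proof -
  have "\<bar>b t \<phi> x\<bar> \<le> (\<Sum>y\<in>S. \<bar>K t x y * (U' t y \<phi> / U t \<phi>)\<bar>)" unfolding b_def by (rule sum_abs)
  also have "\<dots> \<le> (\<Sum>y\<in>S. exp (- t) / \<epsilon>\<^sup>2 * (L / \<kappa>))"
  proof (rule sum_mono)
    fix y assume y: "y \<in> S"
    have "\<bar>U' t y \<phi>\<bar> / U t \<phi> \<le> L / \<kappa>"
      using blipD(1)[OF C11D(2)[OF C11_U[OF assms(1)] y]] U_ge[OF assms(1)] kappa L_nonneg by (intro frac_le) auto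
    then have "\<bar>K t x y\<bar> * (\<bar>U' t y \<phi>\<bar> / U t \<phi>) \<le> exp (- t) / \<epsilon>\<^sup>2 * (L / \<kappa>)"
      using U_pos[OF assms(1), of \<phi>] by (intro mult_mono K_bound[OF assms y]) auto
    then show "\<bar>K t x y * (U' t y \<phi> / U t \<phi>)\<bar> \<le> exp (- t) / \<epsilon>\<^sup>2 * (L / \<kappa>)"
      using U_pos[OF assms(1), of \<phi>] by (simp only: abs_mult abs_divide abs_of_pos)
  qed
  also have "\<dots> = Cb * exp (- t)" by (simp add: Cb_def)
  finally show ?thesis .
qed

lemma b_measurable:
  assumes t: "0 \<le> t" and x: "x \<in> S" and X: "\<And>y. y \<in> S \<Longrightarrow> (\<lambda>\<omega>. X \<omega> y) \<in> borel_measurable N"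
  shows "(\<lambda>\<omega>. b t (X \<omega>) x) \<in> borel_measurable N"
  unfolding b_def
  by (intro borel_measurable_sum borel_measurable_times borel_measurable_const borel_measurable_divide
      blip_measurable[OF C11_blip[OF C11_U[OF t]] X] blip_measurable[OF C11D(2)[OF C11_U[OF t]] X])

lemma b_continuous:
  assumes x: "x \<in> S" and \<phi>: "\<And>x. x \<in> S \<Longrightarrow> continuous_on {0..} (\<lambda>u. \<phi> u x)"
  shows "continuous_on {0..} (\<lambda>u. b u (\<phi> u) x)"
  unfolding b_def
proof (intro continuous_on_sum continuous_on_mult continuous_on_divide K_continuous x)
  show "continuous_on {0..} (\<lambda>u. U u (\<phi> u))"
    unfolding U_def by (rule shift_avg_time_continuous[OF C11_blip[OF U0] \<phi>])
  show "continuous_on {0..} (\<lambda>u. U' u y (\<phi> u))" if "y \<in> S" for y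
    unfolding U'_def by (rule shift_avg_time_continuous[OF C11D(2)[OF U0 that] \<phi>])
  show "\<forall>u\<in>{0..}. U u (\<phi> u) \<noteq> 0" using U_pos by (metis atLeast_iff less_irrefl)
qed

lemma b_integrable:
  assumes x: "x \<in> S" and \<phi>: "\<And>x. x \<in> S \<Longrightarrow> continuous_on {0..} (\<lambda>u. \<phi> u x)" and t: "0 \<le> t"
  shows "set_integrable lborel {t..} (\<lambda>u. b u (\<phi> u) x)"
proof -
  have "set_integrable lborel {0..} (\<lambda>u::real. Cb * exp (- u))"
    using integrable_exp_neg by (intro set_integrable_mult_right)
  then have e: "set_integrable lborel {t..} (\<lambda>u::real. Cb * exp (- u))"
    by (rule set_integrable_subset) (use t in auto)
  have m: "(\<lambda>u. indicator {t..} u *\<^sub>R b u (\<phi> u) x) \<in> borel_measurable borel"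
    by (rule borel_measurable_continuous_on_indicator[OF _ continuous_on_subset[OF b_continuous[where \<phi>=\<phi>, OF x \<phi>]]]) (use t in auto)
  show ?thesis
    unfolding set_integrable_def
  proof (rule Bochner_Integration.integrable_bound[OF e[unfolded set_integrable_def]])
    show "AE u in lborel. norm (indicator {t..} u *\<^sub>R b u (\<phi> u) x) \<le> norm (indicator {t..} u *\<^sub>R (Cb * exp (- u)))"
      using b_bound[OF _ x] t Cb_nonneg by (intro AE_I2) (auto simp: indicator_def abs_mult)
  qed (use m in simp)
qed

text \<open>All along one fixed continuous path. Comparison with a constant \<open>c\<close> is what
  turns the drift integral into a Riemann sum; the last bound sends the field to 0 at large
  times.\<close>

lemma b_integral_bounds:
  assumes x: "x \<in> S" and \<phi>: "\<And>x. x \<in> S \<Longrightarrow> continuous_on {0..} (\<lambda>u. \<phi> u x)" and st: "0 \<le> s" "s \<le> t"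
  shows "(LBINT u:{s..}. b u (\<phi> u) x) - (LBINT u:{t..}. b u (\<phi> u) x) = (LBINT u:{s..<t}. b u (\<phi> u) x)"
    and "\<bar>LBINT u:{s..<t}. b u (\<phi> u) x\<bar> \<le> Cb * (t - s)"
    and "(\<And>u. s \<le> u \<Longrightarrow> u < t \<Longrightarrow> \<bar>b u (\<phi> u) x - c\<bar> \<le> \<delta>) \<Longrightarrow> \<bar>(LBINT u:{s..<t}. b u (\<phi> u) x) - (t - s) * c\<bar> \<le> \<delta> * (t - s)"
    and "\<bar>LBINT u:{t..}. b u (\<phi> u) x\<bar> \<le> Cb * exp (- t)"
proof -
  have int_s: "set_integrable lborel {s..} (\<lambda>u. b u (\<phi> u) x)" by (rule b_integrable[where \<phi>=\<phi>, OF x \<phi> st(1)])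
  have int_t: "set_integrable lborel {t..} (\<lambda>u. b u (\<phi> u) x)" by (rule b_integrable[where \<phi>=\<phi>, OF x \<phi>]) (use st in auto)
  have ist: "set_integrable lborel {s..<t} (\<lambda>u. b u (\<phi> u) x)" by (rule set_integrable_subset[OF int_s]) auto
  have "(LBINT u:{s..<t} \<union> {t..}. b u (\<phi> u) x) = (LBINT u:{s..<t}. b u (\<phi> u) x) + (LBINT u:{t..}. b u (\<phi> u) x)"
    by (rule set_integral_Un[OF _ ist int_t]) auto
  moreover have "{s..<t} \<union> {t..} = {s..}" using st by auto
  ultimately show "(LBINT u:{s..}. b u (\<phi> u) x) - (LBINT u:{t..}. b u (\<phi> u) x) = (LBINT u:{s..<t}. b u (\<phi> u) x)" by simp
  have close: "\<bar>(LBINT u:{s..<t}. b u (\<phi> u) x) - (t - s) * c\<bar> \<le> \<delta> * (t - s)"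
    if d: "\<And>u. s \<le> u \<Longrightarrow> u < t \<Longrightarrow> \<bar>b u (\<phi> u) x - c\<bar> \<le> \<delta>" for c \<delta>
  proof -
    have ci: "integrable lborel (\<lambda>u. indicator {s..<t} u * d)" "(\<integral>u. indicator {s..<t} u * d \<partial>lborel) = (t - s) * d" for d :: real
      using st(2) by simp_all
    have i1: "integrable lborel (\<lambda>u. indicator {s..<t} u * b u (\<phi> u) x)" using ist by (simp add: set_integrable_def)
    have "(LBINT u:{s..<t}. b u (\<phi> u) x) - (t - s) * c = (\<integral>u. indicator {s..<t} u * b u (\<phi> u) x \<partial>lborel) - (\<integral>u. indicator {s..<t} u * c \<partial>lborel)"
      by (simp only: ci(2) set_lebesgue_integral_def real_scaleR_def)
    also have "\<dots> = (\<integral>u. indicator {s..<t} u * b u (\<phi> u) x - indicator {s..<t} u * c \<partial>lborel)"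
      by (rule Bochner_Integration.integral_diff[symmetric, OF i1 ci(1)])
    finally have eq: "(LBINT u:{s..<t}. b u (\<phi> u) x) - (t - s) * c = (\<integral>u. indicator {s..<t} u * b u (\<phi> u) x - indicator {s..<t} u * c \<partial>lborel)" .
    have "\<bar>(LBINT u:{s..<t}. b u (\<phi> u) x) - (t - s) * c\<bar> \<le> (\<integral>u. \<bar>indicator {s..<t} u * b u (\<phi> u) x - indicator {s..<t} u * c\<bar> \<partial>lborel)"
      unfolding eq by (rule integral_abs_bound)
    also have "\<dots> \<le> (\<integral>u. indicator {s..<t} u * \<delta> \<partial>lborel)"
    proof (rule integral_mono)
      show "\<bar>indicator {s..<t} u * b u (\<phi> u) x - indicator {s..<t} u * c\<bar> \<le> indicator {s..<t} u * \<delta>" for u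
        using d by (auto simp: indicator_def)
    qed (intro integrable_abs Bochner_Integration.integrable_diff i1 ci(1))+
    also have "\<dots> = \<delta> * (t - s)" by (subst ci(2)) simp
    finally show ?thesis .
  qed
  then show "(\<And>u. s \<le> u \<Longrightarrow> u < t \<Longrightarrow> \<bar>b u (\<phi> u) x - c\<bar> \<le> \<delta>) \<Longrightarrow> \<bar>(LBINT u:{s..<t}. b u (\<phi> u) x) - (t - s) * c\<bar> \<le> \<delta> * (t - s)" by blast
  have "\<bar>b u (\<phi> u) x - 0\<bar> \<le> Cb" if "s \<le> u" for u
  proof -
    have "Cb * exp (- u) \<le> Cb * 1" using that st Cb_nonneg by (intro mult_left_mono) auto
    then show ?thesis using b_bound[of u x "\<phi> u"] that st x by simp
  qed
  then show "\<bar>LBINT u:{s..<t}. b u (\<phi> u) x\<bar> \<le> Cb * (t - s)" using close[of 0 Cb] by simp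
  note e = has_bochner_integral_exp_tail[of t]
  have "\<bar>LBINT u:{t..}. b u (\<phi> u) x\<bar> \<le> (\<integral>u. \<bar>indicator {t..} u * b u (\<phi> u) x\<bar> \<partial>lborel)"
    unfolding set_lebesgue_integral_def real_scaleR_def by (rule integral_abs_bound)
  also have "\<dots> \<le> (\<integral>u. Cb * (exp (- u) * indicator {t..} u) \<partial>lborel)"
  proof (rule integral_mono)
    show "integrable lborel (\<lambda>u. \<bar>indicator {t..} u * b u (\<phi> u) x\<bar>)" using int_t by (auto simp: set_integrable_def intro!: integrable_abs)
    show "integrable lborel (\<lambda>u. Cb * (exp (- u) * indicator {t..} u))" using integrable.intros[OF e] by (rule integrable_mult_right)
    show "\<bar>indicator {t..} u * b u (\<phi> u) x\<bar> \<le> Cb * (exp (- u) * indicator {t..} u)" for u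
      using b_bound[of u x "\<phi> u"] x st by (auto simp: indicator_def)
  qed
  also have "\<dots> = Cb * exp (- t)" using has_bochner_integral_integral_eq[OF e] by simp
  finally show "\<bar>LBINT u:{t..}. b u (\<phi> u) x\<bar> \<le> Cb * exp (- t)" .
qed

text \<open>The term with \<open>card S\<close> squared is the price of the kernel and the gradient
  at time \<open>t\<close> in place of the true covariance of the step and the gradient at time
  \<open>s\<close>; the other is the error of \<open>covariance_linearisation\<close>. Dividing by
  \<open>\<kappa>\<close> accounts for the quotient by \<open>U t\<close>.\<close>

definition C2 :: "real \<Rightarrow> real" where
  "C2 R = ((real (card S))\<^sup>2 * (R * (K_lip * R + 1 / \<epsilon>\<^sup>2 * (R * C1))) + R\<^sup>2 * (3 * C1 + C1\<^sup>2)) / \<kappa>"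

text \<open>
  The second-order terms of the numerator and the denominator of \<open>F\<^sub>t = E[F\<^sub>s U\<^sub>s] / U\<^sub>t\<close> cancel, and
  the remaining covariance is the drift term.
\<close>

lemma renormalised_step:
  assumes st: "0 \<le> s" "s < t" "t - s \<le> 1" and F: "C11 S R F F'" and LK: "L \<le> R"
  shows "\<bar>shift_avg (incr_law s t) F \<phi> + (t - s) * (\<Sum>x\<in>S. F' x \<phi> * b t \<phi> x) - shift_avg (incr_law s t) (\<lambda>\<phi>. F \<phi> * U s \<phi>) \<phi> / U t \<phi>\<bar>
    \<le> C2 R * ((t - s) * sqrt (t - s))"
proof -
  define h where "h = t - s"
  have h: "0 < h" "h \<le> 1" using st by (auto simp: h_def)
  interpret I: prob_PiM "incr_law s t" S by (rule prob_PiM_incr) (use st in auto)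
  have K0: "0 \<le> R" using L_nonneg LK by simp
  have Us: "C11 S R (U s) (U' s)" using C11_mono[OF C11_U LK] st by simp
  have Ut: "C11 S R (U t) (U' t)" using C11_mono[OF C11_U LK] st by simp
  have sh: "sqrt h \<le> 1" "0 < sqrt h" "h * h \<le> h * sqrt h"
  proof -
    show "sqrt h \<le> 1" "0 < sqrt h" using h by auto
    have "h = sqrt h * sqrt h" using h by simp
    also have "\<dots> \<le> 1 * sqrt h" using h by (intro mult_right_mono) auto
    finally show "h * h \<le> h * sqrt h" using h by (intro mult_left_mono) auto
  qed
  define c where "c x y = cov_on {s..<t} x y" for x y
  define A where "A = shift_avg (incr_law s t) F \<phi>"
  define e where "e = shift_avg (incr_law s t) (\<lambda>\<phi>. F \<phi> * U s \<phi>) \<phi> - A * U t \<phi> - (\<Sum>x\<in>S. \<Sum>y\<in>S. F' x \<phi> * U' s y \<phi> * c x y)"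
  have Uflow: "shift_avg (incr_law s t) (U s) \<phi> = U t \<phi>"
    unfolding U_def using shift_avg_flow[OF _ _ C11_blip[OF U0], of s t] st by simp
  have "\<bar>e\<bar> \<le> R\<^sup>2 * (2 * (\<integral>\<zeta>. l1 S \<zeta> ^ 3 \<partial>incr_law s t) + (\<integral>\<zeta>. l1 S \<zeta> ^ 4 \<partial>incr_law s t) + (\<integral>\<zeta>. (l1 S \<zeta>)\<^sup>2 \<partial>incr_law s t)\<^sup>2)"
    unfolding e_def A_def Uflow[symmetric] c_def
    by (rule I.covariance_linearisation[OF incr_law_gaussian F Us]) (use st incr_moments in auto)
  also have "\<dots> \<le> R\<^sup>2 * (2 * (C1 * (h * sqrt h)) + C1 * h\<^sup>2 + (C1 * h)\<^sup>2)"
    unfolding h_def using incr_moments(6-8)[OF st(1,2)]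
    by (intro mult_left_mono add_mono power_mono) (auto intro!: Bochner_Integration.integral_nonneg)
  also have "\<dots> \<le> R\<^sup>2 * (2 * (C1 * (h * sqrt h)) + C1 * (h * sqrt h) + C1\<^sup>2 * (h * sqrt h))"
    using sh(3) C1_nonneg by (intro mult_left_mono add_mono order_refl) (auto simp: power2_eq_square mult.assoc mult.left_commute[of h C1] intro!: mult_left_mono)
  finally have e: "\<bar>e\<bar> \<le> R\<^sup>2 * (3 * C1 + C1\<^sup>2) * (h * sqrt h)" by (simp add: algebra_simps)
  \<comment> \<open>Replacing \<open>c x y\<close> by \<open>h * K'\<close> costs order
    \<open>h^2\<close>, and replacing \<open>U' s y\<close> by \<open>U' t y\<close> costs
    \<open>sqrt h\<close> times a covariance of order \<open>h\<close>. Since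
    \<open>h \<le> 1\<close>, both are of order \<open>h * sqrt h\<close>.\<close>
  have summand: "\<bar>F' x \<phi> * (h * K' * U' t y \<phi> - c x y * U' s y \<phi>)\<bar> \<le> R * (K_lip * R + 1 / \<epsilon>\<^sup>2 * (R * C1)) * (h * sqrt h)"
    if xy: "x \<in> S" "y \<in> S" and K': "K' = cdot_kernel \<epsilon> t x y" for x y K'
  proof -
    have F'b: "\<bar>F' x \<phi>\<bar> \<le> R" by (rule blipD(1)[OF C11D(2)[OF F xy(1)]])
    have U'b: "\<bar>U' t y \<phi>\<bar> \<le> R" by (rule blipD(1)[OF C11D(2)[OF Ut xy(2)]])
    have U'd: "\<bar>U' t y \<phi> - U' s y \<phi>\<bar> \<le> R * (C1 * sqrt h)"
    proof -
      have "\<bar>U' t y \<phi> - U' s y \<phi>\<bar> \<le> L * (l1 S (\<lambda>x. \<phi> x - \<phi> x) + C1 * sqrt (t - s))"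
        unfolding U'_def by (rule shift_avg_time_lip[OF _ _ C11D(2)[OF U0 xy(2)]]) (use st in auto)
      also have "\<dots> = L * (C1 * sqrt h)" by (simp add: l1_def h_def)
      also have "\<dots> \<le> R * (C1 * sqrt h)" using LK C1_nonneg h by (intro mult_right_mono) auto
      finally show ?thesis .
    qed
    have cb: "\<bar>c x y\<bar> \<le> h / \<epsilon>\<^sup>2" "\<bar>h * K' - c x y\<bar> \<le> K_lip * h\<^sup>2"
      using cov_on_interval[of s t x y] st xy by (auto simp: c_def h_def K')
    have Kl: "0 \<le> K_lip" by (simp add: K_lip_def)
    have "h * K' * U' t y \<phi> - c x y * U' s y \<phi> = (h * K' - c x y) * U' t y \<phi> + c x y * (U' t y \<phi> - U' s y \<phi>)"
      by (simp add: algebra_simps)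
    then have "\<bar>h * K' * U' t y \<phi> - c x y * U' s y \<phi>\<bar> \<le> \<bar>h * K' - c x y\<bar> * \<bar>U' t y \<phi>\<bar> + \<bar>c x y\<bar> * \<bar>U' t y \<phi> - U' s y \<phi>\<bar>"
      unfolding abs_mult[symmetric] by linarith
    also have "\<dots> \<le> (K_lip * h\<^sup>2) * R + (h / \<epsilon>\<^sup>2) * (R * (C1 * sqrt h))"
      using h Kl by (intro add_mono mult_mono cb U'b U'd) auto
    also have "\<dots> \<le> (K_lip * (h * sqrt h)) * R + (h / \<epsilon>\<^sup>2) * (R * (C1 * sqrt h))"
      using mult_right_mono[OF mult_left_mono[OF sh(3) Kl] K0] by (simp add: power2_eq_square)
    also have "\<dots> = (K_lip * R + 1 / \<epsilon>\<^sup>2 * (R * C1)) * (h * sqrt h)" by (simp add: algebra_simps)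
    finally have d: "\<bar>h * K' * U' t y \<phi> - c x y * U' s y \<phi>\<bar> \<le> (K_lip * R + 1 / \<epsilon>\<^sup>2 * (R * C1)) * (h * sqrt h)" .
    have "\<bar>F' x \<phi>\<bar> * \<bar>h * K' * U' t y \<phi> - c x y * U' s y \<phi>\<bar> \<le> R * ((K_lip * R + 1 / \<epsilon>\<^sup>2 * (R * C1)) * (h * sqrt h))"
      using K0 by (intro mult_mono F'b d) auto
    then show ?thesis by (simp only: abs_mult mult.assoc)
  qed
  define T where "T = (\<Sum>x\<in>S. \<Sum>y\<in>S. F' x \<phi> * (h * cdot_kernel \<epsilon> t x y * U' t y \<phi> - c x y * U' s y \<phi>))"
  have T: "\<bar>T\<bar> \<le> (real (card S))\<^sup>2 * (R * (K_lip * R + 1 / \<epsilon>\<^sup>2 * (R * C1))) * (h * sqrt h)"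
  proof -
    have "\<bar>T\<bar> \<le> (\<Sum>x\<in>S. \<bar>\<Sum>y\<in>S. F' x \<phi> * (h * cdot_kernel \<epsilon> t x y * U' t y \<phi> - c x y * U' s y \<phi>)\<bar>)"
      unfolding T_def by (rule sum_abs)
    also have "\<dots> \<le> (\<Sum>x\<in>S. \<Sum>y\<in>S. R * (K_lip * R + 1 / \<epsilon>\<^sup>2 * (R * C1)) * (h * sqrt h))"
      by (intro sum_mono order_trans[OF sum_abs] summand) auto
    also have "\<dots> = (real (card S))\<^sup>2 * (R * (K_lip * R + 1 / \<epsilon>\<^sup>2 * (R * C1))) * (h * sqrt h)"
      by (simp add: power2_eq_square mult_ac)
    finally show ?thesis .
  qed
  have Up: "0 < U t \<phi>" "\<kappa> \<le> U t \<phi>" using U_pos[of t \<phi>] U_ge[of t \<phi>] st by auto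
  have "h * (\<Sum>x\<in>S. F' x \<phi> * b t \<phi> x) = (\<Sum>x\<in>S. \<Sum>y\<in>S. F' x \<phi> * (h * cdot_kernel \<epsilon> t x y * U' t y \<phi>)) / U t \<phi>"
    by (simp add: b_def sum_distrib_left sum_divide_distrib mult_ac)
  \<comment> \<open>Multiplied by \<open>U t \<phi>\<close>, the error is the sum of the drift terms
    minus the exact covariance of \<open>F\<close> and \<open>U s\<close>. Subtracting the
    linearised covariance from both splits it into \<open>T\<close> and \<open>e\<close>.\<close>
  then have eq: "A + h * (\<Sum>x\<in>S. F' x \<phi> * b t \<phi> x) - shift_avg (incr_law s t) (\<lambda>\<phi>. F \<phi> * U s \<phi>) \<phi> / U t \<phi> = (T - e) / U t \<phi>"
    using Up by (simp add: T_def e_def field_simps right_diff_distrib sum_subtractf)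
  have "\<bar>A + h * (\<Sum>x\<in>S. F' x \<phi> * b t \<phi> x) - shift_avg (incr_law s t) (\<lambda>\<phi>. F \<phi> * U s \<phi>) \<phi> / U t \<phi>\<bar> = \<bar>T - e\<bar> / U t \<phi>"
    unfolding eq using Up by (simp add: abs_divide)
  also have "\<dots> \<le> \<bar>T - e\<bar> / \<kappa>" using Up kappa by (intro divide_left_mono) auto
  also have "\<dots> \<le> (((real (card S))\<^sup>2 * (R * (K_lip * R + 1 / \<epsilon>\<^sup>2 * (R * C1))) + R\<^sup>2 * (3 * C1 + C1\<^sup>2)) * (h * sqrt h)) / \<kappa>"
    using T e kappa(1) unfolding distrib_right by (intro divide_right_mono) linarith+
  also have "\<dots> = C2 R * (h * sqrt h)" by (simp add: C2_def)
  finally show ?thesis unfolding A_def h_def .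
qed

end

text \<open>The equation is required separately at each time, with an exceptional set that may
  depend on it, because \<open>gff\<close> is determined only up to a null set at each time.\<close>

locale renormalised_sde = renormalised \<epsilon> M W J U0 U0' L \<kappa>
  for \<epsilon> and M :: "'a measure" and W J U0 U0' L \<kappa> +
  fixes \<Phi> :: "real \<Rightarrow> site \<Rightarrow> 'a \<Rightarrow> real"
  assumes adapted: "t \<ge> 0 \<Longrightarrow> x \<in> sites \<epsilon> \<Longrightarrow> \<Phi> t x \<in> borel_measurable (B.future t)"
    and continuous: "AE \<omega> in M. \<forall>x\<in>sites \<epsilon>. continuous_on {0..} (\<lambda>t. \<Phi> t x \<omega>)"
    and equation: "t \<ge> 0 \<Longrightarrow> AE \<omega> in M. \<forall>x\<in>sites \<epsilon>. \<Phi> t x \<omega> = (LBINT u:{t..}. b u (\<lambda>y. \<Phi> u y \<omega>) x) + gff t x \<omega>"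
begin

definition field :: "real \<Rightarrow> 'a \<Rightarrow> site \<Rightarrow> real" where
  "field t \<omega> x = \<Phi> t x \<omega>"

definition noise_incr :: "real \<Rightarrow> real \<Rightarrow> 'a \<Rightarrow> site \<Rightarrow> real" where
  "noise_incr s t \<omega> x = gff s x \<omega> - gff t x \<omega>"

text \<open>Defined as what remains after the noise, so that the decomposition of the increment is
  an identity everywhere; the formula as an integral holds only almost surely.\<close>

definition drift_incr :: "real \<Rightarrow> real \<Rightarrow> 'a \<Rightarrow> site \<Rightarrow> real" where
  "drift_incr s t \<omega> x = field s \<omega> x - field t \<omega> x - noise_incr s t \<omega> x"

text \<open>The drift is frozen at the later time \<open>t\<close>: the field there is measurable
  for the future of \<open>t\<close> and hence independent of the noise on
  \<open>[s, t)\<close>.\<close>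

definition drift_err :: "real \<Rightarrow> real \<Rightarrow> 'a \<Rightarrow> real" where
  "drift_err s t \<omega> = l1 S (\<lambda>x. drift_incr s t \<omega> x - (t - s) * b t (field t \<omega>) x)"

lemma field_measurable [measurable]: "0 \<le> t \<Longrightarrow> x \<in> S \<Longrightarrow> (\<lambda>\<omega>. field t \<omega> x) \<in> borel_measurable M"
  using B.measurable_future_imp_measurable[OF _ adapted] by (simp add: field_def)

lemma noise_incr_measurable [measurable]: "0 \<le> s \<Longrightarrow> 0 \<le> t \<Longrightarrow> x \<in> S \<Longrightarrow> (\<lambda>\<omega>. noise_incr s t \<omega> x) \<in> borel_measurable M"
  unfolding noise_incr_def by (intro borel_measurable_diff gff_measurable)

lemma drift_incr_measurable [measurable]: "0 \<le> s \<Longrightarrow> 0 \<le> t \<Longrightarrow> x \<in> S \<Longrightarrow> (\<lambda>\<omega>. drift_incr s t \<omega> x) \<in> borel_measurable M"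
  unfolding drift_incr_def by (intro borel_measurable_diff field_measurable noise_incr_measurable)

lemma drift_err_measurable [measurable]: "0 \<le> s \<Longrightarrow> 0 \<le> t \<Longrightarrow> drift_err s t \<in> borel_measurable M"
  unfolding drift_err_def[abs_def] l1_def
  by (intro borel_measurable_sum borel_measurable_abs borel_measurable_diff borel_measurable_times borel_measurable_const
      drift_incr_measurable b_measurable field_measurable)

lemma drift_incr_eq:
  assumes "0 \<le> s" "s \<le> t"
  shows "AE \<omega> in M. \<forall>x\<in>S. drift_incr s t \<omega> x = (LBINT u:{s..<t}. b u (field u \<omega>) x)"
proof -
  have "0 \<le> t" using assms by simp
  show ?thesis
    using equation[OF assms(1)] equation[OF \<open>0 \<le> t\<close>] continuous
  proof eventually_elim
    case (elim \<omega>)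
    have f: "field u \<omega> = (\<lambda>y. \<Phi> u y \<omega>)" for u by (simp add: field_def fun_eq_iff)
    show ?case
    proof
      fix x assume x: "x \<in> S"
      have "(LBINT u:{s..}. b u (field u \<omega>) x) - (LBINT u:{t..}. b u (field u \<omega>) x) = (LBINT u:{s..<t}. b u (field u \<omega>) x)"
        by (rule b_integral_bounds(1)[OF x _ assms]) (use elim in \<open>simp add: f\<close>)
      then show "drift_incr s t \<omega> x = (LBINT u:{s..<t}. b u (field u \<omega>) x)"
        using elim(1,2) x unfolding drift_incr_def noise_incr_def f by simp
    qed
  qed
qed

lemma drift_incr_bound:
  assumes "0 \<le> s" "s \<le> t"
  shows "AE \<omega> in M. l1 S (drift_incr s t \<omega>) \<le> real (card S) * (Cb * (t - s))"
  using drift_incr_eq[OF assms] continuous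
proof eventually_elim
  case (elim \<omega>)
  have "l1 S (drift_incr s t \<omega>) \<le> (\<Sum>x\<in>S. Cb * (t - s))"
    unfolding l1_def
  proof (rule sum_mono)
    fix x assume x: "x \<in> S"
    have "\<bar>LBINT u:{s..<t}. b u (field u \<omega>) x\<bar> \<le> Cb * (t - s)"
      by (rule b_integral_bounds(2)[OF x _ assms]) (use elim in \<open>simp add: field_def\<close>)
    then show "\<bar>drift_incr s t \<omega> x\<bar> \<le> Cb * (t - s)" using elim x by simp
  qed
  then show ?case by simp
qed

lemma b_l1_bound: "0 \<le> t \<Longrightarrow> l1 S (b t \<phi>) \<le> real (card S) * Cb"
proof -
  assume t: "0 \<le> t"
  have "l1 S (b t \<phi>) \<le> (\<Sum>x\<in>S. Cb)"
    unfolding l1_def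
  proof (rule sum_mono)
    fix x assume "x \<in> S"
    moreover have "Cb * exp (- t) \<le> Cb * 1" using t Cb_nonneg by (intro mult_left_mono) auto
    ultimately show "\<bar>b t \<phi> x\<bar> \<le> Cb" using b_bound[OF t, of x \<phi>] by simp
  qed
  then show ?thesis by simp
qed

lemma l1_diff_le: "l1 S (\<lambda>x. f x - g x) \<le> l1 S f + l1 S g"
  unfolding l1_def sum.distrib[symmetric] by (intro sum_mono) (rule abs_triangle_ineq4)

lemma l1_scale: "l1 S (\<lambda>x. c * f x) = \<bar>c\<bar> * l1 S f"
  by (simp add: l1_def abs_mult sum_distrib_left)

lemma drift_err_bound:
  assumes "0 \<le> s" "s \<le> t"
  shows "AE \<omega> in M. drift_err s t \<omega> \<le> 2 * (real (card S) * Cb) * (t - s)"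
  using drift_incr_bound[OF assms]
proof eventually_elim
  case (elim \<omega>)
  have "drift_err s t \<omega> \<le> l1 S (drift_incr s t \<omega>) + (t - s) * l1 S (b t (field t \<omega>))"
    unfolding drift_err_def using l1_diff_le[of "drift_incr s t \<omega>" "\<lambda>x. (t - s) * b t (field t \<omega>) x"] assms
    by (simp add: l1_scale)
  also have "\<dots> \<le> real (card S) * (Cb * (t - s)) + (t - s) * (real (card S) * Cb)"
    using assms by (intro add_mono elim mult_left_mono b_l1_bound) auto
  finally show ?case by (simp add: algebra_simps)
qed

lemma drift_err_integrable:
  assumes "0 \<le> s" "s \<le> t" shows "integrable M (drift_err s t)"
proof (rule B.integrable_const_bound[where B="2 * (real (card S) * Cb) * (t - s)"])
  show "AE \<omega> in M. norm (drift_err s t \<omega>) \<le> 2 * (real (card S) * Cb) * (t - s)"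
    using drift_err_bound[OF assms] by eventually_elim (simp add: drift_err_def)
qed (use assms in \<open>simp add: drift_err_measurable\<close>)

lemma field_future: "0 \<le> t \<Longrightarrow> (\<lambda>\<omega>. \<lambda>x\<in>S. field t \<omega> x) \<in> B.future t \<rightarrow>\<^sub>M PiM S (\<lambda>_. borel)"
  unfolding field_def by (intro measurable_restrict adapted)

text \<open>The backward Markov step: the field at \<open>t\<close> belongs to the future of
  \<open>t\<close>, the noise on \<open>[s, t)\<close> is independent of it, and Fubini's theorem
  integrates the noise out.\<close>

lemma expectation_field_noise:
  assumes st: "0 \<le> s" "s \<le> t" and F: "blip S R F"
  shows "B.expectation (\<lambda>\<omega>. F (\<lambda>x. field t \<omega> x + noise_incr s t \<omega> x)) = B.expectation (\<lambda>\<omega>. shift_avg (incr_law s t) F (field t \<omega>))"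
proof -
  have t: "0 \<le> t" using st by simp
  interpret I: prob_PiM "incr_law s t" S by (rule prob_PiM_incr[OF st])
  let ?X = "\<lambda>\<omega>. \<lambda>x\<in>S. field t \<omega> x" and ?Z = "\<lambda>\<omega>. \<lambda>x\<in>S. gff s x \<omega> - gff t x \<omega>"
  let ?P = "PiM S (\<lambda>_. borel :: real measure)"
  have "B.indep_var ?P ?X ?P ?Z" by (rule indep_increment[OF st field_future[OF t]])
  then have X[measurable]: "?X \<in> M \<rightarrow>\<^sub>M ?P" and Z[measurable]: "?Z \<in> M \<rightarrow>\<^sub>M ?P"
    and d: "distr M ?P ?X \<Otimes>\<^sub>M distr M ?P ?Z = distr M (?P \<Otimes>\<^sub>M ?P) (\<lambda>\<omega>. (?X \<omega>, ?Z \<omega>))"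
    unfolding B.indep_var_distribution_eq by auto
  interpret X: prob_space "distr M ?P ?X" by (rule B.prob_space_distr[OF X])
  interpret XZ: pair_prob_space "distr M ?P ?X" "incr_law s t" ..
  have c: "(\<lambda>p. fst p x) \<in> borel_measurable (distr M ?P ?X \<Otimes>\<^sub>M incr_law s t)" "(\<lambda>p. snd p x) \<in> borel_measurable (distr M ?P ?X \<Otimes>\<^sub>M incr_law s t)"
    if "x \<in> S" for x
  proof -
    have "(\<lambda>\<zeta>. \<zeta> x) \<in> borel_measurable (distr M ?P ?X)"
      by (rule measurable_component_borel[OF _ that]) simp
    from measurable_compose[OF measurable_fst this] show "(\<lambda>p. fst p x) \<in> borel_measurable (distr M ?P ?X \<Otimes>\<^sub>M incr_law s t)" .
    from measurable_compose[OF measurable_snd I.comp_measurable[OF that]] show "(\<lambda>p. snd p x) \<in> borel_measurable (distr M ?P ?X \<Otimes>\<^sub>M incr_law s t)" .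
  qed
  have c': "(\<lambda>p. fst p x) \<in> borel_measurable (?P \<Otimes>\<^sub>M ?P)" "(\<lambda>p. snd p x) \<in> borel_measurable (?P \<Otimes>\<^sub>M ?P)"
    if "x \<in> S" for x
    using measurable_compose[OF measurable_fst measurable_component_borel[OF refl that]]
      measurable_compose[OF measurable_snd measurable_component_borel[OF refl that]] by auto
  have "B.expectation (\<lambda>\<omega>. F (\<lambda>x. field t \<omega> x + noise_incr s t \<omega> x)) = (\<integral>\<omega>. F (\<lambda>x. fst (?X \<omega>, ?Z \<omega>) x + snd (?X \<omega>, ?Z \<omega>) x) \<partial>M)"
    by (intro Bochner_Integration.integral_cong refl blip_cong[OF F]) (simp add: noise_incr_def)
  also have "\<dots> = (\<integral>p. F (\<lambda>x. fst p x + snd p x) \<partial>distr M (?P \<Otimes>\<^sub>M ?P) (\<lambda>\<omega>. (?X \<omega>, ?Z \<omega>)))"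
    by (rule integral_distr[symmetric, OF measurable_Pair[OF X Z]]) (intro blip_measurable[OF F] borel_measurable_add c')
  also have "\<dots> = (\<integral>p. F (\<lambda>x. fst p x + snd p x) \<partial>(distr M ?P ?X \<Otimes>\<^sub>M incr_law s t))"
    unfolding d[symmetric] incr_law_def ..
  also have "\<dots> = (\<integral>\<xi>. \<integral>\<zeta>. F (\<lambda>x. \<xi> x + \<zeta> x) \<partial>incr_law s t \<partial>distr M ?P ?X)"
  proof (subst XZ.integral_fst'[symmetric])
    show "integrable (distr M ?P ?X \<Otimes>\<^sub>M incr_law s t) (\<lambda>p. F (\<lambda>x. fst p x + snd p x))"
    proof (rule XZ.integrable_const_bound[where B=R])
      show "(\<lambda>p. F (\<lambda>x. fst p x + snd p x)) \<in> borel_measurable (distr M ?P ?X \<Otimes>\<^sub>M incr_law s t)"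
        by (intro blip_measurable[OF F] borel_measurable_add c)
    qed (simp add: blipD(1)[OF F])
  qed simp
  also have "\<dots> = (\<integral>\<xi>. shift_avg (incr_law s t) F \<xi> \<partial>distr M ?P ?X)" by (simp add: shift_avg_def)
  also have "\<dots> = B.expectation (\<lambda>\<omega>. shift_avg (incr_law s t) F (?X \<omega>))"
    by (rule integral_distr[OF X]) (rule blip_measurable[OF I.blip_shift_avg[OF F]], rule measurable_component_borel[OF refl])
  also have "\<dots> = B.expectation (\<lambda>\<omega>. shift_avg (incr_law s t) F (field t \<omega>))"
    by (intro Bochner_Integration.integral_cong refl blip_cong[OF I.blip_shift_avg[OF F]]) simp
  finally show ?thesis .
qed

text \<open>In this order: the Taylor remainder of the drift displacement, the change of the
  gradient caused by the noise, and the error of \<open>renormalised_step\<close>.\<close>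

definition C3 :: "real \<Rightarrow> real" where
  "C3 R = R * (real (card S) * Cb)\<^sup>2 + R * (real (card S) * Cb) * C1 + C2 R"

text \<open>The drift is expanded pathwise around field plus noise; afterwards the noise is averaged
  and \<open>renormalised_step\<close> applies. The error of freezing the drift stays explicit,
  since it has no rate for a single step and is small only when summed over a mesh.\<close>

lemma step_expectation:
  assumes st: "0 \<le> s" "s < t" "t - s \<le> 1" and F: "C11 S R F F'" and LR: "L \<le> R"
  defines "Ft \<equiv> \<lambda>\<phi>. shift_avg (incr_law s t) (\<lambda>\<phi>. F \<phi> * U s \<phi>) \<phi> / U t \<phi>"
  shows "\<bar>B.expectation (\<lambda>\<omega>. F (field s \<omega>)) - B.expectation (\<lambda>\<omega>. Ft (field t \<omega>))\<bar>
    \<le> C3 R * ((t - s) * sqrt (t - s)) + R * B.expectation (drift_err s t)"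
proof -
  have t: "0 \<le> t" and st': "s \<le> t" using st by auto
  interpret I: prob_PiM "incr_law s t" S by (rule prob_PiM_incr[OF st(1) st'])
  define h where "h = t - s"
  have h: "0 < h" "h \<le> 1" using st by (auto simp: h_def)
  have R: "0 \<le> R" by (rule C11D(4)[OF F])
  note Fb = C11_blip[OF F]
  \<comment> \<open>Almost sure bound for the displacement by the drift during the step.\<close>
  define d where "d = real (card S) * (Cb * h)"
  have d: "0 \<le> d" using h Cb_nonneg by (simp add: d_def)
  define G where "G \<phi> = h * (\<Sum>x\<in>S. F' x \<phi> * b t \<phi> x)" for \<phi>
  let ?X = "field t" and ?Z = "noise_incr s t" and ?D = "drift_incr s t"
  let ?XZ = "\<lambda>\<omega> x. ?X \<omega> x + ?Z \<omega> x"
  have XZm: "(\<lambda>\<omega>. ?XZ \<omega> x) \<in> borel_measurable M" if "x \<in> S" for x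
    using that st t by (intro borel_measurable_add field_measurable noise_incr_measurable)
  have int: "integrable M (\<lambda>\<omega>. f (Y \<omega>))" if "blip S R' f" "\<And>x. x \<in> S \<Longrightarrow> (\<lambda>\<omega>. Y \<omega> x) \<in> borel_measurable M" for f R' Y
    by (intro B.integrable_const_bound[where B=R'] blip_measurable[OF that]) (simp add: blipD(1)[OF that(1)])
  have i1: "integrable M (\<lambda>\<omega>. F (field s \<omega>))" by (rule int[OF Fb]) (use st in measurable)
  have i2: "integrable M (\<lambda>\<omega>. F (?XZ \<omega>))" by (rule int[OF Fb XZm])
  have i3: "integrable M (\<lambda>\<omega>. shift_avg (incr_law s t) F (?X \<omega>))" by (rule int[OF I.blip_shift_avg[OF Fb]]) (use t in measurable)
  have Gm: "(\<lambda>\<omega>. G (?X \<omega>)) \<in> borel_measurable M"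
    unfolding G_def
    by (intro borel_measurable_times borel_measurable_const borel_measurable_sum b_measurable[OF t] field_measurable t
        blip_measurable[OF C11D(2)[OF F]])
  have Gb: "\<bar>G \<phi>\<bar> \<le> h * (R * (real (card S) * Cb))" for \<phi>
  proof -
    have "\<bar>\<Sum>x\<in>S. F' x \<phi> * b t \<phi> x\<bar> \<le> R * l1 S (b t \<phi>)" by (rule C11_gradient_le[OF F])
    also have "\<dots> \<le> R * (real (card S) * Cb)" by (intro mult_left_mono b_l1_bound t R)
    finally show ?thesis using h by (simp add: G_def abs_mult)
  qed
  have i4: "integrable M (\<lambda>\<omega>. G (?X \<omega>))"
    by (rule B.integrable_const_bound[OF _ Gm]) (use Gb in \<open>simp, blast\<close>)
  have i5: "integrable M (drift_err s t)" by (rule drift_err_integrable[OF st(1) st'])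
  have restr: "l1 S (\<lambda>x\<in>S. gff s x \<omega> - gff t x \<omega>) = l1 S (?Z \<omega>)" for \<omega>
    by (simp add: l1_def noise_incr_def)
  have Zm: "(\<lambda>\<omega>. \<lambda>x\<in>S. gff s x \<omega> - gff t x \<omega>) \<in> M \<rightarrow>\<^sub>M PiM S (\<lambda>_. borel)"
    using st t by (intro measurable_restrict borel_measurable_diff gff_measurable)
  have lm: "l1 S \<in> borel_measurable (PiM S (\<lambda>_. borel))" unfolding l1_def[abs_def] by measurable
  have i6: "integrable M (\<lambda>\<omega>. l1 S (?Z \<omega>))"
    using incr_moments(1)[OF st(1,2)] unfolding incr_law_def integrable_distr_eq[OF Zm lm] restr .
  have e6: "B.expectation (\<lambda>\<omega>. l1 S (?Z \<omega>)) \<le> C1 * sqrt h"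
    using incr_moments(5)[OF st(1,2)] unfolding incr_law_def integral_distr[OF Zm lm] restr h_def .
  have FU: "C11 S (6 * (R * L)) (\<lambda>\<phi>. F \<phi> * U s \<phi>) (\<lambda>x \<phi>. F' x \<phi> * U s \<phi> + F \<phi> * U' s x \<phi>)"
    by (rule C11_mult[OF F C11_U[OF st(1)]])
  have i7: "integrable M (\<lambda>\<omega>. Ft (?X \<omega>))"
  proof (rule B.integrable_const_bound[where B="2 * (6 * (R * L)) / \<kappa>"])
    show "(\<lambda>\<omega>. Ft (?X \<omega>)) \<in> borel_measurable M"
      unfolding Ft_def
      by (intro borel_measurable_divide blip_measurable[OF I.blip_shift_avg[OF C11_blip[OF FU]]] blip_measurable[OF C11_blip[OF C11_U[OF t]]] field_measurable t)
    have "\<bar>Ft \<phi>\<bar> \<le> 2 * (6 * (R * L)) / \<kappa>" for \<phi>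
      using blipD(1)[OF I.blip_shift_avg[OF C11_blip[OF FU]], of \<phi>] U_pos[OF t, of \<phi>] U_ge[OF t, of \<phi>] kappa(1) R L_nonneg
      unfolding Ft_def abs_divide by (intro frac_le) auto
    then show "AE \<omega> in M. norm (Ft (?X \<omega>)) \<le> 2 * (6 * (R * L)) / \<kappa>" by simp
  qed
  have a1: "\<bar>B.expectation (\<lambda>\<omega>. F (field s \<omega>)) - (B.expectation (\<lambda>\<omega>. F (?XZ \<omega>)) + B.expectation (\<lambda>\<omega>. G (?X \<omega>)))\<bar>
     \<le> R * d\<^sup>2 + R * d * (C1 * sqrt h) + R * B.expectation (drift_err s t)"
  proof -
    have eq: "B.expectation (\<lambda>\<omega>. F (field s \<omega>)) - (B.expectation (\<lambda>\<omega>. F (?XZ \<omega>)) + B.expectation (\<lambda>\<omega>. G (?X \<omega>)))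
       = B.expectation (\<lambda>\<omega>. F (field s \<omega>) - (F (?XZ \<omega>) + G (?X \<omega>)))"
      using i1 i2 i4 by simp
    have "\<bar>B.expectation (\<lambda>\<omega>. F (field s \<omega>)) - (B.expectation (\<lambda>\<omega>. F (?XZ \<omega>)) + B.expectation (\<lambda>\<omega>. G (?X \<omega>)))\<bar>
       \<le> B.expectation (\<lambda>\<omega>. \<bar>F (field s \<omega>) - (F (?XZ \<omega>) + G (?X \<omega>))\<bar>)"
      unfolding eq by (rule integral_abs_bound)
    also have "\<dots> \<le> B.expectation (\<lambda>\<omega>. R * d\<^sup>2 + R * d * l1 S (?Z \<omega>) + R * drift_err s t \<omega>)"
    proof (rule integral_mono_AE)
      show "integrable M (\<lambda>\<omega>. \<bar>F (field s \<omega>) - (F (?XZ \<omega>) + G (?X \<omega>))\<bar>)" using i1 i2 i4 by auto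
      show "integrable M (\<lambda>\<omega>. R * d\<^sup>2 + R * d * l1 S (?Z \<omega>) + R * drift_err s t \<omega>)" using i5 i6 by auto
      show "AE \<omega> in M. \<bar>F (field s \<omega>) - (F (?XZ \<omega>) + G (?X \<omega>))\<bar> \<le> R * d\<^sup>2 + R * d * l1 S (?Z \<omega>) + R * drift_err s t \<omega>"
        using drift_incr_bound[OF st(1) st']
      proof eventually_elim
        case (elim \<omega>)
        then have Dd: "l1 S (?D \<omega>) \<le> d" by (simp add: d_def h_def)
        have D: "field s \<omega> x - ?XZ \<omega> x = ?D \<omega> x" for x by (simp add: drift_incr_def)
        have "\<bar>F (field s \<omega>) - F (?XZ \<omega>) - (\<Sum>x\<in>S. F' x (?XZ \<omega>) * ?D \<omega> x)\<bar> \<le> R * (l1 S (?D \<omega>))\<^sup>2"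
          using C11D(3)[OF F, of "field s \<omega>" "?XZ \<omega>"] unfolding D .
        also have "\<dots> \<le> R * d\<^sup>2" using Dd R by (intro mult_left_mono power_mono) auto
        finally have p1: "\<bar>F (field s \<omega>) - F (?XZ \<omega>) - (\<Sum>x\<in>S. F' x (?XZ \<omega>) * ?D \<omega> x)\<bar> \<le> R * d\<^sup>2" .
        have "\<bar>\<Sum>x\<in>S. (F' x (?XZ \<omega>) - F' x (?X \<omega>)) * ?D \<omega> x\<bar> \<le> (R * l1 S (?Z \<omega>)) * l1 S (?D \<omega>)"
        proof (rule abs_sum_mult_le_l1)
          fix x assume "x \<in> S"
          from blipD(2)[OF C11D(2)[OF F this], of "?XZ \<omega>" "?X \<omega>"]
          show "\<bar>F' x (?XZ \<omega>) - F' x (?X \<omega>)\<bar> \<le> R * l1 S (?Z \<omega>)" by (simp add: l1_def)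
        qed
        also have "\<dots> \<le> (R * l1 S (?Z \<omega>)) * d" using Dd R by (intro mult_left_mono) auto
        finally have p2: "\<bar>\<Sum>x\<in>S. (F' x (?XZ \<omega>) - F' x (?X \<omega>)) * ?D \<omega> x\<bar> \<le> R * d * l1 S (?Z \<omega>)" by (simp add: mult_ac)
        have p3: "\<bar>\<Sum>x\<in>S. F' x (?X \<omega>) * (?D \<omega> x - h * b t (?X \<omega>) x)\<bar> \<le> R * drift_err s t \<omega>"
          unfolding drift_err_def h_def by (rule C11_gradient_le[OF F])
        \<comment> \<open>Three errors: the Taylor remainder in the drift, the gradient moved from
          field plus noise back to the field, and the drift replaced by its frozen value.\<close>
        have "F (field s \<omega>) - (F (?XZ \<omega>) + G (?X \<omega>)) = (F (field s \<omega>) - F (?XZ \<omega>) - (\<Sum>x\<in>S. F' x (?XZ \<omega>) * ?D \<omega> x))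
          + (\<Sum>x\<in>S. (F' x (?XZ \<omega>) - F' x (?X \<omega>)) * ?D \<omega> x) + (\<Sum>x\<in>S. F' x (?X \<omega>) * (?D \<omega> x - h * b t (?X \<omega>) x))"
          unfolding G_def by (simp add: left_diff_distrib right_diff_distrib sum_subtractf sum_distrib_left mult_ac)
        then show ?case using p1 p2 p3 by linarith
      qed
    qed
    also have "\<dots> = R * d\<^sup>2 + R * d * B.expectation (\<lambda>\<omega>. l1 S (?Z \<omega>)) + R * B.expectation (drift_err s t)"
      using i5 i6 by (simp add: B.prob_space)
    also have "\<dots> \<le> R * d\<^sup>2 + R * d * (C1 * sqrt h) + R * B.expectation (drift_err s t)"
      using R d by (intro add_mono mult_left_mono e6) auto
    finally show ?thesis .
  qed
  \<comment> \<open>After averaging over the noise, the integrand is a function of the field at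
    \<open>t\<close> alone, and \<open>renormalised_step\<close> bounds it at every
    configuration.\<close>
  have a2: "\<bar>(B.expectation (\<lambda>\<omega>. F (?XZ \<omega>)) + B.expectation (\<lambda>\<omega>. G (?X \<omega>))) - B.expectation (\<lambda>\<omega>. Ft (?X \<omega>))\<bar> \<le> C2 R * (h * sqrt h)"
  proof -
    have eq: "(B.expectation (\<lambda>\<omega>. F (?XZ \<omega>)) + B.expectation (\<lambda>\<omega>. G (?X \<omega>))) - B.expectation (\<lambda>\<omega>. Ft (?X \<omega>))
       = B.expectation (\<lambda>\<omega>. shift_avg (incr_law s t) F (?X \<omega>) + G (?X \<omega>) - Ft (?X \<omega>))"
      unfolding expectation_field_noise[OF st(1) st' Fb] using i3 i4 i7 by simp
    have "\<bar>(B.expectation (\<lambda>\<omega>. F (?XZ \<omega>)) + B.expectation (\<lambda>\<omega>. G (?X \<omega>))) - B.expectation (\<lambda>\<omega>. Ft (?X \<omega>))\<bar>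
       \<le> B.expectation (\<lambda>\<omega>. \<bar>shift_avg (incr_law s t) F (?X \<omega>) + G (?X \<omega>) - Ft (?X \<omega>)\<bar>)"
      unfolding eq by (rule integral_abs_bound)
    also have "\<dots> \<le> B.expectation (\<lambda>\<omega>. C2 R * (h * sqrt h))"
    proof (rule integral_mono)
      show "integrable M (\<lambda>\<omega>. \<bar>shift_avg (incr_law s t) F (?X \<omega>) + G (?X \<omega>) - Ft (?X \<omega>)\<bar>)" using i3 i4 i7 by auto
      show "\<bar>shift_avg (incr_law s t) F (?X \<omega>) + G (?X \<omega>) - Ft (?X \<omega>)\<bar> \<le> C2 R * (h * sqrt h)" for \<omega>
        unfolding G_def Ft_def h_def by (rule renormalised_step[OF st F LR])
    qed simp
    finally show ?thesis by (simp add: B.prob_space)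
  qed
  have sh: "h * h \<le> h * sqrt h"
  proof -
    have "h = sqrt h * sqrt h" using h by simp
    also have "\<dots> \<le> 1 * sqrt h" using h by (intro mult_right_mono) auto
    finally show ?thesis using h by (intro mult_left_mono) auto
  qed
  have "R * d\<^sup>2 = R * (real (card S) * Cb)\<^sup>2 * (h * h)" by (simp add: d_def power2_eq_square mult_ac)
  also have "\<dots> \<le> R * (real (card S) * Cb)\<^sup>2 * (h * sqrt h)" using R by (intro mult_left_mono sh) auto
  finally have a3: "R * d\<^sup>2 \<le> R * (real (card S) * Cb)\<^sup>2 * (h * sqrt h)" .
  have a4: "R * d * (C1 * sqrt h) = R * (real (card S) * Cb) * C1 * (h * sqrt h)" by (simp add: d_def mult_ac)
  have "C3 R * (h * sqrt h) = R * (real (card S) * Cb)\<^sup>2 * (h * sqrt h) + R * (real (card S) * Cb) * C1 * (h * sqrt h) + C2 R * (h * sqrt h)"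
    unfolding C3_def by (simp only: distrib_right)
  then show ?thesis unfolding h_def[symmetric] using a1 a2 a3 a4 by linarith
qed

end

section \<open>Conservation of the quotient and its value at both ends\<close>

context renormalised_sde
begin

definition Fq :: "((site \<Rightarrow> real) \<Rightarrow> real) \<Rightarrow> real \<Rightarrow> (site \<Rightarrow> real) \<Rightarrow> real" where
  "Fq H t \<phi> = shift_avg (incr_law 0 t) H \<phi> / U t \<phi>"

text \<open>One constant serves all times, because averaging preserves the class constants and the
  lower bound \<open>\<kappa>\<close>. The maximum with \<open>L\<close> meets the requirement of
  \<open>step_expectation\<close>.\<close>

lemma Fq_C11:
  assumes H: "C11 S Q H H'"
  obtains R where "L \<le> R" "\<And>t. 0 \<le> t \<Longrightarrow> \<exists>F'. C11 S R (Fq H t) F'"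
proof -
  define R where "R = max L (6 * (Q * (1 / \<kappa> + L / \<kappa>\<^sup>2 + 4 * L\<^sup>2 / \<kappa> ^ 3)))"
  have "\<exists>F'. C11 S R (Fq H t) F'" if t: "0 \<le> t" for t
  proof -
    have "C11 S Q (shift_avg (incr_law 0 t) H) (\<lambda>x. shift_avg (incr_law 0 t) (H' x))"
      by (rule prob_PiM.C11_shift_avg[OF prob_PiM_incr H]) (use t in auto)
    from C11_mult[OF this C11_inverse[OF C11_U[OF t] kappa(1) U_ge[OF t]]]
    obtain F' where "C11 S (6 * (Q * (1 / \<kappa> + L / \<kappa>\<^sup>2 + 4 * L\<^sup>2 / \<kappa> ^ 3))) (\<lambda>\<phi>. shift_avg (incr_law 0 t) H \<phi> * (1 / U t \<phi>)) F'" by blast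
    then have "C11 S (6 * (Q * (1 / \<kappa> + L / \<kappa>\<^sup>2 + 4 * L\<^sup>2 / \<kappa> ^ 3))) (Fq H t) F'"
      by (simp add: Fq_def[abs_def])
    then show ?thesis using C11_mono unfolding R_def by (meson max.cobounded2)
  qed
  moreover have "L \<le> R" by (simp add: R_def)
  ultimately show ?thesis using that by blast
qed

text \<open>For \<open>n = 0\<close> the division by zero makes the mesh identically 0, which is
  harmless since sums over it are empty.\<close>

definition mesh :: "real \<Rightarrow> nat \<Rightarrow> nat \<Rightarrow> real" where
  "mesh T n i = real i * (T / real n)"

lemma mesh_props:
  assumes "T > 0"
  shows "0 \<le> mesh T n i" "mesh T n i \<le> mesh T n (Suc i)" "mesh T n (Suc i) - mesh T n i = T / real n"
    and "n > 0 \<Longrightarrow> i < n \<Longrightarrow> mesh T n (Suc i) \<le> T" "n > 0 \<Longrightarrow> mesh T n i < mesh T n (Suc i)"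
proof -
  show "0 \<le> mesh T n i" "mesh T n i \<le> mesh T n (Suc i)" "mesh T n (Suc i) - mesh T n i = T / real n"
    using assms by (simp_all add: mesh_def distrib_right add_divide_distrib)
  show "n > 0 \<Longrightarrow> mesh T n i < mesh T n (Suc i)" using assms by (simp add: mesh_def distrib_right add_divide_distrib)
  assume n: "n > 0" "i < n"
  then have "real (Suc i) * (T / real n) \<le> real n * (T / real n)" using assms by (intro mult_right_mono) auto
  then show "mesh T n (Suc i) \<le> T" using n by (simp add: mesh_def)
qed

text \<open>Along a continuous path the drift is uniformly continuous on \<open>[0, T]\<close>, so
  the Riemann sums converge pathwise, without a rate. The bounded drift gives a constant majorant,
  and dominated convergence transfers this to expectations.\<close>

lemma drift_err_sum_tendsto_zero:
  assumes T: "T > 0"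
  shows "(\<lambda>n. \<Sum>i<n. B.expectation (drift_err (mesh T n i) (mesh T n (Suc i)))) \<longlonglongrightarrow> 0"
proof -
  let ?f = "\<lambda>n \<omega>. \<Sum>i<n. drift_err (mesh T n i) (mesh T n (Suc i)) \<omega>"
  note mp = mesh_props[OF T]
  let ?B = "2 * (real (card S) * Cb) * T"
  \<comment> \<open>Only countably many mesh points occur, so one null set serves all steps of all
    meshes.\<close>
  have D: "AE \<omega> in M. \<forall>n i. \<forall>x\<in>S. drift_incr (mesh T n i) (mesh T n (Suc i)) \<omega> x = (LBINT u:{mesh T n i..<mesh T n (Suc i)}. b u (field u \<omega>) x)"
    unfolding AE_all_countable by (intro allI drift_incr_eq mp)
  have "(\<lambda>n. integral\<^sup>L M (?f n)) \<longlonglongrightarrow> integral\<^sup>L M (\<lambda>_. 0 :: real)"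
  proof (rule integral_dominated_convergence[where w="\<lambda>_. ?B"])
    show "?f n \<in> borel_measurable M" for n
      by (intro borel_measurable_sum drift_err_measurable mp)
    show "AE \<omega> in M. norm (?f n \<omega>) \<le> ?B" for n
    proof -
      have "AE \<omega> in M. \<forall>i. drift_err (mesh T n i) (mesh T n (Suc i)) \<omega> \<le> 2 * (real (card S) * Cb) * (mesh T n (Suc i) - mesh T n i)"
        unfolding AE_all_countable by (intro allI drift_err_bound mp)
      then show ?thesis
      proof eventually_elim
        case (elim \<omega>)
        have "?f n \<omega> \<le> (\<Sum>i<n. 2 * (real (card S) * Cb) * (T / real n))"
          using elim by (intro sum_mono) (simp add: mp(3))
        also have "\<dots> \<le> ?B" using T Cb_nonneg by (cases "n = 0") auto
        finally have "?f n \<omega> \<le> ?B" .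
        moreover have "0 \<le> ?f n \<omega>" by (intro sum_nonneg) (simp add: drift_err_def)
        ultimately show ?case by simp
      qed
    qed
    show "AE \<omega> in M. (\<lambda>n. ?f n \<omega>) \<longlonglongrightarrow> 0"
      using D continuous
    proof eventually_elim
      case (elim \<omega>)
      have cont: "continuous_on {0..} (\<lambda>u. field u \<omega> x)" if "x \<in> S" for x
        using elim(2) that by (simp add: field_def)
      show ?case
      proof (rule LIMSEQ_I)
        fix r :: real assume r: "r > 0"
        \<comment> \<open>The steps have total length \<open>T\<close> and every site errs by at
          most \<open>\<delta>\<close> per unit of time, so the sum stays below
          \<open>r / 2\<close>.\<close>
        define \<delta> where "\<delta> = r / (2 * (real (card S) + 1) * T)"
        have \<delta>: "\<delta> > 0" using r T by (simp add: \<delta>_def)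
        have "\<forall>x\<in>S. \<exists>\<eta>>0. \<forall>u\<in>{0..T}. \<forall>v\<in>{0..T}. dist v u < \<eta> \<longrightarrow> dist (b v (field v \<omega>) x) (b u (field u \<omega>) x) < \<delta>"
        proof
          fix x assume x: "x \<in> S"
          have "continuous_on {0..T} (\<lambda>u. b u (field u \<omega>) x)"
            by (rule continuous_on_subset[OF b_continuous[OF x cont]]) auto
          then have "uniformly_continuous_on {0..T} (\<lambda>u. b u (field u \<omega>) x)"
            by (rule compact_uniformly_continuous) simp
          then show "\<exists>\<eta>>0. \<forall>u\<in>{0..T}. \<forall>v\<in>{0..T}. dist v u < \<eta> \<longrightarrow> dist (b v (field v \<omega>) x) (b u (field u \<omega>) x) < \<delta>"
            using \<delta> unfolding uniformly_continuous_on_def by blast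
        qed
        from bchoice[OF this] obtain e where e: "\<And>x. x \<in> S \<Longrightarrow> e x > 0"
          "\<And>x u v. x \<in> S \<Longrightarrow> u \<in> {0..T} \<Longrightarrow> v \<in> {0..T} \<Longrightarrow> dist v u < e x \<Longrightarrow> dist (b v (field v \<omega>) x) (b u (field u \<omega>) x) < \<delta>" by blast
        \<comment> \<open>A common modulus for the finitely many sites; inserting 1 makes the
          minimum well defined in any case.\<close>
        define \<eta> where "\<eta> = Min (insert 1 (e ` S))"
        have \<eta>: "\<eta> > 0" "\<And>x. x \<in> S \<Longrightarrow> \<eta> \<le> e x" using e(1) by (auto simp: \<eta>_def)
        obtain N where N: "real N > T / \<eta>" using reals_Archimedean2 by blast
        show "\<exists>no. \<forall>n\<ge>no. norm (?f n \<omega> - 0) < r"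
        proof (intro exI[of _ "Suc N"] allI impI)
          fix n assume n: "Suc N \<le> n"
          then have n0: "n > 0" and "real n > T / \<eta>" using N by auto
          then have Tn: "T / real n < \<eta>" using \<eta>(1) by (simp add: field_simps)
          have "drift_err (mesh T n i) (mesh T n (Suc i)) \<omega> \<le> real (card S) * (\<delta> * (T / real n))" if i: "i < n" for i
          proof -
            let ?s = "mesh T n i" and ?t = "mesh T n (Suc i)"
            have "drift_err ?s ?t \<omega> \<le> (\<Sum>x\<in>S. \<delta> * (?t - ?s))"
              unfolding drift_err_def l1_def
            proof (rule sum_mono)
              fix x assume x: "x \<in> S"
              have "\<bar>(LBINT u:{?s..<?t}. b u (field u \<omega>) x) - (?t - ?s) * b ?t (field ?t \<omega>) x\<bar> \<le> \<delta> * (?t - ?s)"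
              proof (rule b_integral_bounds(3)[OF x cont mp(1,2)])
                fix u assume u: "?s \<le> u" "u < ?t"
                have "dist u ?t < \<eta>" using u mp(3)[of n i] Tn by (simp add: dist_real_def)
                moreover have "u \<in> {0..T}" "?t \<in> {0..T}"
                  using u mp(1)[of n i] mp(1)[of n "Suc i"] mp(4)[OF n0 i] by auto
                ultimately have "dist (b u (field u \<omega>) x) (b ?t (field ?t \<omega>) x) < \<delta>"
                  using e(2)[OF x] \<eta>(2)[OF x] by simp
                then show "\<bar>b u (field u \<omega>) x - b ?t (field ?t \<omega>) x\<bar> \<le> \<delta>" by (simp add: dist_real_def)
              qed
              then show "\<bar>drift_incr ?s ?t \<omega> x - (?t - ?s) * b ?t (field ?t \<omega>) x\<bar> \<le> \<delta> * (?t - ?s)"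
                using elim(1) x by simp
            qed
            then show ?thesis by (simp add: mp(3))
          qed
          then have "?f n \<omega> \<le> (\<Sum>i<n. real (card S) * (\<delta> * (T / real n)))" by (intro sum_mono) auto
          also have "\<dots> = real (card S) * \<delta> * T" using n0 by simp
          also have "\<dots> \<le> (real (card S) + 1) * \<delta> * T" using \<delta> T by (intro mult_right_mono) auto
          also have "\<dots> = r / 2"
          proof -
            have "r / y * y = r" if "y \<noteq> 0" for y using that by simp
            from this[of "2 * (real (card S) + 1) * T"] have "\<delta> * (2 * (real (card S) + 1) * T) = r"
              unfolding \<delta>_def using T by simp
            then show ?thesis by (simp add: algebra_simps)
          qed
          finally have "?f n \<omega> < r" using r by simp
          moreover have "0 \<le> ?f n \<omega>" by (intro sum_nonneg) (simp add: drift_err_def)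
          ultimately show "norm (?f n \<omega> - 0) < r" by simp
        qed
      qed
    qed
  qed simp_all
  moreover have "integral\<^sup>L M (?f n) = (\<Sum>i<n. B.expectation (drift_err (mesh T n i) (mesh T n (Suc i))))" for n
    by (intro Bochner_Integration.integral_sum drift_err_integrable mp)
  ultimately show ?thesis by simp
qed

text \<open>The difference of the two expectations does not depend on the mesh, whereas its bound
  \<open>C3 R * (T * sqrt (T / n))\<close> plus the summed drift errors tends to 0.\<close>

lemma expectation_Fq_conserved:
  assumes H: "C11 S Q H H'" and T: "T > 0"
  shows "B.expectation (\<lambda>\<omega>. Fq H 0 (field 0 \<omega>)) = B.expectation (\<lambda>\<omega>. Fq H T (field T \<omega>))"
proof -
  obtain R where R: "L \<le> R" "\<And>t. 0 \<le> t \<Longrightarrow> \<exists>F'. C11 S R (Fq H t) F'" using Fq_C11[OF H] by blast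
  define E where "E t = B.expectation (\<lambda>\<omega>. Fq H t (field t \<omega>))" for t
  note mp = mesh_props[OF T]
  have step: "\<bar>E s - E t\<bar> \<le> C3 R * ((t - s) * sqrt (t - s)) + R * B.expectation (drift_err s t)"
    if st: "0 \<le> s" "s < t" "t - s \<le> 1" for s t
  proof -
    obtain F' where F': "C11 S R (Fq H s) F'" using R(2)[OF st(1)] by blast
    \<comment> \<open>The quotient times its denominator is the averaged numerator; by the flow its
      further average is the numerator at \<open>t\<close>, so \<open>step_expectation\<close>
      compares consecutive values of \<open>Fq H\<close>.\<close>
    have 1: "(\<lambda>\<phi>. Fq H s \<phi> * U s \<phi>) = shift_avg (incr_law 0 s) H"
      using U_pos[OF st(1)] by (simp add: Fq_def fun_eq_iff less_imp_neq[THEN not_sym])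
    have 2: "shift_avg (incr_law s t) (\<lambda>\<phi>. Fq H s \<phi> * U s \<phi>) \<phi> / U t \<phi> = Fq H t \<phi>" for \<phi>
      unfolding 1 using shift_avg_flow[OF st(1) less_imp_le[OF st(2)] C11_blip[OF H]] by (simp add: Fq_def)
    show ?thesis using step_expectation[OF st F' R(1)] unfolding 2 E_def .
  qed
  have bound: "\<forall>\<^sub>F n in sequentially. \<bar>E 0 - E T\<bar> \<le> C3 R * (T * sqrt (T / real n)) + R * (\<Sum>i<n. B.expectation (drift_err (mesh T n i) (mesh T n (Suc i))))"
  proof -
    obtain N where N: "real N > T" using reals_Archimedean2 by blast
    show ?thesis
      using eventually_ge_at_top[of "Suc N"]
    proof eventually_elim
      case (elim n)
      then have n: "n > 0" "T / real n \<le> 1" using N by auto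
      have m0: "mesh T n 0 = 0" and mn: "mesh T n n = T" using n by (simp_all add: mesh_def)
      have "E T - E 0 = (\<Sum>i<n. E (mesh T n (Suc i)) - E (mesh T n i))"
        using sum_lessThan_telescope[of "\<lambda>i. E (mesh T n i)" n] by (simp only: m0 mn)
      then have "\<bar>E 0 - E T\<bar> \<le> (\<Sum>i<n. \<bar>E (mesh T n (Suc i)) - E (mesh T n i)\<bar>)"
        using sum_abs[of "\<lambda>i. E (mesh T n (Suc i)) - E (mesh T n i)" "{..<n}"] by (simp add: abs_minus_commute)
      also have "\<dots> \<le> (\<Sum>i<n. C3 R * (T / real n * sqrt (T / real n)) + R * B.expectation (drift_err (mesh T n i) (mesh T n (Suc i))))"
      proof (rule sum_mono)
        fix i
        show "\<bar>E (mesh T n (Suc i)) - E (mesh T n i)\<bar> \<le> C3 R * (T / real n * sqrt (T / real n)) + R * B.expectation (drift_err (mesh T n i) (mesh T n (Suc i)))"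
          using step[OF mp(1) mp(5)[OF n(1)]] n(2) unfolding mp(3) by (simp add: abs_minus_commute)
      qed
      also have "\<dots> = C3 R * (T * sqrt (T / real n)) + R * (\<Sum>i<n. B.expectation (drift_err (mesh T n i) (mesh T n (Suc i))))"
        using n by (simp add: sum.distrib sum_distrib_left)
      finally show ?case .
    qed
  qed
  have "(\<lambda>n. T / real n) \<longlonglongrightarrow> 0" by (rule lim_const_over_n)
  then have "(\<lambda>n. C3 R * (T * sqrt (T / real n)) + R * (\<Sum>i<n. B.expectation (drift_err (mesh T n i) (mesh T n (Suc i))))) \<longlonglongrightarrow> C3 R * (T * sqrt 0) + R * 0"
    by (intro tendsto_intros drift_err_sum_tendsto_zero[OF T])
  then have "\<bar>E 0 - E T\<bar> \<le> C3 R * (T * sqrt 0) + R * 0"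
    by (rule tendsto_lowerbound[OF _ bound]) simp
  then show ?thesis by (simp add: E_def)
qed

text \<open>The field at time \<open>t\<close> has covariance of order \<open>exp (- t)\<close>,
  which is the parameter \<open>h\<close> of \<open>l1_moments\<close>. It is also the Gaussian part
  missing between averages over \<open>[0, t)\<close> and over \<open>gauss_density\<close>.\<close>

lemma gff_l1:
  assumes t: "0 \<le> t"
  shows "integrable M (\<lambda>\<omega>. l1 S (\<lambda>x. gff t x \<omega>))" "B.expectation (\<lambda>\<omega>. l1 S (\<lambda>x. gff t x \<omega>)) \<le> C1 * sqrt (exp (- t))"
    and "blip S R f \<Longrightarrow> \<bar>shift_avg gauss_density f \<phi> - shift_avg (incr_law 0 t) f \<phi>\<bar> \<le> R * (C1 * sqrt (exp (- t)))"
proof -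
  let ?G = "\<lambda>\<omega>. \<lambda>x\<in>S. gff t x \<omega>"
  let ?g = "distr M (PiM S (\<lambda>_. borel)) ?G"
  have G: "?G \<in> M \<rightarrow>\<^sub>M PiM S (\<lambda>_. borel)" by (intro measurable_restrict gff_measurable t)
  note gauss = gff_gaussian[OF t]
  interpret G: prob_PiM ?g S by (rule prob_PiM_gaussian[OF finite_S gauss])
  have c: "cov_on {t..} x x \<le> 1 / \<epsilon>\<^sup>2 * exp (- t)" if "x \<in> S" for x
    using cov_on_tail[OF t that that] by simp
  have lm: "l1 S \<in> borel_measurable (PiM S (\<lambda>_. borel))" unfolding l1_def[abs_def] by measurable
  have r: "l1 S (?G \<omega>) = l1 S (\<lambda>x. gff t x \<omega>)" for \<omega> by (simp add: l1_def)
  have m: "integrable ?g (l1 S)" "integral\<^sup>L ?g (l1 S) \<le> C1 * sqrt (exp (- t))"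
    using G.l1_moments(1,5)[OF gauss c] unfolding C1_def by auto
  show "integrable M (\<lambda>\<omega>. l1 S (\<lambda>x. gff t x \<omega>))"
    using m(1) unfolding integrable_distr_eq[OF G lm] r .
  show "B.expectation (\<lambda>\<omega>. l1 S (\<lambda>x. gff t x \<omega>)) \<le> C1 * sqrt (exp (- t))"
    using m(2) unfolding integral_distr[OF G lm] r .
  assume f: "blip S R f"
  have "shift_avg ?g (shift_avg (incr_law 0 t) f) = shift_avg gauss_density f"
  proof (rule shift_avg_gaussian_add[OF finite_S incr_law_gaussian gauss gauss_density_gaussian _ f])
    fix x y assume xy: "x \<in> S" "y \<in> S"
    have "{0..<t} \<union> {t..} = {0..}" using t by auto
    moreover have "{0..<t} \<subseteq> {0..}" "{t..} \<subseteq> {0..}" "{0..<t} \<inter> {t..} = {}" using t by auto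
    ultimately show "cov_on {0..} x y = cov_on {0..<t} x y + cov_on {t..} x y"
      using cov_on_Un[of "{0..<t}" "{t..}" x y] xy by simp
  qed (use t in auto)
  then have "\<bar>shift_avg gauss_density f \<phi> - shift_avg (incr_law 0 t) f \<phi>\<bar> \<le> R * integral\<^sup>L ?g (l1 S)"
    using G.shift_avg_diff_le[OF prob_PiM.blip_shift_avg[OF prob_PiM_incr f] m(1), of 0 t \<phi>] t by simp
  also have "\<dots> \<le> R * (C1 * sqrt (exp (- t)))" by (intro mult_left_mono m blipD(3)[OF f])
  finally show "\<bar>shift_avg gauss_density f \<phi> - shift_avg (incr_law 0 t) f \<phi>\<bar> \<le> R * (C1 * sqrt (exp (- t)))" .
qed

lemma field_tail_bound:
  assumes "0 \<le> t"
  shows "AE \<omega> in M. l1 S (field t \<omega>) \<le> real (card S) * (Cb * exp (- t)) + l1 S (\<lambda>x. gff t x \<omega>)"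
  using equation[OF assms] continuous
proof eventually_elim
  case (elim \<omega>)
  have "l1 S (field t \<omega>) \<le> (\<Sum>x\<in>S. Cb * exp (- t) + \<bar>gff t x \<omega>\<bar>)"
    unfolding l1_def
  proof (rule sum_mono)
    fix x assume x: "x \<in> S"
    have "\<bar>LBINT u:{t..}. b u (\<lambda>y. \<Phi> u y \<omega>) x\<bar> \<le> Cb * exp (- t)"
      by (rule b_integral_bounds(4)[OF x _ assms order_refl]) (use elim in simp)
    moreover have "field t \<omega> x = (LBINT u:{t..}. b u (\<lambda>y. \<Phi> u y \<omega>) x) + gff t x \<omega>"
      using elim x unfolding field_def by blast
    ultimately show "\<bar>field t \<omega> x\<bar> \<le> Cb * exp (- t) + \<bar>gff t x \<omega>\<bar>" by linarith
  qed
  then show ?case by (simp add: sum.distrib l1_def)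
qed

text \<open>At time 0 the quotient is \<open>H / U0\<close>. At large times its Lipschitz constant
  is uniform and the field tends to 0 in mean, so the field may be replaced by 0, and the averages
  in the quotient converge to those over \<open>gauss_density\<close>.\<close>

lemma expectation_field_0:
  assumes H: "C11 S Q H H'"
  shows "B.expectation (\<lambda>\<omega>. H (field 0 \<omega>) / U0 (field 0 \<omega>)) = shift_avg gauss_density H (\<lambda>_. 0) / shift_avg gauss_density U0 (\<lambda>_. 0)"
proof -
  obtain R where R: "L \<le> R" "\<And>t. 0 \<le> t \<Longrightarrow> \<exists>F'. C11 S R (Fq H t) F'" using Fq_C11[OF H] by blast
  define E where "E = B.expectation (\<lambda>\<omega>. Fq H 0 (field 0 \<omega>))"
  \<comment> \<open>The increment over the empty interval is identically 0, so averaging over its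
    law changes nothing.\<close>
  have avg0: "shift_avg (incr_law 0 0) f \<phi> = f \<phi>" if f: "blip S R' f" for f R' \<phi>
  proof -
    have z: "(\<lambda>\<omega>. \<lambda>x\<in>S. gff 0 x \<omega> - gff 0 x \<omega>) = (\<lambda>_. \<lambda>x\<in>S. 0)" by simp
    have "shift_avg (incr_law 0 0) f \<phi> = B.expectation (\<lambda>\<omega>. f (\<lambda>x. \<phi> x + (\<lambda>x\<in>S. 0) x))"
      unfolding shift_avg_def incr_law_def z
      by (rule integral_distr, intro measurable_restrict measurable_const, simp, intro blip_measurable[OF f] borel_measurable_add borel_measurable_const measurable_component_borel[OF refl])
    also have "f (\<lambda>x. \<phi> x + (\<lambda>x\<in>S. 0) x) = f \<phi>" by (rule blip_cong[OF f]) simp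
    finally show ?thesis by (simp add: B.prob_space)
  qed
  have E0: "E = B.expectation (\<lambda>\<omega>. H (field 0 \<omega>) / U0 (field 0 \<omega>))"
    unfolding E_def Fq_def U_def avg0[OF C11_blip[OF H]] avg0[OF C11_blip[OF U0]] ..
  \<comment> \<open>Lipschitz constant \<open>2 * R\<close> times the bound for the mean size of the
    field, with its drift part and its Gaussian part.\<close>
  define a where "a t = 2 * R * (real (card S) * (Cb * exp (- t)) + C1 * sqrt (exp (- t)))" for t
  have close: "\<bar>E - Fq H t (\<lambda>_. 0)\<bar> \<le> a t" if t: "t > 0" for t
  proof -
    have t0: "0 \<le> t" using t by simp
    obtain F' where F': "C11 S R (Fq H t) F'" using R(2)[OF t0] by blast
    note Fb = C11_blip[OF F']
    have R0: "0 \<le> 2 * R" by (rule blipD(3)[OF Fb])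
    have i: "integrable M (\<lambda>\<omega>. Fq H t (field t \<omega>))"
      by (intro B.integrable_const_bound[where B="2 * R"] blip_measurable[OF Fb] field_measurable t0) (simp add: blipD(1)[OF Fb])
    have "E = B.expectation (\<lambda>\<omega>. Fq H t (field t \<omega>))" unfolding E_def by (rule expectation_Fq_conserved[OF H t])
    then have eq: "E - Fq H t (\<lambda>_. 0) = B.expectation (\<lambda>\<omega>. Fq H t (field t \<omega>) - Fq H t (\<lambda>_. 0))"
      using i by (simp add: B.prob_space)
    have "\<bar>E - Fq H t (\<lambda>_. 0)\<bar> \<le> B.expectation (\<lambda>\<omega>. \<bar>Fq H t (field t \<omega>) - Fq H t (\<lambda>_. 0)\<bar>)"
      unfolding eq by (rule integral_abs_bound)
    also have "\<dots> \<le> B.expectation (\<lambda>\<omega>. 2 * R * (real (card S) * (Cb * exp (- t)) + l1 S (\<lambda>x. gff t x \<omega>)))"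
    proof (rule integral_mono_AE)
      show "integrable M (\<lambda>\<omega>. \<bar>Fq H t (field t \<omega>) - Fq H t (\<lambda>_. 0)\<bar>)" using i by auto
      show "integrable M (\<lambda>\<omega>. 2 * R * (real (card S) * (Cb * exp (- t)) + l1 S (\<lambda>x. gff t x \<omega>)))" using gff_l1(1)[OF t0] by auto
      show "AE \<omega> in M. \<bar>Fq H t (field t \<omega>) - Fq H t (\<lambda>_. 0)\<bar> \<le> 2 * R * (real (card S) * (Cb * exp (- t)) + l1 S (\<lambda>x. gff t x \<omega>))"
        using field_tail_bound[OF t0]
      proof eventually_elim
        case (elim \<omega>)
        have "\<bar>Fq H t (field t \<omega>) - Fq H t (\<lambda>_. 0)\<bar> \<le> 2 * R * l1 S (field t \<omega>)"
          using blipD(2)[OF Fb, of "field t \<omega>" "\<lambda>_. 0"] by simp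
        also have "\<dots> \<le> 2 * R * (real (card S) * (Cb * exp (- t)) + l1 S (\<lambda>x. gff t x \<omega>))"
          by (rule mult_left_mono[OF elim R0])
        finally show ?case .
      qed
    qed
    also have "\<dots> = 2 * R * (real (card S) * (Cb * exp (- t)) + B.expectation (\<lambda>\<omega>. l1 S (\<lambda>x. gff t x \<omega>)))"
      using gff_l1(1)[OF t0] by (simp add: B.prob_space)
    also have "\<dots> \<le> a t" unfolding a_def by (intro mult_left_mono add_left_mono gff_l1(2)[OF t0] R0)
    finally show ?thesis .
  qed
  have e0: "((\<lambda>t::real. exp (- t)) \<longlongrightarrow> 0) at_top"
    by (rule filterlim_compose[OF exp_at_bot filterlim_uminus_at_bot_at_top])
  have s0: "((\<lambda>t::real. sqrt (exp (- t))) \<longlongrightarrow> 0) at_top"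
    using tendsto_real_sqrt[OF e0] by simp
  have "(a \<longlongrightarrow> 2 * R * (real (card S) * (Cb * 0) + C1 * 0)) at_top"
    unfolding a_def by (intro tendsto_intros e0 s0)
  then have a0: "(a \<longlongrightarrow> 0) at_top" by simp
  have "((\<lambda>t. Fq H t (\<lambda>_. 0) - E) \<longlongrightarrow> 0) at_top"
    by (rule Lim_null_comparison[OF _ a0]) (use eventually_gt_at_top[of 0] in \<open>eventually_elim, use close in \<open>simp add: abs_minus_commute\<close>\<close>)
  then have lim1: "((\<lambda>t. Fq H t (\<lambda>_. 0)) \<longlongrightarrow> E) at_top" by (rule LIM_zero_cancel)
  have avg_lim: "((\<lambda>t. shift_avg (incr_law 0 t) f (\<lambda>_. 0)) \<longlongrightarrow> shift_avg gauss_density f (\<lambda>_. 0)) at_top" if f: "blip S R' f" for f R'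
  proof (rule LIM_zero_cancel, rule Lim_null_comparison)
    show "\<forall>\<^sub>F t in at_top. norm (shift_avg (incr_law 0 t) f (\<lambda>_. 0) - shift_avg gauss_density f (\<lambda>_. 0)) \<le> R' * (C1 * sqrt (exp (- t)))"
      using eventually_ge_at_top[of 0]
    proof eventually_elim
      case (elim t)
      then show ?case using gff_l1(3)[OF _ f, of t "\<lambda>_. 0"] by (simp only: real_norm_def abs_minus_commute)
    qed
    have "((\<lambda>t. R' * (C1 * sqrt (exp (- t)))) \<longlongrightarrow> R' * (C1 * 0)) at_top" by (intro tendsto_intros s0)
    then show "((\<lambda>t. R' * (C1 * sqrt (exp (- t)))) \<longlongrightarrow> 0) at_top" by simp
  qed
  have UG: "shift_avg gauss_density U0 (\<lambda>_. 0) \<ge> \<kappa>"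
    by (rule prob_PiM.shift_avg_ge[OF prob_PiM_gaussian[OF finite_S gauss_density_gaussian] C11_blip[OF U0] kappa(2)])
  have "((\<lambda>t. Fq H t (\<lambda>_. 0)) \<longlongrightarrow> shift_avg gauss_density H (\<lambda>_. 0) / shift_avg gauss_density U0 (\<lambda>_. 0)) at_top"
    unfolding Fq_def U_def
    by (rule tendsto_divide[OF avg_lim[OF C11_blip[OF H]] avg_lim[OF C11_blip[OF U0]]]) (use UG kappa in auto)
  then have "E = shift_avg gauss_density H (\<lambda>_. 0) / shift_avg gauss_density U0 (\<lambda>_. 0)"
    using tendsto_unique[OF _ lim1] by simp
  then show ?thesis unfolding E0 .
qed

end

section \<open>The sine-Gordon field\<close>

lemma C11_const_1: "C11 S 1 (\<lambda>_. 1) (\<lambda>_ _. 0)"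
  by (simp add: C11_def blip_def)

lemma C11_prod:
  assumes "finite T" "\<And>x. x \<in> T \<Longrightarrow> \<exists>K f'. C11 S K (f x) f'"
  shows "\<exists>K f'. C11 S K (\<lambda>\<phi>. \<Prod>x\<in>T. f x \<phi>) f'"
  using assms
proof (induction T)
  case empty
  then show ?case using C11_const_1 by auto
next
  case (insert x T)
  then obtain K f' L g' where "C11 S K (f x) f'" "C11 S L (\<lambda>\<phi>. \<Prod>x\<in>T. f x \<phi>) g'" by (metis insertCI)
  from C11_mult[OF this] show ?case using insert by auto
qed

lemma C11_exp_cos:
  fixes \<kappa> \<gamma> :: real
  assumes S: "finite S" "x \<in> S"
  shows "\<exists>K f'. C11 S K (\<lambda>\<phi>. exp (- (\<kappa> * cos (\<gamma> * \<phi> x)))) f'"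
proof -
  let ?g = "\<lambda>t. exp (- (\<kappa> * cos t))"
  let ?g' = "\<lambda>t. \<kappa> * sin t * exp (- (\<kappa> * cos t))"
  let ?g'' = "\<lambda>t. (\<kappa> * cos t + (\<kappa> * sin t) * (\<kappa> * sin t)) * exp (- (\<kappa> * cos t))"
  let ?B = "(1 + \<bar>\<kappa>\<bar>)\<^sup>2 * exp \<bar>\<kappa>\<bar>"
  have c: "\<bar>\<kappa> * cos t\<bar> \<le> \<bar>\<kappa>\<bar>" "\<bar>\<kappa> * sin t\<bar> \<le> \<bar>\<kappa>\<bar>" for t
    by (simp_all add: abs_mult mult_left_le)
  have e: "exp (- (\<kappa> * cos t)) \<le> exp \<bar>\<kappa>\<bar>" for t using c(1)[of t] by simp
  have k: "1 \<le> (1 + \<bar>\<kappa>\<bar>)\<^sup>2" "\<bar>\<kappa>\<bar> \<le> (1 + \<bar>\<kappa>\<bar>)\<^sup>2" "\<bar>\<kappa>\<bar> + \<bar>\<kappa>\<bar> * \<bar>\<kappa>\<bar> \<le> (1 + \<bar>\<kappa>\<bar>)\<^sup>2"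
    by (simp_all add: power2_eq_square algebra_simps)
  have b: "\<bar>a * exp (- (\<kappa> * cos t))\<bar> \<le> ?B" if "\<bar>a\<bar> \<le> (1 + \<bar>\<kappa>\<bar>)\<^sup>2" for a t
    unfolding abs_mult by (intro mult_mono that) (use e in auto)
  have a2: "\<bar>\<kappa> * cos t + (\<kappa> * sin t) * (\<kappa> * sin t)\<bar> \<le> (1 + \<bar>\<kappa>\<bar>)\<^sup>2" for t
  proof -
    have "\<bar>(\<kappa> * sin t) * (\<kappa> * sin t)\<bar> \<le> \<bar>\<kappa>\<bar> * \<bar>\<kappa>\<bar>"
      unfolding abs_mult[of "\<kappa> * sin t"] by (intro mult_mono c) auto
    then show ?thesis using c(1)[of t] k(3) by linarith
  qed
  have "C11 S (?B * (1 + \<bar>\<gamma>\<bar>)\<^sup>2) (\<lambda>\<phi>. ?g (0 + (\<Sum>y\<in>S. (if y = x then \<gamma> else 0) * \<phi> y)))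
     (\<lambda>y \<phi>. (if y = x then \<gamma> else 0) * ?g' (0 + (\<Sum>y\<in>S. (if y = x then \<gamma> else 0) * \<phi> y)))"
  proof (rule C11_linear_compose[where g''="?g''"])
    show "(?g has_real_derivative ?g' t) (at t)" for t by (auto intro!: derivative_eq_intros)
    show "(?g' has_real_derivative ?g'' t) (at t)" for t by (auto intro!: derivative_eq_intros simp: algebra_simps)
    show "\<bar>?g t\<bar> \<le> ?B" for t using b[of 1 t] k(1) by simp
    show "\<bar>?g' t\<bar> \<le> ?B" for t using b[of "\<kappa> * sin t" t] c(2)[of t] k(2) by linarith
    show "\<bar>?g'' t\<bar> \<le> ?B" for t by (rule b[OF a2])
  qed auto
  moreover have "(\<Sum>y\<in>S. (if y = x then \<gamma> else 0) * \<phi> y) = \<gamma> * \<phi> x" for \<phi> :: "_ \<Rightarrow> real"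
    using S by (simp add: if_distrib[of "\<lambda>c. c * _"] sum.delta' cong: if_cong)
  ultimately show ?thesis by (simp only: add_0) blast
qed

text \<open>The phase \<open>\<theta>\<close> lets cosines also represent sines, so real observables
  cover the complex exponentials.\<close>

lemma C11_cos_linear:
  assumes "finite S"
  shows "\<exists>K f'. C11 S K (\<lambda>\<phi>. cos (\<theta> + (\<Sum>x\<in>S. a x * \<phi> x))) f'"
proof -
  have "C11 S (1 * (1 + l1 S a)\<^sup>2) (\<lambda>\<phi>. cos (\<theta> + (\<Sum>x\<in>S. a x * \<phi> x))) (\<lambda>x \<phi>. a x * - sin (\<theta> + (\<Sum>x\<in>S. a x * \<phi> x)))"
    by (rule C11_linear_compose[where g''="\<lambda>t. - cos t"]) (auto intro!: derivative_eq_intros abs_le_l1 assms)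
  then show ?thesis by blast
qed

text \<open>The exponential is a product over sites of functions of one coordinate, each treated by
  \<open>C11_exp_cos\<close>. The cosines are bounded, which gives the positive lower bound.\<close>

lemma v0_potential_C11:
  assumes "finite (sites \<epsilon>)"
  obtains K U' \<kappa> where "C11 (sites \<epsilon>) K (\<lambda>\<phi>. exp (- v0_potential \<epsilon> \<beta> z \<phi>)) U'" "\<kappa> > 0" "\<And>\<phi>. exp (- v0_potential \<epsilon> \<beta> z \<phi>) \<ge> \<kappa>"
proof -
  define k where "k = \<epsilon>\<^sup>2 * (2 * z * \<epsilon> powr (- \<beta> / (4 * pi)))"
  have v: "v0_potential \<epsilon> \<beta> z \<phi> = (\<Sum>x\<in>sites \<epsilon>. k * cos (sqrt \<beta> * \<phi> x))" for \<phi>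
    by (simp add: v0_potential_def k_def sum_distrib_left mult_ac)
  have eq: "(\<lambda>\<phi>. exp (- v0_potential \<epsilon> \<beta> z \<phi>)) = (\<lambda>\<phi>. \<Prod>x\<in>sites \<epsilon>. exp (- (k * cos (sqrt \<beta> * \<phi> x))))"
    unfolding v sum_negf[symmetric] by (rule ext) (rule exp_sum[OF assms])
  have "\<exists>K f'. C11 (sites \<epsilon>) K (\<lambda>\<phi>. \<Prod>x\<in>sites \<epsilon>. exp (- (k * cos (sqrt \<beta> * \<phi> x)))) f'"
    by (rule C11_prod[OF assms]) (rule C11_exp_cos[OF assms])
  then obtain K U' where 1: "C11 (sites \<epsilon>) K (\<lambda>\<phi>. exp (- v0_potential \<epsilon> \<beta> z \<phi>)) U'"
    unfolding eq[symmetric] by blast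
  have "v0_potential \<epsilon> \<beta> z \<phi> \<le> (\<Sum>x\<in>sites \<epsilon>. \<bar>k\<bar>)" for \<phi>
    unfolding v
  proof (rule sum_mono)
    fix x
    have "\<bar>k * cos (sqrt \<beta> * \<phi> x)\<bar> \<le> \<bar>k\<bar>" by (simp add: abs_mult mult_left_le)
    then show "k * cos (sqrt \<beta> * \<phi> x) \<le> \<bar>k\<bar>" by linarith
  qed
  then have "exp (- (\<Sum>x\<in>sites \<epsilon>. \<bar>k\<bar>)) \<le> exp (- v0_potential \<epsilon> \<beta> z \<phi>)" for \<phi> by simp
  with 1 show ?thesis by (intro that[of K U' "exp (- (\<Sum>x\<in>sites \<epsilon>. \<bar>k\<bar>))"]) auto
qed

section \<open>Brownian motions on the completed probability space\<close>

lemma indep_vars_completion: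
  assumes M: "prob_space M" and X: "prob_space.indep_vars M N X I"
  shows "prob_space.indep_vars (completion M) N X I"
proof -
  interpret prob_space M by fact
  interpret C: prob_space "completion M" by (rule prob_space_completion)
  have m: "\<And>i. i \<in> I \<Longrightarrow> X i \<in> M \<rightarrow>\<^sub>M N i"
    and ind: "indep_sets (\<lambda>i. {X i -` A \<inter> space M | A. A \<in> sets (N i)}) I"
    using X by (auto simp: indep_vars_def2)
  have "C.indep_sets (\<lambda>i. {X i -` A \<inter> space M | A. A \<in> sets (N i)}) I"
  proof (rule C.indep_setsI)
    fix i assume "i \<in> I"
    then show "{X i -` A \<inter> space M | A. A \<in> sets (N i)} \<subseteq> sets (completion M)"
      using m measurable_sets[OF m] by (auto intro: sets_completionI_sets)
  next
    fix A J assume J: "J \<noteq> {}" "J \<subseteq> I" "finite J" and A: "\<forall>j\<in>J. A j \<in> {X j -` A \<inter> space M | A. A \<in> sets (N j)}"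
    have Am: "A j \<in> sets M" if j: "j \<in> J" for j
    proof -
      obtain A' where A': "A j = X j -` A' \<inter> space M" "A' \<in> sets (N j)" using bspec[OF A j] by blast
      have "j \<in> I" using J j by blast
      from measurable_sets[OF m[OF this] A'(2)] show ?thesis unfolding A'(1) .
    qed
    have "prob (\<Inter>j\<in>J. A j) = (\<Prod>j\<in>J. prob (A j))"
      by (rule indep_setsD[OF ind J(2,1,3) A])
    moreover have "(\<Inter>j\<in>J. A j) \<in> sets M" using Am J by (intro sets.finite_INT) auto
    ultimately show "measure (completion M) (\<Inter>j\<in>J. A j) = (\<Prod>j\<in>J. measure (completion M) (A j))"
      using Am by simp
  qed
  then show ?thesis
    unfolding C.indep_vars_def2 using m by (auto intro: measurable_completion)
qed

lemma brownian_motion_completion: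
  assumes M: "prob_space M" and B: "brownian_motion M B" shows "brownian_motion (completion M) B"
proof -
  interpret prob_space M by fact
  interpret N: prob_space "completion M" by (rule prob_space_completion)
  have m: "\<And>t. t \<ge> 0 \<Longrightarrow> B t \<in> borel_measurable M" using B by (auto simp: brownian_motion_def)
  have ind: "N.indep_vars (\<lambda>_. borel) (\<lambda>i \<omega>. B (\<tau> (Suc i)) \<omega> - B (\<tau> i) \<omega>) {..<n}"
    if "0 \<le> \<tau> 0" "mono \<tau>" for \<tau> :: "nat \<Rightarrow> real" and n
  proof (rule indep_vars_completion[OF M])
    show "indep_vars (\<lambda>_. borel) (\<lambda>i \<omega>. B (\<tau> (Suc i)) \<omega> - B (\<tau> i) \<omega>) {..<n}"
      using B that by (auto simp: brownian_motion_def)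
  qed
  show ?thesis
    unfolding brownian_motion_def
  proof (intro conjI allI impI)
    fix s t :: real assume "0 \<le> s" "s \<le> t"
    then have "(\<lambda>\<omega>. B t \<omega> - B s \<omega>) \<in> borel_measurable M" by (intro borel_measurable_diff m) auto
    then show "distr (completion M) borel (\<lambda>\<omega>. B t \<omega> - B s \<omega>) = centred_normal (t - s)"
      using B \<open>0 \<le> s\<close> \<open>s \<le> t\<close> by (simp add: distr_completion brownian_motion_def)
  qed (use B m ind in \<open>auto simp: brownian_motion_def AE_completion_iff intro: measurable_completion AE_completion\<close>)
qed

lemma (in finite_measure) integral_iexp_cos_sin:
  assumes [measurable]: "X \<in> borel_measurable M"
  shows "(CLINT x|M. iexp (X x)) = Complex (\<integral>x. cos (X x) \<partial>M) (\<integral>x. cos (- (pi / 2) + X x) \<partial>M)"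
proof -
  have i: "integrable M (\<lambda>x. iexp (X x))" by (rule integrable_complex_bounded[where B=1]) simp_all
  have "Re (iexp t) = cos t" "Im (iexp t) = cos (- (pi / 2) + t)" for t
    by (simp_all add: cis_conv_exp[symmetric] cos_add cos_diff)
  then show ?thesis
    using integral_Re[OF i] integral_Im[OF i] by (simp add: complex_eq_iff)
qed

section \<open>The sine-Gordon weight as a perturbed Gaussian\<close>

context torus
begin

lemma sine_gordon_weight_eq: "sine_gordon_weight \<epsilon> \<beta> z \<phi> = gauss_weight \<phi> * exp (- v0_potential \<epsilon> \<beta> z \<phi>)"
proof -
  have "quad \<phi> / 2 = \<epsilon>\<^sup>2 * (\<Sum>x\<in>S. 1 / 2 * \<phi> x * (- \<Delta> \<phi> x) + 1 / 2 * (\<phi> x)\<^sup>2)"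
    unfolding quad_def times_divide_eq_right[symmetric] sum_divide_distrib by (simp add: add_divide_distrib diff_divide_distrib)
  then have "\<epsilon>\<^sup>2 * (\<Sum>x\<in>S. 1 / 2 * \<phi> x * (- \<Delta> \<phi> x) + 1 / 2 * (\<phi> x)\<^sup>2 + 2 * z * \<epsilon> powr (- \<beta> / (4 * pi)) * cos (sqrt \<beta> * \<phi> x))
     = quad \<phi> / 2 + v0_potential \<epsilon> \<beta> z \<phi>"
    by (simp only: v0_potential_def sum.distrib distrib_left)
  then show ?thesis
    unfolding sine_gordon_weight_def gauss_weight_def exp_add[symmetric] by simp
qed

lemma sine_gordon_integral:
  assumes U: "C11 S L (\<lambda>\<phi>. exp (- v0_potential \<epsilon> \<beta> z \<phi>)) U'" and f: "blip S R f"
  shows "integrable Leb (\<lambda>\<phi>. sine_gordon_weight \<epsilon> \<beta> z \<phi> * f \<phi>)"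
    and "(\<integral>\<phi>. sine_gordon_weight \<epsilon> \<beta> z \<phi> * f \<phi> \<partial>Leb) = gauss_Z * shift_avg gauss_density (\<lambda>\<phi>. exp (- v0_potential \<epsilon> \<beta> z \<phi>) * f \<phi>) (\<lambda>_. 0)"
proof -
  let ?U = "\<lambda>\<phi>. exp (- v0_potential \<epsilon> \<beta> z \<phi>)"
  have [measurable]: "?U \<in> borel_measurable Leb" "f \<in> borel_measurable Leb"
    using blip_measurable[OF C11_blip[OF U], of "\<lambda>\<phi>. \<phi>" Leb] blip_measurable[OF f, of "\<lambda>\<phi>. \<phi>" Leb] by simp_all
  have b: "\<bar>?U \<phi> * f \<phi>\<bar> \<le> L * R" for \<phi>
    unfolding abs_mult using C11D(1)[OF U, of \<phi>] C11D(4)[OF U] blipD(1)[OF f, of \<phi>] by (intro mult_mono) auto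
  have w: "sine_gordon_weight \<epsilon> \<beta> z \<phi> * f \<phi> = gauss_weight \<phi> * (?U \<phi> * f \<phi>)" for \<phi>
    by (simp add: sine_gordon_weight_eq mult.assoc)
  have LR: "0 \<le> L * R" using C11D(4)[OF U] blipD(3)[OF f] by simp
  have "integrable Leb (\<lambda>\<phi>. gauss_weight \<phi> * (L * R))" using gauss_weight_integrable by simp
  then show "integrable Leb (\<lambda>\<phi>. sine_gordon_weight \<epsilon> \<beta> z \<phi> * f \<phi>)"
    unfolding w
  proof (rule Bochner_Integration.integrable_bound)
    show "AE \<phi> in Leb. norm (gauss_weight \<phi> * (?U \<phi> * f \<phi>)) \<le> norm (gauss_weight \<phi> * (L * R))"
    proof (rule AE_I2)
      fix \<phi>
      have "gauss_weight \<phi> * \<bar>?U \<phi> * f \<phi>\<bar> \<le> gauss_weight \<phi> * (L * R)"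
        by (rule mult_left_mono[OF b]) (simp add: gauss_weight_def)
      then show "norm (gauss_weight \<phi> * (?U \<phi> * f \<phi>)) \<le> norm (gauss_weight \<phi> * (L * R))"
        unfolding real_norm_def abs_mult[of "gauss_weight \<phi>"] using LR by (simp add: gauss_weight_def)
    qed
  qed measurable
  have "shift_avg gauss_density (\<lambda>\<phi>. ?U \<phi> * f \<phi>) (\<lambda>_. 0) = (\<integral>\<phi>. ?U \<phi> * f \<phi> \<partial>gauss_density)"
    by (simp add: shift_avg_def)
  also have "\<dots> = (\<integral>\<phi>. (gauss_weight \<phi> / gauss_Z) *\<^sub>R (?U \<phi> * f \<phi>) \<partial>Leb)"
    by (rule integral_gauss_density) measurable
  also have "\<dots> = (\<integral>\<phi>. sine_gordon_weight \<epsilon> \<beta> z \<phi> * f \<phi> / gauss_Z \<partial>Leb)"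
    unfolding w by (intro Bochner_Integration.integral_cong refl) simp
  finally show "(\<integral>\<phi>. sine_gordon_weight \<epsilon> \<beta> z \<phi> * f \<phi> \<partial>Leb) = gauss_Z * shift_avg gauss_density (\<lambda>\<phi>. ?U \<phi> * f \<phi>) (\<lambda>_. 0)"
    using gauss_Z_pos by simp
qed

end

section \<open>Identification of the potential and the drift\<close>

context renormalised
begin

text \<open>The Gaussian measure in the potential is a definite description; uniqueness identifies
  it with the law of the noise accumulated on \<open>[0, t)\<close>, which has the same
  covariance.\<close>

lemma v_potential_eq:
  assumes U0_eq: "U0 = (\<lambda>\<phi>. exp (- v0_potential \<epsilon> \<beta> z \<phi>))" and t: "0 \<le> t"
  shows "v_potential \<epsilon> \<beta> z t \<phi> = - ln (U t \<phi>)"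
proof -
  have "is_centred_gaussian S (c_kernel \<epsilon> t) (incr_law 0 t)"
    using incr_law_gaussian[OF order_refl t] is_centred_gaussian_cong[of S "c_kernel \<epsilon> t" "cov_on {0..<t}"] c_kernel_eq_cov_on[OF t] by blast
  then have "gaussian S (c_kernel \<epsilon> t) = incr_law 0 t" by (rule gaussian_eqI[OF finite_S])
  moreover have "U t \<phi> = (\<integral>\<zeta>. exp (- v0_potential \<epsilon> \<beta> z (\<lambda>x. \<phi> x + \<zeta> x)) \<partial>incr_law 0 t)"
    unfolding U_def shift_avg_def unfolding U0_eq ..
  ultimately show ?thesis by (simp only: v_potential_def)
qed

text \<open>Chain rule for the logarithm; the derivative of \<open>U t\<close> in one coordinate is
  available because \<open>U t\<close> lies in the class \<open>C11\<close>.\<close>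

lemma drift_eq:
  assumes U0_eq: "U0 = (\<lambda>\<phi>. exp (- v0_potential \<epsilon> \<beta> z \<phi>))" and t: "0 \<le> t"
  shows "drift \<epsilon> \<beta> z t \<phi> x = - b t \<phi> x"
proof -
  have "partial_deriv (v_potential \<epsilon> \<beta> z t) y \<phi> = - (U' t y \<phi> / U t \<phi>)" if y: "y \<in> S" for y
  proof -
    have "((\<lambda>s. U t (\<phi>(y := s))) has_real_derivative U' t y \<phi>) (at (\<phi> y))"
      by (rule C11_has_partial_derivative[OF C11_U[OF t] y finite_S])
    then have "((\<lambda>s. - ln (U t (\<phi>(y := s)))) has_real_derivative - (1 / U t (\<phi>(y := \<phi> y)) * U' t y \<phi>)) (at (\<phi> y))"
      using U_pos[OF t] by (auto intro!: derivative_eq_intros)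
    then show ?thesis
      unfolding partial_deriv_def v_potential_eq[OF U0_eq t] by (simp add: DERIV_imp_deriv)
  qed
  then show ?thesis unfolding drift_def b_def by (simp add: sum_negf)
qed

end

theorem theorem3p2:
  fixes M :: "'w measure"
    and \<epsilon> \<beta> z :: real
    and W G \<Phi> :: "real \<Rightarrow> site \<Rightarrow> 'w \<Rightarrow> real"
  assumes "0 < \<beta>" and "\<beta> < 6 * pi"
    and "\<epsilon> > 0" and "1 / \<epsilon> \<in> \<nat>"
    and "prob_space M"
    and "lattice_brownian_motion M \<epsilon> W"
    and "gff_process M \<epsilon> W G"
    and "sine_gordon_solution M \<epsilon> \<beta> z W G \<Phi>"
  shows "distr (completion M) (PiM (sites \<epsilon>) (\<lambda>_. lborel)) (\<lambda>\<omega>. \<lambda>x\<in>sites \<epsilon>. \<Phi> 0 x \<omega>)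
           = sine_gordon_measure \<epsilon> \<beta> z"
proof -
  interpret T: torus \<epsilon> by unfold_locales (use assms in auto)
  interpret M: prob_space M by fact
  interpret C: prob_space "completion M" by (rule M.prob_space_completion)
  let ?S = "sites \<epsilon>" and ?N = "completion M"
  \<comment> \<open>The completed space is used because the Wiener integrals and the field are
    measurable only for it.\<close>
  interpret B: lattice_brownian ?N ?S \<epsilon> W
  proof
    show "finite ?S" "\<epsilon> > 0" using assms by auto
    show "brownian_motion ?N (\<lambda>t \<omega>. \<epsilon> * W t x \<omega>)" if "x \<in> ?S" for x
      using that assms by (intro brownian_motion_completion) (auto simp: lattice_brownian_motion_def)
    show "C.indep_vars (\<lambda>_. PiM {0..} (\<lambda>_. borel)) (\<lambda>x \<omega>. \<lambda>t\<in>{0..}. W t x \<omega>) ?S"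
      using assms by (intro indep_vars_completion) (auto simp: lattice_brownian_motion_def)
  qed
  \<comment> \<open>Versions of the integrals are chosen simultaneously for all pairs of a time and
    a site; the null set on which \<open>G\<close> differs from them depends on the pair.\<close>
  have "\<forall>p\<in>{0..} \<times> ?S. \<exists>J :: site \<Rightarrow> 'w \<Rightarrow> real.
       (\<forall>y\<in>?S. is_wiener_integral ?N (\<lambda>u. W u y) (fst p) (\<lambda>u. q_kernel \<epsilon> u (snd p) y) (J y)) \<and>
       (AE \<omega> in M. G (fst p) (snd p) \<omega> = \<epsilon>\<^sup>2 * (\<Sum>y\<in>?S. J y \<omega>))"
    using assms(7) unfolding gff_process_def by auto
  from bchoice[OF this] obtain J0 where J0:
    "\<And>t x y. 0 \<le> t \<Longrightarrow> x \<in> ?S \<Longrightarrow> y \<in> ?S \<Longrightarrow> is_wiener_integral ?N (\<lambda>u. W u y) t (\<lambda>u. q_kernel \<epsilon> u x y) (J0 (t, x) y)"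
    "\<And>t x. 0 \<le> t \<Longrightarrow> x \<in> ?S \<Longrightarrow> AE \<omega> in M. G t x \<omega> = \<epsilon>\<^sup>2 * (\<Sum>y\<in>?S. J0 (t, x) y \<omega>)"
    by fastforce
  have q_meas: "(\<lambda>u. q_kernel \<epsilon> u x y) \<in> borel_measurable borel" if "x \<in> ?S" for x y
    unfolding q_kernel_def using that by (intro measurable_compose[OF _ T.K_measurable]) auto
  obtain L U0' \<kappa> where U0: "C11 ?S L (\<lambda>\<phi>. exp (- v0_potential \<epsilon> \<beta> z \<phi>)) U0'" "\<kappa> > 0" "\<And>\<phi>. exp (- v0_potential \<epsilon> \<beta> z \<phi>) \<ge> \<kappa>"
    using v0_potential_C11[OF T.finite_S] by blast
  let ?U0 = "\<lambda>\<phi>. exp (- v0_potential \<epsilon> \<beta> z \<phi>)"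
  let ?J = "\<lambda>t x y. J0 (t, x) y"
  interpret N: renormalised \<epsilon> ?N W ?J ?U0 U0' L \<kappa>
    by unfold_locales (use U0 in \<open>auto intro!: is_wiener_integral_imp_wiener_limit J0 q_meas\<close>)
  have bwd: "backward_filtration M \<epsilon> W t = B.future t" for t
    by (simp add: backward_filtration_def B.future_def)
  have sol: "\<And>t x. t \<ge> 0 \<Longrightarrow> x \<in> ?S \<Longrightarrow> \<Phi> t x \<in> borel_measurable (B.future t)"
    "AE \<omega> in M. \<forall>x\<in>?S. continuous_on {0..} (\<lambda>t. \<Phi> t x \<omega>)"
    "AE \<omega> in M. \<forall>t\<ge>0. \<forall>x\<in>?S. \<Phi> t x \<omega> = - (LBINT u:{t..}. drift \<epsilon> \<beta> z u (\<lambda>y. \<Phi> u y \<omega>) x) + G t x \<omega>"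
    using assms(8) unfolding sine_gordon_solution_def bwd by blast+
  interpret R: renormalised_sde \<epsilon> ?N W ?J ?U0 U0' L \<kappa> \<Phi>
  proof
    show "\<Phi> t x \<in> borel_measurable (B.future t)" if "t \<ge> 0" "x \<in> ?S" for t x by (rule sol(1)[OF that])
    show "AE \<omega> in ?N. \<forall>x\<in>?S. continuous_on {0..} (\<lambda>t. \<Phi> t x \<omega>)" by (rule AE_completion[OF sol(2)])
    fix t :: real assume t: "t \<ge> 0"
    \<comment> \<open>With \<open>t\<close> fixed only finitely many sites remain, so their null
      sets can be united.\<close>
    have "AE \<omega> in M. \<forall>x\<in>?S. G t x \<omega> = N.gff t x \<omega>"
      using J0(2)[OF t] by (simp add: N.gff_def AE_ball_countable[OF countable_finite[OF T.finite_S]])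
    with sol(3) have "AE \<omega> in M. \<forall>x\<in>?S. \<Phi> t x \<omega> = (LBINT u:{t..}. N.b u (\<lambda>y. \<Phi> u y \<omega>) x) + N.gff t x \<omega>"
    proof eventually_elim
      case (elim \<omega>)
      have "(LBINT u:{t..}. drift \<epsilon> \<beta> z u (\<lambda>y. \<Phi> u y \<omega>) x) = (LBINT u:{t..}. - N.b u (\<lambda>y. \<Phi> u y \<omega>) x)" for x
        using t by (intro set_lebesgue_integral_cong) (auto simp: N.drift_eq[OF refl])
      also have "\<dots> x = - (LBINT u:{t..}. N.b u (\<lambda>y. \<Phi> u y \<omega>) x)" for x
        by (simp add: set_lebesgue_integral_def)
      finally show ?case using elim t by simp
    qed
    then show "AE \<omega> in ?N. \<forall>x\<in>?S. \<Phi> t x \<omega> = (LBINT u:{t..}. N.b u (\<lambda>y. \<Phi> u y \<omega>) x) + N.gff t x \<omega>"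
      by (rule AE_completion)
  qed
  let ?X = "\<lambda>\<omega>. \<lambda>x\<in>?S. \<Phi> 0 x \<omega>"
  have X: "?X \<in> ?N \<rightarrow>\<^sub>M T.Leb"
  proof (rule measurable_restrict)
    fix x assume "x \<in> ?S"
    from R.field_measurable[OF order_refl this] show "\<Phi> 0 x \<in> ?N \<rightarrow>\<^sub>M lborel" by (simp add: R.field_def)
  qed
  have blip1: "blip ?S 1 (\<lambda>_. 1)" by (simp add: blip_def)
  define Z where "Z = sine_gordon_Z \<epsilon> \<beta> z"
  have wi: "integrable T.Leb (sine_gordon_weight \<epsilon> \<beta> z)"
    using T.sine_gordon_integral(1)[OF U0(1) blip1] by simp
  have wm[measurable]: "sine_gordon_weight \<epsilon> \<beta> z \<in> borel_measurable T.Leb" using wi by auto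
  have Z: "Z = T.gauss_Z * shift_avg T.gauss_density ?U0 (\<lambda>_. 0)"
    using T.sine_gordon_integral(2)[OF U0(1) blip1] by (simp add: Z_def sine_gordon_Z_def)
  have Z_pos: "Z > 0"
    unfolding Z_def sine_gordon_Z_def by (rule T.integral_Leb_pos[OF wi]) (simp add: sine_gordon_weight_def)
  have w0: "0 \<le> sine_gordon_weight \<epsilon> \<beta> z \<phi> / Z" for \<phi> using Z_pos by (simp add: sine_gordon_weight_def)
  have cos_eq: "(\<integral>\<phi>. cos (\<theta> + (\<Sum>x\<in>?S. a x * \<phi> x)) \<partial>distr ?N T.Leb ?X) = (\<integral>\<phi>. cos (\<theta> + (\<Sum>x\<in>?S. a x * \<phi> x)) \<partial>sine_gordon_measure \<epsilon> \<beta> z)" for \<theta> a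
  proof -
    let ?f = "\<lambda>\<phi>. cos (\<theta> + (\<Sum>x\<in>?S. a x * \<phi> x))"
    obtain Kf f' where f: "C11 ?S Kf ?f f'" using C11_cos_linear[OF T.finite_S] by blast
    have fm: "?f \<in> borel_measurable T.Leb" by measurable
    have "(\<integral>\<phi>. ?f \<phi> \<partial>distr ?N T.Leb ?X) = (\<integral>\<omega>. ?f (?X \<omega>) \<partial>?N)" by (rule integral_distr[OF X fm])
    \<comment> \<open>Taking \<open>H = U0 * f\<close> makes the quotient at time 0 equal to
      \<open>f\<close>. On the Gaussian side numerator and denominator carry the same
      \<open>gauss_Z\<close>, which cancels and leaves the normalisation by
      \<open>Z\<close>.\<close>
    also have "\<dots> = C.expectation (\<lambda>\<omega>. (?U0 (R.field 0 \<omega>) * ?f (R.field 0 \<omega>)) / ?U0 (R.field 0 \<omega>))"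
      by (simp add: R.field_def)
    also have "\<dots> = shift_avg T.gauss_density (\<lambda>\<phi>. ?U0 \<phi> * ?f \<phi>) (\<lambda>_. 0) / shift_avg T.gauss_density ?U0 (\<lambda>_. 0)"
      by (rule R.expectation_field_0[OF C11_mult[OF U0(1) f]])
    also have "\<dots> = (\<integral>\<phi>. sine_gordon_weight \<epsilon> \<beta> z \<phi> * ?f \<phi> \<partial>T.Leb) / Z"
      unfolding T.sine_gordon_integral(2)[OF U0(1) C11_blip[OF f]] Z using T.gauss_Z_pos by simp
    also have "\<dots> = (\<integral>\<phi>. (sine_gordon_weight \<epsilon> \<beta> z \<phi> / Z) *\<^sub>R ?f \<phi> \<partial>T.Leb)" by simp
    also have "\<dots> = (\<integral>\<phi>. ?f \<phi> \<partial>sine_gordon_measure \<epsilon> \<beta> z)"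
      unfolding sine_gordon_measure_def Z_def[symmetric]
      by (rule integral_density[symmetric]) (use fm w0 in auto)
    finally show ?thesis .
  qed
  have sets_Leb: "sets T.Leb = sets (PiM ?S (\<lambda>_. borel))" by (intro sets_PiM_cong) auto
  have fin1: "finite_measure (distr ?N T.Leb ?X)" by (rule C.finite_measure_distr[OF X])
  have fin2: "finite_measure (sine_gordon_measure \<epsilon> \<beta> z)"
  proof (rule finite_measureI)
    have "emeasure (sine_gordon_measure \<epsilon> \<beta> z) (space (sine_gordon_measure \<epsilon> \<beta> z)) = (\<integral>\<^sup>+\<phi>. ennreal (sine_gordon_weight \<epsilon> \<beta> z \<phi> / Z) \<partial>T.Leb)"
      unfolding sine_gordon_measure_def Z_def[symmetric] by (simp add: emeasure_density cong: nn_integral_cong)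
    also have "\<dots> = ennreal (\<integral>\<phi>. sine_gordon_weight \<epsilon> \<beta> z \<phi> / Z \<partial>T.Leb)"
      using wi w0 by (intro nn_integral_eq_integral) auto
    finally show "emeasure (sine_gordon_measure \<epsilon> \<beta> z) (space (sine_gordon_measure \<epsilon> \<beta> z)) \<noteq> \<infinity>" by simp
  qed
  have sets_sg: "sets (sine_gordon_measure \<epsilon> \<beta> z) = sets T.Leb" by (simp add: sine_gordon_measure_def)
  show ?thesis
  proof (rule finite_measure_eqI_char_PiM[OF T.finite_S fin1 fin2])
    fix a :: "site \<Rightarrow> real"
    let ?Y = "\<lambda>\<phi>. \<Sum>x\<in>?S. a x * \<phi> x"
    have Y: "?Y \<in> borel_measurable T.Leb" by measurable
    have "?Y \<in> borel_measurable (distr ?N T.Leb ?X)" using Y by simp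
    note 1 = finite_measure.integral_iexp_cos_sin[OF fin1 this]
    have "?Y \<in> borel_measurable (sine_gordon_measure \<epsilon> \<beta> z)" using Y measurable_cong_sets[OF sets_sg refl] by blast
    note 2 = finite_measure.integral_iexp_cos_sin[OF fin2 this]
    show "(CLINT \<phi>|distr ?N T.Leb ?X. iexp (?Y \<phi>)) = (CLINT \<phi>|sine_gordon_measure \<epsilon> \<beta> z. iexp (?Y \<phi>))"
      unfolding 1 2 using cos_eq[of 0 a] cos_eq[of "- (pi / 2)" a] by simp
  qed (simp_all add: sets_Leb sets_sg)
qed

end
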